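(* Let $m,s\in\mathbb N$ with $m+s$ even. For every $(m,s)$-connector $c$ let $D_c$ be a (fixed, arbitrarily chosen) reduced totally descending $(m,s)$-tangle diagram with connector $c$, and let $\mathbb{DB}_{m,s}=\{D_c\mid c\in \mathrm{conn}(m,s)\}$. Then $\mathrm{Hom}_{\mathcal B}(m,s)$ is a free $\Bbbk$-module with basis $\mathbb{DB}_{m,s}$.
   Context: $\Bbbk$ is an integral domain of characteristic not $2$, and $q\in\Bbbk$ is such that $q$ and $q-q^{-1}$ are invertible in $\Bbbk$. A strict monoidal supercategory is a strict monoidal category enriched in $\mathbb Z/2$-graded $\Bbbk$-modules (composition is even) whose tensor product satisfies the super interchange law $(f\otimes g)\circ(k\otimes h)=(-1)^{[g][k]}(f\circ k)\otimes(g\circ h)$ for homogeneous morphisms, where $[\cdot]$ is the parity. The periplectic $q$-Brauer category $\mathcal B$ is the strict monoidal ($\Bbbk$-linear) supercategory generated by one object; its objects are the natural numbers, $m$ being the $m$-th tensor power of the generating object $1$, and $0$ the unit object. Generating morphisms: even $X,Y:2\to2$ and odd $\mathsf{cup}:0\to2$, $\mathsf{cap}:2\to0$. Let $I=1_1$ be the identity of the object $1$. Defining relations: (R1) $XY=YX=1_2$ and $(X\otimes I)(I\otimes X)(X\otimes I)=(I\otimes X)(X\otimes I)(I\otimes X)$; (R2) $X-Y=(q-q^{-1})1_2$; (R3) $(\mathsf{cap}\otimes I)(I\otimes \mathsf{cup})=I$ and $(I\otimes\mathsf{cap})(\mathsf{cup}\otimes I)=-I$; (R4) $X\circ\mathsf{cup}=q\,\mathsf{cup}$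 and $(I\otimes X)(\mathsf{cup}\otimes I)=(Y\otimes I)(I\otimes\mathsf{cup})$; (R5) $\mathsf{cap}\circ\mathsf{cup}=0$. Diagrammatically (composition is vertical stacking with $g\circ h$ having $g$ on top, tensor product is horizontal juxtaposition) $X$ is the crossing in which the strand from bottom left to top right passes over, and $Y$ is the crossing in which the strand from bottom right to top left passes over. An $(m,s)$-tangle diagram is a string diagram obtained by tensor products and compositions of $X,Y,\mathsf{cup},\mathsf{cap}$ and $I$, with $m$ bottom endpoints and $s$ top endpoints; it represents a morphism $m\to s$. Label the bottom endpoints $1,\dots,m$ and the top endpoints $\bar1,\dots,\bar s$ from left to right, ordered by $1<2<\cdots<m<\bar s<\cdots<\bar2<\bar1$. The connector $\mathrm{conn}(d)=\{(i_k,j_k)\mid1\le k\le\frac12(m+s)\}$ of a diagram $d$ is the set of pairs of endpoints joined by strands of $d$, with $i_k<j_k$ for all $k$ and $i_o<i_l$ for $o<l$. $\mathrm{conn}(m,s)$ is the set of connectors of all $(m,s)$-tangle diagrams (i.e. all perfect matchings of the endpoints). A loop is a strand without endpoints. A diagram $d$ is totally descending if, taking $i_1,i_2,\dots,i_{(m+s)/2}$ and then one point on each loop as a sequence of base points and traversing all strands of $d$ in this order, each from its base point, each crossing is first met as an over-crossing. A diagram is reduced if two distinct strands cross each other at most once, no strand crosses itself, and there is no loop. *)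

theory Defs
  imports "HOL-Algebra.Algebraic_Closure_Type"
begin

section \<open>The periplectic q-Brauer category\<close>

text \<open>\<open>Strands n\<close> is the identity of the object \<open>n\<close>, i.e. \<open>n\<close> parallel vertical strands;
  \<open>Strands 1\<close> is the strand \<open>I\<close> and \<open>Strands 0\<close> is the empty diagram.\<close>

datatype piece = Strands nat | CrossX | CrossY | Cup | Cap

fun piece_src :: "piece \<Rightarrow> nat" where
  "piece_src (Strands n) = n"
| "piece_src CrossX = 2"
| "piece_src CrossY = 2"
| "piece_src Cup = 0"
| "piece_src Cap = 2"

fun piece_tgt :: "piece \<Rightarrow> nat" where
  "piece_tgt (Strands n) = n"
| "piece_tgt CrossX = 2"
| "piece_tgt CrossY = 2"
| "piece_tgt Cup = 2"
| "piece_tgt Cap = 0"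

text \<open>Formal expressions for morphisms. \<open>Comp g h\<close> is \<open>g \<circ> h\<close>, with \<open>g\<close> on top of \<open>h\<close>, and
  \<open>Tens f g\<close> is \<open>f \<otimes> g\<close>, with \<open>f\<close> to the left of \<open>g\<close>.\<close>

datatype 'k mor =
    Piece piece
  | Comp "'k mor" "'k mor"
  | Tens "'k mor" "'k mor"
  | Zero nat nat
  | Add "'k mor" "'k mor"
  | Scale 'k "'k mor"

inductive in_hom :: "'k mor \<Rightarrow> nat \<Rightarrow> nat \<Rightarrow> bool" where
  "in_hom (Piece x) (piece_src x) (piece_tgt x)"
| "in_hom g n p \<Longrightarrow> in_hom h m n \<Longrightarrow> in_hom (Comp g h) m p"
| "in_hom f m n \<Longrightarrow> in_hom g m' n' \<Longrightarrow> in_hom (Tens f g) (m + m') (n + n')"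
| "in_hom (Zero m n) m n"
| "in_hom f m n \<Longrightarrow> in_hom g m n \<Longrightarrow> in_hom (Add f g) m n"
| "in_hom f m n \<Longrightarrow> in_hom (Scale c f) m n"

text \<open>\<open>has_parity f b\<close>: the expression \<open>f\<close> is homogeneous, odd if \<open>b\<close> is true and even if it is
  false. Addition in \<open>\<int>/2\<close> becomes exclusive or, i.e. \<open>\<noteq>\<close>. The zero morphism has both parities.\<close>

inductive has_parity :: "'k mor \<Rightarrow> bool \<Rightarrow> bool" where
  "has_parity (Piece x) (x = Cup \<or> x = Cap)"
| "has_parity f b \<Longrightarrow> has_parity g b' \<Longrightarrow> has_parity (Comp f g) (b \<noteq> b')"
| "has_parity f b \<Longrightarrow> has_parity g b' \<Longrightarrow> has_parity (Tens f g) (b \<noteq> b')"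
| "has_parity (Zero m n) b"
| "has_parity f b \<Longrightarrow> has_parity g b \<Longrightarrow> has_parity (Add f g) b"
| "has_parity f b \<Longrightarrow> has_parity (Scale c f) b"

abbreviation strand :: "'k mor" where "strand \<equiv> Piece (Strands 1)"
abbreviation ident :: "nat \<Rightarrow> 'k mor" where "ident n \<equiv> Piece (Strands n)"
abbreviation XX :: "'k mor" where "XX \<equiv> Piece CrossX"
abbreviation YY :: "'k mor" where "YY \<equiv> Piece CrossY"
abbreviation cup :: "'k mor" where "cup \<equiv> Piece Cup"
abbreviation cap :: "'k mor" where "cap \<equiv> Piece Cap"

abbreviation unit_inverse :: "'k::comm_ring_1 \<Rightarrow> 'k" where
  "unit_inverse q \<equiv> inv\<^bsub>ring_of_type_algebra\<^esub> q"

text \<open>\<open>mor_eq q m n f g\<close>: the expressions \<open>f, g : m \<rightarrow> n\<close> denote the same morphism, i.e. \<open>mor_eq\<close> is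
  the smallest congruence which satisfies the axioms of a strict monoidal supercategory and
  the defining relations.\<close>

inductive mor_eq :: "'k::comm_ring_1 \<Rightarrow> nat \<Rightarrow> nat \<Rightarrow> 'k mor \<Rightarrow> 'k mor \<Rightarrow> bool" for q where
  \<comment> \<open>congruence\<close>
  refl: "in_hom f m n \<Longrightarrow> mor_eq q m n f f"
| sym: "mor_eq q m n f g \<Longrightarrow> mor_eq q m n g f"
| trans: "mor_eq q m n f g \<Longrightarrow> mor_eq q m n g h \<Longrightarrow> mor_eq q m n f h"
| cong_Comp: "mor_eq q n p g g' \<Longrightarrow> mor_eq q m n h h' \<Longrightarrow> mor_eq q m p (Comp g h) (Comp g' h')"
| cong_Tens: "mor_eq q m n f f' \<Longrightarrow> mor_eq q m' n' g g' \<Longrightarrow>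
    mor_eq q (m + m') (n + n') (Tens f g) (Tens f' g')"
| cong_Add: "mor_eq q m n f f' \<Longrightarrow> mor_eq q m n g g' \<Longrightarrow> mor_eq q m n (Add f g) (Add f' g')"
| cong_Scale: "mor_eq q m n f f' \<Longrightarrow> mor_eq q m n (Scale c f) (Scale c f')"
  \<comment> \<open>module structure on morphism spaces\<close>
| add_assoc: "in_hom f m n \<Longrightarrow> in_hom g m n \<Longrightarrow> in_hom h m n \<Longrightarrow>
    mor_eq q m n (Add (Add f g) h) (Add f (Add g h))"
| add_commute: "in_hom f m n \<Longrightarrow> in_hom g m n \<Longrightarrow> mor_eq q m n (Add f g) (Add g f)"
| add_zero: "in_hom f m n \<Longrightarrow> mor_eq q m n (Add (Zero m n) f) f"
| scale_zero: "in_hom f m n \<Longrightarrow> mor_eq q m n (Scale 0 f) (Zero m n)"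
| scale_one: "in_hom f m n \<Longrightarrow> mor_eq q m n (Scale 1 f) f"
| scale_scale: "in_hom f m n \<Longrightarrow> mor_eq q m n (Scale (c * c') f) (Scale c (Scale c' f))"
| scale_add_left: "in_hom f m n \<Longrightarrow>
    mor_eq q m n (Scale (c + c') f) (Add (Scale c f) (Scale c' f))"
| scale_add_right: "in_hom f m n \<Longrightarrow> in_hom g m n \<Longrightarrow>
    mor_eq q m n (Scale c (Add f g)) (Add (Scale c f) (Scale c g))"
  \<comment> \<open>category, with bilinear composition\<close>
| comp_assoc: "in_hom f n p \<Longrightarrow> in_hom g m n \<Longrightarrow> in_hom h l m \<Longrightarrow>
    mor_eq q l p (Comp (Comp f g) h) (Comp f (Comp g h))"
| comp_id_left: "in_hom f m n \<Longrightarrow> mor_eq q m n (Comp (ident n) f) f"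
| comp_id_right: "in_hom f m n \<Longrightarrow> mor_eq q m n (Comp f (ident m)) f"
| comp_add_left: "in_hom f n p \<Longrightarrow> in_hom g n p \<Longrightarrow> in_hom h m n \<Longrightarrow>
    mor_eq q m p (Comp (Add f g) h) (Add (Comp f h) (Comp g h))"
| comp_add_right: "in_hom f n p \<Longrightarrow> in_hom g m n \<Longrightarrow> in_hom h m n \<Longrightarrow>
    mor_eq q m p (Comp f (Add g h)) (Add (Comp f g) (Comp f h))"
| comp_scale_left: "in_hom f n p \<Longrightarrow> in_hom g m n \<Longrightarrow>
    mor_eq q m p (Comp (Scale c f) g) (Scale c (Comp f g))"
| comp_scale_right: "in_hom f n p \<Longrightarrow> in_hom g m n \<Longrightarrow>
    mor_eq q m p (Comp f (Scale c g)) (Scale c (Comp f g))"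
  \<comment> \<open>strict monoidal structure, with bilinear tensor product\<close>
| tens_assoc: "in_hom f m n \<Longrightarrow> in_hom g m' n' \<Longrightarrow> in_hom h m'' n'' \<Longrightarrow>
    mor_eq q (m + m' + m'') (n + n' + n'') (Tens (Tens f g) h) (Tens f (Tens g h))"
| tens_unit_left: "in_hom f m n \<Longrightarrow> mor_eq q m n (Tens (ident 0) f) f"
| tens_unit_right: "in_hom f m n \<Longrightarrow> mor_eq q m n (Tens f (ident 0)) f"
| tens_id: "mor_eq q (m + n) (m + n) (Tens (ident m) (ident n)) (ident (m + n))"
| tens_add_left: "in_hom f m n \<Longrightarrow> in_hom g m n \<Longrightarrow> in_hom h m' n' \<Longrightarrow>
    mor_eq q (m + m') (n + n') (Tens (Add f g) h) (Add (Tens f h) (Tens g h))"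
| tens_add_right: "in_hom f m n \<Longrightarrow> in_hom g m' n' \<Longrightarrow> in_hom h m' n' \<Longrightarrow>
    mor_eq q (m + m') (n + n') (Tens f (Add g h)) (Add (Tens f g) (Tens f h))"
| tens_scale_left: "in_hom f m n \<Longrightarrow> in_hom g m' n' \<Longrightarrow>
    mor_eq q (m + m') (n + n') (Tens (Scale c f) g) (Scale c (Tens f g))"
| tens_scale_right: "in_hom f m n \<Longrightarrow> in_hom g m' n' \<Longrightarrow>
    mor_eq q (m + m') (n + n') (Tens f (Scale c g)) (Scale c (Tens f g))"
| super_interchange:
    "in_hom f n p \<Longrightarrow> in_hom k m n \<Longrightarrow> in_hom g n' p' \<Longrightarrow> in_hom h m' n' \<Longrightarrow>
     has_parity f a \<Longrightarrow> has_parity g b \<Longrightarrow> has_parity k c \<Longrightarrow> has_parity h d \<Longrightarrow>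
     mor_eq q (m + m') (p + p') (Comp (Tens f g) (Tens k h))
       (Scale (if b \<and> c then - 1 else 1) (Tens (Comp f k) (Comp g h)))"
  \<comment> \<open>defining relations\<close>
| XY: "mor_eq q 2 2 (Comp XX YY) (ident 2)"
| YX: "mor_eq q 2 2 (Comp YY XX) (ident 2)"
| braid: "mor_eq q 3 3 (Comp (Comp (Tens XX strand) (Tens strand XX)) (Tens XX strand))
    (Comp (Comp (Tens strand XX) (Tens XX strand)) (Tens strand XX))"
| skein: "mor_eq q 2 2 (Add XX (Scale (- 1) YY)) (Scale (q - unit_inverse q) (ident 2))"
| zigzag_left: "mor_eq q 1 1 (Comp (Tens cap strand) (Tens strand cup)) strand"
| zigzag_right: "mor_eq q 1 1 (Comp (Tens strand cap) (Tens cup strand)) (Scale (- 1) strand)"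
| X_cup: "mor_eq q 0 2 (Comp XX cup) (Scale q cup)"
| slide_cup: "mor_eq q 1 3 (Comp (Tens strand XX) (Tens cup strand))
    (Comp (Tens YY strand) (Tens strand cup))"
| cap_cup: "mor_eq q 0 0 (Comp cap cup) (Zero 0 0)"

definition mor_rel :: "'k::comm_ring_1 \<Rightarrow> nat \<Rightarrow> nat \<Rightarrow> ('k mor \<times> 'k mor) set" where
  "mor_rel q m n = {(f, g). mor_eq q m n f g}"

definition mor_class :: "'k::comm_ring_1 \<Rightarrow> nat \<Rightarrow> nat \<Rightarrow> 'k mor \<Rightarrow> 'k mor set" where
  "mor_class q m n f = mor_rel q m n `` {f}"

text \<open>The module of all morphisms \<open>m \<rightarrow> n\<close>. The library's record of modules extends the
  one of rings; its multiplicative fields are not constrained by the locale of modules.\<close>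

definition Hom :: "'k::comm_ring_1 \<Rightarrow> nat \<Rightarrow> nat \<Rightarrow> ('k, 'k mor set) module" where
  "Hom q m n = \<lparr>carrier = {f. in_hom f m n} // mor_rel q m n,
     monoid.mult = undefined, one = undefined,
     ring.zero = mor_class q m n (Zero m n),
     ring.add = (\<lambda>A B. \<Union>f\<in>A. \<Union>g\<in>B. mor_class q m n (Add f g)),
     module.smult = (\<lambda>c A. \<Union>f\<in>A. mor_class q m n (Scale c f))\<rparr>"

definition free_with_basis ::
  "('a, 'r) ring_scheme \<Rightarrow> ('a, 'b, 'm) module_scheme \<Rightarrow> ('i \<Rightarrow> 'b) \<Rightarrow> 'i set \<Rightarrow> bool" where
  "free_with_basis R M v S \<longleftrightarrow>
     Module.module R M \<and> v \<in> S \<rightarrow> carrier M \<and>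
     (\<forall>A a. finite A \<and> A \<subseteq> S \<and> a \<in> A \<rightarrow> carrier R \<and>
        (\<Oplus>\<^bsub>M\<^esub>i\<in>A. a i \<odot>\<^bsub>M\<^esub> v i) = \<zero>\<^bsub>M\<^esub> \<longrightarrow> (\<forall>i\<in>A. a i = \<zero>\<^bsub>R\<^esub>)) \<and>
     (\<forall>x\<in>carrier M. \<exists>A a. finite A \<and> A \<subseteq> S \<and> a \<in> A \<rightarrow> carrier R \<and>
        x = (\<Oplus>\<^bsub>M\<^esub>i\<in>A. a i \<odot>\<^bsub>M\<^esub> v i))"


section \<open>Tangle diagrams\<close>

datatype diagram =
    DPiece piece
  | DComp diagram diagram
  | DTens diagram diagram

inductive tangle_diagram :: "nat \<Rightarrow> nat \<Rightarrow> diagram \<Rightarrow> bool" where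
  "tangle_diagram (piece_src x) (piece_tgt x) (DPiece x)"
| "tangle_diagram n p g \<Longrightarrow> tangle_diagram m n h \<Longrightarrow> tangle_diagram m p (DComp g h)"
| "tangle_diagram m n f \<Longrightarrow> tangle_diagram m' n' g \<Longrightarrow>
    tangle_diagram (m + m') (n + n') (DTens f g)"

fun src :: "diagram \<Rightarrow> nat" where
  "src (DPiece x) = piece_src x"
| "src (DComp g h) = src h"
| "src (DTens f g) = src f + src g"

fun tgt :: "diagram \<Rightarrow> nat" where
  "tgt (DPiece x) = piece_tgt x"
| "tgt (DComp g h) = tgt g"
| "tgt (DTens f g) = tgt f + tgt g"

fun mor_of :: "diagram \<Rightarrow> 'k mor" where
  "mor_of (DPiece x) = Piece x"
| "mor_of (DComp g h) = Comp (mor_of g) (mor_of h)"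
| "mor_of (DTens f g) = Tens (mor_of f) (mor_of g)"

text \<open>Endpoints are numbered from 1, and \<open>Top i\<close> is the endpoint written as \<open>i\<close> with a bar.\<close>

datatype endpoint = Bot nat | Top nat

instantiation endpoint :: linorder
begin

fun less_endpoint :: "endpoint \<Rightarrow> endpoint \<Rightarrow> bool" where
  "Bot i < Bot j \<longleftrightarrow> i < j"
| "Bot i < Top j \<longleftrightarrow> True"
| "Top i < Bot j \<longleftrightarrow> False"
| "Top i < Top j \<longleftrightarrow> j < i"

definition less_eq_endpoint :: "endpoint \<Rightarrow> endpoint \<Rightarrow> bool" where
  "u \<le> v \<longleftrightarrow> u < v \<or> u = (v :: endpoint)"

instance
proof
  fix x y z :: endpoint
  show "x < y \<longleftrightarrow> x \<le> y \<and> \<not> y \<le> x"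
    by (cases x; cases y) (auto simp: less_eq_endpoint_def)
  show "x \<le> x"
    by (simp add: less_eq_endpoint_def)
  show "x \<le> y \<Longrightarrow> y \<le> z \<Longrightarrow> x \<le> z"
    by (cases x; cases y; cases z) (auto simp: less_eq_endpoint_def)
  show "x \<le> y \<Longrightarrow> y \<le> x \<Longrightarrow> x = y"
    by (cases x; cases y) (auto simp: less_eq_endpoint_def)
  show "x \<le> y \<or> y \<le> x"
    by (cases x; cases y) (auto simp: less_eq_endpoint_def)
qed

end

text \<open>A diagram is drawn as a stack of layers, listed from bottom to top. The layer \<open>(a, x, b)\<close>
  consists of \<open>a\<close> vertical strands, the piece \<open>x\<close> and \<open>b\<close> vertical strands, from left to right.
  In \<open>f \<otimes> g\<close> the factor \<open>f\<close> is drawn above the level of \<open>g\<close>, according to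
  \<open>f \<otimes> g = (f \<otimes> id) \<circ> (id \<otimes> g)\<close>, which holds without a sign. There is always at least one layer.\<close>

type_synonym layer = "nat \<times> piece \<times> nat"

fun layers :: "diagram \<Rightarrow> layer list" where
  "layers (DPiece x) = [(0, x, 0)]"
| "layers (DComp g h) = layers h @ layers g"
| "layers (DTens f g) =
     map (\<lambda>(a, x, b). (src f + a, x, b)) (layers g) @
     map (\<lambda>(a, x, b). (a, x, b + tgt g)) (layers f)"

text \<open>The arcs within one layer, each given by its two ends on the boundary of the layer.\<close>

fun piece_arcs :: "piece \<Rightarrow> endpoint set set" where
  "piece_arcs (Strands n) = {{Bot i, Top i} | i. i \<in> {1..n}}"
| "piece_arcs CrossX = {{Bot 1, Top 2}, {Bot 2, Top 1}}"
| "piece_arcs CrossY = {{Bot 1, Top 2}, {Bot 2, Top 1}}"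
| "piece_arcs Cup = {{Top 1, Top 2}}"
| "piece_arcs Cap = {{Bot 1, Bot 2}}"

fun shift :: "nat \<Rightarrow> nat \<Rightarrow> endpoint \<Rightarrow> endpoint" where
  "shift k l (Bot i) = Bot (k + i)"
| "shift k l (Top i) = Top (l + i)"

fun layer_arcs :: "layer \<Rightarrow> endpoint set set" where
  "layer_arcs (a, x, b) =
     piece_arcs (Strands a) \<union> image (shift a a) ` piece_arcs x \<union>
     image (shift (a + piece_src x) (a + piece_tgt x)) ` piece_arcs (Strands b)"

text \<open>A point \<open>(l, i)\<close> is the \<open>i\<close>-th point, from the left, on the horizontal line below layer \<open>l\<close>,
  equivalently above layer \<open>l - 1\<close>.
  An arc records the layer which contains it, since the two arcs of a circle \<open>cap \<circ> cup\<close> have the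
  same ends.\<close>

type_synonym point = "nat \<times> nat"
type_synonym arc = "nat \<times> point set"

fun place :: "nat \<Rightarrow> endpoint \<Rightarrow> point" where
  "place l (Bot i) = (l, i)"
| "place l (Top i) = (Suc l, i)"

definition arcs :: "diagram \<Rightarrow> arc set" where
  "arcs d = {(l, place l ` A) | l A. l < length (layers d) \<and> A \<in> layer_arcs (layers d ! l)}"

definition points :: "diagram \<Rightarrow> point set" where
  "points d = \<Union> (snd ` arcs d)"

definition endpoints :: "diagram \<Rightarrow> endpoint set" where
  "endpoints d = Bot ` {1..src d} \<union> Top ` {1..tgt d}"

fun endpoint_pos :: "diagram \<Rightarrow> endpoint \<Rightarrow> point" where
  "endpoint_pos d (Bot i) = (0, i)"
| "endpoint_pos d (Top i) = (length (layers d), i)"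

definition joined :: "diagram \<Rightarrow> point \<Rightarrow> point \<Rightarrow> bool" where
  "joined d p p' \<longleftrightarrow> (\<exists>l. (l, {p, p'}) \<in> arcs d)"

definition strand_of :: "diagram \<Rightarrow> point \<Rightarrow> point set" where
  "strand_of d p = {p'. (joined d)\<^sup>*\<^sup>* p p'}"

definition conn :: "diagram \<Rightarrow> (endpoint \<times> endpoint) set" where
  "conn d = {(u, v). u \<in> endpoints d \<and> v \<in> endpoints d \<and> u < v \<and>
     endpoint_pos d v \<in> strand_of d (endpoint_pos d u)}"

definition connectors :: "nat \<Rightarrow> nat \<Rightarrow> (endpoint \<times> endpoint) set set" where
  "connectors m s = conn ` {d. tangle_diagram m s d}"


subsection \<open>Reduced diagrams\<close>

text \<open>A crossing is identified with the number of the layer which contains it.\<close>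

definition crossings :: "diagram \<Rightarrow> nat set" where
  "crossings d = {l. l < length (layers d) \<and> fst (snd (layers d ! l)) \<in> {CrossX, CrossY}}"

definition crossing_strands :: "diagram \<Rightarrow> nat \<Rightarrow> point set set" where
  "crossing_strands d l = (let a = fst (layers d ! l) in
     {strand_of d (l, a + 1), strand_of d (l, a + 2)})"

definition is_loop :: "diagram \<Rightarrow> point set \<Rightarrow> bool" where
  "is_loop d C \<longleftrightarrow> C \<in> strand_of d ` points d \<and> C \<inter> endpoint_pos d ` endpoints d = {}"

definition reduced :: "diagram \<Rightarrow> bool" where
  "reduced d \<longleftrightarrow>
     (\<forall>l\<in>crossings d. \<forall>l'\<in>crossings d. crossing_strands d l = crossing_strands d l' \<longrightarrow> l = l') \<and>
     (\<forall>l\<in>crossings d. card (crossing_strands d l) = 2) \<and>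
     (\<nexists>C. is_loop d C)"


subsection \<open>Totally descending diagrams\<close>

definition over_arc :: "diagram \<Rightarrow> nat \<Rightarrow> arc" where
  "over_arc d l = (case layers d ! l of (a, x, b) \<Rightarrow>
     (l, place l ` shift a a ` (if x = CrossX then {Bot 1, Top 2} else {Bot 2, Top 1})))"

definition under_arc :: "diagram \<Rightarrow> nat \<Rightarrow> arc" where
  "under_arc d l = (case layers d ! l of (a, x, b) \<Rightarrow>
     (l, place l ` shift a a ` (if x = CrossX then {Bot 2, Top 1} else {Bot 1, Top 2})))"

text \<open>A step \<open>(l, p, p')\<close> traverses an arc in layer \<open>l\<close> from \<open>p\<close> to \<open>p'\<close>. At \<open>p'\<close> one continues along
  the other arc at \<open>p'\<close>, which lies in a different layer.\<close>

type_synonym step = "nat \<times> point \<times> point"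

fun arc_of :: "step \<Rightarrow> arc" where
  "arc_of (l, p, p') = (l, {p, p'})"

fun consecutive :: "step \<Rightarrow> step \<Rightarrow> bool" where
  "consecutive (l, p, p') (k, r, r') \<longleftrightarrow> p' = r \<and> l \<noteq> k"

definition walk :: "diagram \<Rightarrow> step list \<Rightarrow> bool" where
  "walk d w \<longleftrightarrow> w \<noteq> [] \<and> arc_of ` set w \<subseteq> arcs d \<and> successively consecutive w"

definition strand_walk :: "diagram \<Rightarrow> endpoint \<Rightarrow> endpoint \<Rightarrow> step list \<Rightarrow> bool" where
  "strand_walk d u v w \<longleftrightarrow> walk d w \<and>
     fst (snd (hd w)) = endpoint_pos d u \<and> snd (snd (last w)) = endpoint_pos d v"

definition loop_walk :: "diagram \<Rightarrow> step list \<Rightarrow> bool" where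
  "loop_walk d w \<longleftrightarrow> walk d w \<and> consecutive (last w) (hd w)"

definition base_points :: "diagram \<Rightarrow> endpoint list" where
  "base_points d = sorted_list_of_set (fst ` conn d)"

text \<open>\<open>traversal d t\<close>: \<open>t\<close> is the sequence of arcs met when the strands with endpoints are traversed
  from their base points in increasing order, and then every loop, each of them once. On a loop, the
  base point and the direction are arbitrary.\<close>

definition traversal :: "diagram \<Rightarrow> arc list \<Rightarrow> bool" where
  "traversal d t \<longleftrightarrow> (\<exists>ws vs.
     list_all2 (\<lambda>u w. \<exists>v. (u, v) \<in> conn d \<and> strand_walk d u v w) (base_points d) ws \<and>
     list_all (loop_walk d) vs \<and>
     t = map arc_of (concat (ws @ vs)) \<and> distinct t \<and> set t = arcs d)"

definition totally_descending :: "diagram \<Rightarrow> bool" where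
  "totally_descending d \<longleftrightarrow> (\<exists>t. traversal d t \<and>
     (\<forall>l\<in>crossings d. \<exists>i j. i < j \<and> j < length t \<and> t ! i = over_arc d l \<and> t ! j = under_arc d l))"

end

theory Submission
  imports Defs "Jordan_Normal_Form.Determinant"
begin

text \<open>The theorem has two halves, and both rest on reading a diagram layer by layer.

For independence, the category acts on functions on words in the letters \<open>\<plusminus>1, \<dots>, \<plusminus>n\<close>, for every
\<open>n\<close>: this is a representation on the tensor powers of a superspace with \<open>n\<close> even and \<open>n\<close> odd basis
vectors, given by an explicit solution of the braid relation (\<open>braid_relation\<close>, \<open>act_sound\<close>). A diagram
without loops can be run from bottom to top on a word in which every letter occurs once, together
with its negative: a crossing exchanges two letters, a cup inserts a new pair and a cap joins two
letters, so that the last word \<open>g\<close> records the connector (\<open>conn_of_run\<close>). Acting by the diagram on the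
function which singles out the initial word gives a function which is \<open>\<plusminus>1\<close> at \<open>g\<close> and vanishes
at all words other than relabellings of \<open>g\<close> and relabellings of words whose matching has fewer
crossings than the diagram (\<open>leading_step\<close>). For a reduced diagram the
number of crossings is determined by the connector, because two strands cross at most once and
the parity of their crossings is visible in \<open>g\<close> (\<open>reduced_run\<close>). Hence the values of the functions of the \<open>D c\<close>
at the words of the \<open>D c'\<close> form a matrix which is triangular with respect to the number of crossings
and has the entries \<open>\<plusminus>1\<close> on its diagonal.

For spanning, consider first the morphisms \<open>0 \<rightarrow> s\<close>. Let \<open>W s\<close> be spanned by the diagrams in which
the strand at the leftmost end passes below all the others and the remaining strands are of the
same kind. The relations show that \<open>W\<close> is closed under a crossing, a cup or a cap at any position
(\<open>W_opr_closed\<close>), hence it contains all morphisms. Bending strands with caps carries the result to \<open>m \<rightarrow> s\<close>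
(\<open>Hom_spanned\<close>). The spanning diagrams have pairwise different connectors (\<open>bend_conn_inj\<close>).

It remains to compare the two families. Write the \<open>D c\<close> in terms of the spanning diagrams, with a
matrix \<open>A\<close>, and let \<open>B\<close> consist of the values of the spanning diagrams at the words of the \<open>D c\<close>. The
spanning diagrams are no more numerous than the connectors, so both matrices can be taken to be square, and \<open>A B\<close> is the
triangular matrix above. Its determinant is a unit, so \<open>A\<close> is invertible, and the \<open>D c\<close> span as well
(\<open>triangular_basis\<close>).\<close>

section \<open>A solution of the braid relation on a superspace\<close>
definition sg :: "bool \<Rightarrow> 'k::comm_ring_1" where "sg b = (if b then - 1 else 1)"

lemma sg_simps [simp]: "sg True = - 1" "sg False = 1" by (auto simp: sg_def)

lemma sg_sq [simp]: "sg a * sg a = 1" "sg a * (sg a * x) = x" by (auto simp: sg_def)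

text \<open>The letters index a basis of a superspace: the positive ones are even, the negative ones are odd.\<close>

definition letters :: "nat \<Rightarrow> int set" where "letters n = {x. x \<noteq> 0 \<and> \<bar>x\<bar> \<le> int n}"

definition words :: "nat \<Rightarrow> nat \<Rightarrow> int list set" where
  "words n k = {w. set w \<subseteq> letters n \<and> length w = k}"

text \<open>The parity of the basis vector of a word.\<close>

definition negs :: "int list \<Rightarrow> bool" where
  "negs w = odd (length (filter (\<lambda>x. x < 0) w))"

lemma negs_simps [simp]: "negs [] = False" "negs (x # w) = ((x < 0) \<noteq> negs w)"
    "negs (u @ v) = (negs u \<noteq> negs v)"
  by (auto simp: negs_def)

lemma finite_letters [simp]: "finite (letters n)"
proof -
  have "letters n \<subseteq> {- int n..int n}" by (auto simp: letters_def)
  then show ?thesis by (rule finite_subset) simp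
qed

lemma finite_words [simp]: "finite (words n k)"
  unfolding words_def by (rule finite_lists_length_eq) simp

lemma words_0 [simp]: "words n 0 = {[]}" by (auto simp: words_def)

lemma words_splitE:
  assumes "w \<in> words n (a + b)"
  obtains u v where "w = u @ v" "u \<in> words n a" "v \<in> words n b"
proof
  show "w = take a w @ drop a w" by simp
  show "take a w \<in> words n a" "drop a w \<in> words n b"
    using assms set_take_subset[of a w] set_drop_subset[of a w] by (auto simp: words_def)
qed

lemma words_split3E:
  assumes "w \<in> words n (a + m + b)"
  obtains u s v where "w = u @ s @ v" "u \<in> words n a" "s \<in> words n m" "v \<in> words n b"
  by (metis append.assoc assms words_splitE)

lemma words_lengthD: "w \<in> words n k \<Longrightarrow> length w = k" by (simp add: words_def)

lemma words_appendI: "u \<in> words n a \<Longrightarrow> v \<in> words n b \<Longrightarrow> u @ v \<in> words n (a + b)"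
  by (auto simp: words_def)

lemma words_1E: assumes "w \<in> words n (Suc 0)" obtains x where "w = [x]" "x \<in> letters n"
  using assms by (auto simp: words_def length_Suc_conv)

lemma words_2E: assumes "w \<in> words n 2" obtains x y where "w = [x, y]" "x \<in> letters n" "y \<in> letters n"
  using assms by (auto simp: words_def length_Suc_conv numeral_2_eq_2)

lemma words_2: "words n 2 = (\<lambda>(x, y). [x, y]) ` (letters n \<times> letters n)"
  by (auto simp: words_def length_Suc_conv numeral_2_eq_2 image_iff)

lemma sum_words_2:
  "(\<Sum>w\<in>words n 2. f w) = (\<Sum>x\<in>letters n. \<Sum>y\<in>letters n. f [x, y])"
  unfolding words_2
  by (subst sum.reindex) (auto simp: inj_on_def sum.cartesian_product case_prod_unfold)

lemma letters_nz: "x \<in> letters n \<Longrightarrow> x \<noteq> 0" by (simp add: letters_def)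
lemma letters_uminus [simp]: "- x \<in> letters n \<longleftrightarrow> x \<in> letters n" by (simp add: letters_def)
lemma letters_lower: "x \<in> letters n \<Longrightarrow> c \<noteq> 0 \<Longrightarrow> \<bar>c\<bar> \<le> \<bar>x\<bar> \<Longrightarrow> c \<in> letters n"
  by (auto simp: letters_def)

lemma sum_letters_pm:
  fixes f :: "int \<Rightarrow> 'k::comm_ring_1"
  assumes "\<And>x. f x \<noteq> 0 \<Longrightarrow> \<bar>x\<bar> < m" "m \<le> int n + 1"
  shows "(\<Sum>x\<in>letters n. f x) = (\<Sum>k\<in>{0<..<m}. f k + f (- k))"
proof -
  have "(\<Sum>x\<in>letters n. f x) = (\<Sum>x\<in>{0<..<m} \<union> uminus ` {0<..<m}. f x)"
  proof (rule sum.mono_neutral_right)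
    show "{0<..<m} \<union> uminus ` {0<..<m} \<subseteq> letters n"
      using assms(2) by (auto simp: letters_def)
    show "\<forall>i\<in>letters n - ({0<..<m} \<union> uminus ` {0<..<m}). f i = 0"
    proof
      fix i assume i: "i \<in> letters n - ({0<..<m} \<union> uminus ` {0<..<m})"
      show "f i = 0"
      proof (rule ccontr)
        assume "f i \<noteq> 0"
        then have "\<bar>i\<bar> < m" by (rule assms(1))
        then have "i \<in> {0<..<m} \<or> - i \<in> {0<..<m}"
          using i by (auto simp: letters_def)
        then show False using i by (metis DiffD2 UnI1 UnI2 image_eqI minus_minus)
      qed
    qed
  qed simp
  also have "\<dots> = (\<Sum>x\<in>{0<..<m}. f x) + (\<Sum>x\<in>uminus ` {0<..<m}. f x)"
    by (rule sum.union_disjoint) auto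
  also have "(\<Sum>x\<in>uminus ` {0<..<m}. f x) = (\<Sum>k\<in>{0<..<m}. f (- k))"
    by (subst sum.reindex) (auto simp: inj_on_def)
  finally show ?thesis by (simp add: sum.distrib)
qed

locale rmatrix =
  fixes q qi :: "'k::comm_ring_1"
  assumes q_inv: "q * qi = 1"
begin

abbreviation "z \<equiv> q - qi"

text \<open>The terms which couple the pair \<open>x, - x\<close> to the pairs \<open>k, - k\<close> of smaller letters. The cup and the
cap pair each letter with its negative, and these terms make the crossing compatible with that pairing.\<close>

definition low :: "int \<Rightarrow> (int \<Rightarrow> int \<Rightarrow> 'k) \<Rightarrow> 'k" where
  "low x G = (\<Sum>k\<in>{0<..<\<bar>x\<bar>}. G k (- k) - G (- k) k)"

text \<open>The crossing \<open>X\<close>, acting on functions of two letters. For \<open>q = 1\<close> it is the flip with its super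
sign; in general the letters are ordered by their absolute values, and it is a Hecke type
deformation of the flip, with additional terms at opposite letters.\<close>

definition xop :: "(int \<Rightarrow> int \<Rightarrow> 'k) \<Rightarrow> int \<Rightarrow> int \<Rightarrow> 'k" where
  "xop G x y =
    (if \<bar>x\<bar> \<noteq> \<bar>y\<bar> then sg (x < 0 \<and> y < 0) * G y x + (if \<bar>y\<bar> < \<bar>x\<bar> then z * G x y else 0)
     else if x = y then (if 0 < x then q else - qi) * G x x
     else (if 0 < x then qi * G y x + z * G x y else q * G y x) + z * low x G)"

lemma q_cancel: "q * qi = 1" "qi * q = 1" "q * (qi * t) = t" "qi * (q * t) = t"
proof -
  show "q * qi = 1" "qi * q = 1" using q_inv by (simp_all add: mult.commute)
  then show "q * (qi * t) = t" "qi * (q * t) = t" by (simp_all add: mult.assoc[symmetric])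
qed

lemma xop_lt: "\<bar>x\<bar> < \<bar>y\<bar> \<Longrightarrow> xop G x y = sg (x < 0 \<and> y < 0) * G y x"
  by (simp add: xop_def)
lemma xop_gt: "\<bar>y\<bar> < \<bar>x\<bar> \<Longrightarrow> xop G x y = sg (x < 0 \<and> y < 0) * G y x + z * G x y"
  by (simp add: xop_def)
lemma xop_eq: "x \<noteq> 0 \<Longrightarrow> xop G x x = (if 0 < x then q else - qi) * G x x"
  by (simp add: xop_def)
lemma xop_opp: "x \<noteq> 0 \<Longrightarrow> xop G x (- x) =
    (if 0 < x then qi * G (- x) x + z * G x (- x) else q * G (- x) x) + z * low x G"
  by (simp add: xop_def)

lemma xop_opp': "0 < x \<Longrightarrow> xop G (- x) x = q * G x (- x) + z * low x G"
  by (simp add: xop_def low_def)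

lemma low_uminus [simp]: "low (- x) G = low x G" by (simp add: low_def)

lemma xop_cong:
  assumes "\<And>a b. a \<noteq> 0 \<Longrightarrow> b \<noteq> 0 \<Longrightarrow> \<bar>a\<bar> \<le> max \<bar>x\<bar> \<bar>y\<bar> \<Longrightarrow> \<bar>b\<bar> \<le> max \<bar>x\<bar> \<bar>y\<bar> \<Longrightarrow> G a b = H a b"
    and "x \<noteq> 0" "y \<noteq> 0"
  shows "xop G x y = xop H x y"
proof -
  have "low x G = low x H" unfolding low_def
    by (rule sum.cong) (auto intro!: arg_cong2[where f = minus] assms)
  then show ?thesis
    using assms by (auto simp: xop_def)
qed

lemma xop_diff: "xop (\<lambda>a b. G a b - H a b) x y = xop G x y - xop H x y"
  by (auto simp: xop_def low_def algebra_simps sum_subtractf sum.distrib)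

lemma xop_scale: "xop (\<lambda>a b. c * G a b) x y = c * xop G x y"
proof -
  have "low x (\<lambda>a b. c * G a b) = c * low x G"
    unfolding low_def sum_distrib_left by (rule sum.cong) (simp_all add: algebra_simps)
  then show ?thesis by (auto simp: xop_def algebra_simps)
qed

lemma low_xop: "low x (xop G) = - qi * low x G"
proof -
  have "low x (xop G) = (\<Sum>k\<in>{0<..<\<bar>x\<bar>}. - qi * (G k (- k) - G (- k) k))"
    unfolding low_def
    by (rule sum.cong) (simp_all add: xop_opp xop_opp' algebra_simps)
  then show ?thesis by (simp add: low_def sum_distrib_left)
qed

text \<open>The eigenvalues of the crossing are \<open>q\<close> and \<open>- qi\<close>. This is the skein relation together with
\<open>X Y = 1\<close>.\<close>

lemma xop_quadratic: "x \<noteq> 0 \<Longrightarrow> y \<noteq> 0 \<Longrightarrow> xop (xop G) x y = z * xop G x y + G x y"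
proof -
  assume nz: "x \<noteq> 0" "y \<noteq> 0"
  consider "\<bar>x\<bar> < \<bar>y\<bar>" | "\<bar>y\<bar> < \<bar>x\<bar>" | "x = y" | "y = - x" by linarith
  then show ?thesis
  proof cases
    case 1 then show ?thesis by (cases "x < 0 \<and> y < 0") (auto simp: xop_lt xop_gt algebra_simps)
  next
    case 2 then show ?thesis by (cases "x < 0 \<and> y < 0") (auto simp: xop_lt xop_gt algebra_simps)
  next
    case 3 then show ?thesis using nz by (auto simp: xop_eq algebra_simps q_cancel)
  next
    case 4
    show ?thesis
    proof (cases "0 < x")
      case True
      then show ?thesis using 4
        by (simp add: xop_opp xop_opp' low_xop algebra_simps q_cancel)
    next
      case False
      then have "0 < y" "x = - y" using 4 nz by auto
      then show ?thesis
        by (simp add: xop_opp xop_opp' low_xop algebra_simps q_cancel)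
    qed
  qed
qed

definition xop1 :: "(int \<Rightarrow> int \<Rightarrow> int \<Rightarrow> 'k) \<Rightarrow> int \<Rightarrow> int \<Rightarrow> int \<Rightarrow> 'k" where
  "xop1 H x y w = xop (\<lambda>a b. H a b w) x y"
definition xop2 :: "(int \<Rightarrow> int \<Rightarrow> int \<Rightarrow> 'k) \<Rightarrow> int \<Rightarrow> int \<Rightarrow> int \<Rightarrow> 'k" where
  "xop2 H x y w = xop (\<lambda>a b. H x a b) y w"

text \<open>On functions of three letters, the lower pairs \<open>k, - k\<close> can occupy three pairs of positions. The sign in
\<open>low2\<close> comes from moving an odd letter past the third letter.\<close>

definition low1 :: "int \<Rightarrow> (int \<Rightarrow> int \<Rightarrow> int \<Rightarrow> 'k) \<Rightarrow> int \<Rightarrow> 'k" where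
  "low1 m H w = (\<Sum>k\<in>{0<..<\<bar>m\<bar>}. H k (- k) w - H (- k) k w)"
definition low2 :: "int \<Rightarrow> (int \<Rightarrow> int \<Rightarrow> int \<Rightarrow> 'k) \<Rightarrow> int \<Rightarrow> 'k" where
  "low2 m H w = (\<Sum>k\<in>{0<..<\<bar>m\<bar>}. H k w (- k) - sg (w < 0) * H (- k) w k)"
definition low3 :: "int \<Rightarrow> (int \<Rightarrow> int \<Rightarrow> int \<Rightarrow> 'k) \<Rightarrow> int \<Rightarrow> 'k" where
  "low3 m H w = (\<Sum>k\<in>{0<..<\<bar>m\<bar>}. H w k (- k) - H w (- k) k)"

lemma low_low1: "low m (\<lambda>a b. H a b w) = low1 m H w" by (simp add: low_def low1_def)
lemma low_low3: "low m (H w) = low3 m H w" by (simp add: low_def low3_def)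

lemma low1_xop1: "low1 m (xop1 H) w = - qi * low1 m H w"
  using low_xop[of m "\<lambda>a b. H a b w"] by (simp add: low_def low1_def xop1_def)
lemma low3_xop2: "low3 m (xop2 H) w = - qi * low3 m H w"
  using low_xop[of m "\<lambda>a b. H w a b"] by (simp add: low_def low3_def xop2_def)

lemma low1_xop2: "\<bar>m\<bar> \<le> \<bar>w\<bar> \<Longrightarrow> low1 m (xop2 H) w = sg (w < 0) * low2 m H w"
  unfolding low1_def low2_def sum_distrib_left xop2_def
  by (rule sum.cong) (auto simp: xop_lt algebra_simps)
lemma low3_xop1: "\<bar>m\<bar> \<le> \<bar>w\<bar> \<Longrightarrow> low3 m (xop1 H) w = low2 m H w + z * low3 m H w"
  unfolding low3_def low2_def sum_distrib_left sum.distrib[symmetric] xop1_def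
  by (rule sum.cong) (auto simp: xop_gt algebra_simps)
lemma low2_xop1: "\<bar>m\<bar> \<le> \<bar>w\<bar> \<Longrightarrow> low2 m (xop1 H) w = low3 m H w"
  unfolding low3_def low2_def sum_distrib_left sum.distrib[symmetric] xop1_def
  by (rule sum.cong) (auto simp: xop_lt algebra_simps)
lemma low2_xop2: "\<bar>m\<bar> \<le> \<bar>w\<bar> \<Longrightarrow> low2 m (xop2 H) w = sg (w < 0) * low1 m H w + z * low2 m H w"
  unfolding low1_def low2_def sum_distrib_left sum.distrib[symmetric] xop2_def
  by (rule sum.cong) (auto simp: xop_gt algebra_simps)

lemma xop1_lt: "\<bar>x\<bar> < \<bar>y\<bar> \<Longrightarrow> xop1 H x y w = sg (x < 0 \<and> y < 0) * H y x w"
  by (simp add: xop1_def xop_lt)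
lemma xop2_lt: "\<bar>y\<bar> < \<bar>w\<bar> \<Longrightarrow> xop2 H x y w = sg (y < 0 \<and> w < 0) * H x w y"
  by (simp add: xop2_def xop_lt)
lemma xop1_gt: "\<bar>y\<bar> < \<bar>x\<bar> \<Longrightarrow> xop1 H x y w = sg (x < 0 \<and> y < 0) * H y x w + z * H x y w"
  by (simp add: xop1_def xop_gt)
lemma xop2_gt: "\<bar>w\<bar> < \<bar>y\<bar> \<Longrightarrow> xop2 H x y w = sg (y < 0 \<and> w < 0) * H x w y + z * H x y w"
  by (simp add: xop2_def xop_gt)
lemma xop1_eq: "x \<noteq> 0 \<Longrightarrow> xop1 H x x w = (if 0 < x then q else - qi) * H x x w"
  by (simp add: xop1_def xop_eq)
lemma xop2_eq: "x \<noteq> 0 \<Longrightarrow> xop2 H w x x = (if 0 < x then q else - qi) * H w x x"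
  by (simp add: xop2_def xop_eq)
lemma xop1_pos: "0 < x \<Longrightarrow> xop1 H x (- x) w = qi * H (- x) x w + z * H x (- x) w + z * low1 x H w"
  by (simp add: xop1_def xop_opp low_low1)
lemma xop1_neg: "0 < x \<Longrightarrow> xop1 H (- x) x w = q * H x (- x) w + z * low1 x H w"
  by (simp add: xop1_def xop_opp' low_low1)
lemma xop2_pos: "0 < x \<Longrightarrow> xop2 H w x (- x) = qi * H w (- x) x + z * H w x (- x) + z * low3 x H w"
  by (simp add: xop2_def xop_opp low_low3)
lemma xop2_neg: "0 < x \<Longrightarrow> xop2 H w (- x) x = q * H w x (- x) + z * low3 x H w"
  by (simp add: xop2_def xop_opp' low_low3)

lemmas xop12 = xop1_lt xop2_lt xop1_gt xop2_gt xop1_eq xop2_eq xop1_pos xop1_neg xop2_pos xop2_neg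
  low1_xop1 low3_xop2 low1_xop2 low3_xop1 low2_xop1 low2_xop2

lemma low3_split:
  assumes "\<bar>w\<bar> < m" "w \<noteq> 0"
  shows "low3 m H w = low3 w H w + (H w \<bar>w\<bar> (- \<bar>w\<bar>) - H w (- \<bar>w\<bar>) \<bar>w\<bar>) +
    (\<Sum>k\<in>{\<bar>w\<bar><..<m}. H w k (- k) - H w (- k) k)"
proof -
  have "{0<..<\<bar>m\<bar>} = insert \<bar>w\<bar> {0<..<\<bar>w\<bar>} \<union> {\<bar>w\<bar><..<m}" using assms by auto
  then show ?thesis
    unfolding low3_def by (simp only:, subst sum.union_disjoint) (auto simp: algebra_simps)
qed

lemma low1_split:
  assumes "\<bar>w\<bar> < m" "w \<noteq> 0"
  shows "low1 m H w = low1 w H w + (H \<bar>w\<bar> (- \<bar>w\<bar>) w - H (- \<bar>w\<bar>) \<bar>w\<bar> w) +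
    (\<Sum>k\<in>{\<bar>w\<bar><..<m}. H k (- k) w - H (- k) k w)"
proof -
  have "{0<..<\<bar>m\<bar>} = insert \<bar>w\<bar> {0<..<\<bar>w\<bar>} \<union> {\<bar>w\<bar><..<m}" using assms by auto
  then show ?thesis
    unfolding low1_def by (simp only:, subst sum.union_disjoint) (auto simp: algebra_simps)
qed

text \<open>A sum over opposite pairs can be moved past a third letter. This carries the lower terms through the
braid relation.\<close>

lemma low_slide:
  assumes w: "w \<noteq> 0" "\<bar>w\<bar> < m"
  shows "low3 m (xop1 (xop2 H)) w = sg (w < 0) * low1 m H w"
proof -
  have 1: "(\<Sum>k\<in>{\<bar>w\<bar><..<m}. xop1 (xop2 H) w k (- k) - xop1 (xop2 H) w (- k) k) =
      sg (w < 0) * (\<Sum>k\<in>{\<bar>w\<bar><..<m}. H k (- k) w - H (- k) k w)"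
    unfolding sum_distrib_left
    by (rule sum.cong) (auto simp: xop1_lt xop2_lt sg_def)
  show ?thesis
  proof (cases "0 < w")
    case True
    then show ?thesis
      unfolding low3_split[OF w(2,1)] low1_split[OF w(2,1)] 1
      by (simp add: xop12 algebra_simps q_cancel)
  next
    case False
    then obtain v where v: "w = - v" "0 < v" using w by (metis neg_0_less_iff_less neg_equal_iff_equal linorder_neqE_linordered_idom minus_minus minus_zero)
    have e: "xop1 G (- v) (- v) a = - qi * G (- v) (- v) a" "xop2 G a (- v) (- v) = - qi * G a (- v) (- v)"
      for G a using v by (simp_all add: xop1_def xop2_def xop_eq)
    have l: "low1 (- v) = low1 v" "low3 (- v) = low3 v" "low2 (- v) = low2 v"
      by (auto simp: fun_eq_iff low1_def low3_def low2_def)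
    show ?thesis
      unfolding low3_split[OF w(2,1)] low1_split[OF w(2,1)] 1
      using v by (simp add: xop12 e l algebra_simps q_cancel)
  qed
qed

lemma xop1_quadratic: "x \<noteq> 0 \<Longrightarrow> y \<noteq> 0 \<Longrightarrow> xop1 (xop1 H) x y w = z * xop1 H x y w + H x y w"
  unfolding xop1_def by (rule xop_quadratic)
lemma xop2_quadratic: "w \<noteq> 0 \<Longrightarrow> y \<noteq> 0 \<Longrightarrow> xop2 (xop2 H) x y w = z * xop2 H x y w + H x y w"
  unfolding xop2_def by (rule xop_quadratic)

text \<open>The braid relation at a single triple of letters. It is checked directly for triples whose absolute
values increase, and for a few with equal absolute values, and then transported to all orders.\<close>

definition braids :: "int \<Rightarrow> int \<Rightarrow> int \<Rightarrow> bool" where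
  "braids x y w \<longleftrightarrow> (\<forall>H. xop1 (xop2 (xop1 H)) x y w = xop2 (xop1 (xop2 H)) x y w)"

abbreviation (input) "defect H x y w \<equiv> xop1 (xop2 (xop1 H)) x y w - xop2 (xop1 (xop2 H)) x y w"

lemma xop1_cong:
  assumes "\<And>a b. a \<noteq> 0 \<Longrightarrow> b \<noteq> 0 \<Longrightarrow> G a b w = H a b w" "x \<noteq> 0" "y \<noteq> 0"
  shows "xop1 G x y w = xop1 H x y w"
  unfolding xop1_def by (rule xop_cong) (use assms in auto)
lemma xop2_cong:
  assumes "\<And>a b. a \<noteq> 0 \<Longrightarrow> b \<noteq> 0 \<Longrightarrow> G x a b = H x a b" "y \<noteq> 0" "w \<noteq> 0"
  shows "xop2 G x y w = xop2 H x y w"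
  unfolding xop2_def by (rule xop_cong) (use assms in auto)

lemma xop1_lin: "xop1 (\<lambda>a b c. G a b c - H a b c) x y w = xop1 G x y w - xop1 H x y w"
  "xop1 (\<lambda>a b c. G a b c + H a b c) x y w = xop1 G x y w + xop1 H x y w"
  "xop1 (\<lambda>a b c. t * G a b c) x y w = t * xop1 G x y w"
proof -
  show 1: "xop1 (\<lambda>a b c. G a b c - H a b c) x y w = xop1 G x y w - xop1 H x y w" for G H
    unfolding xop1_def by (rule xop_diff)
  show 2: "xop1 (\<lambda>a b c. t * G a b c) x y w = t * xop1 G x y w" for t G
    unfolding xop1_def by (rule xop_scale)
  have "(\<lambda>a b c. G a b c + H a b c) = (\<lambda>a b c. G a b c - (- 1) * H a b c)" by auto
  then show "xop1 (\<lambda>a b c. G a b c + H a b c) x y w = xop1 G x y w + xop1 H x y w"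
    using 1[of G "\<lambda>a b c. - 1 * H a b c"] 2[of "- 1" H] by (simp only:) simp
qed
lemma xop2_lin: "xop2 (\<lambda>a b c. G a b c - H a b c) x y w = xop2 G x y w - xop2 H x y w"
  "xop2 (\<lambda>a b c. G a b c + H a b c) x y w = xop2 G x y w + xop2 H x y w"
  "xop2 (\<lambda>a b c. t * G a b c) x y w = t * xop2 G x y w"
proof -
  show 1: "xop2 (\<lambda>a b c. G a b c - H a b c) x y w = xop2 G x y w - xop2 H x y w" for G H
    unfolding xop2_def by (rule xop_diff)
  show 2: "xop2 (\<lambda>a b c. t * G a b c) x y w = t * xop2 G x y w" for t G
    unfolding xop2_def by (rule xop_scale)
  have "(\<lambda>a b c. G a b c + H a b c) = (\<lambda>a b c. G a b c - (- 1) * H a b c)" by auto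
  then show "xop2 (\<lambda>a b c. G a b c + H a b c) x y w = xop2 G x y w + xop2 H x y w"
    using 1[of G "\<lambda>a b c. - 1 * H a b c"] 2[of "- 1" H] by (simp only:) simp
qed

text \<open>Write \<open>X\<^sub>1\<close>, \<open>X\<^sub>2\<close> for \<open>xop1\<close>, \<open>xop2\<close> and \<open>\<Delta>\<close> for the defect \<open>X\<^sub>1 X\<^sub>2 X\<^sub>1 - X\<^sub>2 X\<^sub>1 X\<^sub>2\<close>. By the quadratic
relation, \<open>X\<^sub>1 \<Delta> = \<Delta> (z - X\<^sub>2)\<close>, and the right-hand side vanishes at a triple at which the braid relation holds
for all functions.\<close>

lemma defect1:
  assumes "braids x y w" "x \<noteq> 0" "y \<noteq> 0" "w \<noteq> 0"
  shows "xop1 (\<lambda>a b c. defect H a b c) x y w = 0"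
proof -
  have b: "xop1 (xop2 (xop1 G)) x y w = xop2 (xop1 (xop2 G)) x y w" for G
    using assms(1) by (simp add: braids_def)
  have "xop1 (xop1 (xop2 (xop1 H))) x y w = z * xop1 (xop2 (xop1 H)) x y w + xop2 (xop1 H) x y w"
    using assms by (intro xop1_quadratic)
  moreover have "xop1 (xop2 (xop1 (xop2 H))) x y w = xop2 (xop1 (xop2 (xop2 H))) x y w" by (rule b)
  moreover have "\<dots> = xop2 (xop1 (\<lambda>a b c. z * xop2 H a b c + H a b c)) x y w"
    by (intro xop2_cong xop1_cong xop2_quadratic) (use assms in auto)
  moreover have "\<dots> = z * xop2 (xop1 (xop2 H)) x y w + xop2 (xop1 H) x y w"
    by (simp add: xop1_lin[abs_def] xop2_lin)
  ultimately show ?thesis by (simp add: xop1_lin b)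
qed

lemma defect2:
  assumes "braids x y w" "x \<noteq> 0" "y \<noteq> 0" "w \<noteq> 0"
  shows "xop2 (\<lambda>a b c. defect H a b c) x y w = 0"
proof -
  have b: "xop1 (xop2 (xop1 G)) x y w = xop2 (xop1 (xop2 G)) x y w" for G
    using assms(1) by (simp add: braids_def)
  have "xop2 (xop2 (xop1 (xop2 H))) x y w = z * xop2 (xop1 (xop2 H)) x y w + xop1 (xop2 H) x y w"
    using assms by (intro xop2_quadratic)
  moreover have "xop2 (xop1 (xop2 (xop1 H))) x y w = xop1 (xop2 (xop1 (xop1 H))) x y w"
    by (rule b[symmetric])
  moreover have "\<dots> = xop1 (xop2 (\<lambda>a b c. z * xop1 H a b c + H a b c)) x y w"
    by (intro xop2_cong xop1_cong xop1_quadratic) (use assms in auto)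
  moreover have "\<dots> = z * xop1 (xop2 (xop1 H)) x y w + xop1 (xop2 H) x y w"
    by (simp add: xop2_lin[abs_def] xop1_lin)
  ultimately show ?thesis by (simp add: xop2_lin b)
qed

lemma sg_eq0: "sg b * t = 0 \<longleftrightarrow> t = 0" by (auto simp: sg_def)

text \<open>At letters with different absolute values, the value of \<open>xop1\<close> is a multiple of the value at
the given triple plus, up to sign, the value at the exchanged triple. Applied to the defect of the
braid relation, of which the former vanishes, it shows that the latter vanishes too.\<close>

lemma braids_swap1:
  assumes "braids x y w" "x \<noteq> 0" "y \<noteq> 0" "w \<noteq> 0" "\<bar>x\<bar> \<noteq> \<bar>y\<bar>"
  shows "braids y x w"
proof -
  have "defect H y x w = 0" for H
  proof -
    have "defect H x y w = 0" using assms(1) by (simp add: braids_def)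
    then show ?thesis
      using defect1[OF assms(1-4), of H] assms(5)
      by (auto simp: xop1_def[of "\<lambda>a b c. defect H a b c"] xop_def sg_eq0 split: if_splits)
  qed
  then show ?thesis by (simp add: braids_def)
qed

lemma braids_swap2:
  assumes "braids x y w" "x \<noteq> 0" "y \<noteq> 0" "w \<noteq> 0" "\<bar>y\<bar> \<noteq> \<bar>w\<bar>"
  shows "braids x w y"
proof -
  have "defect H x w y = 0" for H
  proof -
    have "defect H x y w = 0" using assms(1) by (simp add: braids_def)
    then show ?thesis
      using defect2[OF assms(1-4), of H] assms(5)
      by (auto simp: xop2_def[of "\<lambda>a b c. defect H a b c"] xop_def sg_eq0 split: if_splits)
  qed
  then show ?thesis by (simp add: braids_def)
qed

lemma low_zero: "(\<And>k. k \<noteq> 0 \<Longrightarrow> \<bar>k\<bar> < \<bar>x\<bar> \<Longrightarrow> G k (- k) = 0) \<Longrightarrow> low x G = 0"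
proof -
  assume a: "\<And>k. k \<noteq> 0 \<Longrightarrow> \<bar>k\<bar> < \<bar>x\<bar> \<Longrightarrow> G k (- k) = 0"
  have "G k (- k) - G (- k) k = 0" if "k \<in> {0<..<\<bar>x\<bar>}" for k
    using a[of k] a[of "- k"] that by auto
  then show ?thesis unfolding low_def by (intro sum.neutral) blast
qed

lemma unit_q: "q * t = 0 \<longleftrightarrow> t = 0" "qi * t = 0 \<longleftrightarrow> t = 0"
  using q_cancel(3,4)[of t] by (metis mult_zero_right)+

lemma xop_opp_zero:
  assumes "xop G x (- x) = 0" "G x (- x) = 0" "low x G = 0" "x \<noteq> 0"
  shows "G (- x) x = 0"
  using assms by (auto simp: xop_opp unit_q split: if_splits)

text \<open>The same argument at opposite letters, where the lower pairs enter as well.\<close>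

lemma braids_opp1:
  assumes "braids x (- x) w" "x \<noteq> 0" "w \<noteq> 0" "\<And>k. k \<noteq> 0 \<Longrightarrow> \<bar>k\<bar> < \<bar>x\<bar> \<Longrightarrow> braids k (- k) w"
  shows "braids (- x) x w"
proof -
  have "defect H (- x) x w = 0" for H
  proof (rule xop_opp_zero[where x = x and G = "\<lambda>a b. defect H a b w"])
    show "xop (\<lambda>a b. defect H a b w) x (- x) = 0"
      using defect1[OF assms(1), of H] assms by (simp add: xop1_def[of "\<lambda>a b c. defect H a b c"])
    show "low x (\<lambda>a b. defect H a b w) = 0"
      using assms(4) by (intro low_zero) (auto simp: braids_def)
  qed (use assms in \<open>auto simp: braids_def\<close>)
  then show ?thesis by (simp add: braids_def)
qed

lemma braids_opp2:
  assumes "braids w x (- x)" "x \<noteq> 0" "w \<noteq> 0" "\<And>k. k \<noteq> 0 \<Longrightarrow> \<bar>k\<bar> < \<bar>x\<bar> \<Longrightarrow> braids w k (- k)"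
  shows "braids w (- x) x"
proof -
  have "defect H w (- x) x = 0" for H
  proof (rule xop_opp_zero[where x = x and G = "\<lambda>a b. defect H w a b"])
    show "xop (\<lambda>a b. defect H w a b) x (- x) = 0"
      using defect2[OF assms(1), of H] assms by (simp add: xop2_def[of "\<lambda>a b c. defect H a b c"])
    show "low x (\<lambda>a b. defect H w a b) = 0"
      using assms(4) by (intro low_zero) (auto simp: braids_def)
  qed (use assms in \<open>auto simp: braids_def\<close>)
  then show ?thesis by (simp add: braids_def)
qed

lemma braids_increasing:
  assumes "\<bar>x\<bar> < \<bar>y\<bar>" "\<bar>y\<bar> < \<bar>w\<bar>" shows "braids x y w"
  unfolding braids_def using assms by (simp add: xop1_lt xop2_lt algebra_simps)

lemma braids_eq_lt: "\<bar>x\<bar> < \<bar>w\<bar> \<Longrightarrow> x \<noteq> 0 \<Longrightarrow> braids x x w"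
  unfolding braids_def by (simp add: xop1_lt xop2_lt xop1_eq xop2_eq algebra_simps)

lemma braids_eq_gt: "\<bar>w\<bar> < \<bar>x\<bar> \<Longrightarrow> x \<noteq> 0 \<Longrightarrow> braids w x x"
  unfolding braids_def by (simp add: xop1_lt xop2_lt xop1_eq xop2_eq algebra_simps)

lemma braids_all_eq: "x \<noteq> 0 \<Longrightarrow> braids x x x"
  unfolding braids_def by (simp add: xop1_eq xop2_eq algebra_simps)

lemma braids_opp_lt:
  assumes "\<bar>x\<bar> < \<bar>w\<bar>" "x \<noteq> 0" shows "braids x (- x) w"
proof -
  have e: "xop2 (xop1 H) a (- a) w = sg (w < 0) * H w a (- a)" if "a \<noteq> 0" "\<bar>a\<bar> < \<bar>w\<bar>" for H a
    using that by (simp add: xop2_lt xop1_lt) (auto simp: sg_def)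
  have l: "low1 x (xop2 (xop1 H)) w = sg (w < 0) * low3 x H w" for H
    unfolding low1_def low3_def sum_distrib_left
  proof (rule sum.cong)
    fix k assume "k \<in> {0<..<\<bar>x\<bar>}"
    then show "xop2 (xop1 H) k (- k) w - xop2 (xop1 H) (- k) k w =
        sg (w < 0) * (H w k (- k) - H w (- k) k)"
      using e[of k H] e[of "- k" H] assms by (auto simp: algebra_simps)
  qed simp
  show ?thesis
    unfolding braids_def
  proof
    fix H
    have "xop1 (xop2 (xop1 H)) x (- x) w = sg (w < 0) * xop2 H w x (- x)"
      using e[of x H] e[of "- x" H] assms
      by (auto simp: xop1_def[of "xop2 (xop1 H)"] xop2_def[of H] xop_opp low_low1 low_low3 l algebra_simps)
    also have "\<dots> = xop2 (xop1 (xop2 H)) x (- x) w"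
      using assms by (simp add: xop2_lt xop1_lt) (auto simp: sg_def)
    finally show "xop1 (xop2 (xop1 H)) x (- x) w = xop2 (xop1 (xop2 H)) x (- x) w" .
  qed
qed

lemma braids_opp_gt:
  assumes "\<bar>w\<bar> < \<bar>x\<bar>" "w \<noteq> 0" shows "braids w x (- x)"
proof -
  have e: "xop1 (xop2 H) w a (- a) = sg (w < 0) * H a (- a) w" if "a \<noteq> 0" "\<bar>w\<bar> < \<bar>a\<bar>" for H a
    using that by (simp add: xop2_lt xop1_lt) (auto simp: sg_def)
  have l: "low3 x (xop1 (xop2 H)) w = sg (w < 0) * low1 x H w" for H
    using low_slide[of w "\<bar>x\<bar>" H] assms by (simp add: low3_def low1_def)
  show ?thesis
    unfolding braids_def
  proof
    fix H
    have "xop2 (xop1 (xop2 H)) w x (- x) = sg (w < 0) * xop1 H x (- x) w"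
      using e[of x H] e[of "- x" H] assms
      by (auto simp: xop2_def[of "xop1 (xop2 H)"] xop1_def[of H] xop_opp low_low1 low_low3 l algebra_simps)
    also have "\<dots> = xop1 (xop2 (xop1 H)) w x (- x)"
      using assms by (simp add: xop2_lt xop1_lt) (auto simp: sg_def)
    finally show "xop1 (xop2 (xop1 H)) w x (- x) = xop2 (xop1 (xop2 H)) w x (- x)" by simp
  qed
qed

lemma low_uminus3: "low1 (- v) = low1 v" "low3 (- v) = low3 v" "low2 (- v) = low2 v"
  by (auto simp: fun_eq_iff low1_def low3_def low2_def)

lemma braids_opp_eq:
  assumes "x \<noteq> 0" shows "braids x x (- x)"
proof (cases "0 < x")
  case True
  then show ?thesis unfolding braids_def by (simp add: xop12 algebra_simps q_cancel)
next
  case False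
  then obtain v where v: "x = - v" "0 < v" using assms by (metis neg_0_less_iff_less neg_equal_iff_equal linorder_neqE_linordered_idom minus_minus minus_zero)
  have e: "xop1 G (- v) (- v) a = - qi * G (- v) (- v) a" "xop2 G a (- v) (- v) = - qi * G a (- v) (- v)"
    for G a using v by (simp_all add: xop1_def xop2_def xop_eq)
  show ?thesis unfolding braids_def using v
    by (simp add: xop12 e low_uminus3 algebra_simps q_cancel)
qed

lemma braids_12: assumes "x \<noteq> 0" "w \<noteq> 0" "\<bar>x\<bar> \<noteq> \<bar>w\<bar>" "y = x \<or> y = - x"
  shows "braids x y w \<and> braids x w y \<and> braids w x y"
proof (cases "\<bar>x\<bar> < \<bar>w\<bar>")
  case True
  have "braids x y w" using assms True braids_eq_lt braids_opp_lt by blast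
  then show ?thesis
    using braids_swap2[of x y w] braids_swap1[of x w y] assms by auto
next
  case False
  have "braids w x y" using assms False braids_eq_gt braids_opp_gt by auto
  then show ?thesis
    using braids_swap1[of w x y] braids_swap2[of x w y] assms by auto
qed

text \<open>Exchanging neighbours reduces every triple to one in which the absolute values are sorted, except
that an exchange of two equal or opposite letters has to be treated separately.\<close>

theorem braid_relation:
  assumes "x \<noteq> 0" "y \<noteq> 0" "w \<noteq> 0"
  shows "xop1 (xop2 (xop1 H)) x y w = xop2 (xop1 (xop2 H)) x y w"
proof -
  have "braids x y w"
  proof (cases "\<bar>x\<bar> = \<bar>y\<bar> \<or> \<bar>x\<bar> = \<bar>w\<bar> \<or> \<bar>y\<bar> = \<bar>w\<bar>")
    case False
    note s = assms False
    consider "\<bar>x\<bar> < \<bar>y\<bar>" "\<bar>y\<bar> < \<bar>w\<bar>" | "\<bar>x\<bar> < \<bar>w\<bar>" "\<bar>w\<bar> < \<bar>y\<bar>" | "\<bar>y\<bar> < \<bar>x\<bar>" "\<bar>x\<bar> < \<bar>w\<bar>"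
      | "\<bar>y\<bar> < \<bar>w\<bar>" "\<bar>w\<bar> < \<bar>x\<bar>" | "\<bar>w\<bar> < \<bar>x\<bar>" "\<bar>x\<bar> < \<bar>y\<bar>" | "\<bar>w\<bar> < \<bar>y\<bar>" "\<bar>y\<bar> < \<bar>x\<bar>"
      using False by linarith
    then show ?thesis
    proof cases
      case 1 then show ?thesis by (rule braids_increasing)
    next
      case 2 then show ?thesis using braids_increasing braids_swap2 s by metis
    next
      case 3 then show ?thesis using braids_increasing braids_swap1 s by metis
    next
      case 4 then show ?thesis using braids_increasing braids_swap2[of y x w] braids_swap1 braids_swap2 s by metis
    next
      case 5 then show ?thesis using braids_increasing braids_swap2 braids_swap1 s by metis
    next
      case 6
      have "braids y w x" using braids_increasing[of w y x] braids_swap1[of w y x] s 6 by auto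
      then have "braids y x w" using braids_swap2[of y w x] s by auto
      then show ?thesis using braids_swap1[of y x w] s by auto
    qed
  next
    case True
    show ?thesis
    proof (cases "\<bar>x\<bar> = \<bar>y\<bar> \<and> \<bar>x\<bar> = \<bar>w\<bar>")
      case False
      then consider "\<bar>x\<bar> = \<bar>y\<bar>" "\<bar>x\<bar> \<noteq> \<bar>w\<bar>" | "\<bar>x\<bar> = \<bar>w\<bar>" "\<bar>x\<bar> \<noteq> \<bar>y\<bar>" | "\<bar>y\<bar> = \<bar>w\<bar>" "\<bar>x\<bar> \<noteq> \<bar>y\<bar>"
        using True by auto
      then show ?thesis
      proof cases
        case 1 then show ?thesis using braids_12[of x w y] assms by (auto simp: abs_eq_iff)
      next
        case 2
        have "w = x \<or> w = - x" using 2(1) by arith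
        then show ?thesis using braids_12[of x y w] 2 assms by auto
      next
        case 3
        have "w = y \<or> w = - y" using 3(1) by arith
        then show ?thesis using braids_12[of y x w] 3 assms by auto
      qed
    next
      case e: True
      have A: "braids x x (- x)" "braids x (- x) x" "braids (- x) x x" if "x \<noteq> 0" for x
      proof -
        show 1: "braids x x (- x)" using that by (rule braids_opp_eq)
        show 2: "braids x (- x) x"
          by (rule braids_opp2[OF 1]) (use that braids_12[of _ x] in auto)
        show "braids (- x) x x"
          by (rule braids_opp1[OF 2]) (use that braids_12[of _ x] in auto)
      qed
      have "y = x \<or> y = - x" "w = x \<or> w = - x" using e by arith+
      then show ?thesis
        using A[of x] A[of "- x"] assms braids_all_eq[of x] by auto
    qed
  qed
  then show ?thesis by (simp add: braids_def)
qed

end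

section \<open>The action of morphisms on functions of words\<close>
text \<open>The objects between which an expression is a morphism are computed from the expression, which turns the
inductive typing relation into a check.\<close>

fun msrc :: "'k mor \<Rightarrow> nat" where
  "msrc (Piece p) = piece_src p"
| "msrc (Comp g h) = msrc h"
| "msrc (Tens f g) = msrc f + msrc g"
| "msrc (Zero m n) = m"
| "msrc (Add f g) = msrc f"
| "msrc (Scale c f) = msrc f"

fun mtgt :: "'k mor \<Rightarrow> nat" where
  "mtgt (Piece p) = piece_tgt p"
| "mtgt (Comp g h) = mtgt g"
| "mtgt (Tens f g) = mtgt f + mtgt g"
| "mtgt (Zero m n) = n"
| "mtgt (Add f g) = mtgt f"
| "mtgt (Scale c f) = mtgt f"

fun welltyped :: "'k mor \<Rightarrow> bool" where
  "welltyped (Piece p) = True"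
| "welltyped (Comp g h) = (welltyped g \<and> welltyped h \<and> msrc g = mtgt h)"
| "welltyped (Tens f g) = (welltyped f \<and> welltyped g)"
| "welltyped (Zero m n) = True"
| "welltyped (Add f g) = (welltyped f \<and> welltyped g \<and> msrc f = msrc g \<and> mtgt f = mtgt g)"
| "welltyped (Scale c f) = welltyped f"

lemma in_hom_iff: "in_hom f m n \<longleftrightarrow> welltyped f \<and> msrc f = m \<and> mtgt f = n"
proof
  assume "in_hom f m n" then show "welltyped f \<and> msrc f = m \<and> mtgt f = n"
    by induction auto
next
  have "welltyped f \<Longrightarrow> in_hom f (msrc f) (mtgt f)"
  proof (induction f)
    case (Piece p) then show ?case by (simp add: in_hom.intros(1))
  next
    case (Comp g h) then show ?case by (simp add: in_hom.intros(2)[of g "mtgt h"])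
  next
    case (Tens f g) then show ?case by (simp add: in_hom.intros(3))
  next
    case (Zero m n) then show ?case by (simp add: in_hom.intros(4))
  next
    case (Add f g) then show ?case by (simp add: in_hom.intros(5))
  next
    case (Scale c f) then show ?case by (simp add: in_hom.intros(6))
  qed
  then show "welltyped f \<and> msrc f = m \<and> mtgt f = n \<Longrightarrow> in_hom f m n" by auto
qed

lemma mor_eq_in_hom: "mor_eq q m n f g \<Longrightarrow> in_hom f m n \<and> in_hom g m n"
  by (induction rule: mor_eq.induct) (simp_all add: in_hom_iff)

lemma has_parity_iff:
  "has_parity (Piece p) b \<longleftrightarrow> b = (p = Cup \<or> p = Cap)"
  "has_parity (Comp f g) b \<longleftrightarrow> (\<exists>c d. has_parity f c \<and> has_parity g d \<and> b = (c \<noteq> d))"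
  "has_parity (Tens f g) b \<longleftrightarrow> (\<exists>c d. has_parity f c \<and> has_parity g d \<and> b = (c \<noteq> d))"
  "has_parity (Zero m n) b"
  "has_parity (Add f g) b \<longleftrightarrow> has_parity f b \<and> has_parity g b"
  "has_parity (Scale t f) b \<longleftrightarrow> has_parity f b"
proof -
  show "has_parity (Piece p) b \<longleftrightarrow> b = (p = Cup \<or> p = Cap)"
    by (rule iffI, cases rule: has_parity.cases, assumption) (simp_all add: has_parity.intros)
  show "has_parity (Comp f g) b \<longleftrightarrow> (\<exists>c d. has_parity f c \<and> has_parity g d \<and> b = (c \<noteq> d))"
    by (rule iffI, cases rule: has_parity.cases, assumption) (blast intro: has_parity.intros)+
  show "has_parity (Tens f g) b \<longleftrightarrow> (\<exists>c d. has_parity f c \<and> has_parity g d \<and> b = (c \<noteq> d))"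
    by (rule iffI, cases rule: has_parity.cases, assumption) (blast intro: has_parity.intros)+
  show "has_parity (Zero m n) b" by (rule has_parity.intros)
  show "has_parity (Add f g) b \<longleftrightarrow> has_parity f b \<and> has_parity g b"
    by (rule iffI, cases rule: has_parity.cases, assumption) (blast intro: has_parity.intros)+
  show "has_parity (Scale t f) b \<longleftrightarrow> has_parity f b"
    by (rule iffI, cases rule: has_parity.cases, assumption) (blast intro: has_parity.intros)+
qed

context rmatrix
begin

lemma xop_add: "xop (\<lambda>a b. G a b + H a b) x y = xop G x y + xop H x y"
  using xop_diff[of G "\<lambda>a b. - 1 * H a b" x y] xop_scale[of "- 1" H x y] by simp

lemma xop_zero: "xop (\<lambda>a b. 0) x y = 0"
  using xop_scale[of 0 "\<lambda>a b. 0"] by simp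

lemma xop_sum: "finite A \<Longrightarrow> xop (\<lambda>a b. \<Sum>i\<in>A. f i a b) x y = (\<Sum>i\<in>A. xop (f i) x y)"
  by (induction A rule: finite_induct) (simp_all add: xop_add xop_zero)

lemma xop_parity:
  assumes "xop G x y \<noteq> 0" "x \<noteq> 0" "y \<noteq> 0"
  shows "\<exists>a b. a \<noteq> 0 \<and> b \<noteq> 0 \<and> G a b \<noteq> 0 \<and> ((a < 0) \<noteq> (b < 0)) = ((x < 0) \<noteq> (y < 0))"
proof (rule ccontr)
  assume "\<not> ?thesis"
  then have n: "G a b = 0" if "a \<noteq> 0" "b \<noteq> 0" "((a < 0) \<noteq> (b < 0)) = ((x < 0) \<noteq> (y < 0))" for a b
    using that by blast
  have "xop G x y = 0"
  proof (cases "y = - x")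
    case True
    have k: "G k (- k) = 0" if "k \<noteq> 0" for k using n[of k "- k"] that True assms(2)
      by (cases "k < 0"; cases "x < 0") auto
    have "low x G = 0" using k by (intro low_zero) auto
    then show ?thesis using k[of x] k[of "- x"] True assms(2) by (simp add: xop_opp)
  next
    case False
    have "G x y = 0" "G y x = 0" using n[of x y] n[of y x] assms by auto
    then show ?thesis
    proof (cases "x = y")
      case True
      then show ?thesis using \<open>G x y = 0\<close> assms by (simp add: xop_eq)
    next
      case False
      then have "\<bar>x\<bar> \<noteq> \<bar>y\<bar>" using \<open>y \<noteq> - x\<close> by arith
      then show ?thesis using \<open>G x y = 0\<close> \<open>G y x = 0\<close> by (simp add: xop_def)
    qed
  qed
  then show False using assms by simp
qed

end

definition is_odd :: "piece \<Rightarrow> bool" where "is_odd p \<longleftrightarrow> p = Cup \<or> p = Cap"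

lemma is_odd_simps [simp]: "is_odd Cup" "is_odd Cap" "\<not> is_odd CrossX" "\<not> is_odd CrossY" "\<not> is_odd (Strands k)"
  by (auto simp: is_odd_def)

locale rmatrix_words = rmatrix q qi for q qi :: "'k::comm_ring_1" +
  fixes n :: nat
begin

text \<open>The matrices of the generators. The cup creates all pairs \<open>x, - x\<close> with coefficient 1; the cap
evaluates such a pair, with a sign if its first letter is odd.\<close>

definition entry :: "piece \<Rightarrow> int list \<Rightarrow> int list \<Rightarrow> 'k" where
  "entry p s t = (case p of
      Strands _ \<Rightarrow> (if s = t then 1 else 0)
    | CrossX \<Rightarrow> xop (\<lambda>c d. if t = [c, d] then 1 else 0) (s ! 0) (s ! 1)
    | CrossY \<Rightarrow> xop (\<lambda>c d. if t = [c, d] then 1 else 0) (s ! 0) (s ! 1) - (if s = t then z else 0)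
    | Cup \<Rightarrow> (if s ! 1 = - s ! 0 then 1 else 0)
    | Cap \<Rightarrow> (if t ! 1 = - t ! 0 then sg (t ! 0 < 0) else 0))"

text \<open>An odd generator passes the first \<open>a\<close> tensor factors, which produces a sign.\<close>

definition piece_op :: "piece \<Rightarrow> nat \<Rightarrow> (int list \<Rightarrow> 'k) \<Rightarrow> int list \<Rightarrow> 'k" where
  "piece_op p a F w = sg (is_odd p \<and> negs (take a w)) *
     (\<Sum>t\<in>words n (piece_src p).
        entry p (take (piece_tgt p) (drop a w)) t * F (take a w @ t @ drop (a + piece_tgt p) w))"

text \<open>The argument \<open>a\<close> is the number of strands on the left of the morphism. The strands on its right
need no parameter, since the words are of arbitrary length.\<close>

primrec act :: "'k mor \<Rightarrow> nat \<Rightarrow> (int list \<Rightarrow> 'k) \<Rightarrow> int list \<Rightarrow> 'k" where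
  "act (Piece p) a F = piece_op p a F"
| "act (Comp g h) a F = act g a (act h a F)"
| "act (Tens f g) a F = act f a (act g (a + msrc f) F)"
| "act (Zero m k) a F = (\<lambda>w. 0)"
| "act (Add f g) a F = (\<lambda>w. act f a F w + act g a F w)"
| "act (Scale c f) a F = (\<lambda>w. c * act f a F w)"

lemma piece_op_at:
  assumes "length s = piece_tgt p" "a = length u"
  shows "piece_op p a F (u @ s @ v) =
    sg (is_odd p \<and> negs u) * (\<Sum>t\<in>words n (piece_src p). entry p s t * F (u @ t @ v))"
  using assms by (simp add: piece_op_def)

lemma entry_parity:
  assumes "entry p s t \<noteq> 0" "t \<in> words n (piece_src p)" "s \<in> words n (piece_tgt p)"
  shows "negs s = (negs t \<noteq> is_odd p)"
proof (cases p)
  case (Strands k)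
  then have "s = t" using assms(1) unfolding entry_def by (cases "s = t") simp_all
  then show ?thesis using Strands by simp
next
  case CrossX
  obtain x y where s: "s = [x, y]" "x \<in> letters n" "y \<in> letters n"
    using assms(3) CrossX by (auto elim: words_2E)
  have "xop (\<lambda>c d. if t = [c, d] then 1 else 0) x y \<noteq> (0::'k)"
    using assms(1) CrossX s by (simp add: entry_def)
  then obtain a b where "(if t = [a, b] then 1 else 0) \<noteq> (0::'k)" "((a < 0) \<noteq> (b < 0)) = ((x < 0) \<noteq> (y < 0))"
    using xop_parity[OF _ letters_nz[OF s(2)] letters_nz[OF s(3)]] by blast
  then show ?thesis using s CrossX by (auto split: if_splits)
next
  case CrossY
  obtain x y where s: "s = [x, y]" "x \<in> letters n" "y \<in> letters n"
    using assms(3) CrossY by (auto elim: words_2E)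
  show ?thesis
  proof (cases "s = t")
    case True then show ?thesis using CrossY by simp
  next
    case False
    have "xop (\<lambda>c d. if t = [c, d] then 1 else 0) x y \<noteq> (0::'k)"
      using assms(1) CrossY s False by (auto simp: entry_def split: if_splits)
    then obtain a b where "(if t = [a, b] then 1 else 0) \<noteq> (0::'k)" "((a < 0) \<noteq> (b < 0)) = ((x < 0) \<noteq> (y < 0))"
      using xop_parity[OF _ letters_nz[OF s(2)] letters_nz[OF s(3)]] by blast
    then show ?thesis using s CrossY by (auto split: if_splits)
  qed
next
  case Cup
  then obtain x y where "s = [x, y]" "x \<in> letters n" "t = []"
    using assms(2,3) by (auto elim: words_2E)
  then show ?thesis using assms(1) Cup by (auto simp: entry_def letters_def split: if_splits)
next
  case Cap
  then obtain x y where "t = [x, y]" "x \<in> letters n" "s = []"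
    using assms(2,3) by (auto elim: words_2E)
  then show ?thesis using assms(1) Cap by (auto simp: entry_def letters_def split: if_splits)
qed

lemma piece_op_add: "piece_op p a (\<lambda>w. F w + G w) = (\<lambda>w. piece_op p a F w + piece_op p a G w)"
  by (rule ext) (simp add: piece_op_def distrib_left sum.distrib)
lemma piece_op_scale: "piece_op p a (\<lambda>w. c * F w) = (\<lambda>w. c * piece_op p a F w)"
  by (rule ext) (simp add: piece_op_def sum_distrib_left mult.left_commute)

lemma act_add: "act f a (\<lambda>w. F w + G w) = (\<lambda>w. act f a F w + act f a G w)"
  by (induction f arbitrary: a F G) (simp_all add: piece_op_add distrib_left add_ac)
lemma act_scale: "act f a (\<lambda>w. c * F w) = (\<lambda>w. c * act f a F w)"
  by (induction f arbitrary: a F) (simp_all add: piece_op_scale distrib_left mult_ac)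
lemma act_zero: "act f a (\<lambda>w. 0) = (\<lambda>w. 0)"
  using act_scale[of f a 0 "\<lambda>w. 0"] by simp

lemma piece_op_cong:
  assumes "\<And>w. w \<in> words n (a + piece_src p + b) \<Longrightarrow> F w = G w" "w \<in> words n (a + piece_tgt p + b)"
  shows "piece_op p a F w = piece_op p a G w"
proof -
  obtain u s v where w: "w = u @ s @ v" "u \<in> words n a" "s \<in> words n (piece_tgt p)" "v \<in> words n b"
    using assms(2) by (rule words_split3E)
  have "F (u @ t @ v) = G (u @ t @ v)" if "t \<in> words n (piece_src p)" for t
    using words_appendI[OF words_appendI[OF w(2) that] w(4)] by (intro assms(1)) simp
  then show ?thesis
    using w(2,3)[THEN words_lengthD] by (simp add: w(1) piece_op_at)
qed

lemma act_cong:
  assumes "welltyped f" "\<And>w. w \<in> words n (a + msrc f + b) \<Longrightarrow> F w = G w" "w \<in> words n (a + mtgt f + b)"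
  shows "act f a F w = act f a G w"
  using assms
proof (induction f arbitrary: a b F G w)
  case (Piece p) then show ?case by (auto intro: piece_op_cong)
next
  case (Comp g h)
  have wt: "welltyped g" "welltyped h" "msrc g = mtgt h" using Comp.prems(1) by simp_all
  show ?case unfolding act.simps
  proof (rule Comp.IH(1)[OF wt(1)])
    show "w \<in> words n (a + mtgt g + b)" using Comp.prems(3) by simp
    fix w assume "w \<in> words n (a + msrc g + b)"
    then show "act h a F w = act h a G w"
      using Comp.prems(2) wt by (intro Comp.IH(2)[OF wt(2)]) simp_all
  qed
next
  case (Tens f g)
  have wt: "welltyped f" "welltyped g" using Tens.prems(1) by simp_all
  show ?case unfolding act.simps
  proof (rule Tens.IH(1)[OF wt(1)])
    show "w \<in> words n (a + mtgt f + (mtgt g + b))" using Tens.prems(3) by (simp add: add.assoc)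
    fix w assume "w \<in> words n (a + msrc f + (mtgt g + b))"
    then show "act g (a + msrc f) F w = act g (a + msrc f) G w"
      using Tens.prems(2) by (intro Tens.IH(2)[OF wt(2), where b = b]) (simp_all add: add.assoc)
  qed
next
  case (Add f g)
  have wt: "welltyped f" "welltyped g" "msrc g = msrc f" "mtgt g = mtgt f"
    using Add.prems(1) by simp_all
  have FG: "F w = G w" if "w \<in> words n (a + msrc f + b)" for w
    by (rule Add.prems(2)) (simp add: that)
  have w: "w \<in> words n (a + mtgt f + b)" using Add.prems(3) by simp
  have "act f a F w = act f a G w" by (rule Add.IH(1)[OF wt(1) FG w])
  moreover have "act g a F w = act g a G w"
    by (rule Add.IH(2)[OF wt(2), unfolded wt(3,4), OF FG w])
  ultimately show ?case by simp
next
  case (Scale c f)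
  have "act f a F w = act f a G w"
  proof (rule Scale.IH)
    show "F w = G w" if "w \<in> words n (a + msrc f + b)" for w
      by (rule Scale.prems(2)) (simp add: that)
  qed (use Scale.prems in simp_all)
  then show ?case by simp
qed simp

lemma piece_commute:
  assumes "w \<in> words n (a + piece_tgt p + e + piece_tgt r + b)"
  shows "piece_op r (a + piece_tgt p + e) (piece_op p a F) w =
    sg (is_odd p \<and> is_odd r) * piece_op p a (piece_op r (a + piece_src p + e) F) w"
proof -
  obtain u s x y v where w: "w = u @ s @ x @ y @ v" "u \<in> words n a" "s \<in> words n (piece_tgt p)"
      "x \<in> words n e" "y \<in> words n (piece_tgt r)" "v \<in> words n b"
    using assms by (elim words_splitE) simp
  note len = w(2-6)[THEN words_lengthD]
  have L: "piece_op r (a + piece_tgt p + e) (piece_op p a F) w =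
     sg (is_odd r \<and> negs (u @ s @ x)) * (\<Sum>y'\<in>words n (piece_src r). entry r y y' *
       (sg (is_odd p \<and> negs u) * (\<Sum>s'\<in>words n (piece_src p). entry p s s' * F (u @ s' @ x @ y' @ v))))"
    using len piece_op_at[of y r "a + piece_tgt p + e" "u @ s @ x" "piece_op p a F" v]
    by (simp add: w(1) piece_op_at)
  have R: "piece_op p a (piece_op r (a + piece_src p + e) F) w =
     sg (is_odd p \<and> negs u) * (\<Sum>s'\<in>words n (piece_src p). entry p s s' *
       (sg (is_odd r \<and> negs (u @ s' @ x)) * (\<Sum>y'\<in>words n (piece_src r). entry r y y' * F (u @ s' @ x @ y' @ v))))"
  proof -
    have "piece_op r (a + piece_src p + e) F (u @ s' @ x @ y @ v) =
       sg (is_odd r \<and> negs (u @ s' @ x)) * (\<Sum>y'\<in>words n (piece_src r). entry r y y' * F (u @ s' @ x @ y' @ v))"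
      if "s' \<in> words n (piece_src p)" for s'
      using len piece_op_at[of y r "a + piece_src p + e" "u @ s' @ x" F v] that[THEN words_lengthD] by simp
    then show ?thesis
      using len by (simp add: w(1) piece_op_at)
  qed
  have S: "entry p s s' * (sg (is_odd r \<and> negs (u @ s' @ x)) * t) =
      sg (is_odd p \<and> is_odd r) * (sg (is_odd r \<and> negs (u @ s @ x)) * (entry p s s' * t))"
    if "s' \<in> words n (piece_src p)" for s' t
  proof (cases "entry p s s' = 0")
    case False
    have "negs s = (negs s' \<noteq> is_odd p)" by (rule entry_parity[OF False that w(3)])
    then show ?thesis
      by (cases "negs u"; cases "negs s'"; cases "is_odd p"; cases "is_odd r"; cases "negs x") simp_all
  qed simp
  let ?T = "\<lambda>s'. \<Sum>y'\<in>words n (piece_src r). entry r y y' * F (u @ s' @ x @ y' @ v)"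
  have 1: "(\<Sum>y'\<in>words n (piece_src r). entry r y y' *
       (sg (is_odd p \<and> negs u) * (\<Sum>s'\<in>words n (piece_src p). entry p s s' * F (u @ s' @ x @ y' @ v)))) =
     sg (is_odd p \<and> negs u) * (\<Sum>s'\<in>words n (piece_src p). entry p s s' * ?T s')"
    unfolding sum_distrib_left by (subst sum.swap) (simp only: mult.left_commute)
  have 2: "(\<Sum>s'\<in>words n (piece_src p). entry p s s' * (sg (is_odd r \<and> negs (u @ s' @ x)) * ?T s')) =
     sg (is_odd p \<and> is_odd r) * (sg (is_odd r \<and> negs (u @ s @ x)) *
       (\<Sum>s'\<in>words n (piece_src p). entry p s s' * ?T s'))"
    using S by (simp add: sum_distrib_left cong: sum.cong)
  show ?thesis unfolding L R 1 2 by (simp only: mult.left_commute sg_sq)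
qed

lemma piece_act_commute:
  assumes "welltyped f" "has_parity f c" "w \<in> words n (a + mtgt f + e + piece_tgt r + b)"
  shows "piece_op r (a + mtgt f + e) (act f a F) w = sg (c \<and> is_odd r) * act f a (piece_op r (a + msrc f + e) F) w"
  using assms
proof (induction f arbitrary: a b c e F w)
  case (Piece p)
  then have "c = is_odd p" by (simp add: is_odd_def has_parity_iff)
  then show ?case using piece_commute[of w a p e r b F] Piece.prems(3) by simp
next
  case (Comp g h)
  from Comp.prems(2) obtain c1 c2 where c: "has_parity g c1" "has_parity h c2" "c = (c1 \<noteq> c2)"
    unfolding has_parity_iff by blast
  have "piece_op r (a + mtgt g + e) (act g a (act h a F)) w =
     sg (c1 \<and> is_odd r) * act g a (piece_op r (a + msrc g + e) (act h a F)) w"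
    using Comp.prems c by (intro Comp.IH(1)) auto
  also have "act g a (piece_op r (a + msrc g + e) (act h a F)) w =
     act g a (\<lambda>w. sg (c2 \<and> is_odd r) * act h a (piece_op r (a + msrc h + e) F) w) w"
    by (rule act_cong[where b = "e + piece_tgt r + b"])
       (use Comp.prems c Comp.IH(2)[of c2 _ a e b F] in \<open>simp_all add: add.assoc\<close>)
  finally show ?case using c(3) by (auto simp: act_scale sg_def)
next
  case (Tens f g)
  from Tens.prems(2) obtain c1 c2 where c: "has_parity f c1" "has_parity g c2" "c = (c1 \<noteq> c2)"
    unfolding has_parity_iff by blast
  have "piece_op r (a + mtgt f + (mtgt g + e)) (act f a (act g (a + msrc f) F)) w =
     sg (c1 \<and> is_odd r) * act f a (piece_op r (a + msrc f + (mtgt g + e)) (act g (a + msrc f) F)) w"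
    using Tens.prems c by (intro Tens.IH(1)) (auto simp: add.assoc)
  also have "act f a (piece_op r (a + msrc f + (mtgt g + e)) (act g (a + msrc f) F)) w =
     act f a (\<lambda>w. sg (c2 \<and> is_odd r) * act g (a + msrc f) (piece_op r (a + msrc f + msrc g + e) F) w) w"
  proof (rule act_cong[where b = "mtgt g + e + piece_tgt r + b"])
    fix w assume "w \<in> words n (a + msrc f + (mtgt g + e + piece_tgt r + b))"
    then show "piece_op r (a + msrc f + (mtgt g + e)) (act g (a + msrc f) F) w =
       sg (c2 \<and> is_odd r) * act g (a + msrc f) (piece_op r (a + msrc f + msrc g + e) F) w"
      using Tens.IH(2)[of c2 w "a + msrc f" e b F] Tens.prems c by (simp add: add.assoc)
  qed (use Tens.prems in \<open>auto simp: add.assoc\<close>)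
  finally show ?case using c(3) by (auto simp: act_scale sg_def add.assoc)
next
  case (Zero m k)
  then show ?case by (simp add: piece_op_def)
next
  case (Add f g)
  from Add.prems(2) have c: "has_parity f c" "has_parity g c"
    by (simp_all only: has_parity_iff)
  show ?case
    using Add.IH(1)[of c w a e b F] Add.IH(2)[of c w a e b F] Add.prems c
    by (simp add: piece_op_add algebra_simps)
next
  case (Scale t f)
  from Scale.prems(2) have c: "has_parity f c"
    unfolding has_parity_iff by blast
  show ?case
    using Scale.IH[of c w a e b F] Scale.prems c
    by (simp add: piece_op_scale algebra_simps)
qed

text \<open>The super interchange law: distant morphisms commute up to the sign of their parities.\<close>

lemma act_commute:
  assumes "welltyped f" "has_parity f c" "welltyped g" "has_parity g d"
    "w \<in> words n (a + mtgt f + e + mtgt g + b)"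
  shows "act g (a + mtgt f + e) (act f a F) w = sg (c \<and> d) * act f a (act g (a + msrc f + e) F) w"
  using assms(3-5)
proof (induction g arbitrary: b d e F w)
  case (Piece r)
  then have "d = is_odd r" by (simp add: is_odd_def has_parity_iff)
  then show ?case using piece_act_commute[OF assms(1,2), of w a e r b F] Piece.prems(3) by simp
next
  case (Comp g h)
  from Comp.prems(2) obtain c1 c2 where c: "has_parity g c1" "has_parity h c2" "d = (c1 \<noteq> c2)"
    unfolding has_parity_iff by blast
  have "act g (a + mtgt f + e) (act h (a + mtgt f + e) (act f a F)) w =
    act g (a + mtgt f + e) (\<lambda>w. sg (c \<and> c2) * act f a (act h (a + msrc f + e) F) w) w"
    by (rule act_cong[where b = b]) (use Comp.prems c Comp.IH(2)[of c2 _ e b F] in \<open>simp_all\<close>)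
  also have "\<dots> = sg (c \<and> c2) * (sg (c \<and> c1) * act f a (act g (a + msrc f + e) (act h (a + msrc f + e) F)) w)"
    using Comp.IH(1)[of c1 w e b "act h (a + msrc f + e) F"] Comp.prems c by (simp add: act_scale)
  finally show ?case using c(3) by (auto simp: sg_def)
next
  case (Tens g h)
  from Tens.prems(2) obtain c1 c2 where c: "has_parity g c1" "has_parity h c2" "d = (c1 \<noteq> c2)"
    unfolding has_parity_iff by blast
  have "act g (a + mtgt f + e) (act h (a + mtgt f + (e + msrc g)) (act f a F)) w =
    act g (a + mtgt f + e) (\<lambda>w. sg (c \<and> c2) * act f a (act h (a + msrc f + (e + msrc g)) F) w) w"
    by (rule act_cong[where b = "mtgt h + b"])
      (use Tens.prems c Tens.IH(2)[of c2 _ "e + msrc g" b F] in \<open>simp_all add: add.assoc\<close>)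
  also have "\<dots> = sg (c \<and> c2) * (sg (c \<and> c1) * act f a (act g (a + msrc f + e) (act h (a + msrc f + (e + msrc g)) F)) w)"
    using Tens.IH(1)[of c1 w e "mtgt h + b" "act h (a + msrc f + (e + msrc g)) F"] Tens.prems c
    by (simp add: act_scale add.assoc)
  finally show ?case using c(3) by (auto simp: sg_def add.assoc)
next
  case (Zero m k)
  then show ?case by (simp add: act_zero)
next
  case (Add g h)
  from Add.prems(2) have c: "has_parity g d" "has_parity h d"
    by (simp_all only: has_parity_iff)
  show ?case
    using Add.IH(1)[of d w e b F] Add.IH(2)[of d w e b F] Add.prems c
    by (simp add: act_add algebra_simps)
next
  case (Scale t g)
  from Scale.prems(2) have c: "has_parity g d"
    unfolding has_parity_iff by blast
  show ?case
    using Scale.IH[of d w e b F] Scale.prems c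
    by (simp add: act_scale algebra_simps)
qed

end

section \<open>Soundness of the action\<close>
context rmatrix_words
begin

lemma xop_letters_cong:
  assumes "\<And>a b. a \<in> letters n \<Longrightarrow> b \<in> letters n \<Longrightarrow> G a b = H a b" "x \<in> letters n" "y \<in> letters n"
  shows "xop G x y = xop H x y"
proof (rule xop_cong)
  fix a b :: int assume "a \<noteq> 0" "b \<noteq> 0" "\<bar>a\<bar> \<le> max \<bar>x\<bar> \<bar>y\<bar>" "\<bar>b\<bar> \<le> max \<bar>x\<bar> \<bar>y\<bar>"
  then show "G a b = H a b" using assms(2,3) by (intro assms(1)) (auto simp: letters_def le_max_iff_disj)
qed (use assms letters_nz in auto)

lemma xop_expand:
  assumes "x \<in> letters n" "y \<in> letters n"
  shows "(\<Sum>t\<in>words n 2. xop (\<lambda>c d. if t = [c, d] then 1 else 0) x y * F t) = xop (\<lambda>c d. F [c, d]) x y"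
proof -
  have "(\<Sum>t\<in>words n 2. xop (\<lambda>c d. if t = [c, d] then 1 else 0) x y * F t) =
      xop (\<lambda>c d. \<Sum>t\<in>words n 2. F t * (if t = [c, d] then 1 else 0)) x y"
    by (simp add: xop_sum xop_scale mult.commute)
  also have "\<dots> = xop (\<lambda>c d. F [c, d]) x y"
  proof (rule xop_letters_cong[OF _ assms])
    fix c d assume "c \<in> letters n" "d \<in> letters n"
    then have "[c, d] \<in> words n 2" by (simp add: words_def)
    then have "(\<Sum>t\<in>words n 2. if t = [c, d] then F t else 0) = F [c, d]" by simp
    then show "(\<Sum>t\<in>words n 2. F t * (if t = [c, d] then 1 else 0)) = F [c, d]"
      by (simp add: if_distrib cong: if_cong)
  qed
  finally show ?thesis .
qed

lemma X_at:
  assumes "x \<in> letters n" "y \<in> letters n" "a = length u"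
  shows "act XX a F (u @ x # y # v) = xop (\<lambda>c d. F (u @ c # d # v)) x y"
  using assms(3) piece_op_at[of "[x, y]" CrossX a u F v] xop_expand[OF assms(1,2), of "\<lambda>t. F (u @ t @ v)"]
  by (simp add: entry_def)

lemma Y_at:
  assumes "x \<in> letters n" "y \<in> letters n" "a = length u"
  shows "act YY a F (u @ x # y # v) = xop (\<lambda>c d. F (u @ c # d # v)) x y - z * F (u @ x # y # v)"
proof -
  have "[x, y] \<in> words n 2" using assms by (simp add: words_def)
  then have "(\<Sum>t\<in>words n 2. (if [x, y] = t then z else 0) * F (u @ t @ v)) = z * F (u @ [x, y] @ v)"
    by (subst sum.cong[OF HOL.refl, where h = "\<lambda>t. if t = [x, y] then z * F (u @ t @ v) else 0"]) auto
  then show ?thesis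
    using assms(3) piece_op_at[of "[x, y]" CrossY a u F v] xop_expand[OF assms(1,2), of "\<lambda>t. F (u @ t @ v)"]
    by (simp add: entry_def left_diff_distrib sum_subtractf)
qed

lemma cup_at:
  assumes "a = length u"
  shows "act cup a F (u @ x # y # v) = sg (negs u) * (if y = - x then F (u @ v) else 0)"
  using assms piece_op_at[of "[x, y]" Cup a u F v] by (simp add: entry_def)

lemma cap_at:
  assumes "a = length u"
  shows "act cap a F (u @ v) = sg (negs u) * (\<Sum>c\<in>letters n. sg (c < 0) * F (u @ c # - c # v))"
proof -
  have "(\<Sum>y\<in>letters n. entry Cap [] [c, y] * F (u @ c # y # v)) = sg (c < 0) * F (u @ c # - c # v)"
    if "c \<in> letters n" for c
  proof -
    have "(\<Sum>y\<in>letters n. entry Cap [] [c, y] * F (u @ c # y # v)) =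
        (\<Sum>y\<in>letters n. if y = - c then sg (c < 0) * F (u @ c # y # v) else 0)"
      by (rule sum.cong) (auto simp: entry_def)
    then show ?thesis using that by simp
  qed
  then show ?thesis
    using assms piece_op_at[of "[]" Cap a u F v] by (simp add: sum_words_2 cong: sum.cong)
qed

lemma ident_at:
  assumes "w \<in> words n (a + k + b)"
  shows "act (ident k) a F w = F w"
proof -
  obtain u s v where w: "w = u @ s @ v" "u \<in> words n a" "s \<in> words n k" "v \<in> words n b"
    using assms by (rule words_split3E)
  have "(\<Sum>t\<in>words n k. (if s = t then 1 else 0) * F (u @ t @ v)) = F (u @ s @ v)"
    using w(3) by (subst sum.cong[OF HOL.refl, where h = "\<lambda>t. if t = s then F (u @ t @ v) else 0"]) auto
  then show ?thesis
    using w(2,3)[THEN words_lengthD] by (simp add: w(1) piece_op_at entry_def)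
qed

lemma strand_at: "u \<in> words n a \<Longrightarrow> s \<in> words n k \<Longrightarrow> v \<in> words n b \<Longrightarrow> act (ident k) a F (u @ s @ v) = F (u @ s @ v)"
  by (rule ident_at[where b = b]) (auto simp: words_def)

lemma xop1_letters_cong:
  assumes "\<And>a b. a \<in> letters n \<Longrightarrow> b \<in> letters n \<Longrightarrow> G a b w = H a b w" "x \<in> letters n" "y \<in> letters n"
  shows "xop1 G x y w = xop1 H x y w"
  unfolding xop1_def by (rule xop_letters_cong) (use assms in auto)
lemma xop2_letters_cong:
  assumes "\<And>a b. a \<in> letters n \<Longrightarrow> b \<in> letters n \<Longrightarrow> G x a b = H x a b" "y \<in> letters n" "w \<in> letters n"
  shows "xop2 G x y w = xop2 H x y w"
  unfolding xop2_def by (rule xop_letters_cong) (use assms in auto)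

context
  fixes u v :: "int list" and a b :: nat
  assumes uv: "u \<in> words n a" "v \<in> words n b"
begin

lemma len_u: "length u = a" using uv by (simp add: words_def)

lemma X1_at:
  assumes "x \<in> letters n" "y \<in> letters n" "w \<in> letters n"
  shows "act (Tens XX strand) a F (u @ x # y # w # v) = xop1 (\<lambda>c d e. F (u @ c # d # e # v)) x y w"
proof -
  have "act (ident 1) (a + 2) F (u @ c # d # w # v) = F (u @ c # d # w # v)"
    if "c \<in> letters n" "d \<in> letters n" for c d
    using strand_at[of "u @ [c, d]" "a + 2" "[w]" 1 v b F] uv assms that by (simp add: words_def)
  then show ?thesis
    using assms len_u by (auto simp: X_at xop1_def simp del: act.simps(1) intro!: xop_letters_cong)
qed

lemma X2_at:
  assumes "x \<in> letters n" "y \<in> letters n" "w \<in> letters n"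
  shows "act (Tens strand XX) a F (u @ x # y # w # v) = xop2 (\<lambda>c d e. F (u @ c # d # e # v)) x y w"
proof -
  have "act (ident 1) a (act XX (a + 1) F) (u @ x # y # w # v) = act XX (a + 1) F (u @ x # y # w # v)"
    using strand_at[of u a "[x]" 1 "y # w # v" "b + 2"] uv assms by (simp add: words_def)
  moreover have "act XX (a + 1) F (u @ x # y # w # v) = xop2 (\<lambda>c d e. F (u @ c # d # e # v)) x y w"
    using X_at[of y w "a + 1" "u @ [x]" F v] assms len_u by (simp add: xop2_def)
  ultimately show ?thesis by simp
qed

lemma sound_braid:
  assumes "x \<in> letters n" "y \<in> letters n" "w \<in> letters n"
  shows "act (Comp (Comp (Tens XX strand) (Tens strand XX)) (Tens XX strand)) a F (u @ x # y # w # v) =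
    act (Comp (Comp (Tens strand XX) (Tens XX strand)) (Tens strand XX)) a F (u @ x # y # w # v)"
proof -
  let ?G = "\<lambda>c d e. F (u @ c # d # e # v)"
  have "act (Tens XX strand) a (act (Tens strand XX) a (act (Tens XX strand) a F)) (u @ x # y # w # v) =
     xop1 (\<lambda>c d e. act (Tens strand XX) a (act (Tens XX strand) a F) (u @ c # d # e # v)) x y w"
    by (rule X1_at[OF assms])
  also have "\<dots> = xop1 (xop2 (\<lambda>c d e. act (Tens XX strand) a F (u @ c # d # e # v))) x y w"
    by (intro xop1_letters_cong X2_at assms)
  also have "\<dots> = xop1 (xop2 (xop1 ?G)) x y w"
    by (intro xop1_letters_cong xop2_letters_cong X1_at assms)
  also have "\<dots> = xop2 (xop1 (xop2 ?G)) x y w"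
    using assms letters_nz by (intro braid_relation) auto
  also have "\<dots> = xop2 (xop1 (\<lambda>c d e. act (Tens strand XX) a F (u @ c # d # e # v))) x y w"
    by (intro xop1_letters_cong xop2_letters_cong X2_at[symmetric] assms)
  also have "\<dots> = xop2 (\<lambda>c d e. act (Tens XX strand) a (act (Tens strand XX) a F) (u @ c # d # e # v)) x y w"
    by (intro xop2_letters_cong X1_at[symmetric] assms)
  also have "\<dots> = act (Tens strand XX) a (act (Tens XX strand) a (act (Tens strand XX) a F)) (u @ x # y # w # v)"
    by (rule X2_at[OF assms, symmetric])
  finally show ?thesis by simp
qed

lemma sound_inverse:
  assumes "x \<in> letters n" "y \<in> letters n"
  shows "act XX a (act YY a F) (u @ x # y # v) = F (u @ x # y # v)"
    "act YY a (act XX a F) (u @ x # y # v) = F (u @ x # y # v)"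
proof -
  let ?G = "\<lambda>c d. F (u @ c # d # v)"
  have q: "xop (xop ?G) x y = z * xop ?G x y + ?G x y"
    using assms letters_nz by (intro xop_quadratic) auto
  have "act XX a (act YY a F) (u @ x # y # v) = xop (\<lambda>c d. xop ?G c d - z * ?G c d) x y"
    unfolding X_at[OF assms len_u[symmetric]]
    by (intro xop_letters_cong Y_at) (use assms len_u in auto)
  then show "act XX a (act YY a F) (u @ x # y # v) = F (u @ x # y # v)"
    by (simp only: xop_diff xop_scale q) simp
  have "act YY a (act XX a F) (u @ x # y # v) = xop (xop ?G) x y - z * xop ?G x y"
    unfolding Y_at[OF assms len_u[symmetric]] X_at[OF assms len_u[symmetric]]
    by (intro arg_cong2[where f = minus] xop_letters_cong X_at) (use assms len_u in auto)
  then show "act YY a (act XX a F) (u @ x # y # v) = F (u @ x # y # v)"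
    by (simp only: q) simp
qed

lemma low_delta: "low x (\<lambda>c d. if d = - c then t else 0) = 0"
  by (simp add: low_def)

lemma sound_X_cup:
  assumes "x \<in> letters n" "y \<in> letters n"
  shows "act XX a (act cup a F) (u @ x # y # v) = q * act cup a F (u @ x # y # v)"
proof -
  let ?t = "F (u @ v)"
  have "act XX a (act cup a F) (u @ x # y # v) =
      xop (\<lambda>c d. sg (negs u) * (if d = - c then ?t else 0)) x y"
    unfolding X_at[OF assms len_u[symmetric]]
    by (intro xop_letters_cong cup_at) (use assms len_u in auto)
  also have "\<dots> = sg (negs u) * xop (\<lambda>c d. if d = - c then ?t else 0) x y"
    by (rule xop_scale)
  also have "xop (\<lambda>c d. if d = - c then ?t else 0) x y = q * (if y = - x then ?t else 0)"
    using assms letters_nz by (cases "y = - x") (auto simp: xop_opp low_delta xop_def algebra_simps)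
  finally show ?thesis
    by (simp only: cup_at[OF len_u[symmetric]] mult.left_commute)
qed

lemma sound_cap_cup: "act cap a (act cup a F) (u @ v) = 0"
proof -
  have "(\<Sum>c\<in>letters n. sg (c < 0) * F (u @ v)) = 0"
  proof -
    have "(\<Sum>c\<in>letters n. sg (c < 0) * F (u @ v)) =
        (\<Sum>c\<in>letters n. if c \<in> letters n then sg (c < 0) * F (u @ v) else 0)"
      by (rule sum.cong) auto
    also have "\<dots> = 0"
      by (subst sum_letters_pm[where m = "int n + 1"]) (auto simp: letters_def intro!: sum.neutral split: if_splits)
    finally show ?thesis .
  qed
  then show ?thesis
    by (simp only: cap_at[OF len_u[symmetric]] cup_at[OF len_u[symmetric]])
      (simp add: mult.left_commute sum_distrib_left[symmetric] del: act.simps)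
qed

lemma sound_zigzag_left:
  assumes "x \<in> letters n"
  shows "act (Tens cap strand) a (act (Tens strand cup) a F) (u @ x # v) = F (u @ x # v)"
proof -
  have 1: "act (ident 1) (a + 2) G (u @ c # d # x # v) = G (u @ c # d # x # v)"
    if "c \<in> letters n" "d \<in> letters n" for c d G
    using strand_at[of "u @ [c, d]" "a + 2" "[x]" 1 v b G] uv assms that by (simp add: words_def)
  have 2: "act (ident 1) a G (u @ c # d # x # v) = G (u @ c # d # x # v)"
    if "c \<in> letters n" "d \<in> letters n" for c d G
    using strand_at[of u a "[c]" 1 "d # x # v" "b + 2" G] uv assms that by (simp add: words_def)
  have 3: "act cup (a + 1) F (u @ c # - c # x # v) = sg (negs u \<noteq> (c < 0)) * (if c = x then F (u @ x # v) else 0)" for c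
    using cup_at[of "a + 1" "u @ [c]" F "- c" x v] len_u by auto
  have "act (Tens cap strand) a (act (Tens strand cup) a F) (u @ x # v) =
    sg (negs u) * (\<Sum>c\<in>letters n. sg (c < 0) *
      act (ident 1) (a + 2) (act (ident 1) a (act cup (a + 1) F)) (u @ c # - c # x # v))"
    using cap_at[OF len_u[symmetric], of _ "x # v"] by simp
  also have "\<dots> = sg (negs u) * (\<Sum>c\<in>letters n. if c = x then sg (c < 0) * (sg (negs u \<noteq> (c < 0)) * F (u @ x # v)) else 0)"
    by (rule arg_cong[where f = "(*) _"], rule sum.cong) (use 1 2 3 in \<open>auto simp del: act.simps\<close>)
  also have "\<dots> = F (u @ x # v)"
    using assms by (cases "negs u"; cases "x < 0") simp_all
  finally show ?thesis .
qed

lemma sound_zigzag_right: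
  assumes "x \<in> letters n"
  shows "act (Tens strand cap) a (act (Tens cup strand) a F) (u @ x # v) = - F (u @ x # v)"
proof -
  have 1: "act (ident 1) (a + 2) G (u @ c # d # e # v) = G (u @ c # d # e # v)"
    if "c \<in> letters n" "d \<in> letters n" "e \<in> letters n" for c d e G
    using strand_at[of "u @ [c, d]" "a + 2" "[e]" 1 v b G] uv that by (simp add: words_def)
  have 2: "act (ident 1) a G (u @ x # v) = G (u @ x # v)" for G
    using strand_at[of u a "[x]" 1 "v" "b" G] uv assms by (simp add: words_def)
  have 3: "act cup a G (u @ x # c # - c # v) = sg (negs u) * (if c = - x then G (u @ x # v) else 0)" for c G
    using cup_at[of "a" "u" G x c "- c # v"] len_u by auto
  have "act (Tens strand cap) a (act (Tens cup strand) a F) (u @ x # v) =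
    act cap (a + 1) (act cup a (act (ident 1) (a + 0) F)) (u @ x # v)"
    using 2 by simp
  also have "\<dots> = sg (negs u \<noteq> (x < 0)) * (\<Sum>c\<in>letters n. sg (c < 0) *
      act cup a (act (ident 1) (a + 0) F) (u @ x # c # - c # v))"
    using cap_at[of "a + 1" "u @ [x]" _ v] len_u by (simp del: act.simps)
  also have "\<dots> = sg (negs u \<noteq> (x < 0)) * (\<Sum>c\<in>letters n. if c = - x then sg (c < 0) * (sg (negs u) * F (u @ x # v)) else 0)"
    unfolding 3 2[of F] add_0_right
    by (intro arg_cong2[where f = "(*)"] HOL.refl sum.cong) simp_all
  also have "\<dots> = - F (u @ x # v)"
    using assms letters_nz[OF assms] by (cases "negs u"; cases "x < 0") simp_all
  finally show ?thesis .
qed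

text \<open>The slide of a strand over a cup, after the values of the cup have been inserted.\<close>

lemma slide_fun:
  assumes "x \<noteq> 0" "y \<noteq> 0" "w \<noteq> 0"
  shows "xop2 (\<lambda>c d e. if d = - c then t e else 0) x y w =
     xop1 (\<lambda>c d e. sg (c < 0) * (if e = - d then t c else 0)) x y w - z * (sg (x < 0) * (if w = - y then t x else 0))"
proof -
  have L: "low y (\<lambda>d e. if d = - x then t e else 0) = (if \<bar>x\<bar> < \<bar>y\<bar> then - sg (x < 0) * t x else 0)"
  proof -
    have "low y (\<lambda>d e. if d = - x then t e else 0) =
        (\<Sum>k\<in>{0<..<\<bar>y\<bar>}. if k = \<bar>x\<bar> then - sg (x < 0) * t x else 0)"
      unfolding low_def by (rule sum.cong) (use assms in auto)
    then show ?thesis using assms by simp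
  qed
  have R: "low x (\<lambda>c d. sg (c < 0) * (if w = - d then t c else 0)) = (if \<bar>w\<bar> < \<bar>x\<bar> then t w else 0)"
  proof -
    have "low x (\<lambda>c d. sg (c < 0) * (if w = - d then t c else 0)) =
        (\<Sum>k\<in>{0<..<\<bar>x\<bar>}. if k = \<bar>w\<bar> then t w else 0)"
      unfolding low_def by (rule sum.cong) (use assms in auto)
    then show ?thesis using assms by simp
  qed

  have XX: "xop1 (\<lambda>c d e. sg (c < 0) * (if e = - d then t c else 0)) x y w =
    (if \<bar>x\<bar> < \<bar>y\<bar> then sg (x < 0 \<and> y < 0) * (sg (y < 0) * (if w = - x then t y else 0))
     else if \<bar>y\<bar> < \<bar>x\<bar> then sg (x < 0 \<and> y < 0) * (sg (y < 0) * (if w = - x then t y else 0)) + z * (sg (x < 0) * (if w = - y then t x else 0))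
     else if x = y then (if 0 < x then q else - qi) * (sg (x < 0) * (if w = - x then t x else 0))
     else (if 0 < x then qi * (sg (y < 0) * (if w = - x then t y else 0)) + z * (sg (x < 0) * (if w = - y then t x else 0))
        else q * (sg (y < 0) * (if w = - x then t y else 0))) + z * (if \<bar>w\<bar> < \<bar>x\<bar> then t w else 0))"
    unfolding xop1_def xop_def R by auto
  have X2: "xop2 (\<lambda>c d e. if d = - c then t e else 0) x y w =
    (if \<bar>y\<bar> < \<bar>w\<bar> then sg (y < 0 \<and> w < 0) * (if w = - x then t y else 0)
     else if \<bar>w\<bar> < \<bar>y\<bar> then sg (y < 0 \<and> w < 0) * (if w = - x then t y else 0) + z * (if y = - x then t w else 0)
     else if y = w then (if 0 < y then q else - qi) * (if y = - x then t y else 0)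
     else (if 0 < y then qi * (if w = - x then t y else 0) + z * (if y = - x then t w else 0)
        else q * (if w = - x then t y else 0)) + z * (if \<bar>x\<bar> < \<bar>y\<bar> then - sg (x < 0) * t x else 0))"
    unfolding xop2_def xop_def L by auto
  consider "w = y" | "w = - y" | "\<bar>w\<bar> < \<bar>y\<bar>" | "\<bar>y\<bar> < \<bar>w\<bar>" by linarith
  then show ?thesis
  proof cases
    case 1
    consider "x = y" | "x = - y" | "\<bar>x\<bar> < \<bar>y\<bar>" | "\<bar>y\<bar> < \<bar>x\<bar>" by linarith
    then show ?thesis unfolding X2 XX
      by cases (use 1 assms in \<open>cases "0 < y"; force simp: algebra_simps\<close>)+
  next
    case 2
    consider "x = y" | "x = - y" | "\<bar>x\<bar> < \<bar>y\<bar>" | "\<bar>y\<bar> < \<bar>x\<bar>" by linarith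
    then show ?thesis unfolding X2 XX
      by cases (use 2 assms in \<open>cases "0 < y"; force simp: algebra_simps\<close>)+
  next
    case 3
    then have n: "w \<noteq> y" "w \<noteq> - y" "y \<noteq> w" "\<not> \<bar>y\<bar> < \<bar>w\<bar>" by auto
    have X2': "xop2 (\<lambda>c d e. if d = - c then t e else 0) x y w =
        sg (y < 0 \<and> w < 0) * (if w = - x then t y else 0) + z * (if y = - x then t w else 0)"
      unfolding X2 using 3 n by simp
    consider "x = y" | "x = - y" | "\<bar>x\<bar> < \<bar>y\<bar>" | "\<bar>y\<bar> < \<bar>x\<bar>" by linarith
    then show ?thesis
    proof cases
      case 1 then show ?thesis unfolding X2' XX using n assms by simp
    next
      case 2 then show ?thesis unfolding X2' XX using n 3 assms by simp
    next
      case c: 3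
      then have "y \<noteq> - x" by auto
      then show ?thesis unfolding X2' XX using n c assms
        by (cases "w = - x"; cases "x < 0"; cases "y < 0") simp_all
    next
      case 4
      then have "w \<noteq> - x" "y \<noteq> - x" "x \<noteq> y" using 3 by auto
      then show ?thesis unfolding X2' XX using n 4 by simp
    qed
  next
    case 4
    then have n: "w \<noteq> y" "w \<noteq> - y" "y \<noteq> w" "\<not> \<bar>w\<bar> < \<bar>y\<bar>" by auto
    have X2': "xop2 (\<lambda>c d e. if d = - c then t e else 0) x y w =
        sg (y < 0 \<and> w < 0) * (if w = - x then t y else 0)"
      unfolding X2 using 4 n by simp
    consider "x = y" | "x = - y" | "\<bar>x\<bar> < \<bar>y\<bar>" | "\<bar>y\<bar> < \<bar>x\<bar>" by linarith
    then show ?thesis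
    proof cases
      case 1 then show ?thesis unfolding X2' XX using n assms by simp
    next
      case 2 then show ?thesis unfolding X2' XX using n 4 assms by simp
    next
      case 3
      then have "w \<noteq> - x" "y \<noteq> - x" "x \<noteq> y" using 4 by auto
      then show ?thesis unfolding X2' XX using n 3 by simp
    next
      case c: 4
      then have "\<not> \<bar>x\<bar> < \<bar>y\<bar>" "x \<noteq> y" by auto
      then show ?thesis unfolding X2' XX using n c assms
        by (cases "w = - x"; cases "x < 0"; cases "y < 0") simp_all
    qed
  qed
qed

lemma sound_slide:
  assumes "x \<in> letters n" "y \<in> letters n" "w \<in> letters n"
  shows "act (Comp (Tens strand XX) (Tens cup strand)) a F (u @ x # y # w # v) =
    act (Comp (Tens YY strand) (Tens strand cup)) a F (u @ x # y # w # v)"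
proof -
  let ?t = "\<lambda>e. F (u @ e # v)"
  have 1: "act (ident 1) (a + 2) G (u @ c # d # w # v) = G (u @ c # d # w # v)"
    if "c \<in> letters n" "d \<in> letters n" for c d G
    using strand_at[of "u @ [c, d]" "a + 2" "[w]" 1 v b G] uv assms that by (simp add: words_def)
  have 2: "act (ident 1) a G (u @ c # d # w # v) = G (u @ c # d # w # v)"
    if "c \<in> letters n" "d \<in> letters n" for c d G
    using strand_at[of u a "[c]" 1 "d # w # v" "b + 2" G] uv assms that by (simp add: words_def)
  have 3: "act (ident 1) a G (u @ e # v) = G (u @ e # v)" if "e \<in> letters n" for e G
    using strand_at[of u a "[e]" 1 "v" "b" G] uv that by (simp add: words_def)
  have "act (Tens strand XX) a (act (Tens cup strand) a F) (u @ x # y # w # v) =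
      xop2 (\<lambda>c d e. act (Tens cup strand) a F (u @ c # d # e # v)) x y w"
    by (rule X2_at[OF assms])
  also have "\<dots> = xop2 (\<lambda>c d e. sg (negs u) * (if d = - c then ?t e else 0)) x y w"
  proof (rule xop2_letters_cong[OF _ assms(2,3)])
    fix d e assume "d \<in> letters n" "e \<in> letters n"
    then show "act (Tens cup strand) a F (u @ x # d # e # v) = sg (negs u) * (if d = - x then ?t e else 0)"
      using cup_at[OF len_u[symmetric], of _ x d "e # v"] 3[of e F] by simp
  qed
  also have "\<dots> = sg (negs u) * xop2 (\<lambda>c d e. if d = - c then ?t e else 0) x y w"
    by (rule xop2_lin(3))
  also have "\<dots> = sg (negs u) * (xop1 (\<lambda>c d e. sg (c < 0) * (if e = - d then ?t c else 0)) x y w -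
      z * (sg (x < 0) * (if w = - y then ?t x else 0)))"
    by (subst slide_fun) (use assms letters_nz in auto)
  also have "\<dots> = xop1 (\<lambda>c d e. sg (negs u) * (sg (c < 0) * (if e = - d then ?t c else 0))) x y w -
      z * (sg (negs u) * (sg (x < 0) * (if w = - y then ?t x else 0)))"
    by (simp only: xop1_lin(3) right_diff_distrib mult.left_commute)
  also have "\<dots> = act YY a (act (ident 1) (a + 2) (act (ident 1) a (act cup (a + 1) F))) (u @ x # y # w # v)"
  proof -
    have e: "act (ident 1) (a + 2) (act (ident 1) a (act cup (a + 1) F)) (u @ c # d # w # v) =
        sg (negs u) * (sg (c < 0) * (if w = - d then ?t c else 0))"
      if "c \<in> letters n" "d \<in> letters n" for c d
    proof -
      have "act cup (a + 1) F (u @ c # d # w # v) = sg (negs u \<noteq> (c < 0)) * (if w = - d then ?t c else 0)"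
        using cup_at[of "a + 1" "u @ [c]" F d w v] len_u by auto
      then show ?thesis using 1[OF that] 2[OF that]
        by (cases "negs u"; cases "c < 0") (simp_all del: act.simps)
    qed
    show ?thesis
      unfolding Y_at[OF assms(1,2) len_u[symmetric]] e[OF assms(1,2)] xop1_def
      by (intro arg_cong2[where f = minus] xop_letters_cong HOL.refl e[symmetric] assms)
  qed
  finally show ?thesis by simp
qed

end

lemma words_3E:
  assumes "w \<in> words n 3"
  obtains x y t where "w = [x, y, t]" "x \<in> letters n" "y \<in> letters n" "t \<in> letters n"
  using assms by (auto simp: words_def length_Suc_conv numeral_3_eq_3)

text \<open>The axioms of a strict monoidal supercategory hold because the action is defined by recursion on
the expression and distant pieces commute; the defining relations are the identities for the
crossing. The bound on the length of \<open>w\<close> matters, since a piece acts on words which are long enough.\<close>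

theorem act_sound:
  assumes "mor_eq q m k f g" and qi: "unit_inverse q = qi" and "w \<in> words n (a + k + b)"
  shows "act f a F w = act g a F w"
  using assms(1,3)
proof (induction arbitrary: a b F w rule: mor_eq.induct)
  case (cong_Comp j k g g' m h h')
  have t: "welltyped g" "msrc g = j" "mtgt g = k"
    using cong_Comp.hyps(1)[THEN mor_eq_in_hom] by (simp_all add: in_hom_iff)
  have "act g a (act h a F) w = act g a (act h' a F) w"
    by (rule act_cong[OF t(1), where b = b]) (use t cong_Comp in auto)
  then show ?case using cong_Comp by simp
next
  case (cong_Tens m k f f' m' k' g g')
  have t: "welltyped f" "msrc f = m" "mtgt f = k" "msrc f' = m"
    using cong_Tens.hyps(1)[THEN mor_eq_in_hom] by (simp_all add: in_hom_iff)
  have "act f a (act g (a + m) F) w = act f a (act g' (a + m) F) w"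
    by (rule act_cong[OF t(1), where b = "k' + b"])
      (use t cong_Tens.prems cong_Tens.IH(2)[of _ "a + m" b F] in \<open>simp_all add: add.assoc\<close>)
  then show ?case using cong_Tens.IH(1)[of w a "k' + b" "act g' (a + m) F"] cong_Tens.prems t
    by (simp add: add.assoc)
next
  case (super_interchange f j p k m g j' p' h m' pf pg pk ph)
  have t: "welltyped f" "msrc f = j" "mtgt f = p" "welltyped k" "msrc k = m" "mtgt k = j"
    "welltyped g" "msrc g = j'" "mtgt g = p'" "welltyped h" "msrc h = m'" "mtgt h = j'"
    using super_interchange.hyps(1-4) by (simp_all add: in_hom_iff)
  have "act f a (act g (a + j) (act k a (act h (a + m) F))) w =
      act f a (\<lambda>w. sg (pk \<and> pg) * act k a (act g (a + m) (act h (a + m) F)) w) w"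
  proof (rule act_cong[OF t(1), where b = "p' + b"])
    show "w \<in> words n (a + mtgt f + (p' + b))"
      using super_interchange.prems t by (simp add: add.assoc)
    fix w assume "w \<in> words n (a + msrc f + (p' + b))"
    then show "act g (a + j) (act k a (act h (a + m) F)) w =
        sg (pk \<and> pg) * act k a (act g (a + m) (act h (a + m) F)) w"
      using act_commute[OF t(4) super_interchange.hyps(7) t(7) super_interchange.hyps(6), of w a 0 b "act h (a + m) F"] t
      by (simp add: add.assoc)
  qed
  then show ?case using t by (auto simp: act_scale sg_def)
next
  case (comp_id_left f m k)
  then show ?case by (simp add: ident_at del: act.simps(1))
next
  case (comp_id_right f m k)
  have "act f a (act (ident m) a F) w = act f a F w"
    by (rule act_cong[where b = b])
      (use comp_id_right in \<open>auto simp: in_hom_iff intro: ident_at simp del: act.simps(1)\<close>)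
  then show ?case by simp
next
  case (tens_unit_left f m k)
  then show ?case using ident_at[of w a 0 "k + b" "act f a F"] by (simp add: add.assoc)
next
  case (tens_unit_right f m k)
  have "act f a (act (ident 0) (a + m) F) w = act f a F w"
    by (rule act_cong[where b = b])
      (use tens_unit_right ident_at[of _ "a + m" 0 b F] in \<open>auto simp: in_hom_iff\<close>)
  then show ?case using tens_unit_right by (simp add: in_hom_iff)
next
  case (tens_id j k)
  have "act (ident j) a (act (ident k) (a + j) F) w = act (ident k) (a + j) F w"
    by (rule ident_at[where b = "k + b"]) (use tens_id in \<open>simp add: add.assoc\<close>)
  also have "\<dots> = F w" by (rule ident_at[where b = b]) (use tens_id in \<open>simp add: add.assoc\<close>)
  also have "\<dots> = act (ident (j + k)) a F w" by (rule ident_at[symmetric]) (use tens_id in simp)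
  finally show ?case by simp
next
  case XY
  then have *: "act (ident 2) a F w = F w" by (rule ident_at)
  from XY show ?case using *
    by (elim words_split3E words_2E) (simp add: sound_inverse del: act.simps(1))
next
  case YX
  then have *: "act (ident 2) a F w = F w" by (rule ident_at)
  from YX show ?case using *
    by (elim words_split3E words_2E) (simp add: sound_inverse del: act.simps(1))
next
  case braid
  then show ?case by (elim words_split3E words_3E) (simp only: sound_braid append.simps)
next
  case skein
  then have *: "act (ident 2) a F w = F w" by (rule ident_at)
  from skein show ?case using *
    by (elim words_split3E words_2E) (simp add: X_at Y_at words_lengthD qi del: act.simps(1))
next
  case zigzag_left
  then have *: "act (ident 1) a F w = F w" by (rule ident_at)
  from zigzag_left show ?case using * sound_zigzag_left[of _ a _ b _ F]
    by (elim words_split3E) (auto elim!: words_1E simp del: act.simps(1))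
next
  case zigzag_right
  then have *: "act (ident 1) a F w = F w" by (rule ident_at)
  from zigzag_right show ?case using * sound_zigzag_right[of _ a _ b _ F]
    by (elim words_split3E) (auto elim!: words_1E simp del: act.simps(1))
next
  case X_cup
  then show ?case by (elim words_split3E words_2E) (simp add: sound_X_cup del: act.simps(1))
next
  case slide_cup
  then show ?case by (elim words_split3E words_3E) (simp only: sound_slide append.simps)
next
  case cap_cup
  then show ?case by (elim words_split3E) (simp add: sound_cap_cup del: act.simps(1))
qed (auto simp: act_add act_scale act_zero in_hom_iff add.assoc algebra_simps)

end

section \<open>Crossings of perfect matchings\<close>
text \<open>A generic word is a perfect matching of its positions: the letter \<open>x\<close> is matched with \<open>- x\<close>.\<close>

definition generic :: "int list \<Rightarrow> bool" where
  "generic g \<longleftrightarrow> distinct g \<and> 0 \<notin> set g \<and> (\<forall>x\<in>set g. - x \<in> set g)"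

lemma generic_uminus: "generic g \<Longrightarrow> - x \<in> set g \<longleftrightarrow> x \<in> set g"
  unfolding generic_def by (metis minus_minus)

text \<open>The letter \<open>x\<close> occurs before the letter \<open>y\<close>.\<close>

fun pre :: "int list \<Rightarrow> int \<Rightarrow> int \<Rightarrow> bool" where
  "pre [] x y = False"
| "pre (t # g) x y = (t = x \<and> y \<in> set g \<or> pre g x y)"

lemma pre_in: "pre g x y \<Longrightarrow> x \<in> set g \<and> y \<in> set g"
  by (induction g) auto

lemma pre_append [simp]: "pre (u @ v) x y \<longleftrightarrow> pre u x y \<or> pre v x y \<or> (x \<in> set u \<and> y \<in> set v)"
  by (induction u) (auto dest: pre_in)

lemma pre_total: "distinct g \<Longrightarrow> x \<in> set g \<Longrightarrow> y \<in> set g \<Longrightarrow> x \<noteq> y \<Longrightarrow> pre g y x \<longleftrightarrow> \<not> pre g x y"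
  by (induction g) (auto dest: pre_in)

lemma pre_map: "inj_on f (set g) \<Longrightarrow> x \<in> set g \<Longrightarrow> y \<in> set g \<Longrightarrow> pre (map f g) (f x) (f y) \<longleftrightarrow> pre g x y"
proof (induction g)
  case (Cons t g)
  have i: "f a = f b \<longleftrightarrow> a = b" if "a \<in> set (t # g)" "b \<in> set (t # g)" for a b
    using inj_on_eq_iff[OF Cons.prems(1) that] .
  have 1: "f t = f x \<longleftrightarrow> t = x" by (rule i) (use Cons.prems in auto)
  have y: "f y \<in> f ` set g \<longleftrightarrow> y \<in> set g"
    using Cons.prems by (intro inj_on_image_mem_iff[where B = "set (t # g)"]) auto
  have x: "f x \<in> f ` set g \<longleftrightarrow> x \<in> set g"
    using Cons.prems by (intro inj_on_image_mem_iff[where B = "set (t # g)"]) auto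
  have "pre (map f g) (f x) (f y) \<longleftrightarrow> pre g x y"
  proof (cases "x \<in> set g \<and> y \<in> set g")
    case True
    then show ?thesis using Cons.IH Cons.prems(1) by (simp add: inj_on_insert)
  next
    case False
    then show ?thesis using pre_in[of g x y] pre_in[of "map f g" "f x" "f y"] x y by auto
  qed
  then show ?case by (simp add: 1 y)
qed simp

text \<open>The chords of \<open>x\<close> and \<open>y\<close> cross if and only if an odd number of the four pairs of their ends are in order:
three or one if they interleave, and zero, two or four if they are disjoint or nested. Counting modulo
2 makes the effect of moving an end additive.\<close>

definition cross :: "int list \<Rightarrow> int \<Rightarrow> int \<Rightarrow> bool" where
  "cross g x y \<longleftrightarrow> (pre g x y \<noteq> (pre g x (- y) \<noteq> (pre g (- x) y \<noteq> pre g (- x) (- y))))"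

lemma cross_uminus [simp]: "cross g (- x) y = cross g x y" "cross g x (- y) = cross g x y"
  by (auto simp: cross_def)

lemma cross_abs: "\<bar>x\<bar> = \<bar>x'\<bar> \<Longrightarrow> \<bar>y\<bar> = \<bar>y'\<bar> \<Longrightarrow> cross g x y = cross g x' y'"
  by (metis abs_eq_iff cross_uminus)

lemma cross_sym:
  assumes "generic g" "x \<in> set g" "y \<in> set g" "\<bar>x\<bar> \<noteq> \<bar>y\<bar>"
  shows "cross g y x = cross g x y"
proof -
  have "- x \<in> set g" "- y \<in> set g" "distinct g" using assms by (auto simp: generic_def)
  moreover have "x \<noteq> y" "x \<noteq> - y" "- x \<noteq> y" "- x \<noteq> - y" using assms(4) by auto
  ultimately show ?thesis
    using assms(2,3) pre_total[of g x y] pre_total[of g x "- y"] pre_total[of g "- x" y] pre_total[of g "- x" "- y"]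
    by (auto simp: cross_def)
qed

text \<open>A chord is represented by the absolute value of its letters.\<close>

definition crossing_pairs :: "int list \<Rightarrow> int set set" where
  "crossing_pairs g = {{\<bar>x\<bar>, \<bar>y\<bar>} | x y. x \<in> set g \<and> y \<in> set g \<and> \<bar>x\<bar> \<noteq> \<bar>y\<bar> \<and> cross g x y}"

definition cr :: "int list \<Rightarrow> nat" where "cr g = card (crossing_pairs g)"

lemma finite_crossing_pairs [simp]: "finite (crossing_pairs g)"
proof -
  have "crossing_pairs g \<subseteq> (\<lambda>(x, y). {\<bar>x\<bar>, \<bar>y\<bar>}) ` (set g \<times> set g)"
    by (auto simp: crossing_pairs_def)
  then show ?thesis by (rule finite_subset) simp
qed

lemma generic_swap: "generic (u @ x # y # v) \<Longrightarrow> generic (u @ y # x # v)"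
  by (auto simp: generic_def)

lemma cross_swap:
  assumes "generic (u @ x # y # v)" "\<bar>x\<bar> \<noteq> \<bar>y\<bar>"
  shows "cross (u @ y # x # v) p r = (cross (u @ x # y # v) p r \<noteq> ({\<bar>p\<bar>, \<bar>r\<bar>} = {\<bar>x\<bar>, \<bar>y\<bar>}))"
proof -
  have d: "x \<noteq> y" "x \<noteq> - y" "- x \<noteq> y" using assms(2) by auto
  have nz: "x \<noteq> 0" "y \<noteq> 0" using assms(1) by (auto simp: generic_def)
  have npr: "\<not> pre u x t" "\<not> pre u y t" "\<not> pre v x t" "\<not> pre v y t" "\<not> pre u t x" "\<not> pre u t y" "\<not> pre v t x" "\<not> pre v t y" for t
    using assms(1) by (auto simp: generic_def dest: pre_in)
  have ns: "x \<notin> set u" "x \<notin> set v" "y \<notin> set u" "y \<notin> set v" using assms(1) by (auto simp: generic_def)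
  have p: "pre (u @ y # x # v) s t = (pre (u @ x # y # v) s t \<noteq> ((s = x \<and> t = y) \<or> (s = y \<and> t = x)))" for s t
    using d ns npr by auto
  have e: "{\<bar>p\<bar>, \<bar>r\<bar>} = {\<bar>x\<bar>, \<bar>y\<bar>} \<longleftrightarrow>
     ((p = x \<or> p = - x) \<and> (r = y \<or> r = - y)) \<or> ((p = y \<or> p = - y) \<and> (r = x \<or> r = - x))"
    using assms(2) by (auto simp: doubleton_eq_iff abs_eq_iff)
  let ?d = "\<lambda>s t. (s = x \<and> t = y) \<or> (s = y \<and> t = x)"
  have ne: "x \<noteq> y" "y \<noteq> x" "x \<noteq> - y" "- y \<noteq> x" "- x \<noteq> y" "y \<noteq> - x" "- x \<noteq> - y" "- y \<noteq> - x"
    "x \<noteq> - x" "- x \<noteq> x" "y \<noteq> - y" "- y \<noteq> y" using d nz by auto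
  have d: "(?d p r \<noteq> (?d p (- r) \<noteq> (?d (- p) r \<noteq> ?d (- p) (- r)))) = ({\<bar>p\<bar>, \<bar>r\<bar>} = {\<bar>x\<bar>, \<bar>y\<bar>})"
  proof -
    have m: "- p = t \<longleftrightarrow> p = - t" "- r = t \<longleftrightarrow> r = - t" for t by auto
    consider "p = x" | "p = - x" | "p = y" | "p = - y" | "p \<noteq> x" "p \<noteq> - x" "p \<noteq> y" "p \<noteq> - y" by blast
    then show ?thesis unfolding e m
      by cases ((cases "r = x"; cases "r = - x"; cases "r = y"; cases "r = - y"; simp add: ne nz)+)
  qed
  have xor: "((a \<noteq> a') \<noteq> ((b \<noteq> b') \<noteq> ((c \<noteq> c') \<noteq> (f \<noteq> f')))) =
      ((a \<noteq> (b \<noteq> (c \<noteq> f))) \<noteq> (a' \<noteq> (b' \<noteq> (c' \<noteq> f'))))" for a a' b b' c c' f f' :: bool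
    by (cases a; cases b; cases c; cases f; cases a'; cases b'; cases c') simp_all
  show ?thesis unfolding cross_def p xor d ..
qed

lemma cross_swap_same:
  assumes "generic (u @ x # - x # v)" "\<bar>p\<bar> \<noteq> \<bar>r\<bar>"
  shows "cross (u @ - x # x # v) p r = cross (u @ x # - x # v) p r"
proof -
  have p: "pre (u @ - x # x # v) s t = pre (u @ x # - x # v) s t" if "\<bar>s\<bar> \<noteq> \<bar>t\<bar>" for s t
    using that by auto
  show ?thesis unfolding cross_def using assms(2) by (simp only: p abs_minus_cancel not_False_eq_True)
qed

lemma cr_swap_le:
  assumes "generic (u @ x # y # v)"
  shows "cr (u @ y # x # v) \<le> Suc (cr (u @ x # y # v))"
proof -
  have "crossing_pairs (u @ y # x # v) \<subseteq> insert {\<bar>x\<bar>, \<bar>y\<bar>} (crossing_pairs (u @ x # y # v))"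
  proof
    fix P assume "P \<in> crossing_pairs (u @ y # x # v)"
    then obtain p r where P: "P = {\<bar>p\<bar>, \<bar>r\<bar>}" "p \<in> set (u @ x # y # v)" "r \<in> set (u @ x # y # v)" "\<bar>p\<bar> \<noteq> \<bar>r\<bar>"
        "cross (u @ y # x # v) p r"
      by (auto simp: crossing_pairs_def)
    show "P \<in> insert {\<bar>x\<bar>, \<bar>y\<bar>} (crossing_pairs (u @ x # y # v))"
    proof (cases "\<bar>x\<bar> = \<bar>y\<bar>")
      case True
      then have "y = - x" using assms by (auto simp: generic_def abs_eq_iff)
      then have "cross (u @ x # y # v) p r"
        using cross_swap_same[of u x v p r] assms P by simp
      then show ?thesis using P unfolding crossing_pairs_def by blast
    next
      case False
      then have "P = {\<bar>x\<bar>, \<bar>y\<bar>} \<or> cross (u @ x # y # v) p r"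
        using cross_swap[OF assms False, of p r] P by auto
      then show ?thesis using P unfolding crossing_pairs_def by blast
    qed
  qed
  then have "cr (u @ y # x # v) \<le> card (insert {\<bar>x\<bar>, \<bar>y\<bar>} (crossing_pairs (u @ x # y # v)))"
    unfolding cr_def by (rule card_mono[rotated]) simp
  also have "\<dots> \<le> Suc (cr (u @ x # y # v))" unfolding cr_def by (simp add: card_insert_if)
  finally show ?thesis .
qed

lemma cross_insert:
  assumes "x \<notin> set (u @ v)" "- x \<notin> set (u @ v)" "\<bar>p\<bar> \<noteq> \<bar>x\<bar>" "\<bar>r\<bar> \<noteq> \<bar>x\<bar>"
  shows "cross (u @ x # - x # v) p r = cross (u @ v) p r"
proof -
  have e: "pre (u @ x # - x # v) s t = pre (u @ v) s t" if "\<bar>s\<bar> \<noteq> \<bar>x\<bar>" "\<bar>t\<bar> \<noteq> \<bar>x\<bar>" for s t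
  proof -
    have "x \<noteq> s" "- x \<noteq> s" "t \<noteq> x" "t \<noteq> - x" using that by auto
    then show ?thesis by simp
  qed
  show ?thesis unfolding cross_def using assms(3,4) by (simp only: e abs_minus_cancel not_False_eq_True)
qed

lemma cross_insert_self:
  assumes "x \<notin> set (u @ v)" "- x \<notin> set (u @ v)" "\<bar>r\<bar> \<noteq> \<bar>x\<bar>"
  shows "\<not> cross (u @ x # - x # v) x r" "\<not> cross (u @ x # - x # v) r x"
proof -
  have n: "\<not> pre u x t" "\<not> pre u (- x) t" "\<not> pre v x t" "\<not> pre v (- x) t" "\<not> pre u t x" "\<not> pre u t (- x)" "\<not> pre v t x" "\<not> pre v t (- x)" for t
    using assms by (auto dest: pre_in)
  have r: "r \<noteq> x" "r \<noteq> - x" "- r \<noteq> x" "- r \<noteq> - x" using assms(3) by auto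
  have a: "pre (u @ x # - x # v) x t \<longleftrightarrow> t \<in> set v" "pre (u @ x # - x # v) (- x) t \<longleftrightarrow> t \<in> set v"
    "pre (u @ x # - x # v) t x \<longleftrightarrow> t \<in> set u" "pre (u @ x # - x # v) t (- x) \<longleftrightarrow> t \<in> set u"
    if "t \<noteq> x" "t \<noteq> - x" for t
    using n[of t] that assms(1,2) by (simp_all, blast+)
  show "\<not> cross (u @ x # - x # v) x r" "\<not> cross (u @ x # - x # v) r x"
    unfolding cross_def a[OF r(1,2)] a[OF r(3,4)]
    by (cases "r \<in> set v"; cases "- r \<in> set v"; simp) (cases "r \<in> set u"; cases "- r \<in> set u"; simp)
qed

lemma generic_insert: "generic (u @ v) \<Longrightarrow> x \<noteq> 0 \<Longrightarrow> x \<notin> set (u @ v) \<Longrightarrow> - x \<notin> set (u @ v) \<Longrightarrow> generic (u @ x # - x # v)"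
  by (auto simp: generic_def)

lemma generic_remove: "generic (u @ x # - x # v) \<Longrightarrow> generic (u @ v)"
  unfolding generic_def by (auto simp: minus_equation_iff)

lemma crossing_pairs_insert:
  assumes "x \<notin> set (u @ v)" "- x \<notin> set (u @ v)" "\<And>t. t \<in> set (u @ v) \<Longrightarrow> \<bar>t\<bar> \<noteq> \<bar>x\<bar>"
  shows "crossing_pairs (u @ x # - x # v) = crossing_pairs (u @ v)"
proof
  show "crossing_pairs (u @ x # - x # v) \<subseteq> crossing_pairs (u @ v)"
  proof
    fix P assume "P \<in> crossing_pairs (u @ x # - x # v)"
    then obtain p r where P: "P = {\<bar>p\<bar>, \<bar>r\<bar>}" "p \<in> set (u @ x # - x # v)" "r \<in> set (u @ x # - x # v)" "\<bar>p\<bar> \<noteq> \<bar>r\<bar>"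
        "cross (u @ x # - x # v) p r"
      by (auto simp: crossing_pairs_def)
    have "\<bar>p\<bar> \<noteq> \<bar>x\<bar>" using cross_insert_self(1)[OF assms(1,2), of r] P(4,5) cross_abs[of p x r r] by auto
    moreover have "\<bar>r\<bar> \<noteq> \<bar>x\<bar>" using cross_insert_self(2)[OF assms(1,2), of p] P(4,5) cross_abs[of p p r x] by auto
    ultimately have "p \<in> set (u @ v)" "r \<in> set (u @ v)" "cross (u @ v) p r"
      using P cross_insert[OF assms(1,2), of p r] by auto
    then show "P \<in> crossing_pairs (u @ v)" using P unfolding crossing_pairs_def by blast
  qed
  show "crossing_pairs (u @ v) \<subseteq> crossing_pairs (u @ x # - x # v)"
  proof
    fix P assume "P \<in> crossing_pairs (u @ v)"
    then obtain p r where P: "P = {\<bar>p\<bar>, \<bar>r\<bar>}" "p \<in> set (u @ v)" "r \<in> set (u @ v)" "\<bar>p\<bar> \<noteq> \<bar>r\<bar>"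
        "cross (u @ v) p r"
      by (auto simp: crossing_pairs_def)
    then have "cross (u @ x # - x # v) p r" using cross_insert[OF assms(1,2), of p r] assms(3) by auto
    moreover have "p \<in> set (u @ x # - x # v)" "r \<in> set (u @ x # - x # v)" using P by auto
    ultimately show "P \<in> crossing_pairs (u @ x # - x # v)" using P unfolding crossing_pairs_def by blast
  qed
qed

lemma cr_insert: "generic (u @ x # - x # v) \<Longrightarrow> cr (u @ x # - x # v) = cr (u @ v)"
  unfolding cr_def
  by (subst crossing_pairs_insert) (auto simp: generic_def abs_eq_iff)

text \<open>If the end \<open>x\<close> of one chord is joined to the end \<open>y\<close> of another, the two remaining ends \<open>- x\<close> and
\<open>- y\<close> form a chord, and the letter \<open>y\<close> is free to be used for \<open>- x\<close>.\<close>

definition ren :: "int \<Rightarrow> int \<Rightarrow> int \<Rightarrow> int" where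
  "ren x y t = (if t = x then - y else if t = - x then y else t)"

lemma ren_uminus: "x \<noteq> 0 \<Longrightarrow> ren x y (- t) = - ren x y t"
  by (auto simp: ren_def)

lemma generic_join:
  assumes "generic (u @ x # y # v)" "y \<noteq> - x"
  shows "generic (map (ren x y) (u @ v))" "inj_on (ren x y) (set (u @ v))"
proof -
  have x: "x \<noteq> 0" "y \<noteq> 0" "x \<notin> set (u @ v)" "y \<notin> set (u @ v)" "x \<noteq> y" "distinct (u @ v)" "0 \<notin> set (u @ v)"
    using assms(1) by (auto simp: generic_def)
  show i: "inj_on (ren x y) (set (u @ v))"
    using x by (auto simp: inj_on_def ren_def)
  have c: "- t \<in> set (u @ v)" if "t \<in> set (u @ v)" "t \<noteq> - x" "t \<noteq> - y" for t
  proof -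
    have "- t \<in> set (u @ x # y # v)" using generic_uminus[OF assms(1), of t] that by simp
    moreover have "- t \<noteq> x" "- t \<noteq> y" using that by auto
    ultimately show ?thesis by simp
  qed
  have m: "- x \<in> set (u @ v)" "- y \<in> set (u @ v)"
  proof -
    have "- x \<in> set (u @ x # y # v)" "- y \<in> set (u @ x # y # v)"
      using generic_uminus[OF assms(1), of x] generic_uminus[OF assms(1), of y] by simp_all
    moreover have "- x \<noteq> x" "- y \<noteq> y" "- x \<noteq> y" "- y \<noteq> x" using x assms(2) by auto
    ultimately show "- x \<in> set (u @ v)" "- y \<in> set (u @ v)" by simp_all
  qed
  have yy: "ren x y (- x) = y" "ren x y (- y) = - y" using x assms(2) by (auto simp: ren_def)
  have neg: "- ren x y t \<in> ren x y ` set (u @ v)" if t: "t \<in> set (u @ v)" for t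
  proof -
    consider "t = - x" | "t = - y" | "t \<noteq> - x" "t \<noteq> - y" by blast
    then show ?thesis
    proof cases
      case 1 then show ?thesis using yy m by (metis image_eqI)
    next
      case 2 then show ?thesis using yy m by (metis image_eqI minus_minus)
    next
      case 3 then show ?thesis using c[OF t] ren_uminus[OF x(1), of y t] by (metis image_eqI)
    qed
  qed
  show "generic (map (ren x y) (u @ v))"
    unfolding generic_def
  proof (intro conjI ballI)
    show "distinct (map (ren x y) (u @ v))" using x(6) i by (simp only: distinct_map)
    show "0 \<notin> set (map (ren x y) (u @ v))" using x by (auto simp: ren_def)
    fix s assume "s \<in> set (map (ren x y) (u @ v))"
    then obtain t where "t \<in> set (u @ v)" "s = ren x y t" unfolding set_map by blast
    then show "- s \<in> set (map (ren x y) (u @ v))" unfolding set_map using neg by simp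
  qed
qed

text \<open>A chord crosses the joined chord an odd number of times if and only if it crosses exactly one of
the two parts.\<close>

lemma cross_join:
  assumes "generic (u @ x # y # v)" "y \<noteq> - x" "\<bar>r\<bar> \<noteq> \<bar>x\<bar>" "\<bar>r\<bar> \<noteq> \<bar>y\<bar>" "r \<in> set (u @ v)"
  shows "cross (map (ren x y) (u @ v)) y r = (cross (u @ x # y # v) x r \<noteq> cross (u @ x # y # v) y r)"
    "p \<in> set (u @ v) \<Longrightarrow> \<bar>p\<bar> \<noteq> \<bar>x\<bar> \<Longrightarrow> \<bar>p\<bar> \<noteq> \<bar>y\<bar> \<Longrightarrow> cross (map (ren x y) (u @ v)) p r = cross (u @ x # y # v) p r"
proof -
  have x: "x \<noteq> 0" "y \<noteq> 0" "x \<notin> set (u @ v)" "y \<notin> set (u @ v)" "x \<noteq> y" "distinct (u @ v)" "0 \<notin> set (u @ v)"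
    using assms(1) by (auto simp: generic_def)
  have m: "- x \<in> set (u @ v)" "- y \<in> set (u @ v)"
  proof -
    have "- x \<in> set (u @ x # y # v)" "- y \<in> set (u @ x # y # v)"
      using generic_uminus[OF assms(1), of x] generic_uminus[OF assms(1), of y] by simp_all
    moreover have "- x \<noteq> x" "- y \<noteq> y" "- x \<noteq> y" "- y \<noteq> x" using x assms(2) by auto
    ultimately show "- x \<in> set (u @ v)" "- y \<in> set (u @ v)" by simp_all
  qed
  have i: "inj_on (ren x y) (set (u @ v))" using generic_join(2)[OF assms(1,2)] .
  have o: "ren x y t = t" if "\<bar>t\<bar> \<noteq> \<bar>x\<bar>" for t using that by (auto simp: ren_def)
  have yy: "ren x y (- x) = y" "ren x y (- y) = - y" using x assms(2) by (auto simp: ren_def)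
  have neg: "- t \<in> set (u @ v)" if "t \<in> set (u @ v)" "\<bar>t\<bar> \<noteq> \<bar>x\<bar>" "\<bar>t\<bar> \<noteq> \<bar>y\<bar>" for t
  proof -
    have "- t \<in> set (u @ x # y # v)" using generic_uminus[OF assms(1), of t] that by simp
    moreover have "- t \<noteq> x" "- t \<noteq> y" using that by auto
    ultimately show ?thesis by simp
  qed
  note PM = pre_map[OF i]
  have P: "pre (u @ x # y # v) s t = pre (u @ v) s t" if "s \<noteq> x" "s \<noteq> y" "t \<noteq> x" "t \<noteq> y" for s t
    using that by auto
  have r: "r \<noteq> x" "r \<noteq> y" "- r \<noteq> x" "- r \<noteq> y" using assms(3,4) by auto
  have n: "- r \<in> set (u @ v)" using neg assms by auto
  have npr: "\<not> pre u x t" "\<not> pre u y t" "\<not> pre v x t" "\<not> pre v y t" for t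
    using x by (auto dest: pre_in)
  have Q: "pre (u @ x # y # v) x t = pre (u @ x # y # v) y t" if "t \<noteq> x" "t \<noteq> y" for t
    using that x npr by auto
  have A: "pre (map (ren x y) (u @ v)) y t = pre (u @ x # y # v) (- x) t"
    if "t \<in> set (u @ v)" "\<bar>t\<bar> \<noteq> \<bar>x\<bar>" "\<bar>t\<bar> \<noteq> \<bar>y\<bar>" for t
  proof -
    have "pre (map (ren x y) (u @ v)) (ren x y (- x)) (ren x y t) = pre (u @ v) (- x) t"
      by (rule PM) (use m that in auto)
    moreover have "- x \<noteq> x" "- x \<noteq> y" "t \<noteq> x" "t \<noteq> y" using x assms(2) that by auto
    ultimately show ?thesis using P[of "- x" t] yy o[of t] that(2) by simp
  qed
  have B: "pre (map (ren x y) (u @ v)) (- y) t = pre (u @ x # y # v) (- y) t"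
    if "t \<in> set (u @ v)" "\<bar>t\<bar> \<noteq> \<bar>x\<bar>" "\<bar>t\<bar> \<noteq> \<bar>y\<bar>" for t
  proof -
    have "pre (map (ren x y) (u @ v)) (ren x y (- y)) (ren x y t) = pre (u @ v) (- y) t"
      by (rule PM) (use m that in auto)
    moreover have "- y \<noteq> x" "- y \<noteq> y" "t \<noteq> x" "t \<noteq> y" using x assms(2) that by auto
    ultimately show ?thesis using P[of "- y" t] yy o[of t] that(2) by simp
  qed
  show "cross (map (ren x y) (u @ v)) y r = (cross (u @ x # y # v) x r \<noteq> cross (u @ x # y # v) y r)"
  proof -
    have r': "\<bar>- r\<bar> \<noteq> \<bar>x\<bar>" "\<bar>- r\<bar> \<noteq> \<bar>y\<bar>" using assms(3,4) by simp_all
    have xor: "(a \<noteq> (b \<noteq> (c \<noteq> d))) = ((e \<noteq> (f \<noteq> (a \<noteq> b))) \<noteq> (e \<noteq> (f \<noteq> (c \<noteq> d))))" for a b c d e f :: bool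
      by (cases a; cases b; cases c; cases d) simp_all
    show ?thesis
      unfolding cross_def A[OF assms(5,3,4)] A[OF n r'] B[OF assms(5,3,4)] B[OF n r'] Q[OF r(1,2)] Q[OF r(3,4)]
      by (rule xor)
  qed
  show "cross (map (ren x y) (u @ v)) p r = cross (u @ x # y # v) p r"
    if p: "p \<in> set (u @ v)" "\<bar>p\<bar> \<noteq> \<bar>x\<bar>" "\<bar>p\<bar> \<noteq> \<bar>y\<bar>"
  proof -
    have C: "pre (map (ren x y) (u @ v)) s t = pre (u @ x # y # v) s t"
      if "s \<in> set (u @ v)" "\<bar>s\<bar> \<noteq> \<bar>x\<bar>" "\<bar>s\<bar> \<noteq> \<bar>y\<bar>" "t \<in> set (u @ v)" "\<bar>t\<bar> \<noteq> \<bar>x\<bar>" "\<bar>t\<bar> \<noteq> \<bar>y\<bar>" for s t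
    proof -
      have "pre (map (ren x y) (u @ v)) (ren x y s) (ren x y t) = pre (u @ v) s t"
        by (rule PM) (use that in auto)
      moreover have "s \<noteq> x" "s \<noteq> y" "t \<noteq> x" "t \<noteq> y" using that by auto
      ultimately show ?thesis using P[of s t] o[of s] o[of t] that by simp
    qed
    show ?thesis
      unfolding cross_def using p n neg[OF p] assms(3-5) by (simp only: C abs_minus_cancel not_False_eq_True)
  qed
qed

text \<open>Every crossing of the joined word is the image of a crossing of the original one, since a chord which
crosses the joined chord crosses one of its two parts.\<close>

lemma cr_join_le:
  assumes "generic (u @ x # y # v)" "y \<noteq> - x"
  shows "cr (map (ren x y) (u @ v)) \<le> cr (u @ x # y # v)"
proof -
  let ?g = "u @ x # y # v" and ?g' = "map (ren x y) (u @ v)"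
  let ?f = "\<lambda>S. (\<lambda>t. if t = \<bar>x\<bar> then \<bar>y\<bar> else t) ` S"
  have x: "x \<noteq> 0" "y \<noteq> 0" "\<bar>x\<bar> \<noteq> \<bar>y\<bar>" using assms by (auto simp: generic_def abs_eq_iff)
  have g': "generic ?g'" by (rule generic_join[OF assms])
  have mem: "t \<in> set (u @ v) \<and> \<bar>t\<bar> \<noteq> \<bar>x\<bar>" if T: "t \<in> set ?g'" "\<bar>t\<bar> \<noteq> \<bar>y\<bar>" for t
  proof -
    obtain t0 where t0: "t0 \<in> set (u @ v)" "t = ren x y t0" using T(1) unfolding set_map by blast
    have "t0 \<noteq> x" using assms(1) t0 by (auto simp: generic_def)
    moreover have "t0 \<noteq> - x" using t0 T(2) x by (auto simp: ren_def)
    ultimately show ?thesis using t0 by (auto simp: ren_def abs_eq_iff)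
  qed
  have "crossing_pairs ?g' \<subseteq> ?f ` crossing_pairs ?g"
  proof
    fix P assume "P \<in> crossing_pairs ?g'"
    then obtain p r where P: "P = {\<bar>p\<bar>, \<bar>r\<bar>}" "p \<in> set ?g'" "r \<in> set ?g'" "\<bar>p\<bar> \<noteq> \<bar>r\<bar>" "cross ?g' p r"
      unfolding crossing_pairs_def by auto
    have one: "{\<bar>y\<bar>, \<bar>r\<bar>} \<in> ?f ` crossing_pairs ?g"
      if "r \<in> set ?g'" "\<bar>y\<bar> \<noteq> \<bar>r\<bar>" "cross ?g' y r" for r
    proof -
      have r: "r \<in> set (u @ v)" "\<bar>r\<bar> \<noteq> \<bar>x\<bar>" using mem[of r] that by auto
      then have "cross ?g x r \<or> cross ?g y r"
        using cross_join(1)[OF assms, of r] that by auto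
      moreover have "x \<in> set ?g" "y \<in> set ?g" "r \<in> set ?g" "\<bar>x\<bar> \<noteq> \<bar>r\<bar>" using r by auto
      ultimately have "{\<bar>x\<bar>, \<bar>r\<bar>} \<in> crossing_pairs ?g \<or> {\<bar>y\<bar>, \<bar>r\<bar>} \<in> crossing_pairs ?g"
        using that(2) unfolding crossing_pairs_def by blast
      then show ?thesis
      proof
        assume "{\<bar>x\<bar>, \<bar>r\<bar>} \<in> crossing_pairs ?g"
        then show ?thesis by (rule rev_image_eqI) (use r(2) in \<open>simp add: insert_commute\<close>)
      next
        assume "{\<bar>y\<bar>, \<bar>r\<bar>} \<in> crossing_pairs ?g"
        then show ?thesis by (rule rev_image_eqI) (use r(2) x(3) in simp)
      qed
    qed
    consider "\<bar>p\<bar> = \<bar>y\<bar>" | "\<bar>r\<bar> = \<bar>y\<bar>" | "\<bar>p\<bar> \<noteq> \<bar>y\<bar>" "\<bar>r\<bar> \<noteq> \<bar>y\<bar>" by blast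
    then show "P \<in> ?f ` crossing_pairs ?g"
    proof cases
      case 1
      then show ?thesis using one[of r] P cross_abs[of p y r r] by auto
    next
      case 2
      have "cross ?g' r p" using cross_sym[OF g' P(2,3,4)] P(5) by simp
      then show ?thesis using one[of p] P 2 cross_abs[of r y p p] by (auto simp: insert_commute)
    next
      case 3
      have "p \<in> set (u @ v)" "\<bar>p\<bar> \<noteq> \<bar>x\<bar>" "r \<in> set (u @ v)" "\<bar>r\<bar> \<noteq> \<bar>x\<bar>"
        using mem[of p] mem[of r] P 3 by auto
      then have "cross ?g p r" using cross_join(2)[OF assms, of r p] 3 P by auto
      moreover have "p \<in> set ?g" "r \<in> set ?g" using \<open>p \<in> set (u @ v)\<close> \<open>r \<in> set (u @ v)\<close> by simp_all
      ultimately have "P \<in> crossing_pairs ?g"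
        using P(1,4) unfolding crossing_pairs_def by blast
      then show ?thesis
        by (rule rev_image_eqI) (use P(1) \<open>\<bar>p\<bar> \<noteq> \<bar>x\<bar>\<close> \<open>\<bar>r\<bar> \<noteq> \<bar>x\<bar>\<close> in simp)
    qed
  qed
  then have "cr ?g' \<le> card (?f ` crossing_pairs ?g)" unfolding cr_def by (rule card_mono[rotated]) simp
  also have "\<dots> \<le> cr ?g" unfolding cr_def by (rule card_image_le) simp
  finally show ?thesis .
qed

text \<open>The word \<open>w\<close> respects the matching \<open>g\<close>: matched positions carry opposite letters. Unlike \<open>g\<close>,
it may use a letter for several chords.\<close>

definition compat :: "int list \<Rightarrow> int list \<Rightarrow> bool" where
  "compat w g \<longleftrightarrow> (\<exists>h. (\<forall>x. h (- x) = - h x) \<and> w = map h g)"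

text \<open>The error terms: words which respect a matching with fewer than \<open>N\<close> crossings.\<close>

definition compat_below :: "nat \<Rightarrow> int list \<Rightarrow> bool" where
  "compat_below N w \<longleftrightarrow> (\<exists>g. generic g \<and> cr g < N \<and> compat w g)"

lemma compat_refl: "compat g g" unfolding compat_def by (rule exI[of _ id]) simp

lemma compat_split2E:
  assumes "compat (u @ a # b # v) g"
  obtains h u' x y v' where "g = u' @ x # y # v'" "u = map h u'" "v = map h v'" "a = h x" "b = h y"
    "\<And>x. h (- x) = - h x" "length u = length u'" "length v = length v'"
proof -
  from assms obtain h where h: "\<forall>x. h (- x) = - h x" "u @ a # b # v = map h g" unfolding compat_def by auto
  from h(2) obtain u' r where 1: "g = u' @ r" "u = map h u'" "a # b # v = map h r"
    by (metis append_eq_map_conv)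
  from 1(3) obtain x y v' where "r = x # y # v'" "a = h x" "b = h y" "v = map h v'"
    by (auto simp: Cons_eq_map_conv)
  then show ?thesis using that[of u' x y v' h] h 1 by auto
qed

lemma compat_swap:
  assumes "compat (u @ a # b # v) (u' @ x # y # v')" "length u = length u'"
  shows "compat (u @ b # a # v) (u' @ y # x # v')"
  using assms unfolding compat_def by auto

lemma compat_below_swap: "compat_below N (u @ a # b # v) \<Longrightarrow> compat_below (Suc N) (u @ b # a # v)"
proof -
  assume "compat_below N (u @ a # b # v)"
  then obtain g where g: "generic g" "cr g < N" "compat (u @ a # b # v) g" unfolding compat_below_def by auto
  from g(3) obtain h u' x y v' where e: "g = u' @ x # y # v'" "length u = length u'" by (rule compat_split2E)
  have "compat (u @ b # a # v) (u' @ y # x # v')" using compat_swap[of u a b v u' x y v'] g e by auto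
  moreover have "cr (u' @ y # x # v') < Suc N" using cr_swap_le[of u' x y v'] g e by auto
  ultimately show ?thesis using generic_swap g(1) e unfolding compat_below_def by blast
qed

lemma compat_below_mono: "compat_below N w \<Longrightarrow> N \<le> M \<Longrightarrow> compat_below M w"
  unfolding compat_below_def by (meson less_le_trans)

text \<open>A cap sums over the opposite letters \<open>c, - c\<close> at two neighbouring positions. If these two positions are
matched, the pair can be removed, and otherwise their chords can be joined, which does not create
crossings.\<close>

lemma compat_cap:
  assumes "generic g" "compat (u @ c # - c # v) g"
  shows "\<exists>g'. generic g' \<and> cr g' \<le> cr g \<and> compat (u @ v) g'"
proof -
  obtain h u' x y v' where e: "g = u' @ x # y # v'" "u = map h u'" "v = map h v'" "c = h x" "- c = h y"
    "\<And>x. h (- x) = - h x" "length u = length u'" "length v = length v'"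
    using assms(2) by (rule compat_split2E) blast
  show ?thesis
  proof (cases "y = - x")
    case True
    then have "generic (u' @ v')" "cr (u' @ v') \<le> cr g"
      using assms(1) e(1) generic_remove cr_insert by auto
    moreover have "compat (u @ v) (u' @ v')" unfolding compat_def using e by auto
    ultimately show ?thesis by blast
  next
    case False
    have "h (ren x y t) = h t" for t using e(4,5,6) by (auto simp: ren_def)
    then have "compat (u @ v) (map (ren x y) (u' @ v'))"
      unfolding compat_def using e by (intro exI[of _ h]) auto
    then show ?thesis
      using generic_join(1)[OF _ False] cr_join_le[OF _ False] assms(1) e(1) by blast
  qed
qed

lemma fresh_letter: obtains k :: int where "k \<noteq> 0" "k \<notin> set g" "- k \<notin> set g"
proof -
  have "finite (insert 0 (set g \<union> uminus ` set g))" by simp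
  then obtain k where "k \<notin> insert 0 (set g \<union> uminus ` set g)" using ex_new_if_finite infinite_UNIV_int by blast
  then show ?thesis using that[of k] by (auto simp: image_iff) (metis minus_minus that)
qed

lemma compat_cup:
  assumes "generic g" "compat (u @ v) g"
  shows "\<exists>g'. generic g' \<and> cr g' = cr g \<and> compat (u @ a # - a # v) g'"
proof -
  from assms(2) obtain h where h: "\<forall>x. h (- x) = - h x" "u @ v = map h g" unfolding compat_def by auto
  from h(2) obtain u' v' where 1: "g = u' @ v'" "u = map h u'" "v = map h v'"
    by (metis append_eq_map_conv)
  obtain k where k: "k \<noteq> 0" "k \<notin> set g" "- k \<notin> set g" by (rule fresh_letter)
  let ?h = "\<lambda>t. if t = k then a else if t = - k then - a else h t"
  have "generic (u' @ k # - k # v')" using assms(1) 1 k by (auto intro!: generic_insert)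
  moreover have "compat (u @ a # - a # v) (u' @ k # - k # v')"
    unfolding compat_def using h 1 k by (intro exI[of _ ?h]) (auto simp: minus_equation_iff)
  ultimately show ?thesis using cr_insert 1 by blast
qed

lemma compat_cup_fresh:
  assumes "compat (u @ v) (u' @ v')" "length u = length u'" "k \<noteq> 0" "k \<notin> set (u' @ v')" "- k \<notin> set (u' @ v')"
  shows "compat (u @ a # - a # v) (u' @ k # - k # v')"
proof -
  from assms(1) obtain h where h: "\<forall>x. h (- x) = - h x" "u @ v = map h (u' @ v')" unfolding compat_def by auto
  let ?h = "\<lambda>t. if t = k then a else if t = - k then - a else h t"
  have "u = map h u'" "v = map h v'" using h(2) assms(2) by auto
  then show ?thesis
    unfolding compat_def using h assms by (intro exI[of _ ?h]) (auto simp: minus_equation_iff)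
qed

lemma compat_below_cap: "compat_below N (u @ c # - c # v) \<Longrightarrow> compat_below N (u @ v)"
  unfolding compat_below_def using compat_cap by (meson le_less_trans)

lemma compat_below_cup: "compat_below N (u @ v) \<Longrightarrow> compat_below N (u @ a # - a # v)"
  unfolding compat_below_def using compat_cup by metis

lemma compat_join:
  assumes "compat (u @ c # - c # v) (u' @ x # y # v')" "length u = length u'" "x \<noteq> 0"
  shows "compat (u @ v) (map (ren x y) (u' @ v'))"
proof -
  from assms(1) obtain h where h: "\<forall>x. h (- x) = - h x" "u @ c # - c # v = map h (u' @ x # y # v')" unfolding compat_def by auto
  then have e: "u = map h u'" "v = map h v'" "c = h x" "- c = h y" using assms(2) by auto
  have "h (ren x y t) = h t" for t using e h(1) by (auto simp: ren_def)
  then show ?thesis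
    unfolding compat_def using e h(1) by (intro exI[of _ h]) auto
qed

section \<open>Leading terms of the action of a diagram\<close>
definition is_crossing :: "piece \<Rightarrow> bool" where "is_crossing p \<longleftrightarrow> p = CrossX \<or> p = CrossY"

text \<open>The effect of a layer on a matching. A cap at two letters matched with each other is excluded, since it
would close a loop.\<close>

inductive word_step :: "nat \<Rightarrow> piece \<Rightarrow> int list \<Rightarrow> int list \<Rightarrow> bool" where
  ws_strands: "word_step a (Strands k) g g"
| ws_cross: "is_crossing p \<Longrightarrow> length u = a \<Longrightarrow> word_step a p (u @ x # y # v) (u @ y # x # v)"
| ws_cup: "length u = a \<Longrightarrow> k \<noteq> 0 \<Longrightarrow> k \<notin> set (u @ v) \<Longrightarrow> - k \<notin> set (u @ v) \<Longrightarrow>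
    word_step a Cup (u @ v) (u @ k # - k # v)"
| ws_cap: "length u = a \<Longrightarrow> y \<noteq> - x \<Longrightarrow> word_step a Cap (u @ x # y # v) (map (ren x y) (u @ v))"

context rmatrix_words
begin

text \<open>Up to error terms, the function \<open>F\<close> is supported on the words which respect \<open>g\<close>, and has the values \<open>\<plusminus>1\<close>
there. The bound \<open>N\<close> counts the crossings met so far, which may exceed the number of crossings of
the matching itself.\<close>

definition leading :: "(int list \<Rightarrow> 'k) \<Rightarrow> int list \<Rightarrow> nat \<Rightarrow> bool" where
  "leading F g N \<longleftrightarrow> generic g \<and> cr g \<le> N \<and>
     (\<forall>w\<in>words n (length g). F w \<noteq> 0 \<longrightarrow> compat w g \<or> compat_below N w) \<and>
     (\<forall>w\<in>words n (length g). compat w g \<longrightarrow> \<not> compat_below N w \<longrightarrow> F w = 1 \<or> F w = - 1)"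

lemma xop_nonzero:
  assumes "xop G x y \<noteq> 0" "x \<noteq> 0" "y \<noteq> 0"
  shows "G y x \<noteq> 0 \<or> G x y \<noteq> 0 \<or> (y = - x \<and> (\<exists>c. c \<noteq> 0 \<and> \<bar>c\<bar> < \<bar>x\<bar> \<and> G c (- c) \<noteq> 0))"
proof (rule ccontr)
  assume n: "\<not> ?thesis"
  have "xop G x y = 0"
  proof (cases "y = - x")
    case True
    then have "low x G = 0" using n by (intro low_zero) blast
    moreover have "G x (- x) = 0" "G (- x) x = 0" using n True by blast+
    ultimately show ?thesis using True assms(2) by (simp add: xop_opp)
  next
    case False
    then show ?thesis
    proof (cases "x = y")
      case True then show ?thesis using n assms by (simp add: xop_eq)
    next
      case False
      then have "\<bar>x\<bar> \<noteq> \<bar>y\<bar>" using \<open>y \<noteq> - x\<close> by arith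
      then show ?thesis using n by (simp add: xop_def)
    qed
  qed
  then show False using assms by simp
qed

lemma words_snocE:
  assumes "w \<in> words n (length (u' @ x # y # v'))"
  obtains u a b v where "w = u @ a # b # v" "length u = length u'" "length v = length v'"
    "a \<in> letters n" "b \<in> letters n" "u \<in> words n (length u')" "v \<in> words n (length v')"
proof -
  have "w \<in> words n (length u' + 2 + length v')" using assms by simp
  then obtain u s v where w: "w = u @ s @ v" "u \<in> words n (length u')" "s \<in> words n 2" "v \<in> words n (length v')"
    by (rule words_split3E)
  from w(3) obtain a b where "s = [a, b]" "a \<in> letters n" "b \<in> letters n" by (rule words_2E)
  then show ?thesis using that[of u a b v] w words_lengthD[OF w(2)] words_lengthD[OF w(4)] by simp
qed

lemma words_pairI: "u \<in> words n a \<Longrightarrow> v \<in> words n b \<Longrightarrow> x \<in> letters n \<Longrightarrow> y \<in> letters n \<Longrightarrow>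
    k = a + 2 + b \<Longrightarrow> u @ x # y # v \<in> words n k"
  by (auto simp: words_def)

text \<open>A value of the crossing comes from the exchanged letters, from the same letters or from
smaller opposite pairs. In the last two cases the crossing has been resolved, and the matching
behind the value has fewer crossings than the bound.\<close>

lemma leading_cross:
  assumes L: "leading F (u' @ x # y # v') N" and p: "is_crossing p"
  shows "leading (act (Piece p) (length u') F) (u' @ y # x # v') (Suc N)"
proof -
  let ?g = "u' @ x # y # v'"
  have g: "generic ?g" "cr ?g \<le> N"
    and nz: "\<And>w. w \<in> words n (length ?g) \<Longrightarrow> F w \<noteq> 0 \<Longrightarrow> compat w ?g \<or> compat_below N w"
    and one: "\<And>w. w \<in> words n (length ?g) \<Longrightarrow> compat w ?g \<Longrightarrow> \<not> compat_below N w \<Longrightarrow> F w = 1 \<or> F w = - 1"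
    using L unfolding leading_def by blast+
  have below: "compat_below (Suc N) w" if "compat w ?g \<or> compat_below N w" for w
    using that g compat_below_mono[of N w "Suc N"] unfolding compat_below_def by (meson le_imp_less_Suc le_SucI order_refl)
  obtain e where e: "act (Piece p) (length u') F (u @ a # b # v) =
       xop (\<lambda>c d. F (u @ c # d # v)) a b + e * F (u @ a # b # v)"
    if "length u = length u'" "a \<in> letters n" "b \<in> letters n" for u a b v
  proof (cases "p = CrossX")
    case True
    show ?thesis by (rule that[of 0]) (simp add: True X_at del: act.simps)
  next
    case False
    then have "p = CrossY" using p by (simp add: is_crossing_def)
    then show ?thesis by (intro that[of "- z"]) (simp add: Y_at algebra_simps del: act.simps)
  qed
  have turn: "compat_below (Suc N) (u @ a # - a # v)"
    if "length u = length u'" "u \<in> words n (length u')" "v \<in> words n (length v')" "c \<in> letters n"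
      "F (u @ c # - c # v) \<noteq> 0" for u v c a
  proof -
    have "u @ c # - c # v \<in> words n (length ?g)" by (rule words_pairI[OF that(2,3)]) (use that in auto)
    then have "compat_below (Suc N) (u @ c # - c # v)" using nz[OF _ that(5)] below by blast
    then show ?thesis using compat_below_cap compat_below_cup by blast
  qed
  show ?thesis
    unfolding leading_def
  proof (intro conjI ballI impI)
    show "generic (u' @ y # x # v')" using g(1) by (rule generic_swap)
    show "cr (u' @ y # x # v') \<le> Suc N" using cr_swap_le[OF g(1)] g(2) by simp
    fix w assume "w \<in> words n (length (u' @ y # x # v'))"
    then obtain u a b v where w: "w = u @ a # b # v" "length u = length u'" "length v = length v'"
      "a \<in> letters n" "b \<in> letters n" and uv: "u \<in> words n (length u')" "v \<in> words n (length v')"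
      by (rule words_snocE)
    have W: "u @ c # d # v \<in> words n (length ?g)" if "c \<in> letters n" "d \<in> letters n" for c d
      by (rule words_pairI[OF uv that]) simp
    have swapped: "compat w (u' @ y # x # v') \<or> compat_below (Suc N) w" if "F (u @ b # a # v) \<noteq> 0"
      using nz[OF W that] w compat_swap[of u b a v u' x y v'] compat_below_swap[of N u b a v] by auto
    show "compat w (u' @ y # x # v') \<or> compat_below (Suc N) w" if n0: "act (Piece p) (length u') F w \<noteq> 0"
    proof -
      have "xop (\<lambda>c d. F (u @ c # d # v)) a b \<noteq> 0 \<or> F (u @ a # b # v) \<noteq> 0"
        using n0 e[of u a b v] w by auto
      then consider "F (u @ b # a # v) \<noteq> 0" | "F (u @ a # b # v) \<noteq> 0"
        | c where "b = - a" "c \<noteq> 0" "\<bar>c\<bar> < \<bar>a\<bar>" "F (u @ c # - c # v) \<noteq> 0"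
        using xop_nonzero[OF _ letters_nz[OF w(4)] letters_nz[OF w(5)]] by blast
      then show ?thesis
      proof cases
        case 1 then show ?thesis by (rule swapped)
      next
        case 2 then show ?thesis using nz[OF W[OF w(4,5)]] below w(1) by blast
      next
        case 3
        then have "c \<in> letters n" using letters_lower[OF w(4), of c] by simp
        then show ?thesis using turn[OF w(2) uv, of c a] 3 w(1) by blast
      qed
    qed
    assume c: "compat w (u' @ y # x # v')" and nb: "\<not> compat_below (Suc N) w"
    have c': "compat (u @ b # a # v) ?g" using compat_swap[of u a b v u' y x v'] c w by auto
    have ab: "a \<noteq> b" using below[of w] c' nb w by auto
    have ab': "b \<noteq> - a"
    proof
      assume ba: "b = - a"
      have "compat_below (Suc N) (u @ b # a # v)" using below c' by blast
      then have "compat_below (Suc N) (u @ b # - b # v)" using ba by simp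
      then have "compat_below (Suc N) (u @ a # - a # v)" using compat_below_cap compat_below_cup by blast
      then show False using nb w(1) ba by simp
    qed
    have z0: "F (u @ a # b # v) = 0" using nz[OF W[OF w(4,5)]] below nb w(1) by blast
    have "\<not> compat_below N (u @ b # a # v)" using compat_below_swap nb w(1) by blast
    then have "F (u @ b # a # v) = 1 \<or> F (u @ b # a # v) = - 1" using one[OF W[OF w(5,4)] c'] by blast
    moreover have "\<bar>a\<bar> \<noteq> \<bar>b\<bar>" using ab ab' by arith
    moreover have "act (Piece p) (length u') F w = xop (\<lambda>c d. F (u @ c # d # v)) a b"
      using e[OF w(2,4,5), of v] z0 w(1) by simp
    ultimately show "act (Piece p) (length u') F w = 1 \<or> act (Piece p) (length u') F w = - 1"
      using z0 by (auto simp: xop_def sg_def simp del: act.simps)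
  qed
qed

lemma leading_cup:
  assumes L: "leading F (u' @ v') N" and k: "k \<noteq> 0" "k \<notin> set (u' @ v')" "- k \<notin> set (u' @ v')"
  shows "leading (act cup (length u') F) (u' @ k # - k # v') N"
proof -
  let ?g = "u' @ v'"
  have g: "generic ?g" "cr ?g \<le> N"
    and nz: "\<And>w. w \<in> words n (length ?g) \<Longrightarrow> F w \<noteq> 0 \<Longrightarrow> compat w ?g \<or> compat_below N w"
    and one: "\<And>w. w \<in> words n (length ?g) \<Longrightarrow> compat w ?g \<Longrightarrow> \<not> compat_below N w \<Longrightarrow> F w = 1 \<or> F w = - 1"
    using L unfolding leading_def by blast+
  have g': "generic (u' @ k # - k # v')" by (rule generic_insert) (use g k in auto)
  show ?thesis
    unfolding leading_def
  proof (intro conjI ballI impI)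
    show "generic (u' @ k # - k # v')" by (rule g')
    show "cr (u' @ k # - k # v') \<le> N" using cr_insert[OF g'] g(2) by simp
    fix w assume "w \<in> words n (length (u' @ k # - k # v'))"
    then obtain u a b v where w: "w = u @ a # b # v" "length u = length u'" "length v = length v'"
      "a \<in> letters n" "b \<in> letters n" and uv: "u \<in> words n (length u')" "v \<in> words n (length v')"
      by (rule words_snocE)
    have W: "u @ v \<in> words n (length ?g)" using words_appendI[OF uv] by simp
    have act: "act cup (length u') F w = sg (negs u) * (if b = - a then F (u @ v) else 0)"
      unfolding w(1) by (rule cup_at) (use w in simp)
    show "compat w (u' @ k # - k # v') \<or> compat_below N w" if n0: "act cup (length u') F w \<noteq> 0"
    proof -
      have b: "b = - a" "F (u @ v) \<noteq> 0" using n0 act by (auto split: if_splits)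
      then show ?thesis
        using nz[OF W] compat_cup_fresh[of u v u' v' k a] compat_below_cup[of N u v a] k w by auto
    qed
    assume c: "compat w (u' @ k # - k # v')" and nb: "\<not> compat_below N w"
    from c obtain h where h: "\<forall>x. h (- x) = - h x" "u @ a # b # v = map h (u' @ k # - k # v')"
      unfolding compat_def w(1) by auto
    then have h': "u = map h u'" "a = h k" "b = - a" "v = map h v'" using w(2) by auto
    then have "compat (u @ v) ?g" unfolding compat_def using h by auto
    moreover have "\<not> compat_below N (u @ v)" using compat_below_cup nb w(1) h'(3) by blast
    ultimately have "F (u @ v) = 1 \<or> F (u @ v) = - 1" using one[OF W] by blast
    then show "act cup (length u') F w = 1 \<or> act cup (length u') F w = - 1"
      unfolding act using h' by (auto simp: sg_def)
  qed
qed

text \<open>Among the letters \<open>c\<close> which the cap sums over, only the one that continues the letter at the other end of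
the joined strand gives a word without error terms.\<close>

lemma leading_cap:
  assumes L: "leading F (u' @ x # y # v') N" and xy: "y \<noteq> - x"
  shows "leading (act cap (length u') F) (map (ren x y) (u' @ v')) N"
proof -
  let ?g = "u' @ x # y # v'" and ?g' = "map (ren x y) (u' @ v')"
  have g: "generic ?g" "cr ?g \<le> N"
    and nz: "\<And>w. w \<in> words n (length ?g) \<Longrightarrow> F w \<noteq> 0 \<Longrightarrow> compat w ?g \<or> compat_below N w"
    and one: "\<And>w. w \<in> words n (length ?g) \<Longrightarrow> compat w ?g \<Longrightarrow> \<not> compat_below N w \<Longrightarrow> F w = 1 \<or> F w = - 1"
    using L unfolding leading_def by blast+
  have x0: "x \<noteq> 0" "y \<noteq> 0" "x \<noteq> y" using g(1) by (auto simp: generic_def)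
  show ?thesis
    unfolding leading_def
  proof (intro conjI ballI impI)
    show "generic ?g'" by (rule generic_join(1)[OF g(1) xy])
    show "cr ?g' \<le> N" using cr_join_le[OF g(1) xy] g(2) by simp
    fix w assume "w \<in> words n (length ?g')"
    then have "w \<in> words n (length u' + length v')" by simp
    then obtain u v where w: "w = u @ v" and uv: "u \<in> words n (length u')" "v \<in> words n (length v')"
      by (rule words_splitE)
    have len: "length u = length u'" "length v = length v'" using uv by (simp_all add: words_lengthD)
    have act: "act cap (length u') F w = sg (negs u) * (\<Sum>c\<in>letters n. sg (c < 0) * F (u @ c # - c # v))"
      unfolding w by (rule cap_at) (use len in simp)
    have W: "u @ c # - c # v \<in> words n (length ?g)" if "c \<in> letters n" for c
      by (rule words_pairI[OF uv]) (use that in auto)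
    show "compat w ?g' \<or> compat_below N w" if n0: "act cap (length u') F w \<noteq> 0"
    proof -
      obtain c where c: "c \<in> letters n" "F (u @ c # - c # v) \<noteq> 0"
        using n0 act by (metis (no_types, lifting) mult_zero_right sum.neutral)
      then show ?thesis
        using nz[OF W[OF c(1)]] compat_join[of u c v u' x y v'] compat_below_cap[of N u c v] w len x0 by auto
    qed
    assume c: "compat w ?g'" and nb: "\<not> compat_below N w"
    have nb': "\<not> compat_below N (u @ c # - c # v)" for c using compat_below_cap nb w by blast
    from c obtain h where h: "\<And>x. h (- x) = - h x" "u @ v = map h ?g'"
      unfolding compat_def w by auto
    let ?c0 = "h (ren x y x)"
    have mx: "- x \<in> set (u' @ v')"
    proof -
      have "- x \<in> set ?g" using generic_uminus[OF g(1), of x] by simp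
      moreover have "- x \<noteq> x" "- x \<noteq> y" using x0 xy by auto
      ultimately show ?thesis by simp
    qed
    have uniq: "c = ?c0" if cc: "compat (u @ c # - c # v) ?g" for c
    proof -
      from cc obtain h' where h': "\<And>x. h' (- x) = - h' x" "u @ c # - c # v = map h' ?g"
        unfolding compat_def by auto
      then have e: "u @ v = map h' (u' @ v')" "c = h' x" using len by auto
      then have "map h' (u' @ v') = map (h \<circ> ren x y) (u' @ v')" using h(2) by simp
      then have "\<forall>t\<in>set (u' @ v'). h' t = (h \<circ> ren x y) t" by (simp only: map_eq_conv)
      then have "h' (- x) = h (ren x y (- x))" using mx by (simp only: comp_apply)
      also have "\<dots> = - h (ren x y x)" by (simp only: ren_uminus[OF x0(1)] h(1))
      finally show ?thesis using e(2) h'(1)[of x] by simp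
    qed
    have c0: "compat (u @ ?c0 # - ?c0 # v) ?g"
    proof -
      have "h (ren x y y) = - ?c0" using h(1)[of y] x0 xy by (auto simp: ren_def)
      moreover have "u = map (h \<circ> ren x y) u'" "v = map (h \<circ> ren x y) v'"
        using h(2) len by auto
      ultimately show ?thesis
        unfolding compat_def using h(1) ren_uminus[OF x0(1), of y]
        by (intro exI[of _ "h \<circ> ren x y"]) auto
    qed
    have c0l: "?c0 \<in> letters n"
    proof -
      have "h (ren x y (- x)) \<in> set (u @ v)" unfolding h(2) using mx by auto
      then have "- ?c0 \<in> set (u @ v)" using h(1) ren_uminus[OF x0(1), of y x] by simp
      moreover have "set (u @ v) \<subseteq> letters n" using uv by (auto simp: words_def)
      ultimately show ?thesis using letters_uminus by blast
    qed
    have "(\<Sum>c\<in>letters n. sg (c < 0) * F (u @ c # - c # v)) =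
        (\<Sum>c\<in>letters n. if c = ?c0 then sg (?c0 < 0) * F (u @ ?c0 # - ?c0 # v) else 0)"
    proof (rule sum.cong[OF HOL.refl])
      fix c assume c: "c \<in> letters n"
      have "F (u @ c # - c # v) = 0" if "c \<noteq> ?c0"
        using nz[OF W[OF c]] nb' uniq that by blast
      then show "sg (c < 0) * F (u @ c # - c # v) =
          (if c = ?c0 then sg (?c0 < 0) * F (u @ ?c0 # - ?c0 # v) else 0)" by auto
    qed
    then have "act cap (length u') F w = sg (negs u) * (sg (?c0 < 0) * F (u @ ?c0 # - ?c0 # v))"
      unfolding act using c0l by simp
    moreover have "F (u @ ?c0 # - ?c0 # v) = 1 \<or> F (u @ ?c0 # - ?c0 # v) = - 1"
      using one[OF W[OF c0l] c0 nb'] .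
    ultimately show "act cap (length u') F w = 1 \<or> act cap (length u') F w = - 1"
      by (auto simp: sg_def)
  qed
qed

lemma leading_cong: "leading F g N \<Longrightarrow> (\<And>w. w \<in> words n (length g) \<Longrightarrow> F w = G w) \<Longrightarrow> leading G g N"
  unfolding leading_def by (metis (no_types, lifting))

lemma leading_step:
  assumes "word_step a p g g'" "leading F g N" "a + piece_src p \<le> length g"
  shows "leading (act (Piece p) a F) g' (if is_crossing p then Suc N else N)"
  using assms
proof (induction rule: word_step.induct)
  case (ws_strands a k g)
  have "act (ident k) a F w = F w" if "w \<in> words n (length g)" for w
    by (rule ident_at[where b = "length g - (a + k)"]) (use that ws_strands in simp)
  then show ?case using ws_strands leading_cong[of F g N] by (auto simp: is_crossing_def simp del: act.simps)
next
  case (ws_cross p u a x y v)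
  then show ?case using leading_cross[of F u x y v N p] by simp
next
  case (ws_cup u a k v)
  then show ?case using leading_cup[of F u v N k] by (simp add: is_crossing_def del: act.simps)
next
  case (ws_cap u a y x v)
  then show ?case using leading_cap[of F u x y v N] by (simp add: is_crossing_def del: act.simps)
qed

end

section \<open>Runs through the layers of a diagram\<close>
definition arcs_of :: "layer list \<Rightarrow> arc set" where
  "arcs_of Ls = {(l, place l ` A) | l A. l < length Ls \<and> A \<in> layer_arcs (Ls ! l)}"

definition linked :: "layer list \<Rightarrow> point \<Rightarrow> point \<Rightarrow> bool" where
  "linked Ls p p' \<longleftrightarrow> (\<exists>l. (l, {p, p'}) \<in> arcs_of Ls)"

lemma joined_linked: "joined d = linked (layers d)"
  by (auto simp: joined_def linked_def arcs_def arcs_of_def fun_eq_iff)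

text \<open>The two ends of an arc, in a fixed order, as a case distinction instead of images of sets.\<close>

fun arc_pair :: "layer \<Rightarrow> endpoint \<Rightarrow> endpoint \<Rightarrow> bool" where
  "arc_pair (a, p, b) e e' \<longleftrightarrow>
     (\<exists>i\<in>{1..a}. e = Bot i \<and> e' = Top i) \<or>
     (\<exists>i\<in>{1..b}. e = Bot (a + piece_src p + i) \<and> e' = Top (a + piece_tgt p + i)) \<or>
     (case p of
        Strands k \<Rightarrow> (\<exists>i\<in>{1..k}. e = Bot (a + i) \<and> e' = Top (a + i))
      | Cup \<Rightarrow> e = Top (a + 1) \<and> e' = Top (a + 2)
      | Cap \<Rightarrow> e = Bot (a + 1) \<and> e' = Bot (a + 2)
      | _ \<Rightarrow> (e = Bot (a + 1) \<and> e' = Top (a + 2)) \<or> (e = Bot (a + 2) \<and> e' = Top (a + 1)))"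

lemma shift_image: "shift k l ` {e, e'} = {shift k l e, shift k l e'}" by simp

lemma mem_layer_arcs: "A \<in> layer_arcs L \<longleftrightarrow> (\<exists>e e'. arc_pair L e e' \<and> A = {e, e'})"
proof -
  obtain a p b where L: "L = (a, p, b)" by (cases L)
  have 1: "A \<in> piece_arcs (Strands a) \<longleftrightarrow> (\<exists>i\<in>{1..a}. A = {Bot i, Top i})" by auto
  have S: "piece_arcs (Strands k) = (\<lambda>i. {Bot i, Top i}) ` {1..k}" for k by auto
  have 2: "A \<in> image (shift (a + piece_src p) (a + piece_tgt p)) ` piece_arcs (Strands b) \<longleftrightarrow>
      (\<exists>i\<in>{1..b}. A = {Bot (a + piece_src p + i), Top (a + piece_tgt p + i)})"
    unfolding S image_image shift_image shift.simps by blast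
  have 3: "A \<in> image (shift a a) ` piece_arcs p \<longleftrightarrow> (case p of
        Strands k \<Rightarrow> (\<exists>i\<in>{1..k}. A = {Bot (a + i), Top (a + i)})
      | Cup \<Rightarrow> A = {Top (a + 1), Top (a + 2)}
      | Cap \<Rightarrow> A = {Bot (a + 1), Bot (a + 2)}
      | _ \<Rightarrow> A = {Bot (a + 1), Top (a + 2)} \<or> A = {Bot (a + 2), Top (a + 1)})"
  proof (cases p)
    case (Strands k)
    show ?thesis unfolding Strands S image_image shift_image shift.simps piece.case by blast
  qed auto
  have "A \<in> layer_arcs L \<longleftrightarrow> A \<in> piece_arcs (Strands a) \<or>
      A \<in> image (shift (a + piece_src p) (a + piece_tgt p)) ` piece_arcs (Strands b) \<or>
      A \<in> image (shift a a) ` piece_arcs p"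
    unfolding L layer_arcs.simps by (simp only: Un_iff) blast
  also have "\<dots> \<longleftrightarrow> (\<exists>e e'. arc_pair L e e' \<and> A = {e, e'})"
    unfolding 1 2 3 L arc_pair.simps by (cases p; simp) blast+
  finally show ?thesis .
qed

lemma linked_snoc:
  "linked (Ls @ [L]) p p' \<longleftrightarrow> linked Ls p p' \<or>
     (\<exists>e e'. arc_pair L e e' \<and> {p, p'} = {place (length Ls) e, place (length Ls) e'})"
proof -
  have U: "arcs_of Ks = (\<Union>l<length Ks. (\<lambda>A. (l, place l ` A)) ` layer_arcs (Ks ! l))" for Ks
    unfolding arcs_of_def by blast
  have "arcs_of (Ls @ [L]) = arcs_of Ls \<union> (\<lambda>A. (length Ls, place (length Ls) ` A)) ` layer_arcs L"
    unfolding U by (simp add: lessThan_Suc nth_append Un_commute)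
  then have "linked (Ls @ [L]) p p' \<longleftrightarrow> linked Ls p p' \<or> (\<exists>A. A \<in> layer_arcs L \<and> {p, p'} = place (length Ls) ` A)"
    unfolding linked_def by auto
  also have "(\<exists>A. A \<in> layer_arcs L \<and> {p, p'} = place (length Ls) ` A) \<longleftrightarrow>
      (\<exists>e e'. arc_pair L e e' \<and> {p, p'} = {place (length Ls) e, place (length Ls) e'})"
  proof -
    have "(\<exists>A. A \<in> layer_arcs L \<and> {p, p'} = place (length Ls) ` A) \<longleftrightarrow>
        (\<exists>e e'. arc_pair L e e' \<and> {p, p'} = place (length Ls) ` {e, e'})"
      unfolding mem_layer_arcs by blast
    then show ?thesis by simp
  qed
  finally show ?thesis .
qed

lemma linked_sym: "linked Ls p p' \<Longrightarrow> linked Ls p' p"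
  by (simp add: linked_def insert_commute)

lemma linked_rtrancl_sym: "(linked Ls)\<^sup>*\<^sup>* p p' \<Longrightarrow> (linked Ls)\<^sup>*\<^sup>* p' p"
  by (induction rule: rtranclp_induct) (auto intro: converse_rtranclp_into_rtranclp linked_sym)

text \<open>The number of points on the line below layer \<open>j\<close>, i.e. the target of the first \<open>j\<close> layers.\<close>

definition width :: "nat \<Rightarrow> layer list \<Rightarrow> nat \<Rightarrow> nat" where
  "width m Ls j = (if j = 0 then m else case Ls ! (j - 1) of (a, p, b) \<Rightarrow> a + piece_tgt p + b)"

definition fitting :: "nat \<Rightarrow> layer list \<Rightarrow> bool" where
  "fitting m Ls \<longleftrightarrow> (\<forall>j<length Ls. case Ls ! j of (a, p, b) \<Rightarrow> a + piece_src p + b = width m Ls j)"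

lemma width_snoc [simp]:
  "width m (Ls @ [(a, p, b)]) (Suc (length Ls)) = a + piece_tgt p + b"
  "j \<le> length Ls \<Longrightarrow> width m (Ls @ Ks) j = width m Ls j"
  by (auto simp: width_def nth_append)

lemma fitting_snoc: "fitting m (Ls @ [(a, p, b)]) \<longleftrightarrow> fitting m Ls \<and> a + piece_src p + b = width m Ls (length Ls)"
  unfolding fitting_def by (auto simp: nth_append less_Suc_eq)

definition grid :: "nat \<Rightarrow> layer list \<Rightarrow> point set" where
  "grid m Ls = {(j, i). j \<le> length Ls \<and> 1 \<le> i \<and> i \<le> width m Ls j}"

lemma grid_snoc: "grid m (Ls @ [(a, p, b)]) =
    grid m Ls \<union> Pair (Suc (length Ls)) ` {1..a + piece_tgt p + b}"
  unfolding grid_def by (auto simp: le_Suc_eq)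

text \<open>The second half stands for the bottom ends of the \<open>m\<close> strands, from right to left; the layers only act on
the first half. The final word thus lists all endpoints on the boundary of the diagram, from the top
left corner to the bottom left corner.\<close>

definition start_word :: "nat \<Rightarrow> int list" where
  "start_word m = map (\<lambda>i. int (Suc i)) [0..<m] @ map (\<lambda>i. - int (Suc i)) (rev [0..<m])"

lemma start_word_Suc: "start_word (Suc m) = map (\<lambda>i. int (Suc i)) [0..<m] @
    int (Suc m) # - int (Suc m) # map (\<lambda>i. - int (Suc i)) (rev [0..<m])"
  by (simp add: start_word_def)

lemma length_start_word [simp]: "length (start_word m) = m + m" by (simp add: start_word_def)

lemma start_word_generic: "generic (start_word m) \<and> cr (start_word m) = 0"
proof (induction m)
  case 0 then show ?case by (simp add: start_word_def generic_def cr_def crossing_pairs_def)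
next
  case (Suc m)
  have "generic (start_word (Suc m))"
    unfolding start_word_Suc by (rule generic_insert) (use Suc in \<open>auto simp: start_word_def\<close>)
  then show ?case using Suc cr_insert[of "map (\<lambda>i. int (Suc i)) [0..<m]" "int (Suc m)"]
    unfolding start_word_Suc by (simp add: start_word_def)
qed

inductive run :: "nat \<Rightarrow> layer list \<Rightarrow> int list \<Rightarrow> bool" for m where
  run_nil: "run m [] (start_word m)"
| run_snoc: "run m Ls g \<Longrightarrow> word_step a p g g' \<Longrightarrow> run m (Ls @ [(a, p, b)]) g'"

definition crossing_levels :: "layer list \<Rightarrow> nat set" where
  "crossing_levels Ls = {l. l < length Ls \<and> is_crossing (fst (snd (Ls ! l)))}"

definition crossing_labels :: "layer list \<Rightarrow> (point \<Rightarrow> int) \<Rightarrow> nat \<Rightarrow> int set" where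
  "crossing_labels Ls lab l = {\<bar>lab (l, fst (Ls ! l) + 1)\<bar>, \<bar>lab (l, fst (Ls ! l) + 2)\<bar>}"

text \<open>The points of a diagram are labelled with letters of the current word \<open>g\<close> such that the absolute value
of the label determines the strand. The last condition counts the crossings of two strands modulo 2.\<close>

definition labelling :: "nat \<Rightarrow> layer list \<Rightarrow> int list \<Rightarrow> (point \<Rightarrow> int) \<Rightarrow> bool" where
  "labelling m Ls g lab \<longleftrightarrow> generic g \<and> length g = width m Ls (length Ls) + m \<and>
     (\<forall>i\<in>{1..width m Ls (length Ls)}. lab (length Ls, i) = g ! (i - 1)) \<and>
     (\<forall>i\<in>{1..m}. lab (0, i) = - (g ! (width m Ls (length Ls) + m - i))) \<and>
     (\<forall>p p'. linked Ls p p' \<longrightarrow> \<bar>lab p\<bar> = \<bar>lab p'\<bar>) \<and>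
     (\<forall>p\<in>grid m Ls. \<forall>p'\<in>grid m Ls. \<bar>lab p\<bar> = \<bar>lab p'\<bar> \<longrightarrow> (linked Ls)\<^sup>*\<^sup>* p p') \<and>
     (\<forall>p\<in>grid m Ls. lab p \<in> set g) \<and>
     (\<forall>x\<in>set g. \<forall>y\<in>set g. \<bar>x\<bar> \<noteq> \<bar>y\<bar> \<longrightarrow>
        odd (card {l \<in> crossing_levels Ls. crossing_labels Ls lab l = {\<bar>x\<bar>, \<bar>y\<bar>}}) = cross g x y)"

lemma labelling_nil: "labelling m [] (start_word m) (\<lambda>(j, i). int i)"
  unfolding labelling_def
proof (intro conjI ballI allI impI)
  show "generic (start_word m)" using start_word_generic by simp
  show "length (start_word m) = width m [] (length []) + m" by (simp add: width_def)
  show "(\<lambda>(j, i). int i) (length [], i) = start_word m ! (i - 1)"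
    if "i \<in> {1..width m [] (length [])}" for i
    using that by (auto simp: width_def start_word_def nth_append)
  show "(\<lambda>(j, i). int i) (0, i) = - (start_word m ! (width m [] (length []) + m - i))" if "i \<in> {1..m}" for i
    using that by (auto simp: width_def start_word_def nth_append rev_nth)
  show "\<bar>(\<lambda>(j, i). int i) p\<bar> = \<bar>(\<lambda>(j, i). int i) p'\<bar>" if "linked [] p p'" for p p'
    using that by (simp add: linked_def arcs_of_def)
  show "(linked [])\<^sup>*\<^sup>* p p'" if "p \<in> grid m []" "p' \<in> grid m []" "\<bar>(\<lambda>(j, i). int i) p\<bar> = \<bar>(\<lambda>(j, i). int i) p'\<bar>" for p p'
    using that by (auto simp: grid_def)
  show "(\<lambda>(j, i). int i) p \<in> set (start_word m)" if gp: "p \<in> grid m []" for p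
  proof -
    obtain i where i: "p = (0, i)" "1 \<le> i" "i \<le> m" using gp by (cases p) (auto simp: grid_def width_def)
    then have "int i \<in> (\<lambda>i. int (Suc i)) ` {0..<m}" by (intro image_eqI[of _ _ "i - 1"]) auto
    then show ?thesis using i by (auto simp: start_word_def)
  qed
  fix x y assume xy: "x \<in> set (start_word m)" "y \<in> set (start_word m)" "\<bar>x\<bar> \<noteq> \<bar>y\<bar>"
  have "crossing_pairs (start_word m) = {}" using start_word_generic[of m] by (simp add: cr_def)
  then have "\<not> cross (start_word m) x y" using xy unfolding crossing_pairs_def by blast
  then show "odd (card {l \<in> crossing_levels []. crossing_labels [] (\<lambda>(j, i). int i) l = {\<bar>x\<bar>, \<bar>y\<bar>}}) = cross (start_word m) x y"
    by (simp add: crossing_levels_def)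
qed

lemma crossing_levels_snoc: "crossing_levels (Ls @ [(a, p, b)]) =
    crossing_levels Ls \<union> (if is_crossing p then {length Ls} else {})"
  by (auto simp: crossing_levels_def nth_append less_Suc_eq)

lemma finite_crossing_levels [simp]: "finite (crossing_levels Ls)" by (simp add: crossing_levels_def)

text \<open>A further layer may rename letters, by \<open>r\<close>. The points above it are labelled with the new word.\<close>

definition extend :: "layer list \<Rightarrow> int list \<Rightarrow> (int \<Rightarrow> int) \<Rightarrow> (point \<Rightarrow> int) \<Rightarrow> point \<Rightarrow> int" where
  "extend Ls g' r lab = (\<lambda>(j, i). if j \<le> length Ls then r (lab (j, i)) else g' ! (i - 1))"

lemma extend_simps [simp]:
  "j \<le> length Ls \<Longrightarrow> extend Ls g' r lab (j, i) = r (lab (j, i))"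
  "extend Ls g' r lab (Suc (length Ls), i) = g' ! (i - 1)"
  by (auto simp: extend_def)

lemma linked_levels: "linked Ls (j, i) (j', i') \<Longrightarrow> j \<le> length Ls \<and> j' \<le> length Ls"
proof -
  assume "linked Ls (j, i) (j', i')"
  then obtain l A where l: "l < length Ls" "{(j, i), (j', i')} = place l ` A"
    unfolding linked_def arcs_of_def by auto
  have pl: "fst (place l e) \<le> length Ls" for e using l(1) by (cases e) auto
  have "(j, i) \<in> place l ` A" "(j', i') \<in> place l ` A" using l(2) by (metis insertI1 insertI2)+
  then show ?thesis using pl by (metis fst_conv imageE)
qed

lemma crossing_labels_snoc: "l < length Ls \<Longrightarrow>
    crossing_labels (Ls @ [L]) (extend Ls g' r lab) l = {\<bar>r (lab (l, fst (Ls ! l) + 1))\<bar>, \<bar>r (lab (l, fst (Ls ! l) + 2))\<bar>}"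
  by (simp add: crossing_labels_def nth_append)

text \<open>What the pieces have in common: the strands on both sides of the piece continue their labels.
The remaining premises describe the piece itself.\<close>

lemma labelling_extend:
  assumes L: "labelling m Ls g lab" and fit: "fitting m (Ls @ [(a, p, b)])"
    and g': "generic g'" "length g' = a + piece_tgt p + b + m"
    and frozen: "\<And>i. i < b + m \<Longrightarrow> g' ! (a + piece_tgt p + i) = r (g ! (a + piece_src p + i))"
    and left: "\<And>i. i < a \<Longrightarrow> g' ! i = r (g ! i)"
    and r: "\<And>t. r (- t) = - r t" "\<And>t. t \<in> set g \<Longrightarrow> r t \<in> set g'"
    and mid: "\<And>e e'. (case p of
        Strands k \<Rightarrow> (\<exists>i\<in>{1..k}. e = Bot (a + i) \<and> e' = Top (a + i))
      | Cup \<Rightarrow> e = Top (a + 1) \<and> e' = Top (a + 2)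
      | Cap \<Rightarrow> e = Bot (a + 1) \<and> e' = Bot (a + 2)
      | _ \<Rightarrow> (e = Bot (a + 1) \<and> e' = Top (a + 2)) \<or> (e = Bot (a + 2) \<and> e' = Top (a + 1))) \<Longrightarrow>
        \<bar>extend Ls g' r lab (place (length Ls) e)\<bar> = \<bar>extend Ls g' r lab (place (length Ls) e')\<bar>"
    and old: "\<And>u v. u \<in> grid m Ls \<Longrightarrow> v \<in> grid m Ls \<Longrightarrow> \<bar>r (lab u)\<bar> = \<bar>r (lab v)\<bar> \<Longrightarrow>
        (linked (Ls @ [(a, p, b)]))\<^sup>*\<^sup>* u v"
    and cupnew: "p = Cup \<Longrightarrow> \<bar>g' ! a\<bar> = \<bar>g' ! (a + 1)\<bar> \<and> (\<forall>t\<in>set g. \<bar>r t\<bar> \<noteq> \<bar>g' ! a\<bar>)"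
    and par: "\<And>x y. x \<in> set g' \<Longrightarrow> y \<in> set g' \<Longrightarrow> \<bar>x\<bar> \<noteq> \<bar>y\<bar> \<Longrightarrow>
        odd (card {l \<in> crossing_levels (Ls @ [(a, p, b)]).
          crossing_labels (Ls @ [(a, p, b)]) (extend Ls g' r lab) l = {\<bar>x\<bar>, \<bar>y\<bar>}}) = cross g' x y"
  shows "labelling m (Ls @ [(a, p, b)]) g' (extend Ls g' r lab)"
proof -
  let ?Ls = "Ls @ [(a, p, b)]" and ?lab = "extend Ls g' r lab" and ?n = "length Ls"
  have w: "a + piece_src p + b = width m Ls ?n" using fit by (simp add: fitting_snoc)
  have Ltop: "\<And>i. i \<in> {1..width m Ls ?n} \<Longrightarrow> lab (?n, i) = g ! (i - 1)"
    and Lbot: "\<And>i. i \<in> {1..m} \<Longrightarrow> lab (0, i) = - (g ! (width m Ls ?n + m - i))"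
    and Llink: "\<And>u v. linked Ls u v \<Longrightarrow> \<bar>lab u\<bar> = \<bar>lab v\<bar>"
    and Lset: "\<And>u. u \<in> grid m Ls \<Longrightarrow> lab u \<in> set g"
    and Llen: "length g = width m Ls ?n + m"
    using L unfolding labelling_def by blast+
  have rabs: "\<bar>r s\<bar> = \<bar>r t\<bar>" if "\<bar>s\<bar> = \<bar>t\<bar>" for s t
  proof -
    have "s = t \<or> s = - t" using that by arith
    then show ?thesis using r(1) by auto
  qed
  have pair: "\<bar>?lab (place ?n e)\<bar> = \<bar>?lab (place ?n e')\<bar>" if "arc_pair (a, p, b) e e'" for e e'
  proof -
    from that consider i where "i \<in> {1..a}" "e = Bot i" "e' = Top i"
      | i where "i \<in> {1..b}" "e = Bot (a + piece_src p + i)" "e' = Top (a + piece_tgt p + i)"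
      | "case p of
        Strands k \<Rightarrow> (\<exists>i\<in>{1..k}. e = Bot (a + i) \<and> e' = Top (a + i))
      | Cup \<Rightarrow> e = Top (a + 1) \<and> e' = Top (a + 2)
      | Cap \<Rightarrow> e = Bot (a + 1) \<and> e' = Bot (a + 2)
      | _ \<Rightarrow> (e = Bot (a + 1) \<and> e' = Top (a + 2)) \<or> (e = Bot (a + 2) \<and> e' = Top (a + 1))"
      unfolding arc_pair.simps by blast
    then show ?thesis
    proof cases
      case 1
      then show ?thesis using Ltop[of i] left[of "i - 1"] w by auto
    next
      case 2
      then have "lab (?n, a + piece_src p + i) = g ! (a + piece_src p + (i - 1))"
        using Ltop[of "a + piece_src p + i"] w by auto
      moreover have "g' ! (a + piece_tgt p + i - 1) = r (g ! (a + piece_src p + (i - 1)))"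
        using frozen[of "i - 1"] 2 by auto
      ultimately show ?thesis using 2 by simp
    next
      case 3 then show ?thesis by (rule mid)
    qed
  qed
  have link: "\<bar>?lab u\<bar> = \<bar>?lab v\<bar>" if "linked ?Ls u v" for u v
  proof -
    from that consider "linked Ls u v" | e e' where "arc_pair (a, p, b) e e'" "{u, v} = {place ?n e, place ?n e'}"
      unfolding linked_snoc by blast
    then show ?thesis
    proof cases
      case 1
      then show ?thesis using linked_levels[of Ls "fst u" "snd u" "fst v" "snd v"] rabs[OF Llink[OF 1]]
        by (cases u; cases v) simp
    next
      case 2
      then show ?thesis using pair[OF 2(1)] by (auto simp: doubleton_eq_iff)
    qed
  qed
  have conn1: "(linked ?Ls)\<^sup>*\<^sup>* (place ?n e) (place ?n e')" if "arc_pair (a, p, b) e e'" for e e'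
    by (rule r_into_rtranclp) (use that linked_snoc in blast)
  text \<open>every new point hangs on an old one, unless it belongs to a cup\<close>
  have hang: "\<exists>u\<in>grid m Ls. linked ?Ls (Suc ?n, i) u" 
    if i: "i \<in> {1..a + piece_tgt p + b}" "\<not> (p = Cup \<and> (i = a + 1 \<or> i = a + 2))" for i
  proof -
    have "\<exists>j. 1 \<le> j \<and> j \<le> a + piece_src p + b \<and> arc_pair (a, p, b) (Bot j) (Top i)"
    proof -
      consider "i \<le> a" | "a < i" "i \<le> a + piece_tgt p" | "a + piece_tgt p < i" by linarith
      then show ?thesis
      proof cases
        case 1 then show ?thesis using i by (intro exI[of _ i]) auto
      next
        case 3
        then obtain k where "i = a + piece_tgt p + k" "1 \<le> k" using less_imp_add_positive by (metis Suc_leI One_nat_def)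
        then show ?thesis using i by (intro exI[of _ "a + piece_src p + k"]) auto
      next
        case 2
        show ?thesis
        proof (cases p)
          case (Strands k)
          then show ?thesis using 2 by (intro exI[of _ i]) (auto intro!: bexI[of _ "i - a"])
        next
          case CrossX
          then have "i = a + 1 \<or> i = a + 2" using 2 by auto
          then show ?thesis
          proof
            assume "i = a + 1" then show ?thesis using CrossX by (intro exI[of _ "a + 2"]) auto
          next
            assume "i = a + 2" then show ?thesis using CrossX by (intro exI[of _ "a + 1"]) auto
          qed
        next
          case CrossY
          then have "i = a + 1 \<or> i = a + 2" using 2 by auto
          then show ?thesis
          proof
            assume "i = a + 1" then show ?thesis using CrossY by (intro exI[of _ "a + 2"]) auto
          next
            assume "i = a + 2" then show ?thesis using CrossY by (intro exI[of _ "a + 1"]) auto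
          qed
        next
          case Cup then show ?thesis using 2 i by auto
        next
          case Cap then show ?thesis using 2 by auto
        qed
      qed
    qed
    then obtain j where j: "1 \<le> j" "j \<le> a + piece_src p + b" "arc_pair (a, p, b) (Bot j) (Top i)" by blast
    then have "linked ?Ls (Suc ?n, i) (?n, j)"
      unfolding linked_snoc by (intro disjI2 exI[of _ "Bot j"] exI[of _ "Top i"]) auto
    moreover have "(?n, j) \<in> grid m Ls" using j w by (auto simp: grid_def)
    ultimately show ?thesis by blast
  qed
  have newset: "?lab (Suc ?n, i) \<in> set g'" if "i \<in> {1..a + piece_tgt p + b}" for i
    using that g'(2) by auto
  have set: "?lab u \<in> set g'" if "u \<in> grid m ?Ls" for u
  proof -
    from that consider "u \<in> grid m Ls" | i where "u = (Suc ?n, i)" "i \<in> {1..a + piece_tgt p + b}"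
      unfolding grid_snoc by blast
    then show ?thesis
    proof cases
      case 1
      then show ?thesis using r(2)[OF Lset[OF 1]] by (cases u) (simp add: grid_def)
    next
      case 2 then show ?thesis using newset by blast
    qed
  qed
  have oldold: "(linked ?Ls)\<^sup>*\<^sup>* u v" if "u \<in> grid m Ls" "v \<in> grid m Ls" "\<bar>?lab u\<bar> = \<bar>?lab v\<bar>" for u v
    using that by (intro old) (cases u; cases v; simp add: grid_def)+
  have anchor: "(\<exists>u'\<in>grid m Ls. linked ?Ls u u' \<or> u = u') \<or>
      (p = Cup \<and> (u = (Suc ?n, a + 1) \<or> u = (Suc ?n, a + 2)))" if u: "u \<in> grid m ?Ls" for u
    using u hang unfolding grid_snoc by blast
  have conn: "(linked ?Ls)\<^sup>*\<^sup>* u v" if uv: "u \<in> grid m ?Ls" "v \<in> grid m ?Ls" "\<bar>?lab u\<bar> = \<bar>?lab v\<bar>" for u v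
  proof -
    have cupl: "\<bar>?lab t\<bar> = \<bar>g' ! a\<bar>" if "p = Cup" "t = (Suc ?n, a + 1) \<or> t = (Suc ?n, a + 2)" for t
      using cupnew that by auto
    have oldl: "\<bar>?lab t\<bar> \<noteq> \<bar>g' ! a\<bar>" if "p = Cup" "t' \<in> grid m Ls" "linked ?Ls t t' \<or> t = t'" for t t'
    proof -
      have "\<bar>?lab t\<bar> = \<bar>?lab t'\<bar>" using that(3) link by blast
      moreover have "?lab t' = r (lab t')" using that(2) by (cases t') (simp add: grid_def)
      ultimately show ?thesis using cupnew[OF that(1)] Lset[OF that(2)] by auto
    qed
    consider (uold) u' where "u' \<in> grid m Ls" "linked ?Ls u u' \<or> u = u'"
      | (ucup) "p = Cup" "u = (Suc ?n, a + 1) \<or> u = (Suc ?n, a + 2)"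
      using anchor[OF uv(1)] by blast
    note ucases = this
    consider (vold) v' where "v' \<in> grid m Ls" "linked ?Ls v v' \<or> v = v'"
      | (vcup) "p = Cup" "v = (Suc ?n, a + 1) \<or> v = (Suc ?n, a + 2)"
      using anchor[OF uv(2)] by blast
    note vcases = this
    show ?thesis
    proof (cases rule: ucases)
      case u': uold
      have uu: "(linked ?Ls)\<^sup>*\<^sup>* u u'" using u'(2) by auto
      show ?thesis
      proof (cases rule: vcases)
        case v': vold
        have vv: "(linked ?Ls)\<^sup>*\<^sup>* v' v" using v'(2) linked_sym by blast
        have "\<bar>?lab u\<bar> = \<bar>?lab u'\<bar>" "\<bar>?lab v\<bar> = \<bar>?lab v'\<bar>" using link u'(2) v'(2) by blast+
        then have "\<bar>?lab u'\<bar> = \<bar>?lab v'\<bar>" using uv(3) by simp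
        then have "(linked ?Ls)\<^sup>*\<^sup>* u' v'" using oldold u'(1) v'(1) by blast
        then show ?thesis using uu vv by (meson rtranclp_trans)
      next
        case vcup
        then show ?thesis using oldl[OF vcup(1) u'] cupl[OF vcup] uv(3) by simp
      qed
    next
      case ucup
      show ?thesis
      proof (cases rule: vcases)
        case v': vold
        then show ?thesis using oldl[OF ucup(1) v'] cupl[OF ucup] uv(3) by simp
      next
        case vcup
        have "linked ?Ls (Suc ?n, a + 1) (Suc ?n, a + 2)"
          unfolding linked_snoc using ucup(1) by (intro disjI2 exI[of _ "Top (a + 1)"] exI[of _ "Top (a + 2)"]) auto
        then have "linked ?Ls u v \<or> u = v" using ucup vcup linked_sym by blast
        then show ?thesis by auto
      qed
    qed
  qed
  show ?thesis
    unfolding labelling_def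
  proof (intro conjI ballI allI impI)
    show "generic g'" by (rule g')
    show "length g' = width m ?Ls (length ?Ls) + m" using g'(2) by simp
    show "?lab (length ?Ls, i) = g' ! (i - 1)" for i by simp
    show "?lab (0, i) = - (g' ! (width m ?Ls (length ?Ls) + m - i))" if i: "i \<in> {1..m}" for i
    proof -
      have "width m Ls ?n + m - i = a + piece_src p + (b + m - i)" using w i by auto
      moreover have "width m ?Ls (length ?Ls) + m - i = a + piece_tgt p + (b + m - i)" using i by auto
      moreover have "g' ! (a + piece_tgt p + (b + m - i)) = r (g ! (a + piece_src p + (b + m - i)))"
        by (rule frozen) (use i in auto)
      ultimately show ?thesis using Lbot[OF i] r(1) by simp
    qed
    show "\<bar>?lab u\<bar> = \<bar>?lab v\<bar>" if "linked ?Ls u v" for u v using that by (rule link)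
    show "(linked ?Ls)\<^sup>*\<^sup>* u v" if "u \<in> grid m ?Ls" "v \<in> grid m ?Ls" "\<bar>?lab u\<bar> = \<bar>?lab v\<bar>" for u v
      using that by (rule conn)
    show "?lab u \<in> set g'" if "u \<in> grid m ?Ls" for u using that by (rule set)
    show "odd (card {l \<in> crossing_levels ?Ls. crossing_labels ?Ls ?lab l = {\<bar>x\<bar>, \<bar>y\<bar>}}) = cross g' x y"
      if "x \<in> set g'" "y \<in> set g'" "\<bar>x\<bar> \<noteq> \<bar>y\<bar>" for x y using that by (rule par)
  qed
qed

section \<open>Labelling the points of a diagram along a run\<close>
lemma linked_mono: "(linked Ls)\<^sup>*\<^sup>* u v \<Longrightarrow> (linked (Ls @ [L]))\<^sup>*\<^sup>* u v"
proof -
  have "linked Ls \<le> linked (Ls @ [L])" using linked_snoc by blast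
  then show "(linked Ls)\<^sup>*\<^sup>* u v \<Longrightarrow> (linked (Ls @ [L]))\<^sup>*\<^sup>* u v"
    using rtranclp_mono by blast
qed

lemma labellingD:
  assumes "labelling m Ls g lab"
  shows "generic g" "length g = width m Ls (length Ls) + m"
    "\<And>i. 1 \<le> i \<Longrightarrow> i \<le> width m Ls (length Ls) \<Longrightarrow> lab (length Ls, i) = g ! (i - 1)"
    "\<And>i. 1 \<le> i \<Longrightarrow> i \<le> m \<Longrightarrow> lab (0, i) = - (g ! (width m Ls (length Ls) + m - i))"
    "\<And>p p'. linked Ls p p' \<Longrightarrow> \<bar>lab p\<bar> = \<bar>lab p'\<bar>"
    "\<And>p p'. p \<in> grid m Ls \<Longrightarrow> p' \<in> grid m Ls \<Longrightarrow> \<bar>lab p\<bar> = \<bar>lab p'\<bar> \<Longrightarrow> (linked Ls)\<^sup>*\<^sup>* p p'"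
    "\<And>p. p \<in> grid m Ls \<Longrightarrow> lab p \<in> set g"
    "\<And>x y. x \<in> set g \<Longrightarrow> y \<in> set g \<Longrightarrow> \<bar>x\<bar> \<noteq> \<bar>y\<bar> \<Longrightarrow>
        odd (card {l \<in> crossing_levels Ls. crossing_labels Ls lab l = {\<bar>x\<bar>, \<bar>y\<bar>}}) = cross g x y"
  using assms unfolding labelling_def by auto

lemma crossing_level_less: "l \<in> crossing_levels Ls \<Longrightarrow> l < length Ls"
  by (simp add: crossing_levels_def)

lemma crossing_points_in_grid:
  assumes "fitting m Ls" "l \<in> crossing_levels Ls"
  shows "(l, fst (Ls ! l) + 1) \<in> grid m Ls" "(l, fst (Ls ! l) + 2) \<in> grid m Ls"
proof -
  obtain a p b where L: "Ls ! l = (a, p, b)" by (cases "Ls ! l")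
  have "l < length Ls" "is_crossing p" using assms(2) L by (auto simp: crossing_levels_def)
  moreover have "a + 2 + b = width m Ls l"
  proof -
    have "a + piece_src p + b = width m Ls l"
      using assms(1) \<open>l < length Ls\<close> L unfolding fitting_def by fastforce
    moreover have "piece_src p = 2" using \<open>is_crossing p\<close> by (auto simp: is_crossing_def)
    ultimately show ?thesis by simp
  qed
  ultimately show "(l, fst (Ls ! l) + 1) \<in> grid m Ls" "(l, fst (Ls ! l) + 2) \<in> grid m Ls"
    using L by (auto simp: grid_def)
qed

lemma labelling_strands:
  assumes L: "labelling m Ls g lab" and fit: "fitting m (Ls @ [(a, Strands k, b)])"
  shows "labelling m (Ls @ [(a, Strands k, b)]) g (extend Ls g id lab)"
proof -
  note LD = labellingD[OF L]
  have w: "a + k + b = width m Ls (length Ls)" using fit by (simp add: fitting_snoc)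
  show ?thesis
  proof (rule labelling_extend[OF L fit LD(1)])
    show "length g = a + piece_tgt (Strands k) + b + m" using LD(2) w by simp
    show "\<bar>extend Ls g id lab (place (length Ls) e)\<bar> = \<bar>extend Ls g id lab (place (length Ls) e')\<bar>"
      if e: "case Strands k of
        Strands k \<Rightarrow> (\<exists>i\<in>{1..k}. e = Bot (a + i) \<and> e' = Top (a + i))
      | Cup \<Rightarrow> e = Top (a + 1) \<and> e' = Top (a + 2)
      | Cap \<Rightarrow> e = Bot (a + 1) \<and> e' = Bot (a + 2)
      | _ \<Rightarrow> (e = Bot (a + 1) \<and> e' = Top (a + 2)) \<or> (e = Bot (a + 2) \<and> e' = Top (a + 1))" for e e'
    proof -
      obtain i where "i \<in> {1..k}" "e = Bot (a + i)" "e' = Top (a + i)" using e by auto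
      then show ?thesis using LD(3)[of "a + i"] w by simp
    qed
    show "(linked (Ls @ [(a, Strands k, b)]))\<^sup>*\<^sup>* u v"
      if "u \<in> grid m Ls" "v \<in> grid m Ls" "\<bar>id (lab u)\<bar> = \<bar>id (lab v)\<bar>" for u v
      by (rule linked_mono, rule LD(6)) (use that in auto)
    show "odd (card {l \<in> crossing_levels (Ls @ [(a, Strands k, b)]).
        crossing_labels (Ls @ [(a, Strands k, b)]) (extend Ls g id lab) l = {\<bar>x\<bar>, \<bar>y\<bar>}}) = cross g x y"
      if "x \<in> set g" "y \<in> set g" "\<bar>x\<bar> \<noteq> \<bar>y\<bar>" for x y
    proof -
      have "{l \<in> crossing_levels (Ls @ [(a, Strands k, b)]).
          crossing_labels (Ls @ [(a, Strands k, b)]) (extend Ls g id lab) l = {\<bar>x\<bar>, \<bar>y\<bar>}} =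
        {l \<in> crossing_levels Ls. crossing_labels Ls lab l = {\<bar>x\<bar>, \<bar>y\<bar>}}"
      proof -
        have "crossing_labels (Ls @ [(a, Strands k, b)]) (extend Ls g id lab) l = crossing_labels Ls lab l"
          if "l \<in> crossing_levels Ls" for l
          using crossing_labels_snoc[OF crossing_level_less[OF that]] by (simp add: crossing_labels_def[of Ls])
        then show ?thesis unfolding crossing_levels_snoc by (auto simp: is_crossing_def)
      qed
      then show ?thesis using LD(8)[OF that] by simp
    qed
  qed auto
qed

lemma labelling_cross:
  assumes L: "labelling m Ls (u @ x # y # v) lab" and fit: "fitting m (Ls @ [(a, p, b)])"
    and p: "is_crossing p" and a: "length u = a"
  shows "labelling m (Ls @ [(a, p, b)]) (u @ y # x # v) (extend Ls (u @ y # x # v) id lab)"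
proof -
  let ?g = "u @ x # y # v" and ?g' = "u @ y # x # v" and ?Ls = "Ls @ [(a, p, b)]" and ?n = "length Ls"
  note LD = labellingD[OF L]
  have st: "piece_src p = 2" "piece_tgt p = 2" using p by (auto simp: is_crossing_def)
  have w: "a + 2 + b = width m Ls ?n" using fit st by (simp add: fitting_snoc)
  have g': "generic ?g'" using LD(1) by (rule generic_swap)
  have lx: "lab (?n, a + 1) = x" "lab (?n, a + 2) = y"
    using LD(3)[of "a + 1"] LD(3)[of "a + 2"] w a by (auto simp: nth_append)
  show ?thesis
  proof (rule labelling_extend[OF L fit g'])
    show "length ?g' = a + piece_tgt p + b + m" using LD(2) w st by simp
    show "?g' ! (a + piece_tgt p + i) = id (?g ! (a + piece_src p + i))" for i
      using a st by (simp add: nth_append)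
    show "?g' ! i = id (?g ! i)" if "i < a" for i using that a by (simp add: nth_append)
    show "\<bar>extend Ls ?g' id lab (place ?n e)\<bar> = \<bar>extend Ls ?g' id lab (place ?n e')\<bar>"
      if e: "case p of
        Strands k \<Rightarrow> (\<exists>i\<in>{1..k}. e = Bot (a + i) \<and> e' = Top (a + i))
      | Cup \<Rightarrow> e = Top (a + 1) \<and> e' = Top (a + 2)
      | Cap \<Rightarrow> e = Bot (a + 1) \<and> e' = Bot (a + 2)
      | _ \<Rightarrow> (e = Bot (a + 1) \<and> e' = Top (a + 2)) \<or> (e = Bot (a + 2) \<and> e' = Top (a + 1))" for e e'
    proof -
      have "(e = Bot (a + 1) \<and> e' = Top (a + 2)) \<or> (e = Bot (a + 2) \<and> e' = Top (a + 1))"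
        using e p by (auto simp: is_crossing_def)
      then show ?thesis using lx a by (auto simp: nth_append)
    qed
    show "(linked ?Ls)\<^sup>*\<^sup>* s t"
      if "s \<in> grid m Ls" "t \<in> grid m Ls" "\<bar>id (lab s)\<bar> = \<bar>id (lab t)\<bar>" for s t
      by (rule linked_mono, rule LD(6)) (use that in auto)
    show "odd (card {l \<in> crossing_levels ?Ls. crossing_labels ?Ls (extend Ls ?g' id lab) l = {\<bar>s\<bar>, \<bar>t\<bar>}}) = cross ?g' s t"
      if st': "s \<in> set ?g'" "t \<in> set ?g'" "\<bar>s\<bar> \<noteq> \<bar>t\<bar>" for s t
    proof -
      let ?C = "{l \<in> crossing_levels Ls. crossing_labels Ls lab l = {\<bar>s\<bar>, \<bar>t\<bar>}}"
      have new: "crossing_labels ?Ls (extend Ls ?g' id lab) ?n = {\<bar>x\<bar>, \<bar>y\<bar>}"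
        unfolding crossing_labels_def using lx by simp
      have C: "{l \<in> crossing_levels ?Ls. crossing_labels ?Ls (extend Ls ?g' id lab) l = {\<bar>s\<bar>, \<bar>t\<bar>}} =
          ?C \<union> (if {\<bar>s\<bar>, \<bar>t\<bar>} = {\<bar>x\<bar>, \<bar>y\<bar>} then {?n} else {})"
      proof -
        have "crossing_labels ?Ls (extend Ls ?g' id lab) l = crossing_labels Ls lab l" if "l \<in> crossing_levels Ls" for l
          using crossing_labels_snoc[OF crossing_level_less[OF that]] by (simp add: crossing_labels_def[of Ls])
        then show ?thesis unfolding crossing_levels_snoc using p new by auto
      qed
      have nC: "?n \<notin> ?C" by (auto dest: crossing_level_less)
      have old: "odd (card ?C) = cross ?g s t" by (rule LD(8)) (use st' in auto)
      show ?thesis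
      proof (cases "\<bar>x\<bar> = \<bar>y\<bar>")
        case True
        then have "y = - x" using LD(1) by (auto simp: generic_def abs_eq_iff)
        then have "cross ?g' s t = cross ?g s t" using cross_swap_same[of u x v s t] LD(1) st' by simp
        moreover have "{\<bar>s\<bar>, \<bar>t\<bar>} \<noteq> {\<bar>x\<bar>, \<bar>y\<bar>}" using True st'(3) by (auto simp: doubleton_eq_iff)
        ultimately show ?thesis unfolding C using old by simp
      next
        case False
        show ?thesis
        proof (cases "{\<bar>s\<bar>, \<bar>t\<bar>} = {\<bar>x\<bar>, \<bar>y\<bar>}")
          case True
          have "card (?C \<union> {?n}) = Suc (card ?C)" using nC by simp
          then show ?thesis
            unfolding C cross_swap[OF LD(1) False] using old True by simp
        next
          case f: False
          then show ?thesis
            unfolding C cross_swap[OF LD(1) False] using old by simp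
        qed
      qed
    qed
  qed (use p in \<open>auto simp: is_crossing_def\<close>)
qed

lemma labelling_cup:
  assumes L: "labelling m Ls (u @ v) lab" and fit: "fitting m (Ls @ [(a, Cup, b)])"
    and a: "length u = a" and k: "k \<noteq> 0" "k \<notin> set (u @ v)" "- k \<notin> set (u @ v)"
  shows "labelling m (Ls @ [(a, Cup, b)]) (u @ k # - k # v) (extend Ls (u @ k # - k # v) id lab)"
proof -
  let ?g = "u @ v" and ?g' = "u @ k # - k # v" and ?Ls = "Ls @ [(a, Cup, b)]" and ?n = "length Ls"
  note LD = labellingD[OF L]
  have w: "a + b = width m Ls ?n" using fit by (simp add: fitting_snoc)
  have g': "generic ?g'" by (rule generic_insert) (use LD(1) k in auto)
  have kt: "\<bar>t\<bar> \<noteq> \<bar>k\<bar>" if "t \<in> set ?g" for t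
    using that k by (auto simp: abs_eq_iff)
  show ?thesis
  proof (rule labelling_extend[OF L fit g'])
    show "length ?g' = a + piece_tgt Cup + b + m" using LD(2) w by simp
    show "?g' ! (a + piece_tgt Cup + i) = id (?g ! (a + piece_src Cup + i))" for i
      using a by (simp add: nth_append)
    show "?g' ! i = id (?g ! i)" if "i < a" for i using that a by (simp add: nth_append)
    show "\<bar>extend Ls ?g' id lab (place ?n e)\<bar> = \<bar>extend Ls ?g' id lab (place ?n e')\<bar>"
      if e: "case Cup of
        Strands k \<Rightarrow> (\<exists>i\<in>{1..k}. e = Bot (a + i) \<and> e' = Top (a + i))
      | Cup \<Rightarrow> e = Top (a + 1) \<and> e' = Top (a + 2)
      | Cap \<Rightarrow> e = Bot (a + 1) \<and> e' = Bot (a + 2)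
      | _ \<Rightarrow> (e = Bot (a + 1) \<and> e' = Top (a + 2)) \<or> (e = Bot (a + 2) \<and> e' = Top (a + 1))" for e e'
      using e a by (simp add: nth_append)
    show "(linked ?Ls)\<^sup>*\<^sup>* s t"
      if "s \<in> grid m Ls" "t \<in> grid m Ls" "\<bar>id (lab s)\<bar> = \<bar>id (lab t)\<bar>" for s t
      by (rule linked_mono, rule LD(6)) (use that in auto)
    show "\<bar>?g' ! a\<bar> = \<bar>?g' ! (a + 1)\<bar> \<and> (\<forall>t\<in>set ?g. \<bar>id t\<bar> \<noteq> \<bar>?g' ! a\<bar>)"
      using kt a by (simp add: nth_append)
    show "odd (card {l \<in> crossing_levels ?Ls. crossing_labels ?Ls (extend Ls ?g' id lab) l = {\<bar>s\<bar>, \<bar>t\<bar>}}) = cross ?g' s t"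
      if st': "s \<in> set ?g'" "t \<in> set ?g'" "\<bar>s\<bar> \<noteq> \<bar>t\<bar>" for s t
    proof -
      let ?C = "{l \<in> crossing_levels Ls. crossing_labels Ls lab l = {\<bar>s\<bar>, \<bar>t\<bar>}}"
      have C: "{l \<in> crossing_levels ?Ls. crossing_labels ?Ls (extend Ls ?g' id lab) l = {\<bar>s\<bar>, \<bar>t\<bar>}} = ?C"
      proof -
        have "crossing_labels ?Ls (extend Ls ?g' id lab) l = crossing_labels Ls lab l" if "l \<in> crossing_levels Ls" for l
          using crossing_labels_snoc[OF crossing_level_less[OF that]] by (simp add: crossing_labels_def[of Ls])
        then show ?thesis unfolding crossing_levels_snoc by (auto simp: is_crossing_def)
      qed
      show ?thesis
      proof (cases "\<bar>s\<bar> = \<bar>k\<bar> \<or> \<bar>t\<bar> = \<bar>k\<bar>")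
        case True
        have "?C = {}"
        proof -
          have "\<bar>k\<bar> \<notin> crossing_labels Ls lab l" if "l \<in> crossing_levels Ls" for l
          proof -
            have "fitting m Ls" using fit by (simp add: fitting_snoc)
            then show ?thesis
              using LD(7)[OF crossing_points_in_grid(1)[OF _ that]] LD(7)[OF crossing_points_in_grid(2)[OF _ that]] kt
              unfolding crossing_labels_def by fastforce
          qed
          moreover have "\<bar>k\<bar> \<in> {\<bar>s\<bar>, \<bar>t\<bar>}" using True by auto
          ultimately show ?thesis by blast
        qed
        moreover have "\<not> cross ?g' s t"
          using True st'(3) cross_insert_self(1)[OF k(2,3), of t] cross_insert_self(2)[OF k(2,3), of s]
            cross_abs[of s k t t] cross_abs[of s s t k] by auto
        ultimately show ?thesis unfolding C by (simp only: card.empty) simp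
      next
        case False
        then have "s \<in> set ?g" "t \<in> set ?g" using st' by auto
        then show ?thesis
          unfolding C using LD(8)[of s t] st'(3) cross_insert[OF k(2,3), of s t] False by simp
      qed
    qed
  qed auto
qed

lemma ren_abs: "\<bar>ren x y t\<bar> = (if \<bar>t\<bar> = \<bar>x\<bar> then \<bar>y\<bar> else \<bar>t\<bar>)"
  by (auto simp: ren_def abs_eq_iff)

lemma image_merge:
  assumes "c \<noteq> d" "e \<noteq> c" "e \<noteq> d"
  shows "(\<lambda>t. if t = c then d else t) ` {p, r} = {d, e} \<longleftrightarrow> {p, r} = {c, e} \<or> {p, r} = {d, e}"
    "f \<noteq> c \<Longrightarrow> f \<noteq> d \<Longrightarrow> (\<lambda>t. if t = c then d else t) ` {p, r} = {f, e} \<longleftrightarrow> {p, r} = {f, e}"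
  using assms by (cases "p = c"; cases "r = c"; auto simp: doubleton_eq_iff)+

text \<open>The cap joins two strands. The crossings of either with a third strand add up modulo 2, as they
do in \<open>cross_join\<close>.\<close>

lemma labelling_cap:
  assumes L: "labelling m Ls (u @ x # y # v) lab" and fit: "fitting m (Ls @ [(a, Cap, b)])"
    and a: "length u = a" and xy: "y \<noteq> - x"
  shows "labelling m (Ls @ [(a, Cap, b)]) (map (ren x y) (u @ v)) (extend Ls (map (ren x y) (u @ v)) (ren x y) lab)"
proof -
  let ?g = "u @ x # y # v" and ?g' = "map (ren x y) (u @ v)" and ?Ls = "Ls @ [(a, Cap, b)]" and ?n = "length Ls"
  note LD = labellingD[OF L]
  have w: "a + 2 + b = width m Ls ?n" using fit by (simp add: fitting_snoc)
  have x0: "x \<noteq> 0" "y \<noteq> 0" "x \<noteq> y" "\<bar>x\<bar> \<noteq> \<bar>y\<bar>" using LD(1) xy by (auto simp: generic_def abs_eq_iff)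
  have g': "generic ?g'" by (rule generic_join(1)[OF LD(1) xy])
  have lx: "lab (?n, a + 1) = x" "lab (?n, a + 2) = y"
    using LD(3)[of "a + 1"] LD(3)[of "a + 2"] w a by (auto simp: nth_append)
  have fit': "fitting m Ls" using fit by (simp add: fitting_snoc)
  have gr: "(?n, a + 1) \<in> grid m Ls" "(?n, a + 2) \<in> grid m Ls" using w by (auto simp: grid_def)
  have capl: "linked ?Ls (?n, a + 1) (?n, a + 2)"
    unfolding linked_snoc by (intro disjI2 exI[of _ "Bot (a + 1)"] exI[of _ "Bot (a + 2)"]) auto
  have mem': "s \<in> set (u @ v) \<and> \<bar>s\<bar> \<noteq> \<bar>x\<bar>" if S: "s \<in> set ?g'" "\<bar>s\<bar> \<noteq> \<bar>y\<bar>" for s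
  proof -
    obtain s0 where s0: "s0 \<in> set (u @ v)" "s = ren x y s0" using S(1) unfolding set_map by blast
    have "\<bar>s0\<bar> \<noteq> \<bar>x\<bar>" using s0(2) S(2) ren_abs[of x y s0] by auto
    then show ?thesis using s0 by (auto simp: ren_def)
  qed
  show ?thesis
  proof (rule labelling_extend[OF L fit g'])
    show "length ?g' = a + piece_tgt Cap + b + m" using LD(2) w by simp
    show "?g' ! (a + piece_tgt Cap + i) = ren x y (?g ! (a + piece_src Cap + i))" if "i < b + m" for i
      using a that LD(2) w by (simp add: nth_append)
    show "?g' ! i = ren x y (?g ! i)" if "i < a" for i using that a by (simp add: nth_append)
    show "ren x y (- t) = - ren x y t" for t by (rule ren_uminus[OF x0(1)])
    show "ren x y t \<in> set ?g'" if t: "t \<in> set ?g" for t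
    proof -
      have m: "- x \<in> set (u @ v)" "- y \<in> set (u @ v)"
      proof -
        have "- x \<in> set ?g" "- y \<in> set ?g"
          using generic_uminus[OF LD(1), of x] generic_uminus[OF LD(1), of y] by simp_all
        moreover have "- x \<noteq> x" "- y \<noteq> y" "- x \<noteq> y" "- y \<noteq> x" using x0 xy by auto
        ultimately show "- x \<in> set (u @ v)" "- y \<in> set (u @ v)" by simp_all
      qed
      have "ren x y x = ren x y (- y)" "ren x y y = ren x y (- x)" using x0 xy by (auto simp: ren_def)
      then show ?thesis using t m unfolding set_map by (metis Un_iff image_eqI list.set_intros set_ConsD set_append)
    qed
    show "\<bar>extend Ls ?g' (ren x y) lab (place ?n e)\<bar> = \<bar>extend Ls ?g' (ren x y) lab (place ?n e')\<bar>"
      if e: "case Cap of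
        Strands k \<Rightarrow> (\<exists>i\<in>{1..k}. e = Bot (a + i) \<and> e' = Top (a + i))
      | Cup \<Rightarrow> e = Top (a + 1) \<and> e' = Top (a + 2)
      | Cap \<Rightarrow> e = Bot (a + 1) \<and> e' = Bot (a + 2)
      | _ \<Rightarrow> (e = Bot (a + 1) \<and> e' = Top (a + 2)) \<or> (e = Bot (a + 2) \<and> e' = Top (a + 1))" for e e'
    proof -
      have "e = Bot (a + 1)" "e' = Bot (a + 2)" using e by auto
      then show ?thesis using lx ren_abs[of x y x] ren_abs[of x y y] by simp
    qed
    show "(linked ?Ls)\<^sup>*\<^sup>* s t"
      if st: "s \<in> grid m Ls" "t \<in> grid m Ls" "\<bar>ren x y (lab s)\<bar> = \<bar>ren x y (lab t)\<bar>" for s t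
    proof -
      have tox: "(linked ?Ls)\<^sup>*\<^sup>* p (?n, a + 1)" if "p \<in> grid m Ls" "\<bar>lab p\<bar> = \<bar>x\<bar>" for p
        by (rule linked_mono, rule LD(6)) (use that gr lx in auto)
      have toy: "(linked ?Ls)\<^sup>*\<^sup>* p (?n, a + 2)" if "p \<in> grid m Ls" "\<bar>lab p\<bar> = \<bar>y\<bar>" for p
        by (rule linked_mono, rule LD(6)) (use that gr lx in auto)
      have XY: "(linked ?Ls)\<^sup>*\<^sup>* p p'" if "p \<in> grid m Ls" "\<bar>lab p\<bar> = \<bar>x\<bar>" "p' \<in> grid m Ls" "\<bar>lab p'\<bar> = \<bar>y\<bar>" for p p'
        using tox[OF that(1,2)] linked_rtrancl_sym[OF toy[OF that(3,4)]] capl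
        by (meson rtranclp.rtrancl_into_rtrancl rtranclp_trans)
      consider "\<bar>lab s\<bar> = \<bar>lab t\<bar>" | "\<bar>lab s\<bar> = \<bar>x\<bar>" "\<bar>lab t\<bar> = \<bar>y\<bar>" | "\<bar>lab s\<bar> = \<bar>y\<bar>" "\<bar>lab t\<bar> = \<bar>x\<bar>"
        using st(3) unfolding ren_abs by metis
      then show ?thesis
      proof cases
        case 1 then show ?thesis using linked_mono LD(6) st(1,2) by blast
      next
        case 2 then show ?thesis using XY st(1,2) by blast
      next
        case 3 then show ?thesis using XY st(1,2) linked_rtrancl_sym by blast
      qed
    qed
    show "odd (card {l \<in> crossing_levels ?Ls. crossing_labels ?Ls (extend Ls ?g' (ren x y) lab) l = {\<bar>s\<bar>, \<bar>t\<bar>}}) = cross ?g' s t"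
      if st': "s \<in> set ?g'" "t \<in> set ?g'" "\<bar>s\<bar> \<noteq> \<bar>t\<bar>" for s t
    proof -
      let ?f = "\<lambda>t. if t = \<bar>x\<bar> then \<bar>y\<bar> else t"
      let ?C' = "\<lambda>s t. {l \<in> crossing_levels ?Ls. crossing_labels ?Ls (extend Ls ?g' (ren x y) lab) l = {\<bar>s\<bar>, \<bar>t\<bar>}}"
      let ?C = "\<lambda>s t. {l \<in> crossing_levels Ls. crossing_labels Ls lab l = {\<bar>s\<bar>, \<bar>t\<bar>}}"
      have lab: "crossing_labels ?Ls (extend Ls ?g' (ren x y) lab) l = ?f ` crossing_labels Ls lab l"
        if "l \<in> crossing_levels Ls" for l
        unfolding crossing_labels_snoc[OF crossing_level_less[OF that]] crossing_labels_def[of Ls] ren_abs by simp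
      have C': "?C' s t = {l \<in> crossing_levels Ls. ?f ` crossing_labels Ls lab l = {\<bar>s\<bar>, \<bar>t\<bar>}}" for s t
        unfolding crossing_levels_snoc using lab by (auto simp: is_crossing_def)
      have one: "odd (card (?C' y t)) = cross ?g' y t" if T: "t \<in> set ?g'" "\<bar>y\<bar> \<noteq> \<bar>t\<bar>" for t
      proof -
        have t: "t \<in> set (u @ v)" "\<bar>t\<bar> \<noteq> \<bar>x\<bar>" using mem'[of t] T by auto
        have e: "?f ` crossing_labels Ls lab l = {\<bar>y\<bar>, \<bar>t\<bar>} \<longleftrightarrow>
            crossing_labels Ls lab l = {\<bar>x\<bar>, \<bar>t\<bar>} \<or> crossing_labels Ls lab l = {\<bar>y\<bar>, \<bar>t\<bar>}" for l
          unfolding crossing_labels_def by (rule image_merge(1)) (use T(2) t(2) x0(4) in auto)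
        have "?C' y t = ?C x t \<union> ?C y t" unfolding C' e by blast
        moreover have "?C x t \<inter> ?C y t = {}" using x0(4) t(2) T(2) by (auto simp: doubleton_eq_iff)
        ultimately have "card (?C' y t) = card (?C x t) + card (?C y t)"
          by (simp add: card_Un_disjoint)
        moreover have "odd (card (?C x t)) = cross ?g x t" using LD(8)[of x t] t by auto
        moreover have "odd (card (?C y t)) = cross ?g y t" using LD(8)[of y t] t T(2) by auto
        ultimately show ?thesis using cross_join(1)[OF LD(1) xy t(2) _ t(1)] T(2) by auto
      qed
      consider "\<bar>s\<bar> = \<bar>y\<bar>" | "\<bar>t\<bar> = \<bar>y\<bar>" | "\<bar>s\<bar> \<noteq> \<bar>y\<bar>" "\<bar>t\<bar> \<noteq> \<bar>y\<bar>" by blast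
      then show ?thesis
      proof cases
        case 1
        then show ?thesis using one[of t] st' cross_abs[of s y t t] by simp
      next
        case 2
        have "cross ?g' s t = cross ?g' t s" using cross_sym[OF g' st'] by simp
        then show ?thesis using one[of s] st' 2 cross_abs[of t y s s] by (simp add: insert_commute)
      next
        case 3
        have s: "s \<in> set (u @ v)" "\<bar>s\<bar> \<noteq> \<bar>x\<bar>" and t: "t \<in> set (u @ v)" "\<bar>t\<bar> \<noteq> \<bar>x\<bar>"
          using mem'[of s] mem'[of t] st' 3 by auto
        have e: "?f ` crossing_labels Ls lab l = {\<bar>s\<bar>, \<bar>t\<bar>} \<longleftrightarrow> crossing_labels Ls lab l = {\<bar>s\<bar>, \<bar>t\<bar>}" for l
          unfolding crossing_labels_def by (rule image_merge(2)) (use 3 s(2) t(2) x0(4) in auto)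
        have "?C' s t = ?C s t" unfolding C' e by blast
        moreover have "odd (card (?C s t)) = cross ?g s t" using LD(8)[of s t] s t st'(3) by auto
        ultimately show ?thesis using cross_join(2)[OF LD(1) xy t(2) 3(2) t(1) s 3(1)] by simp
      qed
    qed
  qed auto
qed

lemma labelling_step:
  assumes "word_step a p g g'" "labelling m Ls g lab" "fitting m (Ls @ [(a, p, b)])"
  shows "\<exists>lab'. labelling m (Ls @ [(a, p, b)]) g' lab'"
  using assms
proof (induction rule: word_step.induct)
  case (ws_strands a k g) then show ?case using labelling_strands by blast
next
  case (ws_cross p u a x y v) then show ?case using labelling_cross by blast
next
  case (ws_cup u a k v) then show ?case using labelling_cup by blast
next
  case (ws_cap u a y x v) then show ?case using labelling_cap by blast
qed

lemma run_labelling: "run m Ls g \<Longrightarrow> fitting m Ls \<Longrightarrow> \<exists>lab. labelling m Ls g lab"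
proof (induction rule: run.induct)
  case run_nil then show ?case using labelling_nil by blast
next
  case (run_snoc Ls g a p g' b)
  then show ?case using labelling_step fitting_snoc by blast
qed

section \<open>Connectors and reduced diagrams\<close>
text \<open>A list of layers which can be stacked, from the object \<open>m\<close> to the object \<open>s\<close>.\<close>

fun chain :: "nat \<Rightarrow> layer list \<Rightarrow> nat \<Rightarrow> bool" where
  "chain m [] s \<longleftrightarrow> m = s"
| "chain m ((a, p, b) # Ls) s \<longleftrightarrow> m = a + piece_src p + b \<and> chain (a + piece_tgt p + b) Ls s"

lemma chain_append: "chain m (Ls @ Ks) s \<longleftrightarrow> (\<exists>n. chain m Ls n \<and> chain n Ks s)"
  by (induction m Ls s rule: chain.induct) auto

lemma chain_left: "chain m Ls s \<Longrightarrow> chain (k + m) (map (\<lambda>(a, p, b). (k + a, p, b)) Ls) (k + s)"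
  by (induction m Ls s rule: chain.induct) (auto simp: add.assoc)

lemma chain_right: "chain m Ls s \<Longrightarrow> chain (m + k) (map (\<lambda>(a, p, b). (a, p, b + k)) Ls) (s + k)"
  by (induction m Ls s rule: chain.induct) (auto simp: add.assoc)

lemma tangle_diagram_layers:
  "tangle_diagram m s d \<Longrightarrow> src d = m \<and> tgt d = s \<and> layers d \<noteq> [] \<and> chain m (layers d) s"
proof (induction rule: tangle_diagram.induct)
  case (3 m n f m' n' g)
  then have "chain (m + m') (map (\<lambda>(a, p, b). (m + a, p, b)) (layers g)) (m + n')"
    "chain (m + n') (map (\<lambda>(a, p, b). (a, p, b + n')) (layers f)) (n + n')"
    using chain_left chain_right by auto
  then show ?case using 3 by (auto simp: chain_append)
qed (auto simp: chain_append)

lemma chain_fitting: "chain m Ls s \<Longrightarrow> fitting m Ls \<and> width m Ls (length Ls) = s"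
proof (induction Ls arbitrary: s rule: rev_induct)
  case Nil then show ?case by (simp add: fitting_def width_def)
next
  case (snoc L Ls)
  obtain a p b where L: "L = (a, p, b)" by (cases L)
  then have "chain m Ls (a + piece_src p + b)" "s = a + piece_tgt p + b"
    using snoc.prems by (auto simp: chain_append)
  then show ?case using snoc.IH L by (simp add: fitting_snoc)
qed

lemma fitting_take: "fitting m Ls \<Longrightarrow> fitting m (take j Ls)"
  unfolding fitting_def width_def by auto

text \<open>The position of an endpoint in the final word: top endpoints from left to right, followed by
bottom endpoints from right to left.\<close>

definition word_pos :: "nat \<Rightarrow> nat \<Rightarrow> endpoint \<Rightarrow> nat" where
  "word_pos m s e = (case e of Top i \<Rightarrow> i - 1 | Bot i \<Rightarrow> s + m - i)"

definition ends :: "nat \<Rightarrow> nat \<Rightarrow> endpoint set" where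
  "ends m s = Bot ` {1..m} \<union> Top ` {1..s}"

definition word_conn :: "nat \<Rightarrow> nat \<Rightarrow> int list \<Rightarrow> (endpoint \<times> endpoint) set" where
  "word_conn m s g = {(u, v). u \<in> ends m s \<and> v \<in> ends m s \<and> u < v \<and> \<bar>g ! word_pos m s u\<bar> = \<bar>g ! word_pos m s v\<bar>}"

lemma linked_iff: "linked Ls p p' \<longleftrightarrow>
    (\<exists>l e e'. l < length Ls \<and> arc_pair (Ls ! l) e e' \<and> {p, p'} = {place l e, place l e'})"
proof -
  have "linked Ls p p' \<longleftrightarrow> (\<exists>l A. l < length Ls \<and> A \<in> layer_arcs (Ls ! l) \<and> {p, p'} = place l ` A)"
    unfolding linked_def arcs_of_def by auto
  also have "\<dots> \<longleftrightarrow> (\<exists>l e e'. l < length Ls \<and> arc_pair (Ls ! l) e e' \<and> {p, p'} = place l ` {e, e'})"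
    unfolding mem_layer_arcs by blast
  finally show ?thesis by simp
qed

lemma arc_pair_bounds:
  assumes "arc_pair (a, p, b) e e'" "t = e \<or> t = e'"
  shows "(\<exists>i. t = Bot i \<and> 1 \<le> i \<and> i \<le> a + piece_src p + b) \<or> (\<exists>i. t = Top i \<and> 1 \<le> i \<and> i \<le> a + piece_tgt p + b)"
  using assms by (cases p) auto

lemma linked_grid:
  assumes "fitting m Ls" "linked Ls p p'"
  shows "p \<in> grid m Ls \<and> p' \<in> grid m Ls"
proof -
  obtain l e e' where l: "l < length Ls" "arc_pair (Ls ! l) e e'" "{p, p'} = {place l e, place l e'}"
    using assms(2) unfolding linked_iff by blast
  obtain a r b where L: "Ls ! l = (a, r, b)" by (cases "Ls ! l")
  have w: "a + piece_src r + b = width m Ls l" "a + piece_tgt r + b = width m Ls (Suc l)"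
    using assms(1) l(1) L unfolding fitting_def width_def by fastforce+
  have "place l t \<in> grid m Ls" if "t = e \<or> t = e'" for t
    using arc_pair_bounds[OF l(2)[unfolded L] that] w l(1) by (auto simp: grid_def)
  then show ?thesis using l(3) by (metis doubleton_eq_iff)
qed

lemma strand_of_linked: "strand_of d p = {p'. (linked (layers d))\<^sup>*\<^sup>* p p'}"
  unfolding strand_of_def joined_linked ..

lemma labelling_strand:
  assumes "labelling m Ls g lab" "(linked Ls)\<^sup>*\<^sup>* p p'"
  shows "\<bar>lab p\<bar> = \<bar>lab p'\<bar>"
  using assms(2) by (induction rule: rtranclp_induct) (use labellingD(5)[OF assms(1)] in auto)

text \<open>In a labelling, two points lie on the same strand if and only if their labels have the same absolute
value, and the labels of the endpoints are the letters of the final word.\<close>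

theorem conn_of_run:
  assumes d: "tangle_diagram m s d" and r: "run m (layers d) g"
  shows "conn d = word_conn m s g"
proof -
  let ?Ls = "layers d"
  have T: "src d = m" "tgt d = s" "chain m ?Ls s" using tangle_diagram_layers[OF d] by auto
  have F: "fitting m ?Ls" "width m ?Ls (length ?Ls) = s" using chain_fitting[OF T(3)] by auto
  obtain lab where L: "labelling m ?Ls g lab" using run_labelling[OF r F(1)] by blast
  note LD = labellingD[OF L]
  have E: "endpoints d = ends m s" unfolding endpoints_def ends_def T ..
  have pos: "endpoint_pos d e \<in> grid m ?Ls \<and> \<bar>lab (endpoint_pos d e)\<bar> = \<bar>g ! word_pos m s e\<bar>"
    if e: "e \<in> ends m s" for e
  proof -
    from e consider i where "e = Bot i" "1 \<le> i" "i \<le> m" | i where "e = Top i" "1 \<le> i" "i \<le> s"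
      unfolding ends_def by auto
    then show ?thesis
    proof cases
      case 1
      have "width m ?Ls 0 = m" by (simp add: width_def)
      then show ?thesis using 1 LD(4)[of i] F(2) by (simp add: grid_def word_pos_def)
    next
      case 2
      then show ?thesis using LD(3)[of i] F(2) by (simp add: grid_def word_pos_def)
    qed
  qed
  have "endpoint_pos d v \<in> strand_of d (endpoint_pos d u) \<longleftrightarrow> \<bar>g ! word_pos m s u\<bar> = \<bar>g ! word_pos m s v\<bar>"
    if "u \<in> ends m s" "v \<in> ends m s" for u v
  proof -
    note pu = pos[OF that(1)] and pv = pos[OF that(2)]
    have "(linked ?Ls)\<^sup>*\<^sup>* (endpoint_pos d u) (endpoint_pos d v) \<longleftrightarrow>
        \<bar>lab (endpoint_pos d u)\<bar> = \<bar>lab (endpoint_pos d v)\<bar>"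
      using labelling_strand[OF L] LD(6) pu pv by blast
    then show ?thesis unfolding strand_of_linked using pu pv by simp
  qed
  then show ?thesis unfolding conn_def word_conn_def E by blast
qed

lemma split_word:
  assumes "a + 2 \<le> length g" obtains u x y v where "g = u @ x # y # v" "length u = a"
proof -
  have "drop a g = g ! a # g ! Suc a # drop (Suc (Suc a)) g"
    using assms by (metis Cons_nth_drop_Suc Suc_le_lessD add_2_eq_Suc' less_SucI less_Suc_eq_le)
  then have "g = take a g @ g ! a # g ! Suc a # drop (Suc (Suc a)) g" by (metis append_take_drop_id)
  then show ?thesis using that assms by (metis add_leD1 length_take min.absorb2)
qed

text \<open>The strand at a cap whose ends have opposite letters cannot reach an endpoint: the letters of the strand
disappear from the word, whereas every endpoint keeps its letter.\<close>

lemma cap_closes_loop: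
  assumes d: "tangle_diagram m s d" and j: "j < length (layers d)" "layers d ! j = (a, Cap, b)"
    and L: "labelling m (take j (layers d)) (u @ x # - x # v) lab" and a: "length u = a"
  shows "\<exists>C. is_loop d C"
proof -
  let ?Ls = "layers d" and ?K = "take j (layers d)" and ?g = "u @ x # - x # v"
  have T: "src d = m" "tgt d = s" "chain m ?Ls s" using tangle_diagram_layers[OF d] by auto
  have F: "fitting m ?Ls" using chain_fitting[OF T(3)] by auto
  note LD = labellingD[OF L]
  have lK: "length ?K = j" using j by simp
  have w: "width m ?K j = a + 2 + b"
  proof -
    have "a + 2 + b = width m ?Ls j" using F j unfolding fitting_def by fastforce
    moreover have "width m ?Ls j = width m ?K j" using j by (simp add: width_def)
    ultimately show ?thesis by simp
  qed
  have len: "length ?g = a + 2 + b + m" using LD(2) lK w by simp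
  have at: "i = a \<or> i = a + 1" if "i < length ?g" "\<bar>?g ! i\<bar> = \<bar>x\<bar>" for i
  proof -
    have "?g ! i = x \<or> ?g ! i = - x" using that(2) by arith
    moreover have "?g ! a = x" "?g ! (a + 1) = - x" using a by (auto simp: nth_append)
    moreover have "distinct ?g" using LD(1) by (simp add: generic_def)
    ultimately show ?thesis using that(1) len by (metis (no_types, lifting) add_less_cancel_left less_add_same_cancel1 nth_eq_iff_index_eq one_less_numeral_iff pos2 semiring_norm(76) trans_less_add1)
  qed
  have lev: "lab (j, i) = ?g ! (i - 1)" if "1 \<le> i" "i \<le> a + 2 + b" for i
    using LD(3)[of i] that lK w by simp
  let ?S = "{p \<in> grid m ?K. \<bar>lab p\<bar> = \<bar>x\<bar>}"
  have closed: "p' \<in> ?S" if p: "p \<in> ?S" and pp: "linked ?Ls p p'" for p p'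
  proof -
    obtain l e e' where l: "l < length ?Ls" "arc_pair (?Ls ! l) e e'" "{p, p'} = {place l e, place l e'}"
      using pp unfolding linked_iff by blast
    have pj: "fst p \<le> j" using p lK by (auto simp: grid_def)
    have fl: "fst p \<ge> l" using l(3) by (cases e; cases e'; auto simp: doubleton_eq_iff)
    consider "l < j" | "l = j" using pj fl by linarith
    then show ?thesis
    proof cases
      case 1
      then have "linked ?K p p'" unfolding linked_iff using l j by (intro exI[of _ l] exI[of _ e] exI[of _ e']) simp
      then show ?thesis using linked_grid[OF fitting_take[OF F]] LD(5) p by auto
    next
      case 2
      have e: "arc_pair (a, Cap, b) e e'" using l(2) 2 j by simp
      have lift: "i = a + 1 \<or> i = a + 2" if "p = (j, i)" for i
      proof -
        have i: "1 \<le> i" "i \<le> a + 2 + b" "\<bar>lab (j, i)\<bar> = \<bar>x\<bar>" using p that lK w by (auto simp: grid_def)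
        have "i - 1 < length ?g" unfolding len using i by simp
        moreover have "\<bar>?g ! (i - 1)\<bar> = \<bar>x\<bar>" using lev[OF i(1,2)] i(3) by simp
        ultimately have "i - 1 = a \<or> i - 1 = a + 1" by (rule at)
        then show ?thesis using i(1) by auto
      qed
      have pb: "p = (j, snd p)" using pj fl 2 by (cases p) simp
      have s: "snd p = a + 1 \<or> snd p = a + 2" using lift[OF pb] .
      have "e = Bot (a + 1) \<and> e' = Bot (a + 2)"
        using e s l(3) 2 pb by (auto simp: doubleton_eq_iff)
      then have "p' = (j, a + 1) \<or> p' = (j, a + 2)" using l(3) 2 by (auto simp: doubleton_eq_iff)
      moreover have "\<bar>lab (j, a + 1)\<bar> = \<bar>x\<bar>" "\<bar>lab (j, a + 2)\<bar> = \<bar>x\<bar>"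
        using lev[of "a + 1"] lev[of "a + 2"] a by (auto simp: nth_append)
      ultimately show ?thesis using lK w by (auto simp: grid_def)
    qed
  qed
  let ?C = "strand_of d (j, a + 1)"
  have start: "(j, a + 1) \<in> ?S" using lev[of "a + 1"] a lK w by (auto simp: grid_def nth_append)
  have sub: "?C \<subseteq> ?S"
  proof
    fix p' assume "p' \<in> ?C"
    then have "(linked ?Ls)\<^sup>*\<^sup>* (j, a + 1) p'" unfolding strand_of_linked by simp
    then show "p' \<in> ?S"
    proof (induction rule: rtranclp_induct)
      case base show ?case by (rule start)
    next
      case (step p p') then show ?case using closed by blast
    qed
  qed
  have "?C \<inter> endpoint_pos d ` endpoints d = {}"
  proof -
    have "endpoint_pos d e \<notin> ?S" if "e \<in> endpoints d" for e
    proof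
      assume S: "endpoint_pos d e \<in> ?S"
      from that consider i where "e = Bot i" "1 \<le> i" "i \<le> m" | i where "e = Top i"
        unfolding endpoints_def T by auto
      then show False
      proof cases
        case 1
        then have "lab (0, i) = - (?g ! (a + 2 + b + m - i))" using LD(4)[of i] lK w by simp
        then have "\<bar>?g ! (a + 2 + b + m - i)\<bar> = \<bar>x\<bar>" using S 1 by simp
        then show False using at[of "a + 2 + b + m - i"] 1 len by auto
      next
        case 2
        then show False using S lK j by (simp add: grid_def)
      qed
    qed
    then show ?thesis using sub by blast
  qed
  moreover have "(j, a + 1) \<in> points d"
  proof -
    have "(j, place j ` {Bot (a + 1), Bot (a + 2)}) \<in> arcs d"
    proof -
      have "{Bot (a + 1), Bot (a + 2)} \<in> layer_arcs (?Ls ! j)"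
        unfolding j mem_layer_arcs by (intro exI[of _ "Bot (a + 1)"] exI[of _ "Bot (a + 2)"]) simp
      then show ?thesis unfolding arcs_def using j(1) by blast
    qed
    then show ?thesis unfolding points_def by force
  qed
  ultimately show ?thesis unfolding is_loop_def by blast
qed

text \<open>A run can only get stuck at a cap which closes a loop.\<close>

lemma run_exists:
  assumes d: "tangle_diagram m s d" and nl: "\<nexists>C. is_loop d C"
  shows "j \<le> length (layers d) \<Longrightarrow> \<exists>g. run m (take j (layers d)) g"
proof (induction j)
  case 0 then show ?case using run_nil by auto
next
  case (Suc j)
  let ?Ls = "layers d"
  have j: "j < length ?Ls" using Suc by simp
  obtain g where g: "run m (take j ?Ls) g" using Suc by auto
  have F: "fitting m ?Ls" using chain_fitting tangle_diagram_layers[OF d] by blast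
  obtain lab where L: "labelling m (take j ?Ls) g lab" using run_labelling[OF g fitting_take[OF F]] by blast
  obtain a p b where p: "?Ls ! j = (a, p, b)" by (cases "?Ls ! j")
  have tk: "take (Suc j) ?Ls = take j ?Ls @ [(a, p, b)]" using j p by (simp add: take_Suc_conv_app_nth)
  have len: "length g = a + piece_src p + b + m"
  proof -
    have "a + piece_src p + b = width m ?Ls j" using F j p unfolding fitting_def by fastforce
    moreover have "width m ?Ls j = width m (take j ?Ls) j" using j by (simp add: width_def)
    ultimately show ?thesis using labellingD(2)[OF L] j by simp
  qed
  have "\<exists>g'. word_step a p g g'"
  proof (cases p)
    case (Strands k) then show ?thesis using ws_strands by blast
  next
    case CrossX
    then have "a + 2 \<le> length g" using len by simp
    then obtain u x y v where "g = u @ x # y # v" "length u = a" by (rule split_word)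
    then show ?thesis using ws_cross[of p u a x y v] CrossX by (simp add: is_crossing_def) blast
  next
    case CrossY
    then have "a + 2 \<le> length g" using len by simp
    then obtain u x y v where "g = u @ x # y # v" "length u = a" by (rule split_word)
    then show ?thesis using ws_cross[of p u a x y v] CrossY by (simp add: is_crossing_def) blast
  next
    case Cup
    obtain k where k: "k \<noteq> 0" "k \<notin> set g" "- k \<notin> set g" by (rule fresh_letter)
    have "length (take a g) = a" "take a g @ drop a g = g" using len by auto
    then show ?thesis using ws_cup[of "take a g" a k "drop a g"] k Cup by metis
  next
    case Cap
    then have "a + 2 \<le> length g" using len by simp
    then obtain u x y v where g': "g = u @ x # y # v" "length u = a" by (rule split_word)
    have "y \<noteq> - x" using cap_closes_loop[OF d j p[unfolded Cap], of u x v lab] L g' nl by auto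
    then show ?thesis using ws_cap[of u a y x v] g' Cap by blast
  qed
  then show ?case unfolding tk using run.run_snoc[OF g] by blast
qed

lemma crossings_levels: "crossings d = crossing_levels (layers d)"
  by (auto simp: crossings_def crossing_levels_def is_crossing_def)

text \<open>Two strands of a reduced diagram cross at most once. Hence every crossing belongs to a pair of strands whose
number of crossings is odd, i.e. to a crossing of the final word, and different crossings belong to different
pairs.\<close>

theorem reduced_run:
  assumes d: "tangle_diagram m s d" and red: "reduced d"
  obtains g where "run m (layers d) g" "card (crossing_levels (layers d)) \<le> cr g"
proof -
  let ?Ls = "layers d"
  obtain g where g: "run m ?Ls g"
    using run_exists[OF d, of "length ?Ls"] red by (auto simp: reduced_def)
  have F: "fitting m ?Ls" using chain_fitting tangle_diagram_layers[OF d] by blast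
  obtain lab where L: "labelling m ?Ls g lab" using run_labelling[OF g F] by blast
  note LD = labellingD[OF L]
  let ?K = "crossing_labels ?Ls lab"
  define strand where "strand t = {p'. \<exists>p\<in>grid m ?Ls. \<bar>lab p\<bar> = t \<and> (linked ?Ls)\<^sup>*\<^sup>* p p'}" for t
  have st: "strand_of d p = strand \<bar>lab p\<bar>" if "p \<in> grid m ?Ls" for p
  proof -
    have "(linked ?Ls)\<^sup>*\<^sup>* p p'" if "q \<in> grid m ?Ls" "\<bar>lab q\<bar> = \<bar>lab p\<bar>" "(linked ?Ls)\<^sup>*\<^sup>* q p'" for q p'
      using LD(6)[OF \<open>p \<in> _\<close> that(1)] that(2,3) by (metis rtranclp_trans)
    then show ?thesis unfolding strand_of_linked strand_def using that by auto
  qed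
  have cs: "crossing_strands d l = strand ` ?K l" if "l \<in> crossing_levels ?Ls" for l
    using crossing_points_in_grid[OF F that] st
    unfolding crossing_strands_def crossing_labels_def Let_def by simp
  have inj: "inj_on ?K (crossing_levels ?Ls)"
  proof (rule inj_onI)
    fix l l' assume "l \<in> crossing_levels ?Ls" "l' \<in> crossing_levels ?Ls" "?K l = ?K l'"
    then show "l = l'" using red cs unfolding reduced_def crossings_levels by metis
  qed
  have "?K l \<in> crossing_pairs g" if l: "l \<in> crossing_levels ?Ls" for l
  proof -
    let ?x = "lab (l, fst (?Ls ! l) + 1)" and ?y = "lab (l, fst (?Ls ! l) + 2)"
    have K: "?K l = {\<bar>?x\<bar>, \<bar>?y\<bar>}" by (simp add: crossing_labels_def)
    have xy: "?x \<in> set g" "?y \<in> set g" using LD(7) crossing_points_in_grid[OF F l] by auto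
    have "card (crossing_strands d l) = 2" using red l unfolding reduced_def crossings_levels by blast
    then have "card (strand ` ?K l) = 2" unfolding cs[OF l] .
    then have ne: "\<bar>?x\<bar> \<noteq> \<bar>?y\<bar>" unfolding K by auto
    have "{l' \<in> crossing_levels ?Ls. ?K l' = {\<bar>?x\<bar>, \<bar>?y\<bar>}} = {l}"
      using inj l K unfolding inj_on_def by auto
    then have "cross g ?x ?y" using LD(8)[OF xy ne] by simp
    then show ?thesis unfolding K crossing_pairs_def using xy ne by blast
  qed
  then have "card (crossing_levels ?Ls) \<le> cr g"
    unfolding cr_def by (intro card_inj_on_le[OF inj]) auto
  then show ?thesis using that g by blast
qed

section \<open>Calculus in the supercategory\<close>
text \<open>Equality of morphisms, with the objects left implicit.\<close>

definition eqv :: "'k::comm_ring_1 \<Rightarrow> 'k mor \<Rightarrow> 'k mor \<Rightarrow> bool" where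
  "eqv q f g \<longleftrightarrow> mor_eq q (msrc f) (mtgt f) f g"

lemma eqvD: "eqv q f g \<Longrightarrow> welltyped f \<and> welltyped g \<and> msrc g = msrc f \<and> mtgt g = mtgt f"
  unfolding eqv_def using mor_eq_in_hom[of q "msrc f" "mtgt f" f g] by (simp add: in_hom_iff)

lemma mor_eq_eqv: "mor_eq q m n f g \<longleftrightarrow> in_hom f m n \<and> eqv q f g"
  unfolding eqv_def using mor_eq_in_hom[of q m n f g] by (auto simp: in_hom_iff)

context
  fixes q :: "'k::comm_ring_1"
begin

abbreviation eqv_q :: "'k mor \<Rightarrow> 'k mor \<Rightarrow> bool" (infix "\<approx>" 50) where "f \<approx> g \<equiv> eqv q f g"

lemma eqv_refl: "welltyped f \<Longrightarrow> f \<approx> f"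
  unfolding eqv_def by (rule mor_eq.refl) (simp add: in_hom_iff)
lemma eqv_sym: "f \<approx> g \<Longrightarrow> g \<approx> f"
  using eqvD[of q f g] unfolding eqv_def by (metis mor_eq.sym)
lemma eqv_trans [trans]: "f \<approx> g \<Longrightarrow> g \<approx> h \<Longrightarrow> f \<approx> h"
  using eqvD[of q f g] unfolding eqv_def by (metis mor_eq.trans)
lemma eqv_Comp: "f \<approx> f' \<Longrightarrow> g \<approx> g' \<Longrightarrow> msrc f = mtgt g \<Longrightarrow> Comp f g \<approx> Comp f' g'"
  unfolding eqv_def by (simp add: mor_eq.cong_Comp)
lemma eqv_Tens: "f \<approx> f' \<Longrightarrow> g \<approx> g' \<Longrightarrow> Tens f g \<approx> Tens f' g'"
  unfolding eqv_def by (simp add: mor_eq.cong_Tens)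
lemma eqv_Scale: "f \<approx> f' \<Longrightarrow> Scale c f \<approx> Scale c f'"
  unfolding eqv_def by (simp add: mor_eq.cong_Scale)

lemma eqv_comp_assoc: "welltyped (Comp (Comp f g) h) \<Longrightarrow> Comp (Comp f g) h \<approx> Comp f (Comp g h)"
  unfolding eqv_def msrc.simps mtgt.simps by (rule mor_eq.comp_assoc) (auto simp: in_hom_iff)
lemma eqv_id_left: "welltyped f \<Longrightarrow> n = mtgt f \<Longrightarrow> Comp (ident n) f \<approx> f"
  unfolding eqv_def by (simp add: mor_eq.comp_id_left in_hom_iff)
lemma eqv_id_right: "welltyped f \<Longrightarrow> n = msrc f \<Longrightarrow> Comp f (ident n) \<approx> f"
  unfolding eqv_def by (simp add: mor_eq.comp_id_right in_hom_iff)
lemma eqv_tens_assoc: "welltyped f \<Longrightarrow> welltyped g \<Longrightarrow> welltyped h \<Longrightarrow> Tens (Tens f g) h \<approx> Tens f (Tens g h)"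
  unfolding eqv_def msrc.simps mtgt.simps by (rule mor_eq.tens_assoc) (auto simp: in_hom_iff)
lemma eqv_unit_left: "welltyped f \<Longrightarrow> Tens (ident 0) f \<approx> f"
  unfolding eqv_def by (simp add: mor_eq.tens_unit_left in_hom_iff)
lemma eqv_unit_right: "welltyped f \<Longrightarrow> Tens f (ident 0) \<approx> f"
  unfolding eqv_def by (simp add: mor_eq.tens_unit_right in_hom_iff)
lemma eqv_tens_id: "Tens (ident m) (ident n) \<approx> ident (m + n)"
  unfolding eqv_def by (simp add: mor_eq.tens_id)
lemma eqv_scale_one: "welltyped f \<Longrightarrow> Scale 1 f \<approx> f"
  unfolding eqv_def by (simp add: mor_eq.scale_one in_hom_iff)
lemma eqv_scale_scale: "welltyped f \<Longrightarrow> Scale (c * d) f \<approx> Scale c (Scale d f)"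
  unfolding eqv_def by (simp add: mor_eq.scale_scale in_hom_iff)

lemma eqv_comp_scale_left: "welltyped (Comp f g) \<Longrightarrow> Comp (Scale c f) g \<approx> Scale c (Comp f g)"
  unfolding eqv_def msrc.simps mtgt.simps by (rule mor_eq.comp_scale_left) (auto simp: in_hom_iff)
lemma eqv_comp_scale_right: "welltyped (Comp f g) \<Longrightarrow> Comp f (Scale c g) \<approx> Scale c (Comp f g)"
  unfolding eqv_def msrc.simps mtgt.simps by (rule mor_eq.comp_scale_right) (auto simp: in_hom_iff)
lemma eqv_comp_add_left: "welltyped (Comp (Add f g) h) \<Longrightarrow> Comp (Add f g) h \<approx> Add (Comp f h) (Comp g h)"
  unfolding eqv_def msrc.simps mtgt.simps by (rule mor_eq.comp_add_left) (auto simp: in_hom_iff)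
lemma eqv_comp_add_right: "welltyped (Comp h (Add f g)) \<Longrightarrow> Comp h (Add f g) \<approx> Add (Comp h f) (Comp h g)"
  unfolding eqv_def msrc.simps mtgt.simps by (rule mor_eq.comp_add_right) (auto simp: in_hom_iff)
lemma eqv_tens_scale_left: "welltyped f \<Longrightarrow> welltyped g \<Longrightarrow> Tens (Scale c f) g \<approx> Scale c (Tens f g)"
  unfolding eqv_def msrc.simps mtgt.simps by (rule mor_eq.tens_scale_left) (auto simp: in_hom_iff)
lemma eqv_tens_scale_right: "welltyped f \<Longrightarrow> welltyped g \<Longrightarrow> Tens f (Scale c g) \<approx> Scale c (Tens f g)"
  unfolding eqv_def msrc.simps mtgt.simps by (rule mor_eq.tens_scale_right) (auto simp: in_hom_iff)
lemma eqv_tens_add_left: "welltyped (Add f g) \<Longrightarrow> welltyped h \<Longrightarrow> Tens (Add f g) h \<approx> Add (Tens f h) (Tens g h)"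
  unfolding eqv_def msrc.simps mtgt.simps by (rule mor_eq.tens_add_left) (auto simp: in_hom_iff)
lemma eqv_tens_add_right: "welltyped (Add f g) \<Longrightarrow> welltyped h \<Longrightarrow> Tens h (Add f g) \<approx> Add (Tens h f) (Tens h g)"
  unfolding eqv_def msrc.simps mtgt.simps by (rule mor_eq.tens_add_right) (auto simp: in_hom_iff)

lemma odd_summand: "(i::nat) + j = k + 2 * t \<Longrightarrow> odd k = (odd i \<noteq> odd j)"
  by presburger

lemma half_degrees:
  fixes m n p m' n' :: nat
  assumes "even (n + 3 * m)"
  shows "even (p + 3 * n) \<Longrightarrow> (p + 3 * n) div 2 + (n + 3 * m) div 2 = (p + 3 * m) div 2 + 2 * n"
    "even (n' + 3 * m') \<Longrightarrow> (n + 3 * m) div 2 + (n' + 3 * m') div 2 = (n + n' + 3 * (m + m')) div 2 + 2 * 0"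
proof -
  obtain i where i: "n + 3 * m = 2 * i" using assms by (rule evenE)
  show "(p + 3 * n) div 2 + (n + 3 * m) div 2 = (p + 3 * m) div 2 + 2 * n" if e: "even (p + 3 * n)"
  proof -
    obtain j where j: "p + 3 * n = 2 * j" using e by (rule evenE)
    have "even (p + 3 * m)" using assms that by simp
    then obtain k where k: "p + 3 * m = 2 * k" by (rule evenE)
    have "j + i = k + 2 * n" using i j k by linarith
    then show ?thesis unfolding i j k by simp
  qed
  show "(n + 3 * m) div 2 + (n' + 3 * m') div 2 = (n + n' + 3 * (m + m')) div 2 + 2 * 0" if e: "even (n' + 3 * m')"
  proof -
    obtain j where j: "n' + 3 * m' = 2 * j" using e by (rule evenE)
    have k: "n + n' + 3 * (m + m') = 2 * (i + j)" using i j by (simp add: distrib_left)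
    show ?thesis unfolding i j k by simp
  qed
qed

text \<open>If \<open>f : m \<rightarrow> n\<close> contains \<open>u\<close> cups and \<open>v\<close> caps, then \<open>n - m = 2 u - 2 v\<close>, so that the parity of \<open>u + v\<close> is the one
of \<open>(n - m) / 2\<close>; adding \<open>2 m\<close> avoids negative numbers. If \<open>m + n\<close> is odd, then \<open>f\<close> involves zero morphisms and
has both parities. Thus every morphism is homogeneous, and the interchange law applies to all of them.\<close>

lemma parity_of_degree:
  assumes "welltyped f" "odd (msrc f + mtgt f) \<or> b = odd ((mtgt f + 3 * msrc f) div 2)"
  shows "has_parity f b"
  using assms
proof (induction f arbitrary: b)
  case (Piece p)
  then show ?case by (cases p) (auto simp: has_parity_iff)
next
  case (Comp g h)
  show ?case
  proof (cases "even (msrc g + mtgt g) \<and> even (msrc h + mtgt h)")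
    case True
    let ?c = "odd ((mtgt g + 3 * msrc g) div 2)" and ?d = "odd ((mtgt h + 3 * msrc h) div 2)"
    have "has_parity g ?c" by (rule Comp.IH(1)) (use Comp.prems in simp_all)
    moreover have "has_parity h ?d" by (rule Comp.IH(2)) (use Comp.prems in simp_all)
    moreover have "b = (?c \<noteq> ?d)"
    proof -
      have e: "msrc g = mtgt h" "even (msrc h + mtgt g)" "even (mtgt g + 3 * msrc g)" "even (mtgt h + 3 * msrc h)"
        using True Comp.prems by auto
      have "(mtgt g + 3 * msrc g) div 2 + (mtgt h + 3 * msrc h) div 2 = (mtgt g + 3 * msrc h) div 2 + 2 * mtgt h"
        using half_degrees(1)[of "mtgt h" "msrc h" "mtgt g"] e by simp
      then have "odd ((mtgt g + 3 * msrc h) div 2) = (?c \<noteq> ?d)" by (rule odd_summand)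
      then show ?thesis using Comp.prems e by simp
    qed
    ultimately show ?thesis unfolding has_parity_iff by blast
  next
    case False
    then obtain c d where "has_parity g c" "has_parity h d" "b = (c \<noteq> d)"
    proof (cases "odd (msrc g + mtgt g)")
      case True
      have "has_parity h d" if "d = odd ((mtgt h + 3 * msrc h) div 2)" for d
        by (rule Comp.IH(2)) (use Comp.prems that in simp_all)
      then obtain d where "has_parity h d" by blast
      moreover have "has_parity g (b \<noteq> d)" by (rule Comp.IH(1)) (use Comp.prems True in simp_all)
      ultimately show ?thesis using that[of "b \<noteq> d" d] by auto
    next
      case f: False
      then have o: "odd (msrc h + mtgt h)" using False by auto
      have "has_parity g c" if "c = odd ((mtgt g + 3 * msrc g) div 2)" for c
        by (rule Comp.IH(1)) (use Comp.prems that in simp_all)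
      then obtain c where "has_parity g c" by blast
      moreover have "has_parity h (b \<noteq> c)" by (rule Comp.IH(2)) (use Comp.prems o in simp_all)
      ultimately show ?thesis using that[of c "b \<noteq> c"] by auto
    qed
    then show ?thesis unfolding has_parity_iff by blast
  qed
next
  case (Tens g h)
  show ?case
  proof (cases "even (msrc g + mtgt g) \<and> even (msrc h + mtgt h)")
    case True
    let ?c = "odd ((mtgt g + 3 * msrc g) div 2)" and ?d = "odd ((mtgt h + 3 * msrc h) div 2)"
    have "has_parity g ?c" by (rule Tens.IH(1)) (use Tens.prems in simp_all)
    moreover have "has_parity h ?d" by (rule Tens.IH(2)) (use Tens.prems in simp_all)
    moreover have "b = (?c \<noteq> ?d)"
    proof -
      have e: "even (mtgt g + 3 * msrc g)" "even (mtgt h + 3 * msrc h)"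
        using True Tens.prems by auto
      have "(mtgt g + 3 * msrc g) div 2 + (mtgt h + 3 * msrc h) div 2 = (mtgt g + mtgt h + 3 * (msrc g + msrc h)) div 2 + 2 * 0"
        by (rule half_degrees(2)) (use e in auto)
      then have "odd ((mtgt g + mtgt h + 3 * (msrc g + msrc h)) div 2) = (?c \<noteq> ?d)" by (rule odd_summand)
      moreover have "even (msrc g + msrc h + (mtgt g + mtgt h))" using True by auto
      ultimately show ?thesis using Tens.prems by simp
    qed
    ultimately show ?thesis unfolding has_parity_iff by blast
  next
    case False
    then obtain c d where "has_parity g c" "has_parity h d" "b = (c \<noteq> d)"
    proof (cases "odd (msrc g + mtgt g)")
      case True
      have "has_parity h d" if "d = odd ((mtgt h + 3 * msrc h) div 2)" for d
        by (rule Tens.IH(2)) (use Tens.prems that in simp_all)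
      then obtain d where "has_parity h d" by blast
      moreover have "has_parity g (b \<noteq> d)" by (rule Tens.IH(1)) (use Tens.prems True in simp_all)
      ultimately show ?thesis using that[of "b \<noteq> d" d] by auto
    next
      case f: False
      then have o: "odd (msrc h + mtgt h)" using False by auto
      have "has_parity g c" if "c = odd ((mtgt g + 3 * msrc g) div 2)" for c
        by (rule Tens.IH(1)) (use Tens.prems that in simp_all)
      then obtain c where "has_parity g c" by blast
      moreover have "has_parity h (b \<noteq> c)" by (rule Tens.IH(2)) (use Tens.prems o in simp_all)
      ultimately show ?thesis using that[of c "b \<noteq> c"] by auto
    qed
    then show ?thesis unfolding has_parity_iff by blast
  qed
qed (auto simp: has_parity_iff)

lemma ex_parity: "welltyped f \<Longrightarrow> \<exists>b. has_parity f b"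
  using parity_of_degree by blast

lemma parity_ident: "has_parity (ident n) False" by (simp add: has_parity_iff)

lemma eqv_interchange:
  assumes "welltyped f" "welltyped g" "welltyped k" "welltyped h" "msrc f = mtgt k" "msrc g = mtgt h"
    "has_parity g b" "has_parity k c"
  shows "Comp (Tens f g) (Tens k h) \<approx> Scale (if b \<and> c then - 1 else 1) (Tens (Comp f k) (Comp g h))"
proof -
  obtain a d where "has_parity f a" "has_parity h d" using ex_parity assms by blast
  then show ?thesis
    using mor_eq.super_interchange[of f "msrc f" "mtgt f" k "msrc k" g "msrc g" "mtgt g" h "msrc h" a b c d q] assms
    unfolding eqv_def by (simp add: in_hom_iff)
qed

lemma eqv_interchange_even:
  assumes "welltyped f" "welltyped g" "welltyped k" "welltyped h" "msrc f = mtgt k" "msrc g = mtgt h"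
    "has_parity g False \<or> has_parity k False"
  shows "Comp (Tens f g) (Tens k h) \<approx> Tens (Comp f k) (Comp g h)"
proof -
  obtain b c where bc: "has_parity g b" "has_parity k c" and n: "(b \<and> c) = False" using ex_parity assms by blast
  have "Comp (Tens f g) (Tens k h) \<approx> Scale 1 (Tens (Comp f k) (Comp g h))"
    using eqv_interchange[OF assms(1-6) bc] unfolding n by simp
  also have "\<dots> \<approx> Tens (Comp f k) (Comp g h)" using assms by (intro eqv_scale_one) simp
  finally show ?thesis .
qed

lemma tens_left_right:
  assumes "welltyped f" "welltyped g" "a = msrc f" "b = mtgt g"
  shows "Tens f g \<approx> Comp (Tens f (ident b)) (Tens (ident a) g)"
proof -
  have "Comp (Tens f (ident b)) (Tens (ident a) g) \<approx> Tens (Comp f (ident a)) (Comp (ident b) g)"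
    using assms by (intro eqv_interchange_even) (auto simp: parity_ident)
  also have "\<dots> \<approx> Tens f g" using assms by (intro eqv_Tens eqv_id_left eqv_id_right) auto
  finally show ?thesis by (rule eqv_sym)
qed

lemma tens_right_left:
  assumes "welltyped f" "welltyped g" "has_parity f c" "has_parity g d" "a = mtgt f" "b = msrc g"
  shows "Comp (Tens (ident a) g) (Tens f (ident b)) \<approx> Scale (if c \<and> d then - 1 else 1) (Tens f g)"
proof -
  have "Comp (Tens (ident a) g) (Tens f (ident b)) \<approx>
      Scale (if d \<and> c then - 1 else 1) (Tens (Comp (ident a) f) (Comp g (ident b)))"
    using assms by (intro eqv_interchange) auto
  also have "\<dots> \<approx> Scale (if d \<and> c then - 1 else 1) (Tens f g)"
    using assms by (intro eqv_Scale eqv_Tens eqv_id_left eqv_id_right) auto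
  finally show ?thesis by (simp add: conj_commute)
qed

text \<open>The morphism \<open>f\<close> with \<open>a\<close> strands on its left and \<open>b\<close> strands on its right.\<close>

definition put :: "nat \<Rightarrow> 'k mor \<Rightarrow> nat \<Rightarrow> 'k mor" where
  "put a f b = Tens (ident a) (Tens f (ident b))"

lemma put_types [simp]: "msrc (put a f b) = a + msrc f + b" "mtgt (put a f b) = a + mtgt f + b"
  "welltyped (put a f b) = welltyped f"
  by (auto simp: put_def)

lemma put_cong: "f \<approx> g \<Longrightarrow> put a f b \<approx> put a g b"
  unfolding put_def by (intro eqv_Tens eqv_refl) auto

lemma put_ident: "n = a + k + b \<Longrightarrow> put a (ident k) b \<approx> ident n"
proof -
  have "put a (ident k) b \<approx> Tens (ident a) (ident (k + b))"
    unfolding put_def by (intro eqv_Tens eqv_refl eqv_tens_id) auto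
  also have "\<dots> \<approx> ident (a + (k + b))" by (rule eqv_tens_id)
  finally show "n = a + k + b \<Longrightarrow> put a (ident k) b \<approx> ident n" by (simp add: add.assoc)
qed

lemma put_comp:
  assumes "welltyped f" "welltyped g" "msrc f = mtgt g"
  shows "put a (Comp f g) b \<approx> Comp (put a f b) (put a g b)"
proof -
  have "Comp (put a f b) (put a g b) \<approx> Tens (Comp (ident a) (ident a)) (Comp (Tens f (ident b)) (Tens g (ident b)))"
    unfolding put_def using assms by (intro eqv_interchange_even) (auto simp: parity_ident)
  also have "\<dots> \<approx> Tens (ident a) (Tens (Comp f g) (Comp (ident b) (ident b)))"
    using assms by (intro eqv_Tens eqv_id_left eqv_interchange_even) (auto simp: parity_ident)
  also have "\<dots> \<approx> put a (Comp f g) b"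
    unfolding put_def using assms by (intro eqv_Tens eqv_refl eqv_id_left) auto
  finally show ?thesis by (rule eqv_sym)
qed

lemma put_right:
  assumes "welltyped f"
  shows "put a (Tens f (ident k)) b \<approx> put a f (k + b)"
proof -
  have "Tens (Tens f (ident k)) (ident b) \<approx> Tens f (Tens (ident k) (ident b))"
    using assms by (intro eqv_tens_assoc) auto
  also have "\<dots> \<approx> Tens f (ident (k + b))" using assms by (intro eqv_Tens eqv_refl eqv_tens_id)
  finally have *: "Tens (Tens f (ident k)) (ident b) \<approx> Tens f (ident (k + b))" .
  show ?thesis unfolding put_def by (rule eqv_Tens[OF eqv_refl *]) simp
qed

lemma put_left:
  assumes "welltyped f"
  shows "put a (Tens (ident k) f) b \<approx> put (a + k) f b"
proof -
  have "put a (Tens (ident k) f) b \<approx> Tens (ident a) (Tens (ident k) (Tens f (ident b)))"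
    unfolding put_def using assms by (intro eqv_Tens eqv_refl eqv_tens_assoc) auto
  also have "\<dots> \<approx> Tens (Tens (ident a) (ident k)) (Tens f (ident b))"
    using assms by (intro eqv_sym[OF eqv_tens_assoc]) auto
  also have "\<dots> \<approx> put (a + k) f b"
    unfolding put_def using assms by (intro eqv_Tens eqv_refl eqv_tens_id) auto
  finally show ?thesis .
qed

lemma put_tens:
  assumes "welltyped f" "welltyped g"
  shows "put a (Tens f g) b \<approx> Comp (put a f (mtgt g + b)) (put (a + msrc f) g b)"
proof -
  have "put a (Tens f g) b \<approx> put a (Comp (Tens f (ident (mtgt g))) (Tens (ident (msrc f)) g)) b"
    using assms by (intro put_cong tens_left_right) auto
  also have "\<dots> \<approx> Comp (put a (Tens f (ident (mtgt g))) b) (put a (Tens (ident (msrc f)) g) b)"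
    using assms by (intro put_comp) auto
  also have "\<dots> \<approx> Comp (put a f (mtgt g + b)) (put (a + msrc f) g b)"
    using assms by (intro eqv_Comp put_right put_left) auto
  finally show ?thesis .
qed

lemma put_scale: "welltyped f \<Longrightarrow> put a (Scale c f) b \<approx> Scale c (put a f b)"
proof -
  assume f: "welltyped f"
  have "put a (Scale c f) b \<approx> Tens (ident a) (Scale c (Tens f (ident b)))"
    unfolding put_def using f by (intro eqv_Tens eqv_refl eqv_tens_scale_left) auto
  also have "\<dots> \<approx> Scale c (put a f b)" unfolding put_def using f by (intro eqv_tens_scale_right) auto
  finally show ?thesis .
qed

lemma put_add: "welltyped (Add f g) \<Longrightarrow> put a (Add f g) b \<approx> Add (put a f b) (put a g b)"
proof -
  assume f: "welltyped (Add f g)"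
  have "put a (Add f g) b \<approx> Tens (ident a) (Add (Tens f (ident b)) (Tens g (ident b)))"
    unfolding put_def using f by (intro eqv_Tens eqv_refl eqv_tens_add_left) auto
  also have "\<dots> \<approx> Add (put a f b) (put a g b)" unfolding put_def using f by (intro eqv_tens_add_right) auto
  finally show ?thesis .
qed

lemma put_far:
  assumes "welltyped f" "welltyped g" "has_parity f c" "has_parity g d"
  shows "Comp (put (a + mtgt f + e) g b) (put a f (e + msrc g + b)) \<approx>
    Scale (if c \<and> d then - 1 else 1) (Comp (put a f (e + mtgt g + b)) (put (a + msrc f + e) g b))"
proof -
  let ?g = "Tens (ident e) g" and ?s = "if c \<and> d then - 1 else 1"
  have pg: "has_parity ?g d" using assms parity_ident unfolding has_parity_iff by fastforce
  have wg: "welltyped ?g" using assms by simp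
  have "Comp (put (a + mtgt f + e) g b) (put a f (e + msrc g + b)) \<approx>
      Comp (put (a + mtgt f) ?g b) (put a (Tens f (ident (e + msrc g))) b)"
    using assms by (intro eqv_Comp eqv_sym[OF put_left] eqv_sym[OF put_right]) auto
  also have "\<dots> \<approx> Comp (put a (Tens (ident (mtgt f)) ?g) b) (put a (Tens f (ident (e + msrc g))) b)"
    using assms by (intro eqv_Comp eqv_sym[OF put_left] eqv_refl) auto
  also have "\<dots> \<approx> put a (Comp (Tens (ident (mtgt f)) ?g) (Tens f (ident (e + msrc g)))) b"
    using assms by (intro eqv_sym[OF put_comp]) auto
  also have "\<dots> \<approx> put a (Scale ?s (Tens f ?g)) b"
    using assms wg pg by (intro put_cong tens_right_left) auto
  also have "\<dots> \<approx> Scale ?s (put a (Tens f ?g) b)"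
    using assms by (intro put_scale) auto
  also have "\<dots> \<approx> Scale ?s (Comp (put a f (mtgt ?g + b)) (put (a + msrc f) ?g b))"
    using assms wg by (intro eqv_Scale put_tens) auto
  also have "\<dots> \<approx> Scale ?s (Comp (put a f (e + mtgt g + b)) (put (a + msrc f + e) g b))"
    using assms by (intro eqv_Scale eqv_Comp put_left) (auto intro!: eqv_refl)
  finally show ?thesis .
qed

end

section \<open>A span closed under crossings, cups and caps\<close>
text \<open>The span is defined by its closure properties, which suits the inductive arguments; it is compared with
linear combinations in \<open>lspan_finsum\<close>.\<close>

inductive_set lspan :: "('k::comm_ring_1, 'v, 'x) module_scheme \<Rightarrow> 'v set \<Rightarrow> 'v set" for M B where
  lspan_zero: "\<zero>\<^bsub>M\<^esub> \<in> lspan M B"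
| lspan_base: "x \<in> B \<Longrightarrow> x \<in> lspan M B"
| lspan_add: "x \<in> lspan M B \<Longrightarrow> y \<in> lspan M B \<Longrightarrow> x \<oplus>\<^bsub>M\<^esub> y \<in> lspan M B"
| lspan_smult: "x \<in> lspan M B \<Longrightarrow> c \<odot>\<^bsub>M\<^esub> x \<in> lspan M B"

abbreviation type_ring :: "'k::comm_ring_1 ring" where "type_ring \<equiv> ring_of_type_algebra"

lemma carrier_type_ring [simp]: "carrier type_ring = UNIV" "\<zero>\<^bsub>type_ring\<^esub> = 0" "\<one>\<^bsub>type_ring\<^esub> = 1"
    "x \<oplus>\<^bsub>type_ring\<^esub> y = x + y" "x \<otimes>\<^bsub>type_ring\<^esub> y = x * y"
  by (auto simp: ring_of_type_algebra_def)

text \<open>Modules indexed by the numbers of strands, on which the pieces act at every position, subject to the relations of the category. It is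
instantiated with the morphisms out of the unit object and with postcomposition. Positions are counted from 0.\<close>

locale brauer_ops =
  fixes q qi :: "'k::comm_ring_1" and M :: "nat \<Rightarrow> ('k, 'v) module"
    and opr :: "piece \<Rightarrow> nat \<Rightarrow> 'v \<Rightarrow> 'v" and unit_el :: 'v
  assumes q_inv: "q * qi = 1"
    and mods: "\<And>s. Module.module type_ring (M s)"
    and unit_carrier: "unit_el \<in> carrier (M 0)"
    and opr_closed: "\<And>p a v s s'. v \<in> carrier (M s) \<Longrightarrow> a + piece_src p \<le> s \<Longrightarrow> s' = s + piece_tgt p - piece_src p \<Longrightarrow> opr p a v \<in> carrier (M s')"
    and opr_add: "\<And>p a v w s s'. v \<in> carrier (M s) \<Longrightarrow> w \<in> carrier (M s) \<Longrightarrow> a + piece_src p \<le> s \<Longrightarrow> s' = s + piece_tgt p - piece_src p \<Longrightarrow>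
        opr p a (v \<oplus>\<^bsub>M s\<^esub> w) = opr p a v \<oplus>\<^bsub>M s'\<^esub> opr p a w"
    and opr_smult: "\<And>p a v c s s'. v \<in> carrier (M s) \<Longrightarrow> a + piece_src p \<le> s \<Longrightarrow> s' = s + piece_tgt p - piece_src p \<Longrightarrow>
        opr p a (c \<odot>\<^bsub>M s\<^esub> v) = c \<odot>\<^bsub>M s'\<^esub> opr p a v"
    and far: "\<And>p r a e v s. v \<in> carrier (M s) \<Longrightarrow> a + piece_src p + e + piece_src r \<le> s \<Longrightarrow> \<not> (is_odd p \<and> is_odd r) \<Longrightarrow>
        opr r (a + piece_tgt p + e) (opr p a v) = opr p a (opr r (a + piece_src p + e) v)"
    and far_odd: "\<And>p r a e v s s'. v \<in> carrier (M s) \<Longrightarrow> a + piece_src p + e + piece_src r \<le> s \<Longrightarrow> is_odd p \<Longrightarrow> is_odd r \<Longrightarrow>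
        s' = s + piece_tgt p + piece_tgt r - piece_src p - piece_src r \<Longrightarrow>
        opr r (a + piece_tgt p + e) (opr p a v) = (- 1) \<odot>\<^bsub>M s'\<^esub> opr p a (opr r (a + piece_src p + e) v)"
    and strands: "\<And>v s a k. v \<in> carrier (M s) \<Longrightarrow> a + k \<le> s \<Longrightarrow> opr (Strands k) a v = v"
    and XY: "\<And>v s a. v \<in> carrier (M s) \<Longrightarrow> a + 2 \<le> s \<Longrightarrow> opr CrossX a (opr CrossY a v) = v"
    and YX: "\<And>v s a. v \<in> carrier (M s) \<Longrightarrow> a + 2 \<le> s \<Longrightarrow> opr CrossY a (opr CrossX a v) = v"
    and skein: "\<And>v s a. v \<in> carrier (M s) \<Longrightarrow> a + 2 \<le> s \<Longrightarrow> opr CrossX a v = opr CrossY a v \<oplus>\<^bsub>M s\<^esub> (q - qi) \<odot>\<^bsub>M s\<^esub> v"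
    and braid: "\<And>v s a. v \<in> carrier (M s) \<Longrightarrow> a + 3 \<le> s \<Longrightarrow>
        opr CrossX a (opr CrossX (Suc a) (opr CrossX a v)) = opr CrossX (Suc a) (opr CrossX a (opr CrossX (Suc a) v))"
    and zigzag_left: "\<And>v s a. v \<in> carrier (M s) \<Longrightarrow> Suc a \<le> s \<Longrightarrow> opr Cap a (opr Cup (Suc a) v) = v"
    and zigzag_right: "\<And>v s a. v \<in> carrier (M s) \<Longrightarrow> Suc a \<le> s \<Longrightarrow> opr Cap (Suc a) (opr Cup a v) = (- 1) \<odot>\<^bsub>M s\<^esub> v"
    and X_cup: "\<And>v s s' a. v \<in> carrier (M s) \<Longrightarrow> a \<le> s \<Longrightarrow> s' = s + 2 \<Longrightarrow> opr CrossX a (opr Cup a v) = q \<odot>\<^bsub>M s'\<^esub> opr Cup a v"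
    and slide: "\<And>v s a. v \<in> carrier (M s) \<Longrightarrow> Suc a \<le> s \<Longrightarrow> opr CrossX (Suc a) (opr Cup a v) = opr CrossY a (opr Cup (Suc a) v)"
    and cap_cup: "\<And>v s a. v \<in> carrier (M s) \<Longrightarrow> a \<le> s \<Longrightarrow> opr Cap a (opr Cup a v) = \<zero>\<^bsub>M s\<^esub>"
begin

abbreviation "C s \<equiv> carrier (M s)"
abbreviation "xx \<equiv> opr CrossX"
abbreviation "yy \<equiv> opr CrossY"
abbreviation "cu \<equiv> opr Cup"
abbreviation "ca \<equiv> opr Cap"
abbreviation "z \<equiv> q - qi"

lemma closed [simp, intro]:
  "v \<in> C s \<Longrightarrow> a + 2 \<le> s \<Longrightarrow> xx a v \<in> C s"
  "v \<in> C s \<Longrightarrow> a + 2 \<le> s \<Longrightarrow> yy a v \<in> C s"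
  "v \<in> C s \<Longrightarrow> a \<le> s \<Longrightarrow> cu a v \<in> C (Suc (Suc s))"
  "v \<in> C (Suc (Suc s)) \<Longrightarrow> a \<le> s \<Longrightarrow> ca a v \<in> C s"
  by (auto intro: opr_closed)

lemma smult_closed' [simp, intro]: "v \<in> C s \<Longrightarrow> c \<odot>\<^bsub>M s\<^esub> v \<in> C s"
  using module.smult_closed[OF mods[of s], of c v] by simp
lemma add_closed' [simp, intro]: "v \<in> C s \<Longrightarrow> w \<in> C s \<Longrightarrow> v \<oplus>\<^bsub>M s\<^esub> w \<in> C s"
  using mods[of s] by (simp add: Module.module_def abelian_group_def abelian_monoid.a_closed)
lemma zero_closed' [simp, intro]: "\<zero>\<^bsub>M s\<^esub> \<in> C s"
  using mods[of s] by (simp add: Module.module_def abelian_group_def abelian_monoid.zero_closed)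
lemma smult_one' [simp]: "v \<in> C s \<Longrightarrow> 1 \<odot>\<^bsub>M s\<^esub> v = v"
  using module.smult_one[OF mods[of s], of v] by simp
lemma smult_smult: "v \<in> C s \<Longrightarrow> c \<odot>\<^bsub>M s\<^esub> (d \<odot>\<^bsub>M s\<^esub> v) = (c * d) \<odot>\<^bsub>M s\<^esub> v"
  using module.smult_assoc1[OF mods[of s], of c d v] by simp
lemma smult_add: "v \<in> C s \<Longrightarrow> (c + d) \<odot>\<^bsub>M s\<^esub> v = c \<odot>\<^bsub>M s\<^esub> v \<oplus>\<^bsub>M s\<^esub> d \<odot>\<^bsub>M s\<^esub> v"
  using module.smult_l_distr[OF mods[of s], of c d v] by simp
lemma smult_zero_left [simp]: "v \<in> C s \<Longrightarrow> 0 \<odot>\<^bsub>M s\<^esub> v = \<zero>\<^bsub>M s\<^esub>"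
  using module.smult_l_null[OF mods[of s], of v] by simp
lemma smult_zero_right [simp]: "c \<odot>\<^bsub>M s\<^esub> \<zero>\<^bsub>M s\<^esub> = \<zero>\<^bsub>M s\<^esub>"
  using module.smult_r_null[OF mods[of s], of c] by simp
lemma add_zero_right [simp]: "v \<in> C s \<Longrightarrow> v \<oplus>\<^bsub>M s\<^esub> \<zero>\<^bsub>M s\<^esub> = v"
  using mods[of s] by (simp add: Module.module_def abelian_group_def abelian_monoid.r_zero)
lemma add_assoc': "u \<in> C s \<Longrightarrow> v \<in> C s \<Longrightarrow> w \<in> C s \<Longrightarrow> (u \<oplus>\<^bsub>M s\<^esub> v) \<oplus>\<^bsub>M s\<^esub> w = u \<oplus>\<^bsub>M s\<^esub> (v \<oplus>\<^bsub>M s\<^esub> w)"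
  using mods[of s] by (simp add: Module.module_def abelian_group_def abelian_monoid.a_assoc)

lemma skein': "v \<in> C s \<Longrightarrow> a + 2 \<le> s \<Longrightarrow> yy a v = xx a v \<oplus>\<^bsub>M s\<^esub> (- z) \<odot>\<^bsub>M s\<^esub> v"
proof -
  assume v: "v \<in> C s" "a + 2 \<le> s"
  have "xx a v \<oplus>\<^bsub>M s\<^esub> (- z) \<odot>\<^bsub>M s\<^esub> v = yy a v \<oplus>\<^bsub>M s\<^esub> (z \<odot>\<^bsub>M s\<^esub> v \<oplus>\<^bsub>M s\<^esub> (- z) \<odot>\<^bsub>M s\<^esub> v)"
    unfolding skein[OF v] using v by (simp add: add_assoc')
  also have "z \<odot>\<^bsub>M s\<^esub> v \<oplus>\<^bsub>M s\<^esub> (- z) \<odot>\<^bsub>M s\<^esub> v = \<zero>\<^bsub>M s\<^esub>"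
    using smult_add[OF v(1), of z "- z"] v by simp
  finally show ?thesis using v by simp
qed

lemma yy_yy: "v \<in> C s \<Longrightarrow> a + 2 \<le> s \<Longrightarrow> yy a (yy a v) = v \<oplus>\<^bsub>M s\<^esub> (- z) \<odot>\<^bsub>M s\<^esub> yy a v"
  using skein'[of "yy a v" s a] by (simp add: XY)

lemma braid_yy:
  assumes "v \<in> C s" "a + 3 \<le> s"
  shows "yy a (yy (Suc a) (yy a v)) = yy (Suc a) (yy a (yy (Suc a) v))"
proof -
  define w where "w = yy (Suc a) (yy a (yy (Suc a) v))"
  have w: "w \<in> C s" using assms unfolding w_def by (intro closed) auto
  have "xx a (xx (Suc a) (xx a w)) = xx (Suc a) (xx a (xx (Suc a) w))" using w assms by (intro braid) auto
  also have "xx (Suc a) w = yy a (yy (Suc a) v)" unfolding w_def using assms by (intro XY[of _ s] closed) auto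
  also have "xx a \<dots> = yy (Suc a) v" using assms by (intro XY[of _ s] closed) auto
  also have "xx (Suc a) \<dots> = v" using assms by (intro XY) auto
  finally have v: "v = xx a (xx (Suc a) (xx a w))" ..
  have "yy a v = xx (Suc a) (xx a w)"
    unfolding arg_cong[OF v, of "yy a"] using w assms by (intro YX[of _ s] closed) auto
  moreover have "yy (Suc a) (xx (Suc a) (xx a w)) = xx a w" using w assms by (intro YX[of _ s] closed) auto
  moreover have "yy a (xx a w) = w" using w assms by (intro YX[of _ s]) auto
  ultimately show ?thesis unfolding w_def by simp
qed

lemma far_yy:
  assumes "v \<in> C s" "i + 2 \<le> j" "j + 2 \<le> s"
  shows "yy j (yy i v) = yy i (yy j v)"
proof -
  obtain e where j: "j = i + 2 + e" using assms(2) le_Suc_ex by blast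
  show ?thesis using far[of v s i CrossY e CrossY] assms(1,3) unfolding j by simp
qed
lemma far_xy:
  assumes "v \<in> C s" "i + 2 \<le> j" "j + 2 \<le> s"
  shows "xx i (yy j v) = yy j (xx i v)"
proof -
  obtain e where j: "j = i + 2 + e" using assms(2) le_Suc_ex by blast
  show ?thesis using far[of v s i CrossX e CrossY] assms(1,3) unfolding j by simp
qed
lemma yy_cu_right:
  assumes "v \<in> C s" "i \<le> j" "j + 2 \<le> s"
  shows "yy (Suc (Suc j)) (cu i v) = cu i (yy j v)"
proof -
  obtain e where j: "j = i + e" using assms(2) le_Suc_ex by blast
  show ?thesis using far[of v s i Cup e CrossY] assms(1,3) unfolding j by simp
qed
lemma yy_cu_left:
  assumes "v \<in> C s" "i + 2 \<le> j" "j \<le> s"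
  shows "cu j (yy i v) = yy i (cu j v)"
proof -
  obtain e where j: "j = i + 2 + e" using assms(2) le_Suc_ex by blast
  show ?thesis using far[of v s i CrossY e Cup] assms(1,3) unfolding j by simp
qed
lemma ca_yy_left:
  assumes "v \<in> C s" "i + 2 \<le> j" "j + 2 \<le> s"
  shows "ca j (yy i v) = yy i (ca j v)"
proof -
  obtain e where j: "j = i + 2 + e" using assms(2) le_Suc_ex by blast
  show ?thesis using far[of v s i CrossY e Cap] assms(1,3) unfolding j by simp
qed
lemma ca_yy_right:
  assumes "v \<in> C s" "i \<le> j" "j + 4 \<le> s"
  shows "ca i (yy (Suc (Suc j)) v) = yy j (ca i v)"
proof -
  obtain e where j: "j = i + e" using assms(2) le_Suc_ex by blast
  show ?thesis using far[of v s i Cap e CrossY] assms(1,3) unfolding j by simp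
qed
lemma ca_xx_right:
  assumes "v \<in> C s" "i \<le> j" "j + 4 \<le> s"
  shows "ca i (xx (Suc (Suc j)) v) = xx j (ca i v)"
proof -
  obtain e where j: "j = i + e" using assms(2) le_Suc_ex by blast
  show ?thesis using far[of v s i Cap e CrossX] assms(1,3) unfolding j by simp
qed
lemma cu_cu:
  assumes "v \<in> C s" "i \<le> j" "j \<le> s"
  shows "cu (Suc (Suc j)) (cu i v) = (- 1) \<odot>\<^bsub>M (Suc (Suc (Suc (Suc s))))\<^esub> cu i (cu j v)"
proof -
  obtain e where j: "j = i + e" using assms(2) le_Suc_ex by blast
  show ?thesis using far_odd[of v s i Cup e Cup "Suc (Suc (Suc (Suc s)))"] assms(1,3) unfolding j by simp
qed
lemma ca_cu:
  assumes "v \<in> C s" "i \<le> j" "j + 2 \<le> s"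
  shows "ca (Suc (Suc j)) (cu i v) = (- 1) \<odot>\<^bsub>M s\<^esub> cu i (ca j v)"
proof -
  obtain e where j: "j = i + e" using assms(2) le_Suc_ex by blast
  show ?thesis using far_odd[of v s i Cup e Cap s] assms(1,3) unfolding j by simp
qed
lemma ca_ca:
  assumes "v \<in> C (Suc (Suc (Suc (Suc s))))" "i \<le> j" "j \<le> s"
  shows "ca j (ca i v) = (- 1) \<odot>\<^bsub>M s\<^esub> ca i (ca (Suc (Suc j)) v)"
proof -
  obtain e where j: "j = i + e" using assms(2) le_Suc_ex by blast
  show ?thesis using far_odd[of v "Suc (Suc (Suc (Suc s)))" i Cap e Cap s] assms(1,3) unfolding j by simp
qed

lemma slide_over:
  assumes "v \<in> C s" "Suc a \<le> s"
  shows "cu a v = yy (Suc a) (yy a (cu (Suc a) v))"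
  using YX[of "cu a v" "Suc (Suc s)" "Suc a"] slide[OF assms] assms by simp

lemma minus_minus_smult: "v \<in> C s \<Longrightarrow> (- 1) \<odot>\<^bsub>M s\<^esub> ((- 1) \<odot>\<^bsub>M s\<^esub> v) = v"
  by (simp add: smult_smult)

text \<open>A crossing rotated by a right angle is the opposite crossing, up to the sign of the zigzag.\<close>

lemma rotate_yy:
  assumes "v \<in> C s" "a + 2 \<le> s"
  shows "yy a v = (- 1) \<odot>\<^bsub>M s\<^esub> ca (Suc (Suc a)) (xx (Suc a) (cu a v))"
proof -
  have "xx (Suc a) (cu a v) = yy a (cu (Suc a) v)" using assms by (intro slide[of _ s]) auto
  then have "ca (Suc (Suc a)) (xx (Suc a) (cu a v)) = yy a (ca (Suc (Suc a)) (cu (Suc a) v))"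
    using assms by (simp add: ca_yy_left[of _ "Suc (Suc s)"])
  also have "\<dots> = (- 1) \<odot>\<^bsub>M s\<^esub> yy a v"
    using assms by (simp add: zigzag_right[of _ s] opr_smult[of _ s])
  finally show ?thesis using assms by (simp add: minus_minus_smult)
qed

lemma cap_slide:
  assumes "v \<in> C s" "a + 3 \<le> s"
  shows "ca a (yy (Suc a) v) = ca (Suc a) (xx a v)"
proof -
  obtain n where n: "s = Suc (Suc n)" using assms by (metis add_2_eq_Suc le_Suc_ex numeral_3_eq_3 add_Suc_right add_Suc)
  let ?w = "xx (Suc (Suc a)) (cu (Suc a) v)"
  have w: "?w \<in> C (Suc (Suc s))" using assms by simp
  have "ca a (yy (Suc a) v) = ca a ((- 1) \<odot>\<^bsub>M s\<^esub> ca (Suc (Suc (Suc a))) ?w)"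
    using rotate_yy[of v s "Suc a"] assms by simp
  also have "\<dots> = (- 1) \<odot>\<^bsub>M n\<^esub> ca a (ca (Suc (Suc (Suc a))) ?w)"
    using assms n by (intro opr_smult) auto
  also have "\<dots> = ca (Suc a) (ca a ?w)"
    using ca_ca[of ?w n a "Suc a"] w n assms by simp
  also have "ca a ?w = xx a (ca a (cu (Suc a) v))"
    using assms by (intro ca_xx_right[of _ "Suc (Suc s)"]) auto
  also have "ca a (cu (Suc a) v) = v" using assms by (intro zigzag_left) auto
  finally show ?thesis .
qed

text \<open>The relation between a crossing and a cap is not among the defining ones. It follows from the relation
between a crossing and a cup by rotation.\<close>

lemma cap_yy:
  assumes "v \<in> C (Suc (Suc s))" "a \<le> s"
  shows "ca a (yy a v) = (- q) \<odot>\<^bsub>M s\<^esub> ca a v"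
proof -
  let ?S = "Suc (Suc s)"
  let ?c = "cu a v"
  have c: "?c \<in> C (Suc (Suc ?S))" using assms by auto
  have "ca a (xx (Suc a) ?c) = ca a (yy (Suc a) ?c \<oplus>\<^bsub>M (Suc (Suc ?S))\<^esub> z \<odot>\<^bsub>M (Suc (Suc ?S))\<^esub> ?c)"
    using c assms by (subst skein[of _ "Suc (Suc ?S)"]) auto
  also have "\<dots> = ca a (yy (Suc a) ?c) \<oplus>\<^bsub>M ?S\<^esub> z \<odot>\<^bsub>M ?S\<^esub> ca a ?c"
    using c assms by (subst opr_add[of _ "Suc (Suc ?S)" _ _ _ ?S]) (auto simp: opr_smult[of _ "Suc (Suc ?S)" _ _ ?S])
  also have "ca a ?c = \<zero>\<^bsub>M ?S\<^esub>" using assms by (intro cap_cup) auto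
  also have "ca a (yy (Suc a) ?c) = ca (Suc a) (xx a ?c)" using c assms by (intro cap_slide) auto
  also have "xx a ?c = q \<odot>\<^bsub>M (Suc (Suc ?S))\<^esub> ?c" using assms by (intro X_cup) auto
  also have "ca (Suc a) \<dots> = q \<odot>\<^bsub>M ?S\<^esub> ca (Suc a) ?c" using c assms by (intro opr_smult) auto
  also have "ca (Suc a) ?c = (- 1) \<odot>\<^bsub>M ?S\<^esub> v" using assms by (intro zigzag_right) auto
  finally have e: "ca a (xx (Suc a) ?c) = (- q) \<odot>\<^bsub>M ?S\<^esub> v" using assms by (simp add: smult_smult)
  have "ca a (yy a v) = ca a ((- 1) \<odot>\<^bsub>M ?S\<^esub> ca (Suc (Suc a)) (xx (Suc a) ?c))"
    using rotate_yy[of v ?S a] assms by simp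
  also have "\<dots> = (- 1) \<odot>\<^bsub>M s\<^esub> ca a (ca (Suc (Suc a)) (xx (Suc a) ?c))"
    using c assms by (intro opr_smult) auto
  also have "\<dots> = ca a (ca a (xx (Suc a) ?c))" using ca_ca[of "xx (Suc a) ?c" s a a] c assms by simp
  also have "\<dots> = (- q) \<odot>\<^bsub>M s\<^esub> ca a v" unfolding e using assms by (intro opr_smult) auto
  finally show ?thesis .
qed

text \<open>A new strand which starts at the left and ends behind \<open>k\<close> of the other ends, passing below the strands
between its ends.\<close>

primrec under_strand :: "nat \<Rightarrow> 'v \<Rightarrow> 'v" where
  "under_strand 0 v = cu 0 v"
| "under_strand (Suc k) v = yy (Suc k) (under_strand k v)"

abbreviation "us \<equiv> under_strand"

lemma us_closed [simp]: "v \<in> C s \<Longrightarrow> k \<le> s \<Longrightarrow> us k v \<in> C (Suc (Suc s))"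
  by (induction k) auto

lemma us_add: "v \<in> C s \<Longrightarrow> w \<in> C s \<Longrightarrow> k \<le> s \<Longrightarrow> us k (v \<oplus>\<^bsub>M s\<^esub> w) = us k v \<oplus>\<^bsub>M (Suc (Suc s))\<^esub> us k w"
  by (induction k) (auto simp: opr_add[of _ s _ _ _ "Suc (Suc s)"] opr_add[of _ "Suc (Suc s)" _ _ _ "Suc (Suc s)"])
lemma us_smult: "v \<in> C s \<Longrightarrow> k \<le> s \<Longrightarrow> us k (c \<odot>\<^bsub>M s\<^esub> v) = c \<odot>\<^bsub>M (Suc (Suc s))\<^esub> us k v"
  by (induction k) (auto simp: opr_smult[of _ s _ _ "Suc (Suc s)"] opr_smult[of _ "Suc (Suc s)" _ _ "Suc (Suc s)"])

lemma yy_us_right: "v \<in> C s \<Longrightarrow> k \<le> i \<Longrightarrow> i + 2 \<le> s \<Longrightarrow> yy (Suc (Suc i)) (us k v) = us k (yy i v)"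
proof (induction k)
  case 0 then show ?case by (simp add: yy_cu_right)
next
  case (Suc k)
  then have "yy (Suc (Suc i)) (yy (Suc k) (us k v)) = yy (Suc k) (yy (Suc (Suc i)) (us k v))"
    by (intro far_yy[of _ "Suc (Suc s)"]) auto
  then show ?case using Suc by simp
qed

lemma yy_us_left: "v \<in> C s \<Longrightarrow> Suc i < k \<Longrightarrow> k \<le> s \<Longrightarrow> yy (Suc i) (us k v) = us k (yy i v)"
proof (induction k)
  case (Suc k)
  show ?case
  proof (cases "Suc i = k")
    case True
    have "yy k (yy (Suc k) (yy k (us i v))) = yy (Suc k) (yy k (yy (Suc k) (us i v)))"
      using Suc True by (intro braid_yy[of _ "Suc (Suc s)"]) auto
    moreover have "yy (Suc k) (us i v) = us i (yy i v)" using yy_us_right[of v s i i] Suc True by simp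
    ultimately show ?thesis using True by auto
  next
    case False
    then have "yy (Suc i) (yy (Suc k) (us k v)) = yy (Suc k) (yy (Suc i) (us k v))"
      using Suc by (intro far_yy[of _ "Suc (Suc s)", symmetric]) auto
    then show ?thesis using Suc False by simp
  qed
qed simp

text \<open>Moving the right end of the strand back by the opposite crossing costs a skein term.\<close>

lemma yy_us_back: "v \<in> C s \<Longrightarrow> Suc k \<le> s \<Longrightarrow>
    yy (Suc k) (us (Suc k) v) = us k v \<oplus>\<^bsub>M (Suc (Suc s))\<^esub> (- z) \<odot>\<^bsub>M (Suc (Suc s))\<^esub> us (Suc k) v"
  by (simp add: yy_yy[of _ "Suc (Suc s)"])

lemma cu_us_right: "v \<in> C s \<Longrightarrow> k \<le> i \<Longrightarrow> i \<le> s \<Longrightarrow>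
    cu (Suc (Suc i)) (us k v) = (- 1) \<odot>\<^bsub>M (Suc (Suc (Suc (Suc s))))\<^esub> us k (cu i v)"
proof (induction k)
  case 0 then show ?case by (simp add: cu_cu)
next
  case (Suc k)
  then have "cu (Suc (Suc i)) (yy (Suc k) (us k v)) = yy (Suc k) (cu (Suc (Suc i)) (us k v))"
    by (intro yy_cu_left[of _ "Suc (Suc s)"]) auto
  then show ?case using Suc by (simp add: opr_smult[of _ "Suc (Suc (Suc (Suc s)))" _ _ "Suc (Suc (Suc (Suc s)))"])
qed

lemma cu_us_left: "v \<in> C s \<Longrightarrow> i \<le> k \<Longrightarrow> k \<le> s \<Longrightarrow>
    cu (Suc i) (us k v) = (- 1) \<odot>\<^bsub>M (Suc (Suc (Suc (Suc s))))\<^esub> us (Suc (Suc k)) (cu i v)"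
proof (induction k)
  case 0
  have "cu (Suc 0) (cu 0 v) = yy (Suc (Suc 0)) (yy (Suc 0) (cu (Suc (Suc 0)) (cu 0 v)))"
    using 0 by (intro slide_over[of _ "Suc (Suc s)"]) auto
  then show ?case using 0
    by (simp add: cu_cu opr_smult[of _ "Suc (Suc (Suc (Suc s)))" _ _ "Suc (Suc (Suc (Suc s)))"])
next
  case (Suc k)
  let ?n = "Suc (Suc (Suc (Suc s)))"
  show ?case
  proof (cases "i = Suc k")
    case True
    have "cu (Suc i) (us i v) = yy (Suc (Suc i)) (yy (Suc i) (cu (Suc (Suc i)) (us i v)))"
      using Suc True by (intro slide_over[of _ "Suc (Suc s)"]) (auto simp del: under_strand.simps)
    also have "cu (Suc (Suc i)) (us i v) = (- 1) \<odot>\<^bsub>M ?n\<^esub> us i (cu i v)"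
      using Suc True by (intro cu_us_right) (auto simp del: under_strand.simps)
    finally show ?thesis using Suc True
      by (simp add: opr_smult[of _ ?n _ _ ?n])
  next
    case False
    then have "cu (Suc i) (yy (Suc k) (us k v)) = yy (Suc (Suc (Suc k))) (cu (Suc i) (us k v))"
      using Suc by (intro yy_cu_right[of _ "Suc (Suc s)", symmetric]) auto
    then show ?thesis using Suc False by (simp add: opr_smult[of _ ?n _ _ ?n])
  qed
qed

lemma xx0_us: "v \<in> C s \<Longrightarrow> Suc 0 \<le> s \<Longrightarrow>
    xx 0 (us (Suc 0) v) = cu (Suc 0) v \<oplus>\<^bsub>M (Suc (Suc s))\<^esub> (- z * q) \<odot>\<^bsub>M (Suc (Suc s))\<^esub> us 0 v"
proof -
  assume v: "v \<in> C s" "Suc 0 \<le> s"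
  let ?n = "Suc (Suc s)"
  have "xx 0 (us (Suc 0) v) = xx 0 (xx (Suc 0) (cu 0 v) \<oplus>\<^bsub>M ?n\<^esub> (- z) \<odot>\<^bsub>M ?n\<^esub> cu 0 v)"
    using v by (simp add: skein'[of _ ?n])
  also have "\<dots> = xx 0 (xx (Suc 0) (cu 0 v)) \<oplus>\<^bsub>M ?n\<^esub> (- z) \<odot>\<^bsub>M ?n\<^esub> xx 0 (cu 0 v)"
    using v by (subst opr_add[of _ ?n _ _ _ ?n]) (auto simp: opr_smult[of _ ?n _ _ ?n])
  also have "xx (Suc 0) (cu 0 v) = yy 0 (cu (Suc 0) v)" using v by (intro slide)
  also have "xx 0 \<dots> = cu (Suc 0) v" using v by (intro XY) auto
  also have "xx 0 (cu 0 v) = q \<odot>\<^bsub>M ?n\<^esub> cu 0 v" using v by (intro X_cup) auto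
  finally show ?thesis using v by (simp add: smult_smult)
qed

lemma xx0_us_Suc: "v \<in> C s \<Longrightarrow> Suc (Suc k) \<le> s \<Longrightarrow> xx 0 (us (Suc (Suc k)) v) = yy (Suc (Suc k)) (xx 0 (us (Suc k) v))"
  by (simp add: far_xy[of _ "Suc (Suc s)"])

lemma yy0_us0: "v \<in> C s \<Longrightarrow> yy 0 (us 0 v) = qi \<odot>\<^bsub>M (Suc (Suc s))\<^esub> us 0 v"
proof -
  assume v: "v \<in> C s"
  let ?n = "Suc (Suc s)"
  have "yy 0 (xx 0 (cu 0 v)) = cu 0 v" using v by (intro YX) auto
  then have "q \<odot>\<^bsub>M ?n\<^esub> yy 0 (cu 0 v) = cu 0 v"
    using v by (simp add: X_cup[of _ s 0 ?n] opr_smult[of _ ?n _ _ ?n])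
  then have "qi \<odot>\<^bsub>M ?n\<^esub> (q \<odot>\<^bsub>M ?n\<^esub> yy 0 (cu 0 v)) = qi \<odot>\<^bsub>M ?n\<^esub> cu 0 v" by simp
  then show ?thesis using v q_inv by (simp add: smult_smult mult.commute)
qed

lemma ca_us_right: "v \<in> C (Suc (Suc s)) \<Longrightarrow> k \<le> i \<Longrightarrow> i \<le> s \<Longrightarrow>
    ca (Suc (Suc i)) (us k v) = (- 1) \<odot>\<^bsub>M (Suc (Suc s))\<^esub> us k (ca i v)"
proof (induction k)
  case 0 then show ?case by (simp add: ca_cu)
next
  case (Suc k)
  let ?n = "Suc (Suc s)"
  have "ca (Suc (Suc i)) (yy (Suc k) (us k v)) = yy (Suc k) (ca (Suc (Suc i)) (us k v))"
    using Suc by (intro ca_yy_left[of _ "Suc (Suc ?n)"]) auto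
  then show ?case using Suc by (simp add: opr_smult[of _ ?n _ _ ?n])
qed

lemma ca_us_first: "v \<in> C s \<Longrightarrow> Suc 0 \<le> s \<Longrightarrow> ca 0 (us (Suc 0) v) = (- q) \<odot>\<^bsub>M s\<^esub> v"
proof -
  assume v: "v \<in> C s" "Suc 0 \<le> s"
  let ?n = "Suc (Suc s)"
  have "ca 0 (yy (Suc 0) (cu 0 v)) = ca (Suc 0) (xx 0 (cu 0 v))" using v by (intro cap_slide[of _ ?n]) auto
  also have "xx 0 (cu 0 v) = q \<odot>\<^bsub>M ?n\<^esub> cu 0 v" using v by (intro X_cup) auto
  also have "ca (Suc 0) \<dots> = q \<odot>\<^bsub>M s\<^esub> ca (Suc 0) (cu 0 v)" using v by (intro opr_smult) auto
  also have "ca (Suc 0) (cu 0 v) = (- 1) \<odot>\<^bsub>M s\<^esub> v" using v by (intro zigzag_right) auto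
  finally show ?thesis using v by (simp add: smult_smult)
qed

lemma ca_us_first_Suc: "v \<in> C s \<Longrightarrow> Suc (Suc k) \<le> s \<Longrightarrow> ca 0 (us (Suc (Suc k)) v) = yy k (ca 0 (us (Suc k) v))"
  using ca_yy_right[of "us (Suc k) v" "Suc (Suc s)" 0 k] by simp

lemma ca_us_end_0: "v \<in> C s \<Longrightarrow> Suc 0 \<le> s \<Longrightarrow> ca (Suc 0) (us 0 v) = (- 1) \<odot>\<^bsub>M s\<^esub> v"
  by (simp add: zigzag_right)

lemma ca_us_end_Suc: "v \<in> C (Suc (Suc s)) \<Longrightarrow> k \<le> s \<Longrightarrow>
    ca (Suc (Suc k)) (us (Suc k) v) = ca (Suc k) (us k (yy k v)) \<oplus>\<^bsub>M (Suc (Suc s))\<^esub> z \<odot>\<^bsub>M (Suc (Suc s))\<^esub> us k (ca k v)"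
proof -
  assume v: "v \<in> C (Suc (Suc s))" "k \<le> s"
  let ?n = "Suc (Suc s)" and ?N = "Suc (Suc (Suc (Suc s)))" and ?w = "us k v"
  have w: "?w \<in> C ?N" using v by simp
  have "ca (Suc (Suc k)) (yy (Suc k) ?w) = ca (Suc (Suc k)) (xx (Suc k) ?w \<oplus>\<^bsub>M ?N\<^esub> (- z) \<odot>\<^bsub>M ?N\<^esub> ?w)"
    using v w by (simp add: skein'[of _ ?N])
  also have "\<dots> = ca (Suc (Suc k)) (xx (Suc k) ?w) \<oplus>\<^bsub>M ?n\<^esub> (- z) \<odot>\<^bsub>M ?n\<^esub> ca (Suc (Suc k)) ?w"
    using v w by (subst opr_add[of _ ?N _ _ _ ?n]) (auto simp: opr_smult[of _ ?N _ _ ?n])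
  also have "ca (Suc (Suc k)) (xx (Suc k) ?w) = ca (Suc k) (yy (Suc (Suc k)) ?w)"
    using v w by (intro cap_slide[of _ ?N, symmetric]) auto
  also have "yy (Suc (Suc k)) ?w = us k (yy k v)" using v by (intro yy_us_right) auto
  also have "ca (Suc (Suc k)) ?w = (- 1) \<odot>\<^bsub>M ?n\<^esub> us k (ca k v)" using v by (intro ca_us_right) auto
  finally show ?thesis using v by (simp add: smult_smult)
qed

lemma ca_us_back: "v \<in> C s \<Longrightarrow> Suc k \<le> s \<Longrightarrow> ca (Suc k) (us (Suc k) v) = (- q) \<odot>\<^bsub>M s\<^esub> ca (Suc k) (us k v)"
  by (simp add: cap_yy)

lemma ca_us_left: "v \<in> C (Suc (Suc s)) \<Longrightarrow> i \<le> k \<Longrightarrow> k \<le> s \<Longrightarrow>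
    ca (Suc i) (us (Suc (Suc k)) v) = (- 1) \<odot>\<^bsub>M (Suc (Suc s))\<^esub> us k (ca i v)"
proof (induction k)
  case 0
  let ?n = "Suc (Suc s)" and ?N = "Suc (Suc (Suc (Suc s)))"
  have "ca (Suc 0) (yy (Suc (Suc 0)) (yy (Suc 0) (us 0 v))) = ca (Suc (Suc 0)) (xx (Suc 0) (yy (Suc 0) (us 0 v)))"
    using 0 by (intro cap_slide[of _ ?N]) auto
  also have "xx (Suc 0) (yy (Suc 0) (us 0 v)) = us 0 v" using 0 by (intro XY[of _ ?N]) auto
  also have "ca (Suc (Suc 0)) (us 0 v) = (- 1) \<odot>\<^bsub>M ?n\<^esub> us 0 (ca 0 v)" using 0 by (intro ca_us_right) auto
  finally show ?case using 0 by simp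
next
  case (Suc k)
  let ?n = "Suc (Suc s)" and ?N = "Suc (Suc (Suc (Suc s)))"
  show ?case
  proof (cases "i = Suc k")
    case True
    have "ca (Suc i) (yy (Suc (Suc i)) (yy (Suc i) (us i v))) = ca (Suc (Suc i)) (xx (Suc i) (yy (Suc i) (us i v)))"
      using Suc True by (intro cap_slide[of _ ?N]) (auto simp del: under_strand.simps)
    also have "xx (Suc i) (yy (Suc i) (us i v)) = us i v"
      using Suc True by (intro XY[of _ ?N]) (auto simp del: under_strand.simps)
    also have "ca (Suc (Suc i)) (us i v) = (- 1) \<odot>\<^bsub>M ?n\<^esub> us i (ca i v)"
      using Suc True by (intro ca_us_right) (auto simp del: under_strand.simps)
    finally show ?thesis using True by simp
  next
    case False
    have "ca (Suc i) (yy (Suc (Suc (Suc k))) (us (Suc (Suc k)) v)) = yy (Suc k) (ca (Suc i) (us (Suc (Suc k)) v))"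
      using Suc False by (intro ca_yy_right[of _ ?N]) (auto simp del: under_strand.simps)
    then show ?thesis using Suc False by (simp add: opr_smult[of _ ?n _ _ ?n])
  qed
qed

text \<open>Peeling off the strand at the leftmost end, which passes below all others, leaves a diagram of
the same kind. The number of such diagrams with \<open>s\<close> ends is the number of perfect matchings.\<close>

fun diagram_span_basis :: "nat \<Rightarrow> 'v set" where
  "diagram_span_basis 0 = {unit_el}"
| "diagram_span_basis (Suc 0) = {}"
| "diagram_span_basis (Suc (Suc s)) = (\<Union>k\<in>{..s}. us k ` diagram_span_basis s)"

abbreviation "TT \<equiv> diagram_span_basis"
abbreviation "W s \<equiv> lspan (M s) (TT s)"

lemma TT_closed: "v \<in> TT s \<Longrightarrow> v \<in> C s"
  by (induction s arbitrary: v rule: diagram_span_basis.induct) (auto simp: unit_carrier)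

declare diagram_span_basis.simps(3) [simp del]

lemma lspan_closed: "B \<subseteq> C s \<Longrightarrow> v \<in> lspan (M s) B \<Longrightarrow> v \<in> C s"
  by (erule lspan.induct) auto

lemma W_closed: "v \<in> W s \<Longrightarrow> v \<in> C s"
  using lspan_closed[of "TT s" s v] TT_closed by blast

lemma W_smult: "v \<in> W s \<Longrightarrow> c \<odot>\<^bsub>M s\<^esub> v \<in> W s" by (rule lspan_smult)
lemma W_add: "v \<in> W s \<Longrightarrow> w \<in> W s \<Longrightarrow> v \<oplus>\<^bsub>M s\<^esub> w \<in> W s" by (rule lspan_add)

text \<open>A linear map is determined on the span by its values at the generators.\<close>

lemma W_map:
  assumes add: "\<And>v w. v \<in> C s \<Longrightarrow> w \<in> C s \<Longrightarrow> f (v \<oplus>\<^bsub>M s\<^esub> w) = f v \<oplus>\<^bsub>M t\<^esub> f w"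
    and smult: "\<And>c v. v \<in> C s \<Longrightarrow> f (c \<odot>\<^bsub>M s\<^esub> v) = c \<odot>\<^bsub>M t\<^esub> f v"
    and cl: "\<And>v. v \<in> C s \<Longrightarrow> f v \<in> C t"
    and base: "\<And>v. v \<in> TT s \<Longrightarrow> f v \<in> W t" and v: "v \<in> W s"
  shows "f v \<in> W t"
  using v
proof (induction rule: lspan.induct)
  case lspan_zero
  have "f (\<zero>\<^bsub>M s\<^esub>) = f (0 \<odot>\<^bsub>M s\<^esub> \<zero>\<^bsub>M s\<^esub>)" by simp
  also have "\<dots> = 0 \<odot>\<^bsub>M t\<^esub> f (\<zero>\<^bsub>M s\<^esub>)" by (rule smult) simp
  also have "\<dots> = \<zero>\<^bsub>M t\<^esub>" using cl by simp
  finally show ?case by (simp add: lspan.lspan_zero)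
next
  case (lspan_base x) then show ?case by (rule base)
next
  case (lspan_add x y)
  then show ?case using add[of x y] W_closed by (simp add: W_add)
next
  case (lspan_smult x c)
  then show ?case using smult[of x c] W_closed by (simp add: W_smult)
qed

lemma W_opr:
  assumes "\<And>v. v \<in> TT s \<Longrightarrow> opr p a v \<in> W t" "a + piece_src p \<le> s" "t = s + piece_tgt p - piece_src p" "v \<in> W s"
  shows "opr p a v \<in> W t"
proof (rule W_map[of s "opr p a" t, OF _ _ _ assms(1) assms(4)])
  show "opr p a (v \<oplus>\<^bsub>M s\<^esub> w) = opr p a v \<oplus>\<^bsub>M t\<^esub> opr p a w" if "v \<in> C s" "w \<in> C s" for v w
    by (rule opr_add[OF that assms(2,3)])
  show "opr p a (c \<odot>\<^bsub>M s\<^esub> v) = c \<odot>\<^bsub>M t\<^esub> opr p a v" if "v \<in> C s" for c v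
    by (rule opr_smult[OF that assms(2,3)])
  show "opr p a v \<in> C t" if "v \<in> C s" for v by (rule opr_closed[OF that assms(2,3)])
qed

lemma W_us: "v \<in> W s \<Longrightarrow> k \<le> s \<Longrightarrow> us k v \<in> W (Suc (Suc s))"
  by (rule W_map[of s "us k"]) (auto simp: us_add us_smult diagram_span_basis.simps(3) intro!: lspan_base)

lemma position_cases:
  fixes a b k :: nat
  shows "a = 0 \<or> (\<exists>i. a = Suc i \<and> i \<le> k) \<or> (\<exists>i. a = Suc (Suc i) \<and> k \<le> i)"
    "b = k \<or> k = Suc b \<or> (\<exists>i. b = Suc i \<and> k \<le> i) \<or> (\<exists>j. k = Suc (Suc j) \<and> b \<le> j)"
    "Suc (Suc a) \<le> k \<Longrightarrow> \<exists>n. k = Suc (Suc n)"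
  by presburger+

text \<open>By induction on the number of ends: a piece which does not touch the ends of the leftmost strand can be pulled
through this strand, and the few other positions are covered by the relations. The two claims are proved together, because
a crossing at the leftmost position turns the strand into a cup away from the left border.\<close>

lemma W_yy: "v \<in> W s \<Longrightarrow> a + 2 \<le> s \<Longrightarrow> yy a v \<in> W s"
  and W_cu: "v \<in> W s \<Longrightarrow> a \<le> s \<Longrightarrow> cu a v \<in> W (Suc (Suc s))"
proof -
  have "(\<forall>a v. v \<in> W s \<longrightarrow> a + 2 \<le> s \<longrightarrow> yy a v \<in> W s) \<and> (\<forall>a v. v \<in> W s \<longrightarrow> a \<le> s \<longrightarrow> cu a v \<in> W (Suc (Suc s)))" for s
  proof (induction s rule: diagram_span_basis.induct)
    case 1
    have "cu 0 v \<in> W (Suc (Suc 0))" if "v \<in> W 0" for v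
      using W_us[OF that, of 0] by simp
    then show ?case by auto
  next
    case 2
    have "cu a v \<in> W (Suc (Suc (Suc 0)))" if "v \<in> W (Suc 0)" "a \<le> Suc 0" for a v
      by (rule W_opr[OF _ _ _ that(1)]) (use that in simp_all)
    then show ?case by simp
  next
    case (3 s)
    let ?n = "Suc (Suc s)"
    have IHy: "\<And>a v. v \<in> W s \<Longrightarrow> a + 2 \<le> s \<Longrightarrow> yy a v \<in> W s"
      and IHc: "\<And>a v. v \<in> W s \<Longrightarrow> a \<le> s \<Longrightarrow> cu a v \<in> W ?n"
      using 3 by blast+
    have gen: "\<And>v. v \<in> TT s \<Longrightarrow> v \<in> W s" by (rule lspan_base)
    have upper: "yy (Suc a) w \<in> W ?n" if "w \<in> W ?n" "Suc a + 2 \<le> ?n" for a w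
    proof (rule W_opr[OF _ _ _ that(1)])
      fix u assume "u \<in> TT ?n"
      then obtain k v where u: "u = us k v" "k \<le> s" "v \<in> TT s" by (auto simp: diagram_span_basis.simps(3))
      have v: "v \<in> C s" "v \<in> W s" using u TT_closed gen by auto
      consider "a = k" | "Suc a = k" | "Suc (Suc k) \<le> Suc a" "Suc k \<le> a" | "Suc a < k" by linarith
      then show "yy (Suc a) u \<in> W ?n"
      proof cases
        case 1
        then have "yy (Suc a) u = us (Suc k) v" using u by simp
        then show ?thesis using W_us[OF v(2), of "Suc k"] 1 that(2) by simp
      next
        case 2
        then show ?thesis using yy_us_back[OF v(1), of a] W_us[OF v(2)] u that(2)
          by (metis W_add W_smult Suc_leD)
      next
        case 3
        then obtain i where i: "a = Suc i" by (cases a) auto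
        then show ?thesis using yy_us_right[OF v(1), of k i] W_us[OF IHy[OF v(2)], of i k] u 3 that(2) by simp
      next
        case 4
        then show ?thesis using yy_us_left[OF v(1), of a k] W_us[OF IHy[OF v(2)], of a k] u by simp
      qed
    qed (use that in auto)
    have cu1: "cu (Suc 0) v \<in> W ?n" if "v \<in> W s" "Suc 0 \<le> s" for v using IHc that by simp
    have xx0: "xx 0 (us (Suc k) v) \<in> W ?n" if v: "v \<in> W s" "Suc k \<le> s" for k v
      using that(2)
    proof (induction k)
      case 0
      have "xx 0 (us (Suc 0) v) = cu (Suc 0) v \<oplus>\<^bsub>M ?n\<^esub> (- z * q) \<odot>\<^bsub>M ?n\<^esub> us 0 v"
        by (rule xx0_us[OF W_closed[OF v(1)] 0])
      moreover have "us 0 v \<in> W ?n" by (rule W_us[OF v(1)]) simp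
      ultimately show ?case using cu1[OF v(1) 0] W_add W_smult by simp
    next
      case (Suc k)
      then show ?case using xx0_us_Suc[OF W_closed[OF v(1)], of k] upper by (simp del: under_strand.simps)
    qed
    have yy0: "yy 0 w \<in> W ?n" if "w \<in> W ?n" for w
    proof (rule W_opr[OF _ _ _ that])
      fix u assume "u \<in> TT ?n"
      then obtain k v where u: "u = us k v" "k \<le> s" "v \<in> TT s" by (auto simp: diagram_span_basis.simps(3))
      have v: "v \<in> C s" "v \<in> W s" using u TT_closed gen by auto
      show "yy 0 u \<in> W ?n"
      proof (cases k)
        case 0
        then show ?thesis using u yy0_us0[OF v(1)] W_us[OF v(2), of 0] by (simp add: W_smult del: under_strand.simps)
      next
        case (Suc j)
        have "us k v \<in> C ?n" "us k v \<in> W ?n" using u v W_us by auto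
        then show ?thesis using u Suc skein'[of "us k v" ?n 0] xx0[OF v(2), of j] by (simp add: W_add W_smult del: under_strand.simps)
      qed
    qed auto
    have Y: "yy a w \<in> W ?n" if "w \<in> W ?n" "a + 2 \<le> ?n" for a w
      using upper yy0 that by (cases a) auto
    have CU: "cu a w \<in> W (Suc (Suc ?n))" if "w \<in> W ?n" "a \<le> ?n" for a w
    proof (rule W_opr[OF _ _ _ that(1)])
      fix u assume "u \<in> TT ?n"
      then obtain k v where u: "u = us k v" "k \<le> s" "v \<in> TT s" by (auto simp: diagram_span_basis.simps(3))
      have v: "v \<in> C s" "v \<in> W s" using u TT_closed gen by auto
      consider "a = 0" | i where "a = Suc i" "i \<le> k" | i where "a = Suc (Suc i)" "k \<le> i"
        using position_cases(1)[of a k] by blast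
      then show "cu a u \<in> W (Suc (Suc ?n))"
      proof cases
        case 1
        have "u \<in> W ?n" using u v W_us by auto
        then show ?thesis using W_us[of u ?n 0] 1 by simp
      next
        case 2
        then have i: "i \<le> s" using u(2) by simp
        have "cu a u = (- 1) \<odot>\<^bsub>M (Suc (Suc ?n))\<^esub> us (Suc (Suc k)) (cu i v)"
          unfolding u(1) 2(1) by (rule cu_us_left[OF v(1) 2(2) u(2)])
        moreover have "us (Suc (Suc k)) (cu i v) \<in> W (Suc (Suc ?n))" by (rule W_us[OF IHc[OF v(2) i]]) (use u(2) in simp)
        ultimately show ?thesis by (simp only: W_smult)
      next
        case 3
        then have i: "i \<le> s" using that(2) by simp
        have "cu a u = (- 1) \<odot>\<^bsub>M (Suc (Suc ?n))\<^esub> us k (cu i v)"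
          unfolding u(1) 3(1) by (rule cu_us_right[OF v(1) 3(2) i])
        moreover have "us k (cu i v) \<in> W (Suc (Suc ?n))" by (rule W_us[OF IHc[OF v(2) i]]) (use u(2) in simp)
        ultimately show ?thesis by (simp only: W_smult)
      qed
    qed (use that in auto)
    show ?case using Y CU by blast
  qed
  then show "v \<in> W s \<Longrightarrow> a + 2 \<le> s \<Longrightarrow> yy a v \<in> W s" "v \<in> W s \<Longrightarrow> a \<le> s \<Longrightarrow> cu a v \<in> W (Suc (Suc s))" by blast+
qed

lemma W_xx: "v \<in> W s \<Longrightarrow> a + 2 \<le> s \<Longrightarrow> xx a v \<in> W s"
  using skein[of v s a] W_closed[of v s] W_yy by (simp add: W_add W_smult)

text \<open>Again the cap is pulled through the leftmost strand, unless it ends at that strand. In this case the strand is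
straightened, and only a crossing or a shorter diagram remains.\<close>

lemma W_ca: "v \<in> W (Suc (Suc s)) \<Longrightarrow> a \<le> s \<Longrightarrow> ca a v \<in> W s"
proof (induction s arbitrary: a v rule: less_induct)
  case (less s)
  show ?case
  proof (rule W_opr[OF _ _ _ less.prems(1)])
    fix u assume "u \<in> TT (Suc (Suc s))"
    then obtain k v where u: "u = us k v" "k \<le> s" "v \<in> TT s" by (auto simp: diagram_span_basis.simps(3))
    have v: "v \<in> C s" "v \<in> W s" using u TT_closed by (auto intro: lspan_base)
    have far: "ca (Suc (Suc i)) (us k v) \<in> W s" if T: "k \<le> i" "Suc (Suc i) \<le> s" "v \<in> W s" for k i v
    proof -
      obtain n where n: "s = Suc (Suc n)" using position_cases(3)[OF T(2)] by blast
      have i: "i \<le> n" "k \<le> n" "n < s" using T n by auto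
      have v: "v \<in> W (Suc (Suc n))" using T(3) n by (simp only:)
      have "us k (ca i v) \<in> W s" unfolding n by (rule W_us[OF less.IH[OF i(3) v i(1)] i(2)])
      moreover have "ca (Suc (Suc i)) (us k v) = (- 1) \<odot>\<^bsub>M s\<^esub> us k (ca i v)"
        unfolding n by (rule ca_us_right[OF W_closed[OF v] T(1) i(1)])
      ultimately show ?thesis by (simp only: W_smult)
    qed
    have near: "ca (Suc k) (us k v) \<in> W s" if "Suc k \<le> s" "v \<in> W s" for k v
      using that
    proof (induction k arbitrary: v)
      case 0
      then show ?case using ca_us_end_0[of v s] W_closed[of v s] by (simp add: W_smult del: under_strand.simps)
    next
      case (Suc k)
      obtain n where n: "s = Suc (Suc n)" using position_cases(3)[OF Suc.prems(1)] by blast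
      have k: "k \<le> n" "n < s" using Suc.prems(1) n by auto
      have v: "v \<in> W (Suc (Suc n))" using Suc.prems(2) n by (simp only:)
      have 1: "us k (ca k v) \<in> W s" unfolding n by (rule W_us[OF less.IH[OF k(2) v k(1)] k(1)])
      have "yy k v \<in> W s" by (rule W_yy[OF Suc.prems(2)]) (use Suc.prems(1) in simp)
      then have 2: "ca (Suc k) (us k (yy k v)) \<in> W s" by (rule Suc.IH[rotated]) (use Suc.prems(1) in simp)
      have "ca (Suc (Suc k)) (us (Suc k) v) = ca (Suc k) (us k (yy k v)) \<oplus>\<^bsub>M s\<^esub> z \<odot>\<^bsub>M s\<^esub> us k (ca k v)"
        unfolding n by (rule ca_us_end_Suc[OF W_closed[OF v] k(1)])
      then show ?case by (simp only: W_add[OF 2 W_smult[OF 1]])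
    qed
    have zero: "ca 0 (us (Suc k) v) \<in> W s" if "Suc k \<le> s" "v \<in> W s" for k v
      using that(1)
    proof (induction k)
      case 0
      then show ?case using ca_us_first[of v s] W_closed[OF that(2)] that(2) by (simp add: W_smult del: under_strand.simps)
    next
      case (Suc k)
      then show ?case using ca_us_first_Suc[of v s k] W_closed[OF that(2)] W_yy by (simp del: under_strand.simps)
    qed
    show "ca a u \<in> W s"
    proof (cases a)
      case 0
      show ?thesis
      proof (cases k)
        case 0
        then show ?thesis using u \<open>a = 0\<close> cap_cup[OF v(1), of 0] by (simp add: lspan_zero)
      next
        case (Suc j)
        then show ?thesis using zero[of j v] u v \<open>a = 0\<close> by (simp del: under_strand.simps)
      qed
    next
      case (Suc b)
      consider "b = k" | "k = Suc b" | i where "b = Suc i" "k \<le> i" | j where "k = Suc (Suc j)" "b \<le> j"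
        using position_cases(2)[of b k] by blast
      then show ?thesis
      proof cases
        case 1
        then show ?thesis using near[of k v] u v Suc less.prems by simp
      next
        case 2
        have "ca (Suc b) (us b v) \<in> W s" using near[of b v] v Suc less.prems by simp
        moreover have "ca a u = (- q) \<odot>\<^bsub>M s\<^esub> ca (Suc b) (us b v)"
          unfolding u(1) 2 Suc by (rule ca_us_back[OF v(1)]) (use u(2) 2 in simp)
        ultimately show ?thesis by (simp only: W_smult)
      next
        case 3
        then show ?thesis using far[of k i v] u v Suc less.prems by simp
      next
        case 4
        have "Suc (Suc j) \<le> s" using u(2) 4(1) by simp
        then obtain n where n: "s = Suc (Suc n)" using position_cases(3) by blast
        have j: "j \<le> n" "b \<le> n" "n < s" using 4 u(2) n by auto
        have w: "v \<in> W (Suc (Suc n))" using v(2) n by (simp only:)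
        have 1: "us j (ca b v) \<in> W s" unfolding n by (rule W_us[OF less.IH[OF j(3) w j(2)] j(1)])
        have "ca a u = (- 1) \<odot>\<^bsub>M s\<^esub> us j (ca b v)"
          unfolding n u(1) 4(1) Suc by (rule ca_us_left[OF W_closed[OF w] 4(2) j(1)])
        then show ?thesis by (simp only: W_smult[OF 1])
      qed
    qed
  qed (use less.prems in auto)
qed

theorem W_opr_closed:
  assumes "v \<in> W s" "a + piece_src p \<le> s" "t = s + piece_tgt p - piece_src p"
  shows "opr p a v \<in> W t"
proof (cases p)
  case (Strands k)
  then show ?thesis using assms strands[OF W_closed[OF assms(1)], of a k] by simp
next
  case CrossX then show ?thesis using assms W_xx by simp
next
  case CrossY then show ?thesis using assms W_yy by simp
next
  case Cup then show ?thesis using assms W_cu by simp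
next
  case Cap
  then obtain n where "s = Suc (Suc n)" using assms(2) by (metis add_leD2 add_2_eq_Suc le_Suc_ex piece_src.simps(5))
  then show ?thesis using assms W_ca[of v n a] Cap by simp
qed

end

section \<open>Modules of morphisms and postcomposition\<close>
context
  fixes q :: "'k::comm_ring_1"
begin

lemma mor_class_def': "mor_class q m n f = {g. mor_eq q m n f g}"
  by (auto simp: mor_class_def mor_rel_def)

lemma mor_class_eq: "mor_eq q m n f g \<Longrightarrow> mor_class q m n f = mor_class q m n g"
  unfolding mor_class_def' using mor_eq.trans mor_eq.sym by blast

lemma carrier_Hom: "carrier (Hom q m n) = mor_class q m n ` {f. in_hom f m n}"
  unfolding Hom_def quotient_def mor_class_def by auto

lemma UN_mor_class:
  assumes "in_hom f m n" "\<And>f'. mor_eq q m n f f' \<Longrightarrow> G f' = G f"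
  shows "(\<Union>f'\<in>mor_class q m n f. G f') = G f"
  using mor_eq.refl[OF assms(1)] assms(2) unfolding mor_class_def' by blast

lemma Hom_add: "in_hom f m n \<Longrightarrow> in_hom g m n \<Longrightarrow>
    mor_class q m n f \<oplus>\<^bsub>Hom q m n\<^esub> mor_class q m n g = mor_class q m n (Add f g)"
proof -
  assume fg: "in_hom f m n" "in_hom g m n"
  have "(\<Union>f'\<in>mor_class q m n f. \<Union>g'\<in>mor_class q m n g. mor_class q m n (Add f' g')) =
      (\<Union>g'\<in>mor_class q m n g. mor_class q m n (Add f g'))"
    by (rule UN_mor_class[OF fg(1)])
      (rule SUP_cong[OF HOL.refl], rule mor_class_eq, rule mor_eq.cong_Add, erule mor_eq.sym,
        auto simp: mor_class_def' intro: mor_eq.refl dest!: mor_eq_in_hom)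
  also have "\<dots> = mor_class q m n (Add f g)"
    by (rule UN_mor_class[OF fg(2)], rule mor_class_eq, rule mor_eq.cong_Add[OF mor_eq.refl[OF fg(1)]], erule mor_eq.sym)
  finally show ?thesis by (simp add: Hom_def)
qed

lemma Hom_smult: "in_hom f m n \<Longrightarrow> c \<odot>\<^bsub>Hom q m n\<^esub> mor_class q m n f = mor_class q m n (Scale c f)"
proof -
  assume f: "in_hom f m n"
  have "(\<Union>f'\<in>mor_class q m n f. mor_class q m n (Scale c f')) = mor_class q m n (Scale c f)"
    by (rule UN_mor_class[OF f], rule mor_class_eq, rule mor_eq.cong_Scale, erule mor_eq.sym)
  then show ?thesis by (simp add: Hom_def)
qed

lemma Hom_zero: "\<zero>\<^bsub>Hom q m n\<^esub> = mor_class q m n (Zero m n)" by (simp add: Hom_def)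

lemma carrier_HomE:
  assumes "v \<in> carrier (Hom q m n)"
  obtains f where "in_hom f m n" "v = mor_class q m n f"
  using assms unfolding carrier_Hom by blast

lemma mor_class_carrier [intro]: "in_hom f m n \<Longrightarrow> mor_class q m n f \<in> carrier (Hom q m n)"
  unfolding carrier_Hom by blast

lemmas in_hom_rules = in_hom.intros(4-6)

text \<open>The relation \<open>mor_eq\<close> contains the axioms of a module, so that they hold for classes.\<close>

theorem Hom_module: "Module.module type_ring (Hom q m n)"
proof (rule moduleI)
  show "cring (type_ring :: 'k ring)" by (rule cring_from_type_algebra)
  show "abelian_group (Hom q m n)"
  proof (rule abelian_groupI)
    fix x y assume "x \<in> carrier (Hom q m n)" "y \<in> carrier (Hom q m n)"
    then obtain f g where f: "in_hom f m n" "x = mor_class q m n f" and g: "in_hom g m n" "y = mor_class q m n g"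
      by (metis carrier_HomE)
    show "x \<oplus>\<^bsub>Hom q m n\<^esub> y \<in> carrier (Hom q m n)"
      using f g by (auto simp: Hom_add intro: in_hom_rules)
    show "x \<oplus>\<^bsub>Hom q m n\<^esub> y = y \<oplus>\<^bsub>Hom q m n\<^esub> x"
      using f g by (simp add: Hom_add mor_class_eq[OF mor_eq.add_commute])
  next
    show "\<zero>\<^bsub>Hom q m n\<^esub> \<in> carrier (Hom q m n)" by (auto simp: Hom_zero intro: in_hom_rules)
  next
    fix x y w assume "x \<in> carrier (Hom q m n)" "y \<in> carrier (Hom q m n)" "w \<in> carrier (Hom q m n)"
    then obtain f g h where "in_hom f m n" "x = mor_class q m n f" "in_hom g m n" "y = mor_class q m n g"
      "in_hom h m n" "w = mor_class q m n h" by (metis carrier_HomE)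
    then show "(x \<oplus>\<^bsub>Hom q m n\<^esub> y) \<oplus>\<^bsub>Hom q m n\<^esub> w = x \<oplus>\<^bsub>Hom q m n\<^esub> (y \<oplus>\<^bsub>Hom q m n\<^esub> w)"
      by (simp add: Hom_add in_hom_rules mor_class_eq[OF mor_eq.add_assoc])
  next
    fix x assume "x \<in> carrier (Hom q m n)"
    then obtain f where f: "in_hom f m n" "x = mor_class q m n f" by (rule carrier_HomE)
    show "\<zero>\<^bsub>Hom q m n\<^esub> \<oplus>\<^bsub>Hom q m n\<^esub> x = x"
      using f by (simp add: Hom_zero Hom_add in_hom_rules mor_class_eq[OF mor_eq.add_zero])
    have "mor_eq q m n (Add (Scale (- 1) f) f) (Zero m n)"
    proof -
      have "mor_eq q m n (Add (Scale (- 1) f) f) (Add (Scale (- 1) f) (Scale 1 f))"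
        using f(1) by (intro mor_eq.cong_Add mor_eq.refl mor_eq.sym[OF mor_eq.scale_one] in_hom_rules)
      moreover have "mor_eq q m n (Add (Scale (- 1) f) (Scale 1 f)) (Scale (- 1 + 1) f)"
        using f(1) by (intro mor_eq.sym[OF mor_eq.scale_add_left])
      moreover have "mor_eq q m n (Scale (- 1 + 1) f) (Zero m n)"
        using mor_eq.scale_zero[OF f(1)] by simp
      ultimately show ?thesis by (meson mor_eq.trans)
    qed
    then have "mor_class q m n (Add (Scale (- 1) f) f) = mor_class q m n (Zero m n)" by (rule mor_class_eq)
    then have "mor_class q m n (Scale (- 1) f) \<oplus>\<^bsub>Hom q m n\<^esub> x = \<zero>\<^bsub>Hom q m n\<^esub>"
      using f by (simp add: Hom_zero Hom_add in_hom_rules)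
    then show "\<exists>y\<in>carrier (Hom q m n). y \<oplus>\<^bsub>Hom q m n\<^esub> x = \<zero>\<^bsub>Hom q m n\<^esub>"
      by (rule bexI[where x = "mor_class q m n (Scale (- 1) f)"]) (rule mor_class_carrier, rule in_hom_rules(3), rule f(1))
  qed
next
  fix c x assume "x \<in> carrier (Hom q m n)"
  then obtain f where f: "in_hom f m n" "x = mor_class q m n f" by (rule carrier_HomE)
  show "c \<odot>\<^bsub>Hom q m n\<^esub> x \<in> carrier (Hom q m n)" using f by (auto simp: Hom_smult intro: in_hom_rules)
  show "\<one>\<^bsub>type_ring\<^esub> \<odot>\<^bsub>Hom q m n\<^esub> x = x"
    using f by (simp add: Hom_smult mor_class_eq[OF mor_eq.scale_one])
next
  fix c d x assume "x \<in> carrier (Hom q m n)"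
  then obtain f where f: "in_hom f m n" "x = mor_class q m n f" by (rule carrier_HomE)
  show "(c \<oplus>\<^bsub>type_ring\<^esub> d) \<odot>\<^bsub>Hom q m n\<^esub> x = c \<odot>\<^bsub>Hom q m n\<^esub> x \<oplus>\<^bsub>Hom q m n\<^esub> d \<odot>\<^bsub>Hom q m n\<^esub> x"
    using f by (simp add: Hom_smult Hom_add in_hom_rules mor_class_eq[OF mor_eq.scale_add_left])
  show "(c \<otimes>\<^bsub>type_ring\<^esub> d) \<odot>\<^bsub>Hom q m n\<^esub> x = c \<odot>\<^bsub>Hom q m n\<^esub> (d \<odot>\<^bsub>Hom q m n\<^esub> x)"
    using f by (simp add: Hom_smult in_hom_rules mor_class_eq[OF mor_eq.scale_scale])
next
  fix c x y assume "x \<in> carrier (Hom q m n)" "y \<in> carrier (Hom q m n)"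
  then obtain f g where "in_hom f m n" "x = mor_class q m n f" "in_hom g m n" "y = mor_class q m n g"
    by (metis carrier_HomE)
  then show "c \<odot>\<^bsub>Hom q m n\<^esub> (x \<oplus>\<^bsub>Hom q m n\<^esub> y) = c \<odot>\<^bsub>Hom q m n\<^esub> x \<oplus>\<^bsub>Hom q m n\<^esub> c \<odot>\<^bsub>Hom q m n\<^esub> y"
    by (simp add: Hom_smult Hom_add in_hom_rules mor_class_eq[OF mor_eq.scale_add_right])
qed

text \<open>Composition of the classes in \<open>A\<close> with \<open>D\<close> placed on top, behind \<open>a\<close> strands. The objects are read off from
the representatives, so that the position is the only parameter.\<close>

definition post :: "'k mor \<Rightarrow> nat \<Rightarrow> 'k mor set \<Rightarrow> 'k mor set" where
  "post D a A = (\<Union>f\<in>A. mor_class q (msrc f) (mtgt f + mtgt D - msrc D) (Comp (put a D (mtgt f - a - msrc D)) f))"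

lemma class_eqI: "eqv q f g \<Longrightarrow> msrc f = m \<Longrightarrow> mtgt f = n \<Longrightarrow> mor_class q m n f = mor_class q m n g"
  using eqvD[of q f g] by (intro mor_class_eq) (auto simp: mor_eq_eqv in_hom_iff)

lemma post_class:
  assumes "in_hom f m s" "welltyped D" "s = a + msrc D + b" "t = a + mtgt D + b"
  shows "post D a (mor_class q m s f) = mor_class q m t (Comp (put a D b) f)"
proof -
  have f: "welltyped f" "msrc f = m" "mtgt f = s" using assms(1) by (auto simp: in_hom_iff)
  have "post D a (mor_class q m s f) =
      mor_class q (msrc f) (mtgt f + mtgt D - msrc D) (Comp (put a D (mtgt f - a - msrc D)) f)"
    unfolding post_def
  proof (rule UN_mor_class[OF assms(1)])
    fix f' assume "mor_eq q m s f f'"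
    then have e: "eqv q f f'" "msrc f' = m" "mtgt f' = s" using mor_eq_in_hom by (auto simp: mor_eq_eqv in_hom_iff dest: eqvD)
    show "mor_class q (msrc f') (mtgt f' + mtgt D - msrc D) (Comp (put a D (mtgt f' - a - msrc D)) f') =
      mor_class q (msrc f) (mtgt f + mtgt D - msrc D) (Comp (put a D (mtgt f - a - msrc D)) f)"
      unfolding e f
      by (rule class_eqI, rule eqv_Comp[OF eqv_refl eqv_sym[OF e(1)]]) (use e f assms in auto)
  qed
  then show ?thesis using f assms by (simp add: add_ac)
qed

lemma in_hom_put: "in_hom f m s \<Longrightarrow> welltyped D \<Longrightarrow> s = a + msrc D + b \<Longrightarrow> in_hom (Comp (put a D b) f) m (a + mtgt D + b)"
  by (simp add: in_hom_iff)

lemma postE: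
  assumes "v \<in> carrier (Hom q m s)" "a + msrc D \<le> s"
  obtains f b where "in_hom f m s" "v = mor_class q m s f" "s = a + msrc D + b"
  using assms by (metis carrier_HomE le_Suc_ex)

lemma post_closed:
  assumes "v \<in> carrier (Hom q m s)" "a + msrc D \<le> s" "welltyped D" "t = s + mtgt D - msrc D"
  shows "post D a v \<in> carrier (Hom q m t)"
proof -
  obtain f b where f: "in_hom f m s" "v = mor_class q m s f" "s = a + msrc D + b" using assms(1,2) by (rule postE)
  have "t = a + mtgt D + b" using f assms by simp
  then show ?thesis using post_class[OF f(1) assms(3) f(3), of t] in_hom_put[OF f(1) assms(3) f(3)] f(2) by auto
qed

lemma post_add:
  assumes "v \<in> carrier (Hom q m s)" "w \<in> carrier (Hom q m s)" "a + msrc D \<le> s" "welltyped D" "t = s + mtgt D - msrc D"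
  shows "post D a (v \<oplus>\<^bsub>Hom q m s\<^esub> w) = post D a v \<oplus>\<^bsub>Hom q m t\<^esub> post D a w"
proof -
  obtain f b where f: "in_hom f m s" "v = mor_class q m s f" "s = a + msrc D + b" using assms(1,3) by (rule postE)
  obtain g where g: "in_hom g m s" "w = mor_class q m s g" using assms(2) by (rule carrier_HomE)
  have t: "t = a + mtgt D + b" using f assms by simp
  note P = post_class[OF _ assms(4) f(3) t]
  have "eqv q (Comp (put a D b) (Add f g)) (Add (Comp (put a D b) f) (Comp (put a D b) g))"
    using f g assms by (intro eqv_comp_add_right) (auto simp: in_hom_iff)
  then have "mor_class q m t (Comp (put a D b) (Add f g)) = mor_class q m t (Add (Comp (put a D b) f) (Comp (put a D b) g))"
    by (rule class_eqI) (use f g t in \<open>auto simp: in_hom_iff\<close>)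
  then show ?thesis
    using f g P in_hom_put[OF _ assms(4) f(3)] t by (simp add: Hom_add in_hom_rules)
qed

lemma post_smult:
  assumes "v \<in> carrier (Hom q m s)" "a + msrc D \<le> s" "welltyped D" "t = s + mtgt D - msrc D"
  shows "post D a (c \<odot>\<^bsub>Hom q m s\<^esub> v) = c \<odot>\<^bsub>Hom q m t\<^esub> post D a v"
proof -
  obtain f b where f: "in_hom f m s" "v = mor_class q m s f" "s = a + msrc D + b" using assms(1,2) by (rule postE)
  have t: "t = a + mtgt D + b" using f assms by simp
  note P = post_class[OF _ assms(3) f(3) t]
  have "eqv q (Comp (put a D b) (Scale c f)) (Scale c (Comp (put a D b) f))"
    using f assms by (intro eqv_comp_scale_right) (auto simp: in_hom_iff)
  then have "mor_class q m t (Comp (put a D b) (Scale c f)) = mor_class q m t (Scale c (Comp (put a D b) f))"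
    by (rule class_eqI) (use f t in \<open>auto simp: in_hom_iff\<close>)
  then show ?thesis
    using f P in_hom_put[OF _ assms(3) f(3)] t by (simp add: Hom_smult in_hom_rules)
qed

lemma post_cong:
  assumes "eqv q D E" "v \<in> carrier (Hom q m s)" "a + msrc D \<le> s"
  shows "post D a v = post E a v"
proof -
  obtain f b where f: "in_hom f m s" "v = mor_class q m s f" "s = a + msrc D + b" using assms(2,3) by (rule postE)
  have DE: "welltyped D" "welltyped E" "msrc E = msrc D" "mtgt E = mtgt D" using eqvD[OF assms(1)] by auto
  have "eqv q (Comp (put a D b) f) (Comp (put a E b) f)"
    using f DE by (intro eqv_Comp put_cong assms(1) eqv_refl) (auto simp: in_hom_iff)
  then have "mor_class q m (a + mtgt D + b) (Comp (put a D b) f) = mor_class q m (a + mtgt D + b) (Comp (put a E b) f)"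
    by (rule class_eqI) (use f DE in \<open>auto simp: in_hom_iff\<close>)
  then show ?thesis
    using post_class[OF f(1) DE(1) f(3)] post_class[OF f(1) DE(2), of a b] f DE by simp
qed

lemma post_comp:
  assumes "v \<in> carrier (Hom q m s)" "a + msrc E \<le> s" "welltyped (Comp D E)"
  shows "post (Comp D E) a v = post D a (post E a v)"
proof -
  obtain f b where f: "in_hom f m s" "v = mor_class q m s f" "s = a + msrc E + b" using assms(1,2) by (rule postE)
  have w: "welltyped D" "welltyped E" "msrc D = mtgt E" using assms(3) by auto
  have F: "in_hom (Comp (put a E b) f) m (a + mtgt E + b)" by (rule in_hom_put[OF f(1) w(2) f(3)])
  have "eqv q (Comp (put a (Comp D E) b) f) (Comp (Comp (put a D b) (put a E b)) f)"
    using f w by (intro eqv_Comp put_comp eqv_refl) (auto simp: in_hom_iff)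
  also have "eqv q (Comp (Comp (put a D b) (put a E b)) f) (Comp (put a D b) (Comp (put a E b) f))"
    using f w by (intro eqv_comp_assoc) (auto simp: in_hom_iff)
  finally have "mor_class q m (a + mtgt D + b) (Comp (put a (Comp D E) b) f) =
      mor_class q m (a + mtgt D + b) (Comp (put a D b) (Comp (put a E b) f))"
    by (rule class_eqI) (use f w in \<open>auto simp: in_hom_iff\<close>)
  then show ?thesis
    using post_class[OF f(1) assms(3), of a b] post_class[OF f(1) w(2) f(3)] post_class[OF F w(1), of a b] f w by simp
qed

lemma post_right:
  assumes "v \<in> carrier (Hom q m s)" "a + msrc D + k \<le> s" "welltyped D"
  shows "post (Tens D (ident k)) a v = post D a v"
proof -
  have "a + msrc (Tens D (ident k)) \<le> s" using assms(2) by simp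
  with assms(1) obtain f b where f: "in_hom f m s" "v = mor_class q m s f" "s = a + msrc (Tens D (ident k)) + b" by (rule postE)
  have "eqv q (Comp (put a (Tens D (ident k)) b) f) (Comp (put a D (k + b)) f)"
    using f assms by (intro eqv_Comp put_right eqv_refl) (auto simp: in_hom_iff)
  then have "mor_class q m (a + mtgt D + (k + b)) (Comp (put a (Tens D (ident k)) b) f) =
      mor_class q m (a + mtgt D + (k + b)) (Comp (put a D (k + b)) f)"
    by (rule class_eqI) (use f in \<open>auto simp: in_hom_iff\<close>)
  then show ?thesis
    using post_class[OF f(1) _ f(3), of "a + mtgt D + (k + b)"] post_class[OF f(1) assms(3), of a "k + b"] f assms(3) by simp
qed

lemma post_left:
  assumes "v \<in> carrier (Hom q m s)" "a + k + msrc D \<le> s" "welltyped D"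
  shows "post (Tens (ident k) D) a v = post D (a + k) v"
proof -
  have "a + msrc (Tens (ident k) D) \<le> s" using assms(2) by simp
  with assms(1) obtain f b where f: "in_hom f m s" "v = mor_class q m s f" "s = a + msrc (Tens (ident k) D) + b" by (rule postE)
  have "eqv q (Comp (put a (Tens (ident k) D) b) f) (Comp (put (a + k) D b) f)"
    using f assms by (intro eqv_Comp put_left eqv_refl) (auto simp: in_hom_iff)
  then have "mor_class q m (a + k + mtgt D + b) (Comp (put a (Tens (ident k) D) b) f) =
      mor_class q m (a + k + mtgt D + b) (Comp (put (a + k) D b) f)"
    by (rule class_eqI) (use f in \<open>auto simp: in_hom_iff\<close>)
  then show ?thesis
    using post_class[OF f(1) _ f(3), of "a + k + mtgt D + b"] post_class[OF f(1) assms(3), of "a + k" b] f assms(3) by simp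
qed

lemma post_ident:
  assumes "v \<in> carrier (Hom q m s)" "a + k \<le> s"
  shows "post (ident k) a v = v"
proof -
  have "a + msrc (ident k :: 'k mor) \<le> s" using assms(2) by simp
  with assms(1) obtain f b where f: "in_hom f m s" "v = mor_class q m s f" "s = a + msrc (ident k :: 'k mor) + b" by (rule postE)
  have "eqv q (Comp (put a (ident k) b) f) (Comp (ident s) f)"
    using f by (intro eqv_Comp put_ident eqv_refl) (auto simp: in_hom_iff)
  also have "eqv q (Comp (ident s) f) f" using f by (intro eqv_id_left) (auto simp: in_hom_iff)
  finally have "mor_class q m s (Comp (put a (ident k) b) f) = mor_class q m s f"
    by (rule class_eqI) (use f in \<open>auto simp: in_hom_iff\<close>)
  then show ?thesis using post_class[OF f(1) _ f(3), of s] f by simp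
qed

lemma post_Scale:
  assumes "v \<in> carrier (Hom q m s)" "a + msrc D \<le> s" "welltyped D" "t = s + mtgt D - msrc D"
  shows "post (Scale c D) a v = c \<odot>\<^bsub>Hom q m t\<^esub> post D a v"
proof -
  obtain f b where f: "in_hom f m s" "v = mor_class q m s f" "s = a + msrc D + b" using assms(1,2) by (rule postE)
  have t: "t = a + mtgt D + b" using f assms by simp
  have "eqv q (Comp (put a (Scale c D) b) f) (Comp (Scale c (put a D b)) f)"
    using f assms by (intro eqv_Comp put_scale eqv_refl) (auto simp: in_hom_iff)
  also have "eqv q (Comp (Scale c (put a D b)) f) (Scale c (Comp (put a D b) f))"
    using f assms by (intro eqv_comp_scale_left) (auto simp: in_hom_iff)
  finally have "mor_class q m t (Comp (put a (Scale c D) b) f) = mor_class q m t (Scale c (Comp (put a D b) f))"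
    by (rule class_eqI) (use f t in \<open>auto simp: in_hom_iff\<close>)
  then show ?thesis
    using post_class[OF f(1), of "Scale c D" a b t] post_class[OF f(1) assms(3) f(3) t] f assms(3) t in_hom_put[OF f(1) assms(3) f(3)]
    by (simp add: Hom_smult)
qed

lemma post_Add:
  assumes "v \<in> carrier (Hom q m s)" "a + msrc D \<le> s" "welltyped (Add D E)" "t = s + mtgt D - msrc D"
  shows "post (Add D E) a v = post D a v \<oplus>\<^bsub>Hom q m t\<^esub> post E a v"
proof -
  obtain f b where f: "in_hom f m s" "v = mor_class q m s f" "s = a + msrc D + b" using assms(1,2) by (rule postE)
  have w: "welltyped D" "welltyped E" "msrc E = msrc D" "mtgt E = mtgt D" using assms(3) by auto
  have t: "t = a + mtgt D + b" using f assms by simp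
  have "eqv q (Comp (put a (Add D E) b) f) (Comp (Add (put a D b) (put a E b)) f)"
    using f assms by (intro eqv_Comp put_add eqv_refl) (auto simp: in_hom_iff)
  also have "eqv q (Comp (Add (put a D b) (put a E b)) f) (Add (Comp (put a D b) f) (Comp (put a E b) f))"
    using f w by (intro eqv_comp_add_left) (auto simp: in_hom_iff)
  finally have "mor_class q m t (Comp (put a (Add D E) b) f) = mor_class q m t (Add (Comp (put a D b) f) (Comp (put a E b) f))"
    by (rule class_eqI) (use f t in \<open>auto simp: in_hom_iff\<close>)
  then show ?thesis
    using post_class[OF f(1), of "Add D E" a b t] post_class[OF f(1) w(1) f(3) t] post_class[OF f(1) w(2), of a b t] f w t
      in_hom_put[OF f(1) w(1) f(3)] in_hom_put[OF f(1) w(2), of a b]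
    by (simp add: Hom_add)
qed

lemma post_far:
  assumes "v \<in> carrier (Hom q m s)" "a + msrc D + e + msrc E \<le> s" "welltyped D" "welltyped E" "has_parity D c" "has_parity E d"
    "t = s + mtgt D + mtgt E - msrc D - msrc E"
  shows "post E (a + mtgt D + e) (post D a v) =
    (if c \<and> d then - 1 else 1) \<odot>\<^bsub>Hom q m t\<^esub> post D a (post E (a + msrc D + e) v)"
proof -
  have "a + msrc D + e + msrc E \<le> s" using assms(2) .
  with assms(1) obtain f b where f: "in_hom f m s" "v = mor_class q m s f" "s = a + msrc D + e + msrc E + b" by (rule postE)
  let ?c = "if c \<and> d then - 1 else (1 :: 'k)"
  have t: "t = a + mtgt D + e + mtgt E + b" using f(3) assms(7) by simp
  have F: "in_hom (Comp (put a D (e + msrc E + b)) f) m (a + mtgt D + e + msrc E + b)"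
    "in_hom (Comp (put (a + msrc D + e) E b) f) m (a + msrc D + e + mtgt E + b)"
    using f assms by (auto simp: in_hom_iff)
  have 1: "post E (a + mtgt D + e) (post D a v) = mor_class q m t (Comp (put (a + mtgt D + e) E b) (Comp (put a D (e + msrc E + b)) f))"
    using post_class[OF f(1) assms(3), of a "e + msrc E + b" "a + mtgt D + e + msrc E + b"] post_class[OF F(1) assms(4), of "a + mtgt D + e" b t] f(2,3) t
    by (simp add: add.assoc)
  have 2: "post D a (post E (a + msrc D + e) v) = mor_class q m t (Comp (put a D (e + mtgt E + b)) (Comp (put (a + msrc D + e) E b) f))"
    using post_class[OF f(1) assms(4), of "a + msrc D + e" b "a + msrc D + e + mtgt E + b"] post_class[OF F(2) assms(3), of a "e + mtgt E + b" t] f(2,3) t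
    by (simp add: add.assoc)
  have F2: "in_hom (Comp (put a D (e + mtgt E + b)) (Comp (put (a + msrc D + e) E b) f)) m t"
    using f assms t by (auto simp: in_hom_iff)
  have "eqv q (Comp (put (a + mtgt D + e) E b) (Comp (put a D (e + msrc E + b)) f))
      (Comp (Comp (put (a + mtgt D + e) E b) (put a D (e + msrc E + b))) f)"
    using f assms by (intro eqv_sym[OF eqv_comp_assoc]) (auto simp: in_hom_iff)
  also have "eqv q \<dots> (Comp (Scale ?c (Comp (put a D (e + mtgt E + b)) (put (a + msrc D + e) E b))) f)"
    using f assms by (intro eqv_Comp put_far eqv_refl) (auto simp: in_hom_iff)
  also have "eqv q \<dots> (Scale ?c (Comp (Comp (put a D (e + mtgt E + b)) (put (a + msrc D + e) E b)) f))"
    using f assms by (intro eqv_comp_scale_left) (auto simp: in_hom_iff)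
  also have "eqv q \<dots> (Scale ?c (Comp (put a D (e + mtgt E + b)) (Comp (put (a + msrc D + e) E b) f)))"
    using f assms by (intro eqv_Scale eqv_comp_assoc) (auto simp: in_hom_iff)
  finally show ?thesis unfolding 1 2 Hom_smult[OF F2]
    by (rule class_eqI) (use f t in \<open>auto simp: in_hom_iff\<close>)
qed

end

section \<open>Spanning the morphisms out of the unit object\<close>
text \<open>A name for the hypothesis on \<open>q\<close> under which the generators act on the morphisms out of the unit object.\<close>

locale brauer_module =
  fixes q :: "'k::comm_ring_1"
  assumes q_invertible: "q * unit_inverse q = 1"
begin

lemma relation_post:
  assumes "mor_eq q k l D E" "v \<in> carrier (Hom q m s)" "a + k \<le> s"
  shows "post q D a v = post q E a v"
proof -
  have "eqv q D E" "msrc D = k" using assms(1) by (auto simp: mor_eq_eqv in_hom_iff)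
  then show ?thesis using assms by (intro post_cong) auto
qed

lemma post_piece_closed:
  assumes "v \<in> carrier (Hom q m s)" "a + piece_src p \<le> s" "t = s + piece_tgt p - piece_src p"
  shows "post q (Piece p) a v \<in> carrier (Hom q m t)"
  using assms by (intro post_closed) auto

text \<open>Each assumption of the locale is a defining relation, or the super interchange law, composed with
a morphism.\<close>

lemma brauer_hom: "brauer_ops q (unit_inverse q) (Hom q 0) (\<lambda>p. post q (Piece p)) (mor_class q 0 0 (ident 0))"
proof (rule brauer_ops.intro)
  fix s show "Module.module type_ring (Hom q 0 s)" by (rule Hom_module)
next
  show "mor_class q 0 0 (ident 0) \<in> carrier (Hom q 0 0)"
    by (rule mor_class_carrier) (simp add: in_hom_iff)
next
  fix p a and v :: "'k mor set" and s s'
  assume "v \<in> carrier (Hom q 0 s)" "a + piece_src p \<le> s" "s' = s + piece_tgt p - piece_src p"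
  then show "post q (Piece p) a v \<in> carrier (Hom q 0 s')" using post_piece_closed by blast
next
  fix p a and v w :: "'k mor set" and s s'
  assume "v \<in> carrier (Hom q 0 s)" "w \<in> carrier (Hom q 0 s)" "a + piece_src p \<le> s" "s' = s + piece_tgt p - piece_src p"
  then show "post q (Piece p) a (v \<oplus>\<^bsub>Hom q 0 s\<^esub> w) = post q (Piece p) a v \<oplus>\<^bsub>Hom q 0 s'\<^esub> post q (Piece p) a w"
    by (intro post_add) auto
next
  fix p a and v :: "'k mor set" and c s s'
  assume "v \<in> carrier (Hom q 0 s)" "a + piece_src p \<le> s" "s' = s + piece_tgt p - piece_src p"
  then show "post q (Piece p) a (c \<odot>\<^bsub>Hom q 0 s\<^esub> v) = c \<odot>\<^bsub>Hom q 0 s'\<^esub> post q (Piece p) a v"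
    by (intro post_smult) auto
next
  fix p r a e and v :: "'k mor set" and s
  assume v: "v \<in> carrier (Hom q 0 s)" "a + piece_src p + e + piece_src r \<le> s" and o: "\<not> (is_odd p \<and> is_odd r)"
  let ?t = "s + piece_tgt p + piece_tgt r - piece_src p - piece_src r"
  have "post q (Piece r) (a + mtgt (Piece p :: 'k mor) + e) (post q (Piece p) a v) =
    (if is_odd p \<and> is_odd r then - 1 else 1) \<odot>\<^bsub>Hom q 0 ?t\<^esub> post q (Piece p) a (post q (Piece r) (a + msrc (Piece p :: 'k mor) + e) v)"
    by (rule post_far[where c = "is_odd p" and d = "is_odd r", OF v(1)]) (use v in \<open>auto simp: has_parity_iff is_odd_def\<close>)
  moreover have "post q (Piece p) a (post q (Piece r) (a + piece_src p + e) v) \<in> carrier (Hom q 0 ?t)"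
    by (rule post_piece_closed, rule post_piece_closed[OF v(1) _ HOL.refl]) (use v in auto)
  ultimately show "post q (Piece r) (a + piece_tgt p + e) (post q (Piece p) a v) =
      post q (Piece p) a (post q (Piece r) (a + piece_src p + e) v)"
    using o module.smult_one[OF Hom_module, of _ q 0 ?t] by simp
next
  fix p r a e and v :: "'k mor set" and s s'
  assume v: "v \<in> carrier (Hom q 0 s)" "a + piece_src p + e + piece_src r \<le> s" and o: "is_odd p" "is_odd r"
    and s': "s' = s + piece_tgt p + piece_tgt r - piece_src p - piece_src r"
  have "post q (Piece r) (a + mtgt (Piece p :: 'k mor) + e) (post q (Piece p) a v) =
    (if is_odd p \<and> is_odd r then - 1 else 1) \<odot>\<^bsub>Hom q 0 s'\<^esub> post q (Piece p) a (post q (Piece r) (a + msrc (Piece p :: 'k mor) + e) v)"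
    by (rule post_far[where c = "is_odd p" and d = "is_odd r", OF v(1)]) (use v s' in \<open>auto simp: has_parity_iff is_odd_def\<close>)
  then show "post q (Piece r) (a + piece_tgt p + e) (post q (Piece p) a v) =
      (- 1) \<odot>\<^bsub>Hom q 0 s'\<^esub> post q (Piece p) a (post q (Piece r) (a + piece_src p + e) v)"
    using o by simp
next
  fix v :: "'k mor set" and s a k
  assume "v \<in> carrier (Hom q 0 s)" "a + k \<le> s"
  then show "post q (ident k) a v = v" by (rule post_ident)
next
  fix v :: "'k mor set" and s a
  assume v: "v \<in> carrier (Hom q 0 s)" "a + 2 \<le> s"
  have "post q XX a (post q YY a v) = post q (Comp XX YY) a v"
    using v by (intro post_comp[symmetric]) auto
  also have "\<dots> = post q (ident 2) a v" by (rule relation_post[OF mor_eq.XY v])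
  also have "\<dots> = v" by (rule post_ident[OF v])
  finally show "post q XX a (post q YY a v) = v" .
  have "post q YY a (post q XX a v) = post q (Comp YY XX) a v"
    using v by (intro post_comp[symmetric]) auto
  also have "\<dots> = post q (ident 2) a v" by (rule relation_post[OF mor_eq.YX v])
  also have "\<dots> = v" by (rule post_ident[OF v])
  finally show "post q YY a (post q XX a v) = v" .
  let ?x = "post q XX a v" and ?y = "post q YY a v" and ?M = "Hom q 0 s"
  have c: "?x \<in> carrier ?M" "?y \<in> carrier ?M" using v by (auto intro!: post_piece_closed[OF v(1)])
  interpret M: Module.module type_ring ?M by (rule Hom_module)
  have "?x \<oplus>\<^bsub>?M\<^esub> (- 1) \<odot>\<^bsub>?M\<^esub> ?y = post q (Add XX (Scale (- 1) YY)) a v"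
    using v post_Add[of v q 0 s a XX "Scale (- 1) YY" s] post_Scale[of v q 0 s a YY s "- 1"] by simp
  also have "\<dots> = post q (Scale (q - unit_inverse q) (ident 2)) a v" by (rule relation_post[OF mor_eq.skein v])
  also have "\<dots> = (q - unit_inverse q) \<odot>\<^bsub>?M\<^esub> v"
    using v post_Scale[of v q 0 s a "ident 2" s] post_ident[OF v] by simp
  finally have sk: "?x \<oplus>\<^bsub>?M\<^esub> (- 1) \<odot>\<^bsub>?M\<^esub> ?y = (q - unit_inverse q) \<odot>\<^bsub>?M\<^esub> v" .
  have d: "(- 1) \<odot>\<^bsub>?M\<^esub> ?y \<in> carrier ?M" using M.smult_closed[of "-1" ?y] c by simp
  have "(- 1) \<odot>\<^bsub>?M\<^esub> ?y \<oplus>\<^bsub>?M\<^esub> ?y = (- 1 + 1) \<odot>\<^bsub>?M\<^esub> ?y"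
    using M.smult_l_distr[of "-1" 1 ?y] M.smult_one[of ?y] c by simp
  also have "\<dots> = \<zero>\<^bsub>?M\<^esub>" using M.smult_l_null[of ?y] c by simp
  finally have z: "(- 1) \<odot>\<^bsub>?M\<^esub> ?y \<oplus>\<^bsub>?M\<^esub> ?y = \<zero>\<^bsub>?M\<^esub>" .
  have "?x = ?x \<oplus>\<^bsub>?M\<^esub> ((- 1) \<odot>\<^bsub>?M\<^esub> ?y \<oplus>\<^bsub>?M\<^esub> ?y)" using c z by simp
  also have "\<dots> = (q - unit_inverse q) \<odot>\<^bsub>?M\<^esub> v \<oplus>\<^bsub>?M\<^esub> ?y" using c d sk M.a_assoc[of ?x "(- 1) \<odot>\<^bsub>?M\<^esub> ?y" ?y] by simp
  also have "\<dots> = ?y \<oplus>\<^bsub>?M\<^esub> (q - unit_inverse q) \<odot>\<^bsub>?M\<^esub> v"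
    using c v M.smult_closed[of "q - unit_inverse q" v] by (intro M.a_comm) auto
  finally show "?x = ?y \<oplus>\<^bsub>?M\<^esub> (q - unit_inverse q) \<odot>\<^bsub>?M\<^esub> v" .
next
  fix v :: "'k mor set" and s a
  assume v: "v \<in> carrier (Hom q 0 s)" "a + 3 \<le> s"
  have c: "post q XX a v \<in> carrier (Hom q 0 s)" if "a + 2 \<le> s" "v \<in> carrier (Hom q 0 s)" for v a
    by (rule post_piece_closed[OF that(2)]) (use that in auto)
  have l: "post q (Tens XX strand) a v = post q XX a v" "post q (Tens strand XX) a v = post q XX (Suc a) v"
    if "v \<in> carrier (Hom q 0 s)" for v
    using that v post_right[of v q 0 s a XX 1] post_left[of v q 0 s a 1 XX] by simp_all
  have t: "post q (Comp (Comp D E) F) a v = post q D a (post q E a (post q F a v))"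
    if "welltyped (Comp (Comp D E) F)" "msrc D = 3" "msrc E = 3" "msrc F = 3" for D E F :: "'k mor"
  proof -
    have "post q F a v \<in> carrier (Hom q 0 s)" by (rule post_closed[OF v(1)]) (use v that in auto)
    then show ?thesis using that v post_comp[of v q 0 s a F "Comp D E"] post_comp[of "post q F a v" q 0 s a E D] by simp
  qed
  have "post q (Comp (Comp (Tens XX strand) (Tens strand XX)) (Tens XX strand)) a v =
      post q (Comp (Comp (Tens strand XX) (Tens XX strand)) (Tens strand XX)) a v"
    by (rule relation_post[OF mor_eq.braid v])
  moreover have "post q (Comp (Comp (Tens XX strand) (Tens strand XX)) (Tens XX strand)) a v = post q XX a (post q XX (Suc a) (post q XX a v))"
    by (subst t) (use l c v in simp_all)
  moreover have "post q (Comp (Comp (Tens strand XX) (Tens XX strand)) (Tens strand XX)) a v = post q XX (Suc a) (post q XX a (post q XX (Suc a) v))"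
    by (subst t) (use l c v in simp_all)
  ultimately show "post q XX a (post q XX (Suc a) (post q XX a v)) = post q XX (Suc a) (post q XX a (post q XX (Suc a) v))" by simp
next
  fix v :: "'k mor set" and s a
  assume v: "v \<in> carrier (Hom q 0 s)" "Suc a \<le> s"
  have v1: "a + 1 \<le> s" using v by simp
  have u: "post q cup b v \<in> carrier (Hom q 0 (s + 2))" if "b \<le> s" for b by (rule post_piece_closed[OF v(1)]) (use that in auto)
  have r: "post q (Tens strand cup) a v = post q cup (Suc a) v" "post q (Tens cup strand) a v = post q cup a v"
    using v post_left[OF v(1), of a 1 cup] post_right[OF v(1), of a cup 1] by simp_all
  have "post q cap a (post q cup (Suc a) v) = post q (Comp (Tens cap strand) (Tens strand cup)) a v"
    using v r post_comp[OF v(1), of a "Tens strand cup" "Tens cap strand"] post_right[OF u[of "Suc a"], of a cap 1] by simp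
  also have "\<dots> = post q strand a v" by (rule relation_post[OF mor_eq.zigzag_left v(1) v1])
  also have "\<dots> = v" by (rule post_ident[OF v(1) v1])
  finally show "post q cap a (post q cup (Suc a) v) = v" .
  have "post q cap (Suc a) (post q cup a v) = post q (Comp (Tens strand cap) (Tens cup strand)) a v"
    using v r post_comp[OF v(1), of a "Tens cup strand" "Tens strand cap"] post_left[OF u[of a], of a 1 cap] by simp
  also have "\<dots> = post q (Scale (- 1) strand) a v" by (rule relation_post[OF mor_eq.zigzag_right v(1) v1])
  also have "\<dots> = (- 1) \<odot>\<^bsub>Hom q 0 s\<^esub> v"
    using v v1 post_Scale[OF v(1), of a strand s "- 1"] post_ident[OF v(1) v1] by simp
  finally show "post q cap (Suc a) (post q cup a v) = (- 1) \<odot>\<^bsub>Hom q 0 s\<^esub> v" .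
  have "post q XX (Suc a) (post q cup a v) = post q (Comp (Tens strand XX) (Tens cup strand)) a v"
    using v r post_comp[OF v(1), of a "Tens cup strand" "Tens strand XX"] post_left[OF u[of a], of a 1 XX] by simp
  also have "\<dots> = post q (Comp (Tens YY strand) (Tens strand cup)) a v" by (rule relation_post[OF mor_eq.slide_cup v(1) v1])
  also have "\<dots> = post q YY a (post q cup (Suc a) v)"
    using v r post_comp[OF v(1), of a "Tens strand cup" "Tens YY strand"] post_right[OF u[of "Suc a"], of a YY 1] by simp
  finally show "post q XX (Suc a) (post q cup a v) = post q YY a (post q cup (Suc a) v)" .
next
  fix v :: "'k mor set" and s s' a
  assume v: "v \<in> carrier (Hom q 0 s)" "a \<le> s" "s' = s + 2"
  have v1: "a + 0 \<le> s" using v by simp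
  have "post q XX a (post q cup a v) = post q (Comp XX cup) a v"
    using v post_comp[OF v(1), of a cup XX] by simp
  also have "\<dots> = post q (Scale q cup) a v" by (rule relation_post[OF mor_eq.X_cup v(1) v1])
  also have "\<dots> = q \<odot>\<^bsub>Hom q 0 s'\<^esub> post q cup a v" using v post_Scale[OF v(1), of a cup s' q] by simp
  finally show "post q XX a (post q cup a v) = q \<odot>\<^bsub>Hom q 0 s'\<^esub> post q cup a v" .
next
  fix v :: "'k mor set" and s a
  assume v: "v \<in> carrier (Hom q 0 s)" "a \<le> s"
  have v1: "a + 0 \<le> s" using v by simp
  have z: "mor_eq q 0 0 (Zero 0 0) (Scale 0 (Zero 0 0))" by (rule mor_eq.sym, rule mor_eq.scale_zero, rule in_hom_rules)
  have "post q cap a (post q cup a v) = post q (Comp cap cup) a v"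
    using v post_comp[OF v(1), of a cup cap] by simp
  also have "\<dots> = post q (Zero 0 0) a v" by (rule relation_post[OF mor_eq.cap_cup v(1) v1])
  also have "\<dots> = post q (Scale 0 (Zero 0 0)) a v" by (rule relation_post[OF z v(1) v1])
  also have "\<dots> = 0 \<odot>\<^bsub>Hom q 0 s\<^esub> post q (Zero 0 0) a v"
    using v post_Scale[OF v(1), of a "Zero 0 0" s 0] by simp
  also have "\<dots> = \<zero>\<^bsub>Hom q 0 s\<^esub>"
    using module.smult_l_null[OF Hom_module, of "post q (Zero 0 0) a v" q 0 s] post_closed[OF v(1), of a "Zero 0 0" s] v by simp
  finally show "post q cap a (post q cup a v) = \<zero>\<^bsub>Hom q 0 s\<^esub>" .
qed (rule q_invertible)

interpretation br: brauer_ops q "unit_inverse q" "Hom q 0" "\<lambda>p. post q (Piece p)" "mor_class q 0 0 (ident 0)"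
  by (rule brauer_hom)

text \<open>Every morphism is built from pieces, each of which preserves the span.\<close>

lemma post_spanned:
  assumes "welltyped f" "v \<in> lspan (Hom q 0 s) (br.diagram_span_basis s)" "a + msrc f \<le> s" "t = s + mtgt f - msrc f"
  shows "post q f a v \<in> lspan (Hom q 0 t) (br.diagram_span_basis t)"
  using assms
proof (induction f arbitrary: a v s t)
  case (Piece p)
  then show ?case using br.W_opr_closed[of v s a p t] by simp
next
  case (Comp g h)
  have "post q h a v \<in> br.W (s + mtgt h - msrc h)" using Comp.prems by (intro Comp.IH(2)) auto
  then have "post q g a (post q h a v) \<in> br.W t" using Comp.prems by (intro Comp.IH(1)) auto
  then show ?case using post_comp[OF br.W_closed[OF Comp.prems(2)], of a h g] Comp.prems by simp
next
  case (Tens g h)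
  have v: "v \<in> carrier (Hom q 0 s)" by (rule br.W_closed[OF Tens.prems(2)])
  let ?u = "post q h (a + msrc g) v" and ?r = "s + mtgt h - msrc h"
  have "?u \<in> br.W ?r" using Tens.prems by (intro Tens.IH(2)) auto
  moreover from this have "post q g a ?u \<in> br.W t" using Tens.prems by (intro Tens.IH(1)) auto
  moreover have "post q (Tens g h) a v = post q g a ?u"
  proof -
    have "post q (Tens g h) a v = post q (Comp (Tens g (ident (mtgt h))) (Tens (ident (msrc g)) h)) a v"
      using Tens.prems v by (intro post_cong tens_left_right) auto
    also have "\<dots> = post q (Tens g (ident (mtgt h))) a (post q (Tens (ident (msrc g)) h) a v)"
      using Tens.prems v by (intro post_comp) auto
    also have "post q (Tens (ident (msrc g)) h) a v = ?u" using Tens.prems v by (intro post_left) auto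
    also have "post q (Tens g (ident (mtgt h))) a ?u = post q g a ?u"
      using Tens.prems \<open>?u \<in> br.W ?r\<close> by (intro post_right[of _ _ _ ?r]) (auto dest: br.W_closed)
    finally show ?thesis .
  qed
  ultimately show ?case by simp
next
  case (Zero k l)
  have v: "v \<in> carrier (Hom q 0 s)" by (rule br.W_closed[OF Zero.prems(2)])
  have "post q (Zero k l) a v = post q (Scale 0 (Zero k l)) a v"
    using Zero.prems v by (intro relation_post[OF mor_eq.sym[OF mor_eq.scale_zero]] in_hom_rules) auto
  also have "\<dots> = 0 \<odot>\<^bsub>Hom q 0 t\<^esub> post q (Zero k l) a v" using Zero.prems v by (intro post_Scale) auto
  also have "\<dots> = \<zero>\<^bsub>Hom q 0 t\<^esub>"
    using module.smult_l_null[OF Hom_module, of "post q (Zero k l) a v" q 0 t] post_closed[OF v, of a "Zero k l" t] Zero.prems by simp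
  finally show ?case by (simp add: lspan_zero)
next
  case (Add f g)
  have v: "v \<in> carrier (Hom q 0 s)" by (rule br.W_closed[OF Add.prems(2)])
  have "post q f a v \<in> br.W t" "post q g a v \<in> br.W t" using Add.prems by (auto intro!: Add.IH)
  then show ?case using post_Add[OF v, of a f g t] Add.prems by (simp add: lspan_add)
next
  case (Scale c f)
  have v: "v \<in> carrier (Hom q 0 s)" by (rule br.W_closed[OF Scale.prems(2)])
  have "post q f a v \<in> br.W t" using Scale.prems by (auto intro!: Scale.IH)
  then show ?case using post_Scale[OF v, of a f t c] Scale.prems by (simp add: lspan_smult)
qed

text \<open>A morphism \<open>0 \<rightarrow> s\<close> is the image of the identity of the unit object under postcomposition with itself.\<close>

theorem Hom_unit_spanned:
  assumes "v \<in> carrier (Hom q 0 s)"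
  shows "v \<in> lspan (Hom q 0 s) (br.diagram_span_basis s)"
proof -
  obtain f where f: "in_hom f 0 s" "v = mor_class q 0 s f" using assms by (rule carrier_HomE)
  have w: "welltyped f" "msrc f = 0" "mtgt f = s" using f(1) by (auto simp: in_hom_iff)
  have i: "in_hom (ident 0 :: 'k mor) 0 0" by (simp add: in_hom_iff)
  have "post q f 0 (mor_class q 0 0 (ident 0)) \<in> lspan (Hom q 0 s) (br.diagram_span_basis s)"
    by (rule post_spanned[where s = 0]) (use w in \<open>auto intro: lspan_base\<close>)
  moreover have "post q f 0 (mor_class q 0 0 (ident 0)) = v"
  proof -
    have "post q f 0 (mor_class q 0 0 (ident 0)) = mor_class q 0 s (Comp (put 0 f 0) (ident 0))"
      by (rule post_class[OF i]) (use w in auto)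
    also have "\<dots> = mor_class q 0 s f"
    proof (rule class_eqI)
      have "eqv q (Comp (put 0 f 0) (ident 0)) (put 0 f 0)" using w by (intro eqv_id_right) auto
      also have "eqv q (put 0 f 0) (Tens f (ident 0))" unfolding put_def using w by (intro eqv_unit_left) auto
      also have "eqv q (Tens f (ident 0)) f" using w by (intro eqv_unit_right)
      finally show "eqv q (Comp (put 0 f 0) (ident 0)) f" .
    qed (use w in auto)
    finally show ?thesis using f by simp
  qed
  ultimately show ?thesis by simp
qed

end

section \<open>One diagram for each perfect matching\<close>
text \<open>Unlike \<open>run\<close>, this starts from an arbitrary word; the strands to the right of a layer are irrelevant for it, which
allows to add further strands on the right.\<close>

inductive steps :: "int list \<Rightarrow> layer list \<Rightarrow> int list \<Rightarrow> bool" where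
  steps_nil: "steps g [] g"
| steps_cons: "word_step a p g g' \<Longrightarrow> steps g' Ls g'' \<Longrightarrow> steps g ((a, p, b) # Ls) g''"

lemma steps_append: "steps g Ls g' \<Longrightarrow> steps g' Ks g'' \<Longrightarrow> steps g (Ls @ Ks) g''"
  by (induction rule: steps.induct) (auto intro: steps_cons)

lemma steps_one: "word_step a p g g' \<Longrightarrow> steps g [(a, p, b)] g'"
  by (rule steps_cons[OF _ steps_nil])

lemma steps_right: "steps g Ls g' \<Longrightarrow> steps g (map (\<lambda>(a, p, b). (a, p, b + k)) Ls) g'"
  by (induction rule: steps.induct) (auto intro: steps.intros)

lemma run_steps: "steps g Ls g' \<Longrightarrow> run m Ks g \<Longrightarrow> run m (Ks @ Ls) g'"
proof (induction arbitrary: Ks rule: steps.induct)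
  case (steps_cons a p g g' Ls g'' b)
  have "run m ((Ks @ [(a, p, b)]) @ Ls) g''"
    by (rule steps_cons.IH, rule run_snoc[OF steps_cons.prems steps_cons.hyps(1)])
  then show ?case by simp
qed simp

text \<open>The shape of the tensor product agrees with \<open>put\<close>, so that the morphism of the diagram is literally the
one used for postcomposition.\<close>

definition put_on :: "nat \<Rightarrow> piece \<Rightarrow> nat \<Rightarrow> diagram \<Rightarrow> diagram" where
  "put_on a p b d = DComp (DTens (DPiece (Strands a)) (DTens (DPiece p) (DPiece (Strands b)))) d"

lemma put_on_mor: "mor_of (put_on a p b d) = Comp (put a (Piece p) b) (mor_of d)"
  by (simp add: put_on_def put_def)

lemma put_on_tangle:
  assumes "tangle_diagram m (a + piece_src p + b) d"
  shows "tangle_diagram m (a + piece_tgt p + b) (put_on a p b d)"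
proof -
  have "tangle_diagram (a + (piece_src p + b)) (a + (piece_tgt p + b)) (DTens (DPiece (Strands a)) (DTens (DPiece p) (DPiece (Strands b))))"
    using tangle_diagram.intros(3)[OF tangle_diagram.intros(1)[of "Strands a"]
        tangle_diagram.intros(3)[OF tangle_diagram.intros(1)[of p] tangle_diagram.intros(1)[of "Strands b"]]] by simp
  then show ?thesis unfolding put_on_def using assms
    by (intro tangle_diagram.intros(2)[where n = "a + piece_src p + b"]) (simp_all add: add.assoc)
qed

lemma steps_put_on:
  assumes "word_step a p g g'"
  shows "\<exists>Ks. layers (put_on a p b d) = layers d @ Ks \<and> steps g Ks g'"
proof (intro exI conjI)
  show "layers (put_on a p b d) = layers d @ [(a + piece_src p, Strands b, 0), (a, p, b), (0, Strands a, piece_tgt p + b)]"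
    by (simp add: put_on_def)
  show "steps g [(a + piece_src p, Strands b, 0), (a, p, b), (0, Strands a, piece_tgt p + b)] g'"
    by (rule steps_cons[OF ws_strands steps_cons[OF assms steps_cons[OF ws_strands steps_nil]]])
qed

fun under_diagram :: "nat \<Rightarrow> nat \<Rightarrow> diagram \<Rightarrow> diagram" where
  "under_diagram s 0 d = put_on 0 Cup s d"
| "under_diagram s (Suc k) d = put_on (Suc k) CrossY (s - Suc k) (under_diagram s k d)"

lemma under_tangle: "tangle_diagram m s d \<Longrightarrow> k \<le> s \<Longrightarrow> tangle_diagram m (Suc (Suc s)) (under_diagram s k d)"
proof (induction k)
  case 0 then show ?case using put_on_tangle[of m 0 Cup s d] by simp
next
  case (Suc k) then show ?case using put_on_tangle[of m "Suc k" CrossY "s - Suc k" "under_diagram s k d"] by simp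
qed

lemma steps_under:
  assumes "e \<noteq> 0" "e \<notin> set (g @ T)" "- e \<notin> set (g @ T)" "k \<le> length g"
  shows "\<exists>Ks. layers (under_diagram s k d) = layers d @ Ks \<and> steps (g @ T) Ks (e # take k g @ - e # drop k g @ T)"
  using assms(4)
proof (induction k)
  case 0
  have "word_step 0 Cup ([] @ (g @ T)) ([] @ e # - e # (g @ T))" by (rule ws_cup) (use assms in auto)
  then show ?case using steps_put_on[of 0 Cup "g @ T" "e # - e # g @ T" s d] by simp
next
  case (Suc k)
  then obtain Ks where K: "layers (under_diagram s k d) = layers d @ Ks" "steps (g @ T) Ks (e # take k g @ - e # drop k g @ T)" by auto
  have g: "drop k g = g ! k # drop (Suc k) g" "take (Suc k) g = take k g @ [g ! k]"
    using Suc.prems by (simp_all add: Cons_nth_drop_Suc take_Suc_conv_app_nth)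
  have "word_step (Suc k) CrossY ((e # take k g) @ - e # g ! k # drop (Suc k) g @ T) ((e # take k g) @ g ! k # - e # drop (Suc k) g @ T)"
    by (rule ws_cross) (use Suc.prems in \<open>auto simp: is_crossing_def\<close>)
  from steps_put_on[OF this, of "s - Suc k" "under_diagram s k d"] obtain Js where
    "layers (under_diagram s (Suc k) d) = layers (under_diagram s k d) @ Js"
    "steps (e # take k g @ - e # drop k g @ T) Js (e # take (Suc k) g @ - e # drop (Suc k) g @ T)"
    using g by auto
  then show ?case using K steps_append[OF K(2)] by auto
qed

text \<open>The spanning diagrams are encoded by the positions at which the successive strands end, the outermost one
first.\<close>

fun code :: "nat list \<Rightarrow> bool" where
  "code [] \<longleftrightarrow> True"
| "code (k # ks) \<longleftrightarrow> k \<le> 2 * length ks \<and> code ks"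

fun cup_diagram :: "nat list \<Rightarrow> diagram" where
  "cup_diagram [] = DPiece (Strands 0)"
| "cup_diagram (k # ks) = under_diagram (2 * length ks) k (cup_diagram ks)"

text \<open>The matching of the diagram of a code. The letters exceed \<open>c\<close>, which keeps them apart from the letters of
\<open>m\<close> further strands.\<close>

fun cup_word :: "nat \<Rightarrow> nat list \<Rightarrow> int list" where
  "cup_word c [] = []"
| "cup_word c (k # ks) = (let g = cup_word c ks; e = int (c + Suc (length ks)) in
     e # take k g @ - e # drop k g)"

lemma length_cup_word [simp]: "length (cup_word c ks) = 2 * length ks"
  by (induction ks) (auto simp: Let_def)

lemma set_cup_word: "x \<in> set (cup_word c ks) \<Longrightarrow> int c < \<bar>x\<bar> \<and> \<bar>x\<bar> \<le> int (c + length ks)"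
proof (induction ks)
  case (Cons k ks)
  have "x \<in> set (cup_word c ks) \<or> \<bar>x\<bar> = int (c + Suc (length ks))"
    using Cons.prems by (auto simp: Let_def dest: in_set_takeD in_set_dropD)
  then show ?case using Cons.IH by auto
qed simp

lemma cup_word_generic: "generic (cup_word c ks)"
proof (induction ks)
  case (Cons k ks)
  let ?g = "cup_word c ks" and ?e = "int (c + Suc (length ks))"
  have e: "?e \<notin> set ?g" "- ?e \<notin> set ?g" using set_cup_word[of ?e c ks] set_cup_word[of "- ?e" c ks] by auto
  have s: "set (cup_word c (k # ks)) = insert ?e (insert (- ?e) (set ?g))"
    using set_append[of "take k ?g" "drop k ?g"] by (simp only: append_take_drop_id) (auto simp: Let_def)
  have d: "distinct ?g" using Cons unfolding generic_def by simp
  then have "distinct (cup_word c (k # ks))"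
    using e set_take_disj_set_drop_if_distinct[OF d, of k k] by (auto simp: Let_def dest: in_set_takeD in_set_dropD)
  then show ?case using Cons unfolding generic_def s by auto
qed (simp add: generic_def)

lemma cup_diagram_tangle: "code ks \<Longrightarrow> tangle_diagram 0 (2 * length ks) (cup_diagram ks)"
proof (induction ks)
  case Nil then show ?case using tangle_diagram.intros(1)[of "Strands 0"] by simp
next
  case (Cons k ks) then show ?case using under_tangle[of 0 "2 * length ks" "cup_diagram ks" k] by simp
qed

lemma steps_cup_diagram:
  assumes "code ks" "\<And>x. x \<in> set T \<Longrightarrow> \<bar>x\<bar> \<le> int c"
  shows "steps T (layers (cup_diagram ks)) (cup_word c ks @ T)"
  using assms(1)
proof (induction ks)
  case Nil show ?case by (simp add: steps_one ws_strands)
next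
  case (Cons k ks)
  let ?e = "int (c + Suc (length ks))"
  have e: "?e \<notin> set (cup_word c ks @ T)" "- ?e \<notin> set (cup_word c ks @ T)"
    using set_cup_word[of ?e c ks] set_cup_word[of "- ?e" c ks] assms(2)[of ?e] assms(2)[of "- ?e"] by auto
  obtain Ks where "layers (under_diagram (2 * length ks) k (cup_diagram ks)) = layers (cup_diagram ks) @ Ks"
    "steps (cup_word c ks @ T) Ks (?e # take k (cup_word c ks) @ - ?e # drop k (cup_word c ks) @ T)"
    using steps_under[of ?e "cup_word c ks" T k "2 * length ks" "cup_diagram ks"] e Cons.prems by auto
  then show ?case using steps_append[OF Cons.IH] Cons.prems by (simp add: Let_def)
qed

text \<open>The last \<open>m\<close> upper ends are bent down with caps, one at a time.\<close>

fun bend :: "nat \<Rightarrow> nat \<Rightarrow> diagram \<Rightarrow> diagram" where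
  "bend 0 s d = d"
| "bend (Suc m) s d = DComp (DTens (DPiece (Strands s)) (DPiece Cap)) (DTens (bend m (Suc s) d) (DPiece (Strands 1)))"

lemma bend_tangle: "tangle_diagram 0 (m + s) d \<Longrightarrow> tangle_diagram m s (bend m s d)"
proof (induction m arbitrary: s)
  case (Suc m)
  have "tangle_diagram m (Suc s) (bend m (Suc s) d)" using Suc by simp
  from tangle_diagram.intros(3)[OF this tangle_diagram.intros(1)[of "Strands 1"]]
  have "tangle_diagram (Suc m) (s + 2) (DTens (bend m (Suc s) d) (DPiece (Strands 1)))" by simp
  moreover have "tangle_diagram (s + 2) s (DTens (DPiece (Strands s)) (DPiece Cap))"
    using tangle_diagram.intros(3)[OF tangle_diagram.intros(1)[of "Strands s"] tangle_diagram.intros(1)[of Cap]] by simp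
  ultimately show ?case by (auto intro: tangle_diagram.intros(2))
qed simp

text \<open>Bending does not change the matching. A cap joins the letter \<open>a\<close> of a new strand with the letter \<open>y\<close> at
the end which is bent, and the remaining letter \<open>- a\<close> at the bottom takes over the role of \<open>y\<close>. As \<open>word_step\<close>
renames \<open>y\<close> to \<open>- a\<close>, the word agrees with the original one only up to the relabelling \<open>h\<close>. The words
\<open>B\<close> and \<open>V\<close> collect the letters of the strands which are bent later.\<close>

lemma steps_bend:
  assumes "steps (A @ B @ V @ map uminus (rev A)) (layers d) (g @ A @ B @ V @ map uminus (rev A))"
    "length g = m + s" "length A = m" "0 \<notin> set (g @ A)"
    "distinct (map abs A)" "abs ` set g \<inter> abs ` set (A @ B @ V) = {}" "abs ` set A \<inter> abs ` set (B @ V) = {}"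
  shows "\<exists>h. (\<forall>x. h (- x) = - h x) \<and> abs ` h ` set g \<subseteq> abs ` set (g @ A) \<and>
     steps (A @ B @ V @ map uminus (rev A)) (layers (bend m s d)) (map h (take s g) @ B @ V @ map h (drop s g))"
  using assms
proof (induction m arbitrary: s A B V)
  case 0
  then have "steps (A @ B @ V @ map uminus (rev A)) (layers (bend 0 s d)) (map id (take s g) @ B @ V @ map id (drop s g))" by simp
  then show ?case by (intro exI[of _ id]) auto
next
  case (Suc m)
  obtain A0 a where A: "A = A0 @ [a]" "length A0 = m" using Suc.prems(3) by (metis length_Suc_conv_rev)
  let ?T = "A @ B @ V @ map uminus (rev A)"
  have "\<exists>h. (\<forall>x. h (- x) = - h x) \<and> abs ` h ` set g \<subseteq> abs ` set (g @ A0) \<and>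
     steps (A0 @ (a # B) @ (V @ [- a]) @ map uminus (rev A0)) (layers (bend m (Suc s) d))
       (map h (take (Suc s) g) @ (a # B) @ (V @ [- a]) @ map h (drop (Suc s) g))"
    by (rule Suc.IH) (use Suc.prems A in auto)
  then obtain h where h: "\<And>x. h (- x) = - h x" "abs ` h ` set g \<subseteq> abs ` set (g @ A0)"
    "steps ?T (layers (bend m (Suc s) d)) (map h (take (Suc s) g) @ (a # B) @ (V @ [- a]) @ map h (drop (Suc s) g))"
    using A by auto
  define y where "y = h (g ! s)"
  have s: "s < length g" using Suc.prems(2) by simp
  then have "y \<in> h ` set g" unfolding y_def by simp
  then have y: "\<bar>y\<bar> \<in> abs ` set (g @ A0)" using h(2) by blast
  have y0: "y \<noteq> 0" using y Suc.prems(4) A by auto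
  have ya: "\<bar>y\<bar> \<noteq> \<bar>a\<bar>" using y Suc.prems(5,6) A by auto
  have yB: "\<bar>y\<bar> \<notin> abs ` set (B @ V)" using y Suc.prems(6,7) A by auto
  let ?r = "ren y a"
  have r_other: "?r t = t" if "\<bar>t\<bar> \<noteq> \<bar>y\<bar>" for t using that by (auto simp: ren_def)
  have r_abs: "\<bar>?r t\<bar> = \<bar>t\<bar> \<or> \<bar>?r t\<bar> = \<bar>a\<bar>" for t by (auto simp: ren_def)
  have "?r t = t" if "t \<in> set (B @ V)" for t
    by (rule r_other) (use yB imageI[OF that, of abs] in metis)
  then have rB: "map ?r B = B" "map ?r V = V" by (auto intro: map_idI)
  have ra: "?r (- a) = - a" using ya by (intro r_other) auto
  have ry: "?r y = - a" by (simp add: ren_def)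
  have "word_step s Cap (map h (take s g) @ y # a # (B @ V @ [- a] @ map h (drop (Suc s) g)))
      (map ?r (map h (take s g) @ (B @ V @ [- a] @ map h (drop (Suc s) g))))"
    by (rule ws_cap) (use s ya in auto)
  moreover have "map ?r (map h (take s g) @ (B @ V @ [- a] @ map h (drop (Suc s) g))) =
      map (?r \<circ> h) (take s g) @ B @ V @ map (?r \<circ> h) (drop s g)"
    using rB ra ry s by (simp add: y_def Cons_nth_drop_Suc[symmetric])
  moreover have "map h (take (Suc s) g) @ (a # B) @ (V @ [- a]) @ map h (drop (Suc s) g) =
      map h (take s g) @ y # a # (B @ V @ [- a] @ map h (drop (Suc s) g))"
    using s by (simp add: take_Suc_conv_app_nth y_def)
  ultimately have cap: "word_step s Cap (map h (take (Suc s) g) @ (a # B) @ (V @ [- a]) @ map h (drop (Suc s) g))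
      (map (?r \<circ> h) (take s g) @ B @ V @ map (?r \<circ> h) (drop s g))" by simp
  have L: "layers (bend (Suc m) s d) = [(src (bend m (Suc s) d), Strands 1, 0)] @
      map (\<lambda>(a, x, b). (a, x, b + 1)) (layers (bend m (Suc s) d)) @ [(s, Cap, 0)] @ [(0, Strands s, 0)]"
    by simp
  have "steps ?T (layers (bend (Suc m) s d)) (map (?r \<circ> h) (take s g) @ B @ V @ map (?r \<circ> h) (drop s g))"
    unfolding L by (rule steps_append[OF steps_one[OF ws_strands] steps_append[OF steps_right[OF h(3)] steps_append[OF steps_one[OF cap] steps_one[OF ws_strands]]]])
  moreover have "(?r \<circ> h) (- x) = - (?r \<circ> h) x" for x by (simp add: h(1) ren_uminus[OF y0])
  moreover have "abs ` (?r \<circ> h) ` set g \<subseteq> abs ` set (g @ A)"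
  proof
    fix t assume "t \<in> abs ` (?r \<circ> h) ` set g"
    then obtain x where x: "x \<in> set g" "t = \<bar>?r (h x)\<bar>" by auto
    have "\<bar>h x\<bar> \<in> abs ` set (g @ A0)" using h(2) x(1) by blast
    then show "t \<in> abs ` set (g @ A)" using r_abs[of "h x"] x(2) A by auto
  qed
  ultimately show ?case by blast
qed

lemma bend_run:
  assumes "code ks" "2 * length ks = m + s"
  obtains h where "\<And>x. h (- x) = - h x" "run m (layers (bend m s (cup_diagram ks))) (map h (cup_word m ks))"
proof -
  let ?A = "map (\<lambda>i. int (Suc i)) [0..<m]" and ?g = "cup_word m ks"
  have A: "start_word m = ?A @ [] @ [] @ map uminus (rev ?A)" by (simp add: start_word_def rev_map)
  have gA: "int m < \<bar>x\<bar>" if "x \<in> set ?g" for x using set_cup_word[OF that] by simp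
  have "steps (start_word m) (layers (cup_diagram ks)) (?g @ start_word m)"
    by (rule steps_cup_diagram[OF assms(1)]) (auto simp: start_word_def)
  then have "\<exists>h. (\<forall>x. h (- x) = - h x) \<and> abs ` h ` set ?g \<subseteq> abs ` set (?g @ ?A) \<and>
     steps (?A @ [] @ [] @ map uminus (rev ?A)) (layers (bend m s (cup_diagram ks))) (map h (take s ?g) @ [] @ [] @ map h (drop s ?g))"
    unfolding A
    by (rule steps_bend) (use assms gA in \<open>auto simp: distinct_map inj_on_def dest: gA\<close>)
  then obtain h where h: "\<forall>x. h (- x) = - h x"
    "steps (?A @ [] @ [] @ map uminus (rev ?A)) (layers (bend m s (cup_diagram ks))) (map h (take s ?g) @ [] @ [] @ map h (drop s ?g))"
    by blast
  have "map h (take s ?g) @ [] @ [] @ map h (drop s ?g) = map h ?g" by (simp flip: map_append)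
  then have "steps (start_word m) (layers (bend m s (cup_diagram ks))) (map h ?g)" using h(2) unfolding A by (simp only:)
  then have "run m ([] @ layers (bend m s (cup_diagram ks))) (map h ?g)"
    by (intro run_steps[OF _ run_nil]) simp
  then show thesis using h(1) by (intro that[of h]) simp_all
qed

lemma word_pos_onto:
  assumes "i < m + s"
  obtains u where "u \<in> ends m s" "word_pos m s u = i"
proof (cases "i < s")
  case True
  have "Top (Suc i) \<in> ends m s" unfolding ends_def by (rule UnI2, rule imageI) (use True in simp)
  then show thesis by (rule that) (simp add: word_pos_def)
next
  case False
  have "Bot (s + m - i) \<in> ends m s" unfolding ends_def by (rule UnI1, rule imageI) (use assms False in auto)
  then show thesis by (rule that) (use assms in \<open>simp add: word_pos_def\<close>)
qed

lemma word_pos_less: "u \<in> ends m s \<Longrightarrow> word_pos m s u < m + s"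
  by (auto simp: ends_def word_pos_def)

lemma word_conn_compat:
  assumes "generic g" "generic (map h g)" "\<And>x. h (- x) = - h x" "length g = m + s"
  shows "word_conn m s (map h g) = word_conn m s g"
proof -
  have "\<bar>h x\<bar> = \<bar>h y\<bar> \<longleftrightarrow> \<bar>x\<bar> = \<bar>y\<bar>" if "x \<in> set g" "y \<in> set g" for x y
  proof
    have inj: "inj_on h (set g)" using assms(2) by (simp add: generic_def distinct_map)
    have my: "- y \<in> set g" using assms(1) that by (simp add: generic_def)
    assume "\<bar>h x\<bar> = \<bar>h y\<bar>"
    then have "h x = h y \<or> h x = h (- y)" unfolding assms(3) by linarith
    then have "x = y \<or> x = - y" using inj_onD[OF inj] that my by blast
    then show "\<bar>x\<bar> = \<bar>y\<bar>" by auto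
  next
    assume "\<bar>x\<bar> = \<bar>y\<bar>"
    then have "x = y \<or> x = - y" by linarith
    then show "\<bar>h x\<bar> = \<bar>h y\<bar>" using assms(3) by auto
  qed
  then have "\<bar>map h g ! word_pos m s u\<bar> = \<bar>map h g ! word_pos m s v\<bar> \<longleftrightarrow> \<bar>g ! word_pos m s u\<bar> = \<bar>g ! word_pos m s v\<bar>"
    if "u \<in> ends m s" "v \<in> ends m s" for u v using that word_pos_less[of _ m s] assms(4) by simp
  then show ?thesis unfolding word_conn_def by blast
qed

lemma word_conn_pairing:
  assumes "word_conn m s g = word_conn m s g'" "i < m + s" "j < m + s"
  shows "\<bar>g ! i\<bar> = \<bar>g ! j\<bar> \<longleftrightarrow> \<bar>g' ! i\<bar> = \<bar>g' ! j\<bar>"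
proof -
  obtain u v where u: "u \<in> ends m s" "word_pos m s u = i" and v: "v \<in> ends m s" "word_pos m s v = j"
    using assms word_pos_onto by metis
  consider "u < v" | "v < u" | "u = v" by (rule linorder_cases)
  then show ?thesis
  proof cases
    case 1
    then have "\<bar>f ! i\<bar> = \<bar>f ! j\<bar> \<longleftrightarrow> (u, v) \<in> word_conn m s f" for f using u v by (simp add: word_conn_def)
    then show ?thesis using assms(1) by simp
  next
    case 2
    then have "\<bar>f ! i\<bar> = \<bar>f ! j\<bar> \<longleftrightarrow> (v, u) \<in> word_conn m s f" for f using u v by (auto simp: word_conn_def)
    then show ?thesis using assms(1) by simp
  next
    case 3 then show ?thesis using u v by simp
  qed
qed

lemma nth_insert_pair:
  assumes "k \<le> length r"
  shows "(e # take k r @ - e # drop k r) ! 0 = e" "(e # take k r @ - e # drop k r) ! Suc k = - e"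
    "i < length r \<Longrightarrow> (e # take k r @ - e # drop k r) ! (if i < k then Suc i else Suc (Suc i)) = r ! i"
  using assms by (auto simp: nth_append)

text \<open>The position matched with the first one determines the first entry of the code, and the
remaining pairs determine the rest.\<close>

lemma cup_word_injective:
  assumes "length ks = length ks'" "code ks" "code ks'"
    "\<And>i j. i < 2 * length ks \<Longrightarrow> j < 2 * length ks \<Longrightarrow>
       \<bar>cup_word c ks ! i\<bar> = \<bar>cup_word c ks ! j\<bar> \<longleftrightarrow> \<bar>cup_word c ks' ! i\<bar> = \<bar>cup_word c ks' ! j\<bar>"
  shows "ks = ks'"
  using assms
proof (induction ks arbitrary: ks')
  case (Cons k ks)
  obtain l ls where l: "ks' = l # ls" "length ls = length ks" using Cons.prems(1) by (cases ks') auto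
  let ?e = "int (c + Suc (length ks))" and ?r = "cup_word c ks" and ?t = "cup_word c ls"
  let ?g = "?e # take k ?r @ - ?e # drop k ?r" and ?h = "?e # take l ?t @ - ?e # drop l ?t"
  have w: "cup_word c (k # ks) = ?g" "cup_word c (l # ls) = ?h" using l by (simp_all add: Let_def)
  have kl: "k \<le> length ?r" "l \<le> length ?t" using Cons.prems(2,3) l by simp_all
  have eq: "\<bar>?g ! i\<bar> = \<bar>?g ! j\<bar> \<longleftrightarrow> \<bar>?h ! i\<bar> = \<bar>?h ! j\<bar>" if "i < Suc (Suc (2 * length ks))" "j < Suc (Suc (2 * length ks))" for i j
    using Cons.prems(4)[of i j] that unfolding l(1) w by simp
  have small: "\<bar>x\<bar> \<noteq> ?e" if "x \<in> set ?t" for x using set_cup_word[OF that] l by auto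
  have c: "\<bar>?g ! 0\<bar> = \<bar>?g ! Suc k\<bar>" unfolding nth_insert_pair(1,2)[OF kl(1)] by (rule abs_minus_cancel[symmetric])
  have "\<bar>?h ! 0\<bar> = \<bar>?h ! Suc k\<bar>"
    by (rule iffD1[OF eq c]) (use kl in simp_all)
  moreover have "\<bar>?h ! 0\<bar> = ?e" unfolding nth_insert_pair(1)[OF kl(2)] by linarith
  ultimately have pair: "\<bar>?h ! Suc k\<bar> = ?e" by (simp only:)
  have other: "\<bar>?h ! Suc i\<bar> \<noteq> ?e" if "i \<noteq> l" "i \<le> length ?t" for i
  proof (cases "i < l")
    case True
    have len: "i < length ?t" using True kl by simp
    have eqn: "?h ! Suc i = ?t ! i" using nth_insert_pair(3)[OF kl(2) len, of ?e] True by (simp only: if_True)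
    show ?thesis unfolding eqn by (rule small[OF nth_mem[OF len]])
  next
    case False
    then obtain j where j: "i = Suc j" "\<not> j < l" "j < length ?t" using \<open>i \<noteq> l\<close> \<open>i \<le> length ?t\<close> by (cases i) auto
    have eqn: "?h ! Suc (Suc j) = ?t ! j" using nth_insert_pair(3)[OF kl(2) j(3), of ?e] j(2) by (simp only: if_False)
    show ?thesis unfolding j(1) eqn by (rule small[OF nth_mem[OF j(3)]])
  qed
  have k: "k = l"
  proof (rule ccontr)
    assume "k \<noteq> l"
    moreover have "k \<le> length ?t" using kl l by simp
    ultimately show False using other pair by blast
  qed
  have "ks = ls"
  proof (rule Cons.IH)
    fix i j assume ij: "i < 2 * length ks" "j < 2 * length ks"
    let ?p = "\<lambda>i. if i < k then Suc i else Suc (Suc i)"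
    have "?g ! ?p i = ?r ! i" "?g ! ?p j = ?r ! j" by (rule nth_insert_pair(3)[OF kl(1)], use ij in simp)+
    moreover have "?h ! ?p i = ?t ! i" "?h ! ?p j = ?t ! j"
      unfolding k by (rule nth_insert_pair(3)[OF kl(2)], use ij l in simp)+
    moreover have "?p i < Suc (Suc (2 * length ks))" "?p j < Suc (Suc (2 * length ks))" using ij by auto
    ultimately show "\<bar>?r ! i\<bar> = \<bar>?r ! j\<bar> \<longleftrightarrow> \<bar>?t ! i\<bar> = \<bar>?t ! j\<bar>" using eq[of "?p i" "?p j"] by (simp only:)
  qed (use l Cons.prems in auto)
  then show ?case using k l by simp
qed simp

section \<open>Spanning the morphisms out of an arbitrary object\<close>
lemma tangle_in_hom: "tangle_diagram m s d \<Longrightarrow> in_hom (mor_of d) m s"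
  by (induction rule: tangle_diagram.induct) (auto intro: in_hom.intros)

lemma lspan_mono: "v \<in> lspan M B \<Longrightarrow> B \<subseteq> B' \<Longrightarrow> v \<in> lspan M B'"
  by (induction rule: lspan.induct) (auto intro: lspan.intros)

definition codes :: "nat \<Rightarrow> nat list set" where "codes N = {ks. code ks \<and> 2 * length ks = N}"

context brauer_module
begin

interpretation br: brauer_ops q "unit_inverse q" "Hom q 0" "\<lambda>p. post q (Piece p)" "mor_class q 0 0 (ident 0)"
  by (rule brauer_hom)

text \<open>The vector \<open>us k v\<close> of the abstract span is the class of an actual diagram.\<close>

lemma under_class:
  assumes "tangle_diagram 0 s d" "k \<le> s"
  shows "br.us k (mor_class q 0 s (mor_of d)) = mor_class q 0 (Suc (Suc s)) (mor_of (under_diagram s k d))"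
  using assms(2)
proof (induction k)
  case 0
  have "post q cup 0 (mor_class q 0 s (mor_of d)) = mor_class q 0 (Suc (Suc s)) (Comp (put 0 cup s) (mor_of d))"
    by (rule post_class[OF tangle_in_hom[OF assms(1)]]) simp_all
  then show ?case unfolding br.under_strand.simps under_diagram.simps put_on_mor .
next
  case (Suc k)
  have d: "tangle_diagram 0 (Suc (Suc s)) (under_diagram s k d)"
    by (rule under_tangle[OF assms(1)]) (use Suc.prems in simp)
  have IH: "br.us k (mor_class q 0 s (mor_of d)) = mor_class q 0 (Suc (Suc s)) (mor_of (under_diagram s k d))"
    by (rule Suc.IH) (use Suc.prems in simp)
  have "post q YY (Suc k) (mor_class q 0 (Suc (Suc s)) (mor_of (under_diagram s k d))) =
      mor_class q 0 (Suc (Suc s)) (Comp (put (Suc k) YY (s - Suc k)) (mor_of (under_diagram s k d)))"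
    by (rule post_class[OF tangle_in_hom[OF d]]) (use Suc.prems in simp_all)
  then show ?case unfolding br.under_strand.simps under_diagram.simps put_on_mor IH .
qed

lemma span_basis_diagrams:
  "br.diagram_span_basis s \<subseteq> (\<lambda>ks. mor_class q 0 s (mor_of (cup_diagram ks))) ` codes s"
proof (induction s rule: br.diagram_span_basis.induct)
  case 1
  have "[] \<in> codes 0" by (simp add: codes_def)
  then show ?case by force
next
  case (3 s)
  show ?case
  proof
    fix v assume "v \<in> br.diagram_span_basis (Suc (Suc s))"
    then obtain k u where k: "k \<le> s" "u \<in> br.diagram_span_basis s" "v = br.us k u"
      by (auto simp: br.diagram_span_basis.simps(3))
    have "u \<in> (\<lambda>ks. mor_class q 0 s (mor_of (cup_diagram ks))) ` codes s" using 3[of k] k by blast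
    then obtain ks where ks: "code ks" "2 * length ks = s" "u = mor_class q 0 s (mor_of (cup_diagram ks))"
      by (auto simp: codes_def)
    have "v = mor_class q 0 (Suc (Suc s)) (mor_of (cup_diagram (k # ks)))"
      using under_class[of s "cup_diagram ks" k] cup_diagram_tangle[OF ks(1)] k ks by simp
    moreover have "k # ks \<in> codes (Suc (Suc s))" using k ks by (simp add: codes_def)
    ultimately show "v \<in> (\<lambda>ks. mor_class q 0 (Suc (Suc s)) (mor_of (cup_diagram ks))) ` codes (Suc (Suc s))"
      by (rule image_eqI)
  qed
qed simp

text \<open>Bending one upper end to the bottom, for morphisms.\<close>

definition bend_mor :: "nat \<Rightarrow> 'k mor \<Rightarrow> 'k mor" where
  "bend_mor s f = Comp (Tens (ident s) cap) (Tens f strand)"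

definition bend_class :: "nat \<Rightarrow> nat \<Rightarrow> 'k mor set \<Rightarrow> 'k mor set" where
  "bend_class m s A = (\<Union>f\<in>A. mor_class q (Suc m) s (bend_mor s f))"

lemma in_hom_bend: "in_hom f m (Suc s) \<Longrightarrow> in_hom (bend_mor s f) (Suc m) s"
  by (simp add: in_hom_iff bend_mor_def)

lemma bend_class_eq:
  assumes "in_hom f m (Suc s)"
  shows "bend_class m s (mor_class q m (Suc s) f) = mor_class q (Suc m) s (bend_mor s f)"
  unfolding bend_class_def
proof (rule UN_mor_class[OF assms])
  fix f' assume f': "mor_eq q m (Suc s) f f'"
  have "eqv q (bend_mor s f') (bend_mor s f)" unfolding bend_mor_def
    by (intro eqv_Comp eqv_Tens eqv_refl eqv_sym[of q f f'])
      (use f' mor_eq_in_hom[OF f'] in \<open>auto simp: mor_eq_eqv in_hom_iff\<close>)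
  then show "mor_class q (Suc m) s (bend_mor s f') = mor_class q (Suc m) s (bend_mor s f)"
    by (rule class_eqI) (use mor_eq_in_hom[OF f'] in \<open>auto simp: in_hom_iff bend_mor_def\<close>)
qed

lemma bend_add:
  assumes "in_hom f m (Suc s)" "in_hom g m (Suc s)"
  shows "mor_class q (Suc m) s (bend_mor s (Add f g)) = mor_class q (Suc m) s (bend_mor s f) \<oplus>\<^bsub>Hom q (Suc m) s\<^esub> mor_class q (Suc m) s (bend_mor s g)"
proof -
  have w: "welltyped f" "welltyped g" "msrc f = m" "msrc g = m" "mtgt f = Suc s" "mtgt g = Suc s" using assms by (auto simp: in_hom_iff)
  have "eqv q (bend_mor s (Add f g)) (Comp (Tens (ident s) cap) (Add (Tens f strand) (Tens g strand)))"
    unfolding bend_mor_def using w by (intro eqv_Comp eqv_tens_add_left eqv_refl) auto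
  also have "eqv q \<dots> (Add (bend_mor s f) (bend_mor s g))"
    unfolding bend_mor_def using w by (intro eqv_comp_add_right) auto
  finally have "mor_class q (Suc m) s (bend_mor s (Add f g)) = mor_class q (Suc m) s (Add (bend_mor s f) (bend_mor s g))"
    by (rule class_eqI) (use w in \<open>auto simp: bend_mor_def\<close>)
  then show ?thesis using assms by (simp add: Hom_add in_hom_bend)
qed

lemma bend_scale:
  assumes "in_hom f m (Suc s)"
  shows "mor_class q (Suc m) s (bend_mor s (Scale c f)) = c \<odot>\<^bsub>Hom q (Suc m) s\<^esub> mor_class q (Suc m) s (bend_mor s f)"
proof -
  have w: "welltyped f" "msrc f = m" "mtgt f = Suc s" using assms by (auto simp: in_hom_iff)
  have "eqv q (bend_mor s (Scale c f)) (Comp (Tens (ident s) cap) (Scale c (Tens f strand)))"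
    unfolding bend_mor_def using w by (intro eqv_Comp eqv_tens_scale_left eqv_refl) auto
  also have "eqv q \<dots> (Scale c (bend_mor s f))"
    unfolding bend_mor_def using w by (intro eqv_comp_scale_right) auto
  finally have "mor_class q (Suc m) s (bend_mor s (Scale c f)) = mor_class q (Suc m) s (Scale c (bend_mor s f))"
    by (rule class_eqI) (use w in \<open>auto simp: bend_mor_def\<close>)
  then show ?thesis using assms by (simp add: Hom_smult in_hom_bend)
qed

lemma smult_zero_Hom: "v \<in> carrier (Hom q m s) \<Longrightarrow> 0 \<odot>\<^bsub>Hom q m s\<^esub> v = \<zero>\<^bsub>Hom q m s\<^esub>"
  using module.smult_l_null[OF Hom_module, of v q m s] by simp

lemma bend_lspan:
  assumes "v \<in> lspan (Hom q m (Suc s)) B" "B \<subseteq> carrier (Hom q m (Suc s))"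
  shows "v \<in> carrier (Hom q m (Suc s)) \<and> bend_class m s v \<in> lspan (Hom q (Suc m) s) (bend_class m s ` B)"
  using assms(1)
proof (induction rule: lspan.induct)
  case lspan_zero
  have z: "in_hom (Zero m (Suc s)) m (Suc s)" by (rule in_hom_rules)
  have "mor_class q m (Suc s) (Zero m (Suc s)) = mor_class q m (Suc s) (Scale 0 (Zero m (Suc s)))"
    by (rule mor_class_eq[OF mor_eq.sym[OF mor_eq.scale_zero[OF z]]])
  then have "bend_class m s \<zero>\<^bsub>Hom q m (Suc s)\<^esub> = 0 \<odot>\<^bsub>Hom q (Suc m) s\<^esub> mor_class q (Suc m) s (bend_mor s (Zero m (Suc s)))"
    using bend_class_eq[OF in_hom_rules(3)[OF z], of 0] bend_scale[OF z, of 0] by (simp add: Hom_zero)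
  also have "\<dots> = \<zero>\<^bsub>Hom q (Suc m) s\<^esub>" by (intro smult_zero_Hom mor_class_carrier in_hom_bend z)
  finally show ?case using mor_class_carrier[OF z] by (simp add: Hom_zero lspan.lspan_zero[of "Hom q (Suc m) s", unfolded Hom_zero])
next
  case (lspan_base x)
  then show ?case using assms(2) by (auto intro: lspan.lspan_base)
next
  case (lspan_add x y)
  obtain f where f: "in_hom f m (Suc s)" "x = mor_class q m (Suc s) f" using lspan_add.IH(1) carrier_HomE by blast
  obtain g where g: "in_hom g m (Suc s)" "y = mor_class q m (Suc s) g" using lspan_add.IH(2) carrier_HomE by blast
  have xy: "x \<oplus>\<^bsub>Hom q m (Suc s)\<^esub> y = mor_class q m (Suc s) (Add f g)" using f g by (simp add: Hom_add)
  have "bend_class m s (x \<oplus>\<^bsub>Hom q m (Suc s)\<^esub> y) = bend_class m s x \<oplus>\<^bsub>Hom q (Suc m) s\<^esub> bend_class m s y"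
    unfolding xy using f g bend_class_eq[OF in_hom_rules(2)[OF f(1) g(1)]] bend_class_eq[OF f(1)] bend_class_eq[OF g(1)] bend_add[OF f(1) g(1)] by simp
  then show ?case using lspan_add.IH lspan.lspan_add mor_class_carrier[OF in_hom_rules(2)[OF f(1) g(1)]] xy by metis
next
  case (lspan_smult x c)
  obtain f where f: "in_hom f m (Suc s)" "x = mor_class q m (Suc s) f" using lspan_smult.IH carrier_HomE by blast
  have xy: "c \<odot>\<^bsub>Hom q m (Suc s)\<^esub> x = mor_class q m (Suc s) (Scale c f)" using f by (simp add: Hom_smult)
  have "bend_class m s (c \<odot>\<^bsub>Hom q m (Suc s)\<^esub> x) = c \<odot>\<^bsub>Hom q (Suc m) s\<^esub> bend_class m s x"
    unfolding xy using f bend_class_eq[OF in_hom_rules(3)[OF f(1)]] bend_class_eq[OF f(1)] bend_scale[OF f(1)] by simp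
  then show ?case using lspan_smult.IH lspan.lspan_smult mor_class_carrier[OF in_hom_rules(3)[OF f(1)]] xy by metis
qed

text \<open>Bending the end back up with a cup and straightening the zigzag recovers the morphism up to
sign. The sign depends on the parity of \<open>f\<close>, which has to pass the cap.\<close>

lemma bend_onto:
  assumes f: "in_hom f (Suc m) s"
  shows "\<exists>g c. in_hom g m (Suc s) \<and> eqv q f (Scale c (bend_mor s g))"
proof -
  have w: "welltyped f" "msrc f = Suc m" "mtgt f = s" using f by (auto simp: in_hom_iff)
  define g where "g = Comp (Tens f strand) (Tens (ident m) cup)"
  have g: "in_hom g m (Suc s)" using w by (simp add: g_def in_hom_iff)
  obtain b where b: "has_parity f b" using ex_parity[OF w(1)] by blast
  define e where "e = (if b \<and> True then - 1 else (1 :: 'k))"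
  let ?mid = "Tens (Tens (ident m) cup) strand"
  have "eqv q (Tens g strand) (Tens g (Comp strand strand))"
    using g by (intro eqv_Tens eqv_refl eqv_sym[OF eqv_id_left]) (auto simp: in_hom_iff)
  also have "eqv q \<dots> (Comp (Tens (Tens f strand) strand) ?mid)"
    unfolding g_def using w by (intro eqv_sym[OF eqv_interchange_even]) (auto simp: parity_ident)
  also have "eqv q \<dots> (Comp (Tens f (Tens strand strand)) (Tens (ident m) (Tens cup strand)))"
    using w by (intro eqv_Comp eqv_tens_assoc) auto
  also have "eqv q \<dots> (Comp (Tens f (ident (1 + 1))) (Tens (ident m) (Tens cup strand)))"
    using w by (intro eqv_Comp eqv_Tens eqv_refl eqv_tens_id) auto
  finally have 1: "eqv q (Tens g strand) (Comp (Tens f (ident 2)) (Tens (ident m) (Tens cup strand)))" by (simp add: numeral_2_eq_2)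
  have "eqv q (bend_mor s g) (Comp (Tens (ident s) cap) (Comp (Tens f (ident 2)) (Tens (ident m) (Tens cup strand))))"
    unfolding bend_mor_def using w g by (intro eqv_Comp eqv_refl 1) (auto simp: in_hom_iff)
  also have "eqv q \<dots> (Comp (Comp (Tens (ident s) cap) (Tens f (ident 2))) (Tens (ident m) (Tens cup strand)))"
    using w by (intro eqv_sym[OF eqv_comp_assoc]) auto
  also have "eqv q \<dots> (Comp (Scale e (Tens f cap)) (Tens (ident m) (Tens cup strand)))"
    unfolding e_def using w b by (intro eqv_Comp tens_right_left eqv_refl) (auto simp: has_parity_iff)
  also have "eqv q \<dots> (Scale e (Comp (Tens f cap) (Tens (ident m) (Tens cup strand))))"
    using w by (intro eqv_comp_scale_left) auto
  also have "eqv q \<dots> (Scale (e * (- 1)) f)"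
  proof -
    let ?zz = "Comp (Tens strand cap) (Tens cup strand)"
    have "eqv q (Tens f cap) (Comp (Tens f (ident 0)) (Tens (ident (Suc m)) cap))"
      using w by (intro tens_left_right) auto
    also have "eqv q \<dots> (Comp f (Tens (ident m) (Tens strand cap)))"
    proof (intro eqv_Comp)
      have "eqv q (Tens (ident (m + 1)) cap) (Tens (Tens (ident m) strand) cap)"
        by (intro eqv_Tens eqv_sym[OF eqv_tens_id] eqv_refl) auto
      also have "eqv q \<dots> (Tens (ident m) (Tens strand cap))" by (intro eqv_tens_assoc) auto
      finally show "eqv q (Tens (ident (Suc m)) cap) (Tens (ident m) (Tens strand cap))" by simp
    qed (use w in \<open>auto intro: eqv_unit_right\<close>)
    finally have "eqv q (Comp (Tens f cap) (Tens (ident m) (Tens cup strand)))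
        (Comp (Comp f (Tens (ident m) (Tens strand cap))) (Tens (ident m) (Tens cup strand)))"
      using w by (intro eqv_Comp eqv_refl) auto
    also have "eqv q \<dots> (Comp f (Comp (Tens (ident m) (Tens strand cap)) (Tens (ident m) (Tens cup strand))))"
      using w by (intro eqv_comp_assoc) auto
    also have "eqv q \<dots> (Comp f (Tens (Comp (ident m) (ident m)) ?zz))"
      using w by (intro eqv_Comp eqv_refl eqv_interchange_even) (auto simp: parity_ident)
    also have "eqv q \<dots> (Comp f (Tens (ident m) (Scale (- 1) strand)))"
      using w mor_eq.zigzag_right[of q]
      by (intro eqv_Comp eqv_refl eqv_Tens eqv_id_left) (auto simp: mor_eq_eqv)
    also have "eqv q \<dots> (Comp f (Scale (- 1) (ident (m + 1))))"
    proof (intro eqv_Comp eqv_refl)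
      have "eqv q (Tens (ident m) (Scale (- 1) strand)) (Scale (- 1) (Tens (ident m) strand))" by (intro eqv_tens_scale_right) auto
      also have "eqv q \<dots> (Scale (- 1) (ident (m + 1)))" by (intro eqv_Scale eqv_tens_id)
      finally show "eqv q (Tens (ident m) (Scale (- 1) strand)) (Scale (- 1) (ident (m + 1)))" .
    qed (use w in auto)
    also have "eqv q \<dots> (Scale (- 1) (Comp f (ident (m + 1))))" using w by (intro eqv_comp_scale_right) auto
    also have "eqv q \<dots> (Scale (- 1) f)" using w by (intro eqv_Scale eqv_id_right) auto
    finally have "eqv q (Scale e (Comp (Tens f cap) (Tens (ident m) (Tens cup strand)))) (Scale e (Scale (- 1) f))" by (rule eqv_Scale)
    also have "eqv q \<dots> (Scale (e * (- 1)) f)" using w by (intro eqv_sym[OF eqv_scale_scale])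
    finally show ?thesis .
  qed
  finally have 2: "eqv q (bend_mor s g) (Scale (e * (- 1)) f)" .
  have ee: "e * e = 1" by (simp add: e_def)
  have "eqv q (Scale (- e) (bend_mor s g)) (Scale (- e) (Scale (e * (- 1)) f))" by (rule eqv_Scale[OF 2])
  also have "eqv q \<dots> (Scale (- e * (e * (- 1))) f)" using w by (intro eqv_sym[OF eqv_scale_scale])
  also have "eqv q (Scale (- e * (e * (- 1))) f) f"
  proof -
    have "- e * (e * (- 1)) = 1" using ee by simp
    then show ?thesis using w by (simp only: eqv_scale_one)
  qed
  finally show ?thesis using g eqv_sym by blast
qed

theorem Hom_spanned:
  "v \<in> carrier (Hom q m s) \<Longrightarrow>
   v \<in> lspan (Hom q m s) ((\<lambda>ks. mor_class q m s (mor_of (bend m s (cup_diagram ks)))) ` codes (m + s))"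
proof (induction m arbitrary: s v)
  case 0
  then show ?case using lspan_mono[OF Hom_unit_spanned span_basis_diagrams] by simp
next
  case (Suc m)
  let ?n = "\<lambda>ks. mor_class q m (Suc s) (mor_of (bend m (Suc s) (cup_diagram ks)))"
  obtain f where f: "in_hom f (Suc m) s" "v = mor_class q (Suc m) s f" using Suc.prems by (rule carrier_HomE)
  obtain g c where g: "in_hom g m (Suc s)" "eqv q f (Scale c (bend_mor s g))" using bend_onto[OF f(1)] by blast
  have n: "in_hom (mor_of (bend m (Suc s) (cup_diagram ks))) m (Suc s)" if "ks \<in> codes (m + Suc s)" for ks
  proof (intro tangle_in_hom bend_tangle)
    show "tangle_diagram 0 (m + Suc s) (cup_diagram ks)" using that cup_diagram_tangle[of ks] by (simp add: codes_def)
  qed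
  have "mor_class q m (Suc s) g \<in> lspan (Hom q m (Suc s)) (?n ` codes (m + Suc s))"
    by (rule Suc.IH[OF mor_class_carrier[OF g(1)]])
  moreover have "?n ` codes (m + Suc s) \<subseteq> carrier (Hom q m (Suc s))" using n by blast
  ultimately have "bend_class m s (mor_class q m (Suc s) g) \<in> lspan (Hom q (Suc m) s) (bend_class m s ` ?n ` codes (m + Suc s))"
    using bend_lspan by blast
  moreover have "bend_class m s ` ?n ` codes (m + Suc s) =
      (\<lambda>ks. mor_class q (Suc m) s (mor_of (bend (Suc m) s (cup_diagram ks)))) ` codes (Suc m + s)"
    unfolding image_image by (rule image_cong) (use bend_class_eq[OF n] in \<open>simp_all add: bend_mor_def\<close>)
  moreover have "v = c \<odot>\<^bsub>Hom q (Suc m) s\<^esub> bend_class m s (mor_class q m (Suc s) g)"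
  proof -
    have "v = mor_class q (Suc m) s (Scale c (bend_mor s g))"
      unfolding f(2) by (rule class_eqI[OF g(2)]) (use f(1) in \<open>auto simp: in_hom_iff\<close>)
    then show ?thesis using Hom_smult[OF in_hom_bend[OF g(1)]] bend_class_eq[OF g(1)] by simp
  qed
  ultimately show ?case by (simp only: lspan.lspan_smult)
qed

end

lemma bend_conn:
  assumes "ks \<in> codes (m + s)"
  shows "conn (bend m s (cup_diagram ks)) = word_conn m s (cup_word m ks)"
    "tangle_diagram m s (bend m s (cup_diagram ks))"
proof -
  have ks: "code ks" "2 * length ks = m + s" using assms by (auto simp: codes_def)
  show d: "tangle_diagram m s (bend m s (cup_diagram ks))"
    using bend_tangle[of m s "cup_diagram ks"] cup_diagram_tangle[OF ks(1)] ks(2) by simp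
  obtain h where h: "\<And>x. h (- x) = - h x" "run m (layers (bend m s (cup_diagram ks))) (map h (cup_word m ks))"
    using bend_run[OF ks] by blast
  have "fitting m (layers (bend m s (cup_diagram ks)))"
    using chain_fitting tangle_diagram_layers[OF d] by blast
  then have "generic (map h (cup_word m ks))"
    using run_labelling[OF h(2)] labellingD(1) by blast
  then have "word_conn m s (map h (cup_word m ks)) = word_conn m s (cup_word m ks)"
    by (intro word_conn_compat cup_word_generic h(1)) (simp_all add: ks)
  then show "conn (bend m s (cup_diagram ks)) = word_conn m s (cup_word m ks)"
    using conn_of_run[OF d h(2)] by simp
qed

lemma bend_conn_inj: "inj_on (\<lambda>ks. conn (bend m s (cup_diagram ks))) (codes (m + s))"
proof (rule inj_onI)
  fix ks ks' assume k: "ks \<in> codes (m + s)" "ks' \<in> codes (m + s)"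
    and eq: "conn (bend m s (cup_diagram ks)) = conn (bend m s (cup_diagram ks'))"
  have e: "word_conn m s (cup_word m ks) = word_conn m s (cup_word m ks')" using eq bend_conn(1)[OF k(1)] bend_conn(1)[OF k(2)] by simp
  have l: "2 * length ks = m + s" "2 * length ks' = m + s" using k by (auto simp: codes_def)
  show "ks = ks'"
  proof (rule cup_word_injective)
    show "length ks = length ks'" using l by simp
    show "code ks" "code ks'" using k by (auto simp: codes_def)
    show "\<bar>cup_word m ks ! i\<bar> = \<bar>cup_word m ks ! j\<bar> \<longleftrightarrow> \<bar>cup_word m ks' ! i\<bar> = \<bar>cup_word m ks' ! j\<bar>"
      if "i < 2 * length ks" "j < 2 * length ks" for i j
      using word_conn_pairing[OF e, of i j] that l by simp
  qed
qed

section \<open>The action of reduced diagrams is triangular\<close>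
text \<open>An injective relabelling that respects negation carries crossing chords to crossing chords.\<close>

lemma cr_relabel_le:
  assumes "generic g" "generic (map h g)" "\<And>x. h (- x) = - h x"
  shows "cr (map h g) \<le> cr g"
proof -
  have inj: "inj_on h (set g)" using assms(2) by (simp add: generic_def distinct_map)
  have h_abs: "\<bar>h t\<bar> = \<bar>h \<bar>t\<bar>\<bar>" for t using assms(3)[of t] by (cases "0 \<le> t") simp_all
  have "crossing_pairs (map h g) \<subseteq> (\<lambda>P. (\<lambda>t. \<bar>h t\<bar>) ` P) ` crossing_pairs g"
  proof
    fix P assume "P \<in> crossing_pairs (map h g)"
    then obtain x y where xy: "x \<in> set g" "y \<in> set g" "P = {\<bar>h x\<bar>, \<bar>h y\<bar>}" "\<bar>h x\<bar> \<noteq> \<bar>h y\<bar>" "cross (map h g) (h x) (h y)"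
      by (auto simp: crossing_pairs_def)
    have m: "- x \<in> set g" "- y \<in> set g" using xy assms(1) by (auto simp: generic_def)
    have "cross g x y"
      using xy(5) unfolding cross_def assms(3)[symmetric] using pre_map[OF inj] xy(1,2) m by simp
    moreover have "\<bar>x\<bar> \<noteq> \<bar>y\<bar>" using xy(4) h_abs[of x] h_abs[of y] by auto
    ultimately have "{\<bar>x\<bar>, \<bar>y\<bar>} \<in> crossing_pairs g" using xy by (auto simp: crossing_pairs_def)
    moreover have "P = (\<lambda>t. \<bar>h t\<bar>) ` {\<bar>x\<bar>, \<bar>y\<bar>}" using xy(3) h_abs[of x] h_abs[of y] by simp
    ultimately show "P \<in> (\<lambda>P. (\<lambda>t. \<bar>h t\<bar>) ` P) ` crossing_pairs g" by blast
  qed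
  then show ?thesis unfolding cr_def by (rule surj_card_le[OF finite_crossing_pairs])
qed

text \<open>A generic word is never an error term of its own number of crossings; this keeps the diagonal entries
\<open>\<plusminus>1\<close>.\<close>

lemma compat_below_generic:
  assumes "compat_below N g" "generic g"
  shows "cr g < N"
proof -
  obtain g' h where "generic g'" "cr g' < N" "g = map h g'" "\<forall>x. h (- x) = - h x"
    using assms(1) unfolding compat_below_def compat_def by blast
  then show ?thesis using cr_relabel_le[of g' h] assms(2) by simp
qed

text \<open>The word of a reduced diagram, chosen independently of the number of letters of the representation.\<close>

lemma reduced_word:
  assumes "tangle_diagram m s d" "reduced d"
  obtains g where "run m (layers d) g" "card (crossing_levels (layers d)) \<le> cr g"
    "conn d = word_conn m s g" "generic g" "length g = s + m"
proof -
  obtain g where g: "run m (layers d) g" "card (crossing_levels (layers d)) \<le> cr g" using reduced_run[OF assms] by blast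
  have c: "chain m (layers d) s" using tangle_diagram_layers[OF assms(1)] by blast
  have f: "fitting m (layers d)" "width m (layers d) (length (layers d)) = s" using chain_fitting[OF c] by simp_all
  obtain lab where lab: "labelling m (layers d) g lab" using run_labelling[OF g(1) f(1)] by blast
  show thesis by (rule that[OF g conn_of_run[OF assms(1) g(1)]]) (use labellingD(1,2)[OF lab] f(2) in simp_all)
qed

text \<open>The function which is 1 on the words respecting the matching of the \<open>m\<close> straight strands, and 0 elsewhere.\<close>

definition start_vector :: "nat \<Rightarrow> int list \<Rightarrow> 'k::comm_ring_1" where
  "start_vector m w = (if drop m w = map uminus (rev (take m w)) then 1 else 0)"

lemma start_word_split: "start_word m = map (\<lambda>i. int (Suc i)) [0..<m] @ map uminus (rev (map (\<lambda>i. int (Suc i)) [0..<m]))"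
  by (simp add: start_word_def rev_map)

lemma start_compat:
  assumes "length w = m + m"
  shows "compat w (start_word m) \<longleftrightarrow> drop m w = map uminus (rev (take m w))"
proof
  assume "compat w (start_word m)"
  then obtain h where h: "\<And>x. h (- x) = - h x" "w = map h (start_word m)" unfolding compat_def by blast
  show "drop m w = map uminus (rev (take m w))"
    unfolding h(2) start_word_split by (simp add: rev_map h(1) comp_def del: of_nat_Suc)
next
  assume d: "drop m w = map uminus (rev (take m w))"
  define h where "h = (\<lambda>x. if x > 0 then w ! (nat x - 1) else if x < 0 then - (w ! (nat (- x) - 1)) else 0)"
  have o: "h (- x) = - h x" for x by (simp add: h_def)
  have "map h (map (\<lambda>i. int (Suc i)) [0..<m]) = take m w"
    using assms by (intro nth_equalityI) (simp_all add: h_def nat_add_distrib)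
  then have "map h (start_word m) = take m w @ map uminus (rev (take m w))"
    unfolding start_word_split by (simp only: map_append map_map[of h uminus] rev_map[symmetric] comp_def o)
      (metis (no_types, lifting) map_map[of uminus h, unfolded comp_def] rev_map)
  then have "map h (start_word m) = w" unfolding d[symmetric] by (metis append_take_drop_id)
  then show "compat w (start_word m)" unfolding compat_def using o by metis
qed

context rmatrix_words
begin

lemma leading_start: "leading (start_vector m) (start_word m) 0"
  unfolding leading_def
proof (intro conjI ballI impI)
  fix w assume "w \<in> words n (length (start_word m))"
  then have l: "length w = m + m" by (simp add: words_def)
  show "start_vector m w \<noteq> (0 :: 'k) \<Longrightarrow> compat w (start_word m) \<or> compat_below 0 w"
    unfolding start_vector_def start_compat[OF l] by (simp split: if_splits)
  show "compat w (start_word m) \<Longrightarrow> start_vector m w = (1 :: 'k) \<or> start_vector m w = (- 1 :: 'k)"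
    unfolding start_vector_def start_compat[OF l] by simp
qed (use start_word_generic[of m] in auto)

text \<open>A diagram acts layer by layer, in the order in which its layers are drawn.\<close>

fun act_layers :: "layer list \<Rightarrow> nat \<Rightarrow> (int list \<Rightarrow> 'k) \<Rightarrow> int list \<Rightarrow> 'k" where
  "act_layers [] e F = F"
| "act_layers ((a, p, b) # Ls) e F = act_layers Ls e (act (Piece p) (e + a) F)"

lemma act_layers_append: "act_layers (Ls @ Ks) e F = act_layers Ks e (act_layers Ls e F)"
  by (induction Ls e F rule: act_layers.induct) simp_all

lemma act_layers_left: "act_layers (map (\<lambda>(a, p, b). (k + a, p, b)) Ls) e F = act_layers Ls (e + k) F"
  by (induction Ls arbitrary: F) (auto simp: add.assoc simp del: act.simps)

lemma act_layers_right: "act_layers (map (\<lambda>(a, p, b). (a, p, b + k)) Ls) e F = act_layers Ls e F"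
  by (induction Ls arbitrary: F) (auto simp del: act.simps)

lemma msrc_mor_of: "msrc (mor_of d) = src d" by (induction d) simp_all

lemma act_diagram: "act (mor_of d) e F = act_layers (layers d) e F"
proof (induction d arbitrary: e F)
  case (DPiece p) then show ?case by simp
next
  case (DComp g h) then show ?case by (simp add: act_layers_append)
next
  case (DTens f g)
  then show ?case
    by (simp only: layers.simps mor_of.simps act.simps act_layers_append act_layers_left act_layers_right msrc_mor_of)
qed

text \<open>Every crossing of the run increases the bound by one.\<close>

lemma leading_run:
  assumes "run m Ls g" "chain m Ls s" "leading F (start_word m) 0"
  shows "leading (act_layers Ls 0 F) g (card (crossing_levels Ls))"
  using assms(1,2)
proof (induction arbitrary: s rule: run.induct)
  case run_nil
  then show ?case using assms(3) by (simp add: crossing_levels_def)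
next
  case (run_snoc Ls g a p g' b)
  have c: "chain m Ls (a + piece_src p + b)" using run_snoc.prems by (auto simp: chain_append)
  have f: "fitting m Ls" "width m Ls (length Ls) = a + piece_src p + b" using chain_fitting[OF c] by simp_all
  obtain lab where lab: "labelling m Ls g lab" using run_labelling[OF run_snoc.hyps(1) f(1)] by blast
  have len: "a + piece_src p \<le> length g" using labellingD(2)[OF lab] f(2) by simp
  have "length Ls \<notin> crossing_levels Ls" by (simp add: crossing_levels_def)
  then have "card (crossing_levels (Ls @ [(a, p, b)])) = (if is_crossing p then Suc (card (crossing_levels Ls)) else card (crossing_levels Ls))"
    unfolding crossing_levels_snoc by simp
  then show ?case
    using leading_step[OF run_snoc.hyps(2) run_snoc.IH[OF c] len] by (simp add: act_layers_append del: act.simps)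
qed

theorem leading_reduced:
  assumes d: "tangle_diagram m s d" and g: "run m (layers d) g" "card (crossing_levels (layers d)) \<le> cr g"
  shows "leading (act (mor_of d) 0 (start_vector m)) g (cr g)"
proof -
  have c: "chain m (layers d) s" using tangle_diagram_layers[OF d] by blast
  have L: "leading (act (mor_of d) 0 (start_vector m)) g (card (crossing_levels (layers d)))"
    unfolding act_diagram by (rule leading_run[OF g(1) c leading_start])
  then have "cr g \<le> card (crossing_levels (layers d))" unfolding leading_def by blast
  then show ?thesis using L g(2) by simp
qed

lemma leading_diagonal:
  assumes "leading F g (cr g)" "g \<in> words n (length g)"
  shows "F g = 1 \<or> F g = - 1"
  using assms compat_below_generic[of "cr g" g] compat_refl[of g] unfolding leading_def by blast

lemma leading_off_diagonal:
  assumes "leading F g' N" "g \<in> words n (length g')" "F g \<noteq> 0" "generic g"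
  shows "compat g g' \<or> cr g < N"
  using assms compat_below_generic[of N g] unfolding leading_def by blast

end

section \<open>Inverting a factor of a triangular matrix\<close>
lemma prod_list_unit: "(\<And>x. x \<in> set xs \<Longrightarrow> x dvd 1) \<Longrightarrow> prod_list xs dvd (1 :: 'a::comm_semiring_1)"
proof (induction xs)
  case (Cons x xs)
  then have "x * prod_list xs dvd 1 * 1" by (intro mult_dvd_mono) auto
  then show ?case by simp
qed simp

text \<open>Sorting the indices by rank makes the product \<open>A B\<close> lower triangular. Its determinant is the product of
its diagonal entries, hence a unit, and so is the determinant of \<open>A\<close>; the adjugate of \<open>A\<close> gives the inverse.\<close>

lemma triangular_product_inverse:
  fixes A B U :: "'i \<Rightarrow> 'i \<Rightarrow> 'a::comm_ring_1" and rank :: "'i \<Rightarrow> nat"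
  assumes fin: "finite C"
    and prod: "\<And>i k. i \<in> C \<Longrightarrow> k \<in> C \<Longrightarrow> (\<Sum>j\<in>C. A i j * B j k) = U i k"
    and diagonal: "\<And>i. i \<in> C \<Longrightarrow> U i i dvd 1"
    and triangular: "\<And>i k. i \<in> C \<Longrightarrow> k \<in> C \<Longrightarrow> U i k \<noteq> 0 \<Longrightarrow> i = k \<or> rank k < rank i"
  shows "\<exists>A'. \<forall>j\<in>C. \<forall>l\<in>C. (\<Sum>i\<in>C. A' j i * A i l) = (if j = l then 1 else 0)"
proof -
  obtain ys where ys: "set ys = C" "distinct ys" using finite_distinct_list[OF fin] by blast
  define xs where "xs = sort_key rank ys"
  have xs: "set xs = C" "distinct xs" "sorted (map rank xs)" using ys by (auto simp: xs_def)
  define N where "N = length xs"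
  have bij: "bij_betw ((!) xs) {0..<N} C"
    using bij_betw_nth[OF xs(2), of "{0..<N}" C] xs(1) by (simp add: N_def lessThan_atLeast0)
  have inC: "xs ! i \<in> C" if "i < N" for i using that xs(1) by (auto simp: N_def)
  have reindex: "(\<Sum>i\<in>C. f i) = (\<Sum>i = 0..<N. f (xs ! i))" for f :: "'i \<Rightarrow> 'a"
    using sum.reindex_bij_betw[OF bij, of f] by simp
  let ?m = "\<lambda>F. mat N N (\<lambda>(i, j). F (xs ! i) (xs ! j)) :: 'a mat"
  have AB: "?m A * ?m B = ?m U"
    by (rule eq_matI) (simp_all add: scalar_prod_def prod[OF inC inC, symmetric] reindex)
  have "det (?m U) = prod_list (diag_mat (?m U))"
  proof (rule det_lower_triangular)
    fix i k assume ik: "i < k" "k < N"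
    have "rank (xs ! i) \<le> rank (xs ! k)"
      using sorted_nth_mono[OF xs(3), of i k] ik by (simp add: N_def)
    moreover have "xs ! i \<noteq> xs ! k" using ik xs(2) by (simp add: N_def nth_eq_iff_index_eq)
    ultimately have "U (xs ! i) (xs ! k) = 0" using triangular[of "xs ! i" "xs ! k"] inC ik by force
    then show "?m U $$ (i, k) = 0" using ik by simp
  qed simp
  moreover have "prod_list (diag_mat (?m U)) dvd 1"
    by (rule prod_list_unit) (use diagonal inC in \<open>auto simp: diag_mat_def\<close>)
  ultimately have "det (?m A) * det (?m B) dvd 1"
    using det_mult[of "?m A" N "?m B"] AB by simp
  then obtain r where "1 = det (?m A) * det (?m B) * r" by (rule dvdE)
  then have r: "det (?m B) * r * det (?m A) = 1" by (simp add: mult_ac)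
  define P where "P = (det (?m B) * r) \<cdot>\<^sub>m adj_mat (?m A)"
  have P: "P \<in> carrier_mat N N" unfolding P_def using adj_mat(1)[of "?m A" N] by simp
  have "P * ?m A = (det (?m B) * r) \<cdot>\<^sub>m (det (?m A) \<cdot>\<^sub>m 1\<^sub>m N)"
    unfolding P_def using adj_mat(1,3)[of "?m A" N] mult_smult_assoc_mat[of "adj_mat (?m A)" N N "?m A" N] by simp
  also have "\<dots> = 1\<^sub>m N" by (rule eq_matI) (use r in \<open>auto simp: mult.assoc[symmetric]\<close>)
  finally have PA: "P * ?m A = 1\<^sub>m N" .
  define pos where "pos = inv_into {0..<N} ((!) xs)"
  have pos: "pos j < N" "xs ! pos j = j" if "j \<in> C" for j
    using that bij_betw_inv_into_right[OF bij that] bij_betw_apply[OF bij_betw_inv_into[OF bij] that] by (auto simp: pos_def)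
  have pos_nth: "pos (xs ! i) = i" if "i < N" for i
    using bij_betw_inv_into_left[OF bij, of i] that by (simp add: pos_def)
  show ?thesis
  proof (intro exI ballI)
    fix j l assume jl: "j \<in> C" "l \<in> C"
    have "(\<Sum>i\<in>C. P $$ (pos j, pos i) * A i l) = (\<Sum>i = 0..<N. P $$ (pos j, i) * A (xs ! i) l)"
      unfolding reindex by (rule sum.cong) (simp_all add: pos_nth)
    also have "\<dots> = (P * ?m A) $$ (pos j, pos l)"
      using P pos jl by (simp add: scalar_prod_def)
    also have "\<dots> = (if j = l then 1 else 0)" unfolding PA using pos jl by (auto, metis)
    finally show "(\<Sum>i\<in>C. (\<lambda>j i. P $$ (pos j, pos i)) j i * A i l) = (if j = l then 1 else 0)" .
  qed
qed

section \<open>The basis theorem\<close>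
lemma lspan_finsum:
  assumes mod: "Module.module type_ring M" and fin: "finite C" and n: "\<And>j. j \<in> C \<Longrightarrow> n j \<in> carrier M"
    and v: "v \<in> lspan M (n ` C)"
  shows "\<exists>a. v = (\<Oplus>\<^bsub>M\<^esub>j\<in>C. a j \<odot>\<^bsub>M\<^esub> n j)"
proof -
  interpret M: Module.module type_ring M by (rule mod)
  have c: "(\<lambda>j. a j \<odot>\<^bsub>M\<^esub> n j) \<in> C \<rightarrow> carrier M" for a using n by (auto intro: M.smult_closed)
  show ?thesis using v
  proof (induction rule: lspan.induct)
    case lspan_zero
    have "(\<Oplus>\<^bsub>M\<^esub>j\<in>C. 0 \<odot>\<^bsub>M\<^esub> n j) = (\<Oplus>\<^bsub>M\<^esub>j\<in>C. \<zero>\<^bsub>M\<^esub>)"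
      using n M.smult_l_null by (intro M.finsum_cong') auto
    then show ?case by (intro exI[of _ "\<lambda>_. 0"]) simp
  next
    case (lspan_base x)
    then obtain l where l: "l \<in> C" "x = n l" by blast
    have "(\<Oplus>\<^bsub>M\<^esub>j\<in>C. (if j = l then 1 else 0) \<odot>\<^bsub>M\<^esub> n j) = (\<Oplus>\<^bsub>M\<^esub>j\<in>C. if l = j then n j else \<zero>\<^bsub>M\<^esub>)"
      using n M.smult_l_null M.smult_one by (intro M.finsum_cong') auto
    also have "\<dots> = n l" using l fin n by (intro M.finsum_singleton) auto
    finally show ?case using l by (intro exI[of _ "\<lambda>j. if j = l then 1 else 0"]) simp
  next
    case (lspan_add x y)
    then obtain a b where ab: "x = (\<Oplus>\<^bsub>M\<^esub>j\<in>C. a j \<odot>\<^bsub>M\<^esub> n j)" "y = (\<Oplus>\<^bsub>M\<^esub>j\<in>C. b j \<odot>\<^bsub>M\<^esub> n j)" by blast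
    have "x \<oplus>\<^bsub>M\<^esub> y = (\<Oplus>\<^bsub>M\<^esub>j\<in>C. a j \<odot>\<^bsub>M\<^esub> n j \<oplus>\<^bsub>M\<^esub> b j \<odot>\<^bsub>M\<^esub> n j)"
      unfolding ab by (rule M.finsum_addf[symmetric, OF c c])
    also have "\<dots> = (\<Oplus>\<^bsub>M\<^esub>j\<in>C. (a j + b j) \<odot>\<^bsub>M\<^esub> n j)"
      using n M.smult_l_distr[of "a _" "b _" "n _"] c[of "\<lambda>j. a j + b j"] by (intro M.finsum_cong') auto
    finally show ?case by (rule exI[of _ "\<lambda>j. a j + b j"])
  next
    case (lspan_smult x r)
    then obtain a where a: "x = (\<Oplus>\<^bsub>M\<^esub>j\<in>C. a j \<odot>\<^bsub>M\<^esub> n j)" by blast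
    have "r \<odot>\<^bsub>M\<^esub> x = (\<Oplus>\<^bsub>M\<^esub>j\<in>C. r \<odot>\<^bsub>M\<^esub> (a j \<odot>\<^bsub>M\<^esub> n j))"
      unfolding a by (rule M.finsum_smult_ldistr[OF fin _ c]) simp
    also have "\<dots> = (\<Oplus>\<^bsub>M\<^esub>j\<in>C. (r * a j) \<odot>\<^bsub>M\<^esub> n j)"
      using n M.smult_assoc1[of r "a _" "n _"] c[of "\<lambda>j. r * a j"] by (intro M.finsum_cong') auto
    finally show ?case by (rule exI[of _ "\<lambda>j. r * a j"])
  qed
qed

lemma lspan_subset: "v \<in> lspan M B \<Longrightarrow> B \<subseteq> lspan M B' \<Longrightarrow> v \<in> lspan M B'"
  by (induction rule: lspan.induct) (auto intro: lspan.intros)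

lemma finsum_lspan:
  assumes mod: "Module.module type_ring M" and "finite I" and "\<And>i. i \<in> I \<Longrightarrow> x i \<in> carrier M \<and> x i \<in> lspan M B"
  shows "(\<Oplus>\<^bsub>M\<^esub>i\<in>I. b i \<odot>\<^bsub>M\<^esub> x i) \<in> lspan M B"
proof -
  interpret M: Module.module type_ring M by (rule mod)
  show ?thesis using assms(2,3)
  proof (induction I rule: finite_induct)
    case empty then show ?case by (simp add: lspan_zero)
  next
    case (insert i I)
    have "(\<Oplus>\<^bsub>M\<^esub>i\<in>insert i I. b i \<odot>\<^bsub>M\<^esub> x i) = b i \<odot>\<^bsub>M\<^esub> x i \<oplus>\<^bsub>M\<^esub> (\<Oplus>\<^bsub>M\<^esub>i\<in>I. b i \<odot>\<^bsub>M\<^esub> x i)"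
      by (rule M.finsum_insert) (use insert in \<open>auto intro: M.smult_closed\<close>)
    then show ?case using insert by (auto intro: lspan_add lspan_smult)
  qed
qed

lemma combine_finsum:
  assumes mod: "Module.module type_ring M" and fin: "finite I" and n: "\<And>j. j \<in> C \<Longrightarrow> n j \<in> carrier M"
  shows "(\<Oplus>\<^bsub>M\<^esub>i\<in>I. b i \<odot>\<^bsub>M\<^esub> (\<Oplus>\<^bsub>M\<^esub>j\<in>C. A i j \<odot>\<^bsub>M\<^esub> n j)) = (\<Oplus>\<^bsub>M\<^esub>j\<in>C. (\<Sum>i\<in>I. b i * A i j) \<odot>\<^bsub>M\<^esub> n j)"
proof (cases "finite C")
  case finC: True
  interpret M: Module.module type_ring M by (rule mod)
  have c: "(\<lambda>j. a j \<odot>\<^bsub>M\<^esub> n j) \<in> C \<rightarrow> carrier M" for a using n by (auto intro: M.smult_closed)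
  have S: "(\<Oplus>\<^bsub>M\<^esub>j\<in>C. a j \<odot>\<^bsub>M\<^esub> n j) \<in> carrier M" for a by (rule M.finsum_closed[OF c])
  show ?thesis using fin
  proof (induction I rule: finite_induct)
    case empty
    have "(\<Oplus>\<^bsub>M\<^esub>j\<in>C. 0 \<odot>\<^bsub>M\<^esub> n j) = (\<Oplus>\<^bsub>M\<^esub>j\<in>C. \<zero>\<^bsub>M\<^esub>)"
      using n M.smult_l_null by (intro M.finsum_cong') auto
    then show ?case by simp
  next
    case (insert i I)
    have "(\<Oplus>\<^bsub>M\<^esub>i\<in>insert i I. b i \<odot>\<^bsub>M\<^esub> (\<Oplus>\<^bsub>M\<^esub>j\<in>C. A i j \<odot>\<^bsub>M\<^esub> n j)) =
        b i \<odot>\<^bsub>M\<^esub> (\<Oplus>\<^bsub>M\<^esub>j\<in>C. A i j \<odot>\<^bsub>M\<^esub> n j) \<oplus>\<^bsub>M\<^esub> (\<Oplus>\<^bsub>M\<^esub>j\<in>C. (\<Sum>i\<in>I. b i * A i j) \<odot>\<^bsub>M\<^esub> n j)"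
      unfolding insert.IH[symmetric] by (rule M.finsum_insert) (use insert S in \<open>auto intro: M.smult_closed\<close>)
    also have "b i \<odot>\<^bsub>M\<^esub> (\<Oplus>\<^bsub>M\<^esub>j\<in>C. A i j \<odot>\<^bsub>M\<^esub> n j) = (\<Oplus>\<^bsub>M\<^esub>j\<in>C. b i \<odot>\<^bsub>M\<^esub> (A i j \<odot>\<^bsub>M\<^esub> n j))"
      by (rule M.finsum_smult_ldistr[OF finC _ c]) simp
    also have "\<dots> = (\<Oplus>\<^bsub>M\<^esub>j\<in>C. (b i * A i j) \<odot>\<^bsub>M\<^esub> n j)"
      using n M.smult_assoc1[of "b i" "A i _" "n _"] c[of "\<lambda>j. b i * A i j"] by (intro M.finsum_cong') auto
    also have "\<dots> \<oplus>\<^bsub>M\<^esub> (\<Oplus>\<^bsub>M\<^esub>j\<in>C. (\<Sum>i\<in>I. b i * A i j) \<odot>\<^bsub>M\<^esub> n j) =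
        (\<Oplus>\<^bsub>M\<^esub>j\<in>C. (b i * A i j) \<odot>\<^bsub>M\<^esub> n j \<oplus>\<^bsub>M\<^esub> (\<Sum>i\<in>I. b i * A i j) \<odot>\<^bsub>M\<^esub> n j)"
      by (rule M.finsum_addf[symmetric, OF c c])
    also have "\<dots> = (\<Oplus>\<^bsub>M\<^esub>j\<in>C. (\<Sum>i\<in>insert i I. b i * A i j) \<odot>\<^bsub>M\<^esub> n j)"
      using insert.hyps n M.smult_l_distr[of "b i * A i _" "\<Sum>i\<in>I. b i * A i _" "n _"] c[of "\<lambda>j. \<Sum>i\<in>insert i I. b i * A i j"]
      by (intro M.finsum_cong') auto
    finally show ?case .
  qed
next
  case False
  interpret M: Module.module type_ring M by (rule mod)
  have "(\<Oplus>\<^bsub>M\<^esub>i\<in>I. b i \<odot>\<^bsub>M\<^esub> \<zero>\<^bsub>M\<^esub>) = (\<Oplus>\<^bsub>M\<^esub>i\<in>I. \<zero>\<^bsub>M\<^esub>)"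
    using M.smult_r_null by (intro M.finsum_cong') auto
  then show ?thesis using False by (simp add: M.finsum_infinite)
qed

lemma functional_finsum:
  assumes mod: "Module.module type_ring M" and "finite I" and "\<And>i. i \<in> I \<Longrightarrow> x i \<in> carrier M"
    and add: "\<And>v w. v \<in> carrier M \<Longrightarrow> w \<in> carrier M \<Longrightarrow> L (v \<oplus>\<^bsub>M\<^esub> w) = L v + L w"
    and smult: "\<And>c v. v \<in> carrier M \<Longrightarrow> L (c \<odot>\<^bsub>M\<^esub> v) = c * L v"
  shows "L (\<Oplus>\<^bsub>M\<^esub>i\<in>I. a i \<odot>\<^bsub>M\<^esub> x i) = (\<Sum>i\<in>I. a i * L (x i))"
proof -
  interpret M: Module.module type_ring M by (rule mod)
  have "L \<zero>\<^bsub>M\<^esub> = 0" using smult[of "\<zero>\<^bsub>M\<^esub>" 0] M.smult_l_null[of "\<zero>\<^bsub>M\<^esub>"] by simp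
  show ?thesis using assms(2,3)
  proof (induction I rule: finite_induct)
    case empty then show ?case using \<open>L \<zero>\<^bsub>M\<^esub> = 0\<close> by simp
  next
    case (insert i I)
    have S: "(\<Oplus>\<^bsub>M\<^esub>i\<in>I. a i \<odot>\<^bsub>M\<^esub> x i) \<in> carrier M" by (rule M.finsum_closed) (use insert in \<open>auto intro: M.smult_closed\<close>)
    have x: "x i \<in> carrier M" "a i \<odot>\<^bsub>M\<^esub> x i \<in> carrier M" using insert.prems by (auto intro: M.smult_closed)
    have "(\<Oplus>\<^bsub>M\<^esub>i\<in>insert i I. a i \<odot>\<^bsub>M\<^esub> x i) = a i \<odot>\<^bsub>M\<^esub> x i \<oplus>\<^bsub>M\<^esub> (\<Oplus>\<^bsub>M\<^esub>i\<in>I. a i \<odot>\<^bsub>M\<^esub> x i)"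
      by (rule M.finsum_insert) (use insert in \<open>auto intro: M.smult_closed\<close>)
    then show ?case using insert add[OF x(2) S] smult[OF x(1)] by simp
  qed
qed

text \<open>A family \<open>x\<close> is a basis as soon as there is a spanning family \<open>n\<close> with the same index set, and functionals \<open>L\<close> for
which the matrix of the values at \<open>x\<close> is triangular with units on the diagonal. Independence: among the indices with a nonzero
coefficient, one of maximal rank is detected by its functional. Spanning: the matrix which expresses \<open>x\<close> in terms
of \<open>n\<close> is a left factor of the triangular matrix, and thus invertible.\<close>

theorem triangular_basis:
  fixes M :: "('k::idom, 'v, 'z) module_scheme" and x n :: "'i \<Rightarrow> 'v" and L :: "'i \<Rightarrow> 'v \<Rightarrow> 'k" and rank :: "'i \<Rightarrow> nat"
  assumes mod: "Module.module type_ring M" and fin: "finite C"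
    and x: "\<And>i. i \<in> C \<Longrightarrow> x i \<in> carrier M" and n: "\<And>i. i \<in> C \<Longrightarrow> n i \<in> carrier M"
    and spanning: "\<And>v. v \<in> carrier M \<Longrightarrow> v \<in> lspan M (n ` C)"
    and add: "\<And>i v w. i \<in> C \<Longrightarrow> v \<in> carrier M \<Longrightarrow> w \<in> carrier M \<Longrightarrow> L i (v \<oplus>\<^bsub>M\<^esub> w) = L i v + L i w"
    and smult: "\<And>i c v. i \<in> C \<Longrightarrow> v \<in> carrier M \<Longrightarrow> L i (c \<odot>\<^bsub>M\<^esub> v) = c * L i v"
    and diagonal: "\<And>i. i \<in> C \<Longrightarrow> L i (x i) dvd 1"
    and triangular: "\<And>i k. i \<in> C \<Longrightarrow> k \<in> C \<Longrightarrow> L k (x i) \<noteq> 0 \<Longrightarrow> i = k \<or> rank k < rank i"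
  shows "free_with_basis type_ring M x C"
proof -
  interpret M: Module.module type_ring M by (rule mod)
  have L_sum: "L k (\<Oplus>\<^bsub>M\<^esub>i\<in>I. a i \<odot>\<^bsub>M\<^esub> y i) = (\<Sum>i\<in>I. a i * L k (y i))"
    if "k \<in> C" "finite I" "\<And>i. i \<in> I \<Longrightarrow> y i \<in> carrier M" for k I a and y :: "'i \<Rightarrow> 'v"
    by (rule functional_finsum[OF mod that(2,3)]) (use that(1) add smult in auto)
  have indep: "\<forall>i\<in>I. a i = 0" if I: "I \<subseteq> C" "(\<Oplus>\<^bsub>M\<^esub>i\<in>I. a i \<odot>\<^bsub>M\<^esub> x i) = \<zero>\<^bsub>M\<^esub>" for I a
  proof (rule ccontr)
    assume "\<not> (\<forall>i\<in>I. a i = 0)"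
    then have ne: "{i \<in> I. a i \<noteq> 0} \<noteq> {}" by blast
    have finI: "finite I" using I(1) fin by (rule finite_subset)
    let ?J = "{i \<in> I. a i \<noteq> 0}"
    have J: "finite (rank ` ?J)" using finI by simp
    have "Max (rank ` ?J) \<in> rank ` ?J" using Max_in[OF J] ne by blast
    then obtain k where k': "k \<in> ?J" "rank k = Max (rank ` ?J)" by force
    then have k: "k \<in> I" "a k \<noteq> 0" "\<And>i. i \<in> I \<Longrightarrow> a i \<noteq> 0 \<Longrightarrow> rank i \<le> rank k"
      using Max_ge[OF J] by simp_all
    have kC: "k \<in> C" using k(1) I(1) by blast
    have "0 = L k \<zero>\<^bsub>M\<^esub>" using smult[OF kC, of "\<zero>\<^bsub>M\<^esub>" 0] M.smult_l_null[of "\<zero>\<^bsub>M\<^esub>"] by simp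
    also have "\<dots> = (\<Sum>i\<in>I. a i * L k (x i))"
      unfolding I(2)[symmetric] by (rule L_sum[OF kC finI]) (use x I(1) in auto)
    also have "\<dots> = (\<Sum>i\<in>{k}. a i * L k (x i))"
    proof (rule sum.mono_neutral_right[OF finI])
      show "{k} \<subseteq> I" using k(1) by simp
      show "\<forall>i\<in>I - {k}. a i * L k (x i) = 0"
      proof
        fix i assume i: "i \<in> I - {k}"
        then have "L k (x i) = 0 \<or> rank k < rank i" using triangular[of i k] kC I(1) by blast
        then show "a i * L k (x i) = 0" using k(3)[of i] i by force
      qed
    qed
    finally have "a k * L k (x k) = 0" by simp
    then show False using k(2) diagonal[OF kC] by auto
  qed
  have combination: "\<exists>a. v = (\<Oplus>\<^bsub>M\<^esub>i\<in>C. a i \<odot>\<^bsub>M\<^esub> x i)" if v: "v \<in> carrier M" for v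
  proof -
    have "\<forall>i\<in>C. \<exists>a. x i = (\<Oplus>\<^bsub>M\<^esub>j\<in>C. a j \<odot>\<^bsub>M\<^esub> n j)"
      using lspan_finsum[OF mod fin n spanning[OF x]] by blast
    then obtain A where A: "\<And>i. i \<in> C \<Longrightarrow> x i = (\<Oplus>\<^bsub>M\<^esub>j\<in>C. A i j \<odot>\<^bsub>M\<^esub> n j)" by metis
    have "\<exists>A'. \<forall>j\<in>C. \<forall>l\<in>C. (\<Sum>i\<in>C. A' j i * A i l) = (if j = l then 1 else 0)"
    proof (rule triangular_product_inverse[where U = "\<lambda>i k. L k (x i)" and B = "\<lambda>j k. L k (n j)" and rank = rank, OF fin])
      show "(\<Sum>j\<in>C. A i j * L k (n j)) = L k (x i)" if ik: "i \<in> C" "k \<in> C" for i k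
        unfolding A[OF ik(1)] by (rule L_sum[OF ik(2) fin n, symmetric])
      show "L i (x i) dvd 1" if "i \<in> C" for i by (rule diagonal[OF that])
      show "i = k \<or> rank k < rank i" if "i \<in> C" "k \<in> C" "L k (x i) \<noteq> 0" for i k by (rule triangular[OF that])
    qed
    then obtain A' where
      A': "\<And>j l. j \<in> C \<Longrightarrow> l \<in> C \<Longrightarrow> (\<Sum>i\<in>C. A' j i * A i l) = (if j = l then 1 else 0)" by blast
    have "n j \<in> lspan M (x ` C)" if j: "j \<in> C" for j
    proof -
      have "(\<Oplus>\<^bsub>M\<^esub>i\<in>C. A' j i \<odot>\<^bsub>M\<^esub> x i) = (\<Oplus>\<^bsub>M\<^esub>i\<in>C. A' j i \<odot>\<^bsub>M\<^esub> (\<Oplus>\<^bsub>M\<^esub>l\<in>C. A i l \<odot>\<^bsub>M\<^esub> n l))"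
        using A n by (intro M.finsum_cong') (auto intro!: M.smult_closed M.finsum_closed)
      also have "\<dots> = (\<Oplus>\<^bsub>M\<^esub>l\<in>C. (\<Sum>i\<in>C. A' j i * A i l) \<odot>\<^bsub>M\<^esub> n l)" by (rule combine_finsum[OF mod fin n])
      also have "\<dots> = (\<Oplus>\<^bsub>M\<^esub>l\<in>C. if j = l then n l else \<zero>\<^bsub>M\<^esub>)"
        using A'[OF j] n M.smult_l_null M.smult_one by (intro M.finsum_cong') auto
      also have "\<dots> = n j" using j fin n by (intro M.finsum_singleton) auto
      finally have "n j = (\<Oplus>\<^bsub>M\<^esub>i\<in>C. A' j i \<odot>\<^bsub>M\<^esub> x i)" by simp
      moreover have "(\<Oplus>\<^bsub>M\<^esub>i\<in>C. A' j i \<odot>\<^bsub>M\<^esub> x i) \<in> lspan M (x ` C)"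
        by (rule finsum_lspan[OF mod fin]) (use x in \<open>auto intro: lspan_base\<close>)
      ultimately show ?thesis by (simp only:)
    qed
    then have "v \<in> lspan M (x ` C)" using lspan_subset[OF spanning[OF v]] by blast
    then show ?thesis using lspan_finsum[OF mod fin, of x v] x by blast
  qed
  have span: "\<exists>A a. finite A \<and> A \<subseteq> C \<and> a \<in> A \<rightarrow> carrier type_ring \<and> v = (\<Oplus>\<^bsub>M\<^esub>i\<in>A. a i \<odot>\<^bsub>M\<^esub> x i)"
    if "v \<in> carrier M" for v
  proof -
    obtain a where "v = (\<Oplus>\<^bsub>M\<^esub>i\<in>C. a i \<odot>\<^bsub>M\<^esub> x i)" using combination[OF \<open>v \<in> carrier M\<close>] by blast
    then show ?thesis using fin by (intro exI[of _ C] exI[of _ a]) (simp add: Pi_UNIV)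
  qed
  show ?thesis unfolding free_with_basis_def
    using mod x indep span by auto
qed

lemma finite_connectors: "finite (connectors m s)"
proof (rule finite_subset)
  show "connectors m s \<subseteq> Pow (ends m s \<times> ends m s)"
  proof
    fix c assume "c \<in> connectors m s"
    then obtain d where "tangle_diagram m s d" "c = conn d" unfolding connectors_def by blast
    then show "c \<in> Pow (ends m s \<times> ends m s)"
      using tangle_diagram_layers[of m s d] unfolding conn_def endpoints_def ends_def by auto
  qed
  show "finite (Pow (ends m s \<times> ends m s))" unfolding ends_def by simp
qed

theorem theorem2p9:
  fixes q :: "'k::idom"
    and m s :: nat
    and D :: "(endpoint \<times> endpoint) set \<Rightarrow> diagram"
  assumes "CHAR('k) \<noteq> 2"
    and "q dvd 1"
    and "(q - unit_inverse q) dvd 1"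
    and "even (m + s)"
    and "\<And>c. c \<in> connectors m s \<Longrightarrow>
           tangle_diagram m s (D c) \<and> conn (D c) = c \<and> reduced (D c) \<and> totally_descending (D c)"
  shows "free_with_basis (ring_of_type_algebra :: 'k ring) (Hom q m s)
           (\<lambda>d. mor_class q m s (mor_of d)) (D ` connectors m s)"
proof -
  have q_inv: "q * unit_inverse q = 1"
  proof -
    interpret R: cring "type_ring :: 'k ring" by (rule cring_from_type_algebra)
    obtain r where r: "1 = q * r" using assms(2) by (rule dvdE)
    have "q \<in> Units type_ring" unfolding Units_def using r by (auto intro!: exI[of _ r] simp: mult.commute)
    from R.Units_r_inv[OF this] show ?thesis by simp
  qed
  interpret brauer_module q by standard (rule q_inv)
  let ?C = "D ` connectors m s" and ?M = "Hom q m s"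
  let ?x = "\<lambda>d. mor_class q m s (mor_of d)"
  have C: "tangle_diagram m s d" "reduced d" if "d \<in> ?C" for d using that assms(5) by auto
  have conn_inj: "d = d'" if "d \<in> ?C" "d' \<in> ?C" "conn d = conn d'" for d d' using that assms(5) by auto
  have finC: "finite ?C" using finite_connectors by simp
  let ?nd = "\<lambda>ks. bend m s (cup_diagram ks)"
  \<comment> \<open>The spanning diagrams, indexed by the elements of the basis; an index whose connector is not the one
    of a spanning diagram is filled up with zero.\<close>
  define n where "n d = (if \<exists>ks\<in>codes (m + s). conn (?nd ks) = conn d
      then ?x (?nd (SOME ks. ks \<in> codes (m + s) \<and> conn (?nd ks) = conn d)) else \<zero>\<^bsub>?M\<^esub>)" for d
  have n_code: "n (D (conn (?nd ks))) = ?x (?nd ks)" "D (conn (?nd ks)) \<in> ?C" if ks: "ks \<in> codes (m + s)" for ks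
  proof -
    have c: "conn (?nd ks) \<in> connectors m s" unfolding connectors_def using bend_conn(2)[OF ks] by blast
    then show "D (conn (?nd ks)) \<in> ?C" by blast
    have cD: "conn (D (conn (?nd ks))) = conn (?nd ks)" using assms(5)[OF c] by blast
    have "(SOME ls. ls \<in> codes (m + s) \<and> conn (?nd ls) = conn (?nd ks)) = ks"
      by (rule some_equality) (use ks inj_onD[OF bend_conn_inj] in blast)+
    then show "n (D (conn (?nd ks))) = ?x (?nd ks)" unfolding n_def cD using ks by auto
  qed
  have n_carrier: "n d \<in> carrier ?M" for d
  proof (cases "\<exists>ks\<in>codes (m + s). conn (?nd ks) = conn d")
    case True
    then have "(SOME ks. ks \<in> codes (m + s) \<and> conn (?nd ks) = conn d) \<in> codes (m + s)"
      using someI_ex[of "\<lambda>ks. ks \<in> codes (m + s) \<and> conn (?nd ks) = conn d"] by blast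
    from mor_class_carrier[OF tangle_in_hom[OF bend_conn(2)[OF this]]] True show ?thesis by (simp add: n_def)
  next
    case False
    then show ?thesis unfolding n_def by (auto simp: Hom_zero intro: in_hom_rules)
  qed
  have "\<forall>d\<in>?C. \<exists>g. run m (layers d) g \<and> card (crossing_levels (layers d)) \<le> cr g \<and>
      conn d = word_conn m s g \<and> generic g \<and> length g = s + m"
  proof
    fix d assume d: "d \<in> ?C"
    show "\<exists>g. run m (layers d) g \<and> card (crossing_levels (layers d)) \<le> cr g \<and>
        conn d = word_conn m s g \<and> generic g \<and> length g = s + m"
      by (rule reduced_word[OF C[OF d]]) blast
  qed
  from bchoice[OF this] obtain \<gamma> where \<gamma>_all: "\<forall>d\<in>?C. run m (layers d) (\<gamma> d) \<and> card (crossing_levels (layers d)) \<le> cr (\<gamma> d) \<and>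
      conn d = word_conn m s (\<gamma> d) \<and> generic (\<gamma> d) \<and> length (\<gamma> d) = s + m" by blast
  have \<gamma>: "\<And>d. d \<in> ?C \<Longrightarrow> run m (layers d) (\<gamma> d)" "\<And>d. d \<in> ?C \<Longrightarrow> card (crossing_levels (layers d)) \<le> cr (\<gamma> d)"
    "\<And>d. d \<in> ?C \<Longrightarrow> conn d = word_conn m s (\<gamma> d)" "\<And>d. d \<in> ?C \<Longrightarrow> generic (\<gamma> d)" "\<And>d. d \<in> ?C \<Longrightarrow> length (\<gamma> d) = s + m"
    using bspec[OF \<gamma>_all] by blast+
  \<comment> \<open>The words of all basis diagrams have to be words in the letters of the representation.\<close>
  obtain N where N: "\<And>t. t \<in> (\<Union>d\<in>?C. abs ` set (\<gamma> d)) \<Longrightarrow> t \<le> int N"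
  proof -
    let ?T = "insert 0 (\<Union>d\<in>?C. abs ` set (\<gamma> d))"
    have "t \<le> int (nat (Max ?T))" if "t \<in> (\<Union>d\<in>?C. abs ` set (\<gamma> d))" for t
    proof -
      have "finite ?T" by (rule finite.insertI, rule finite_UN_I[OF finC]) simp
      then have "t \<le> Max ?T" "0 \<le> Max ?T" using Max_ge that by blast+
      then show ?thesis by simp
    qed
    then show thesis by (rule that)
  qed
  interpret W: rmatrix_words q "unit_inverse q" N by standard (rule q_inv)
  have \<gamma>_words: "\<gamma> d \<in> words N (s + m)" if "d \<in> ?C" for d
  proof -
    have "x \<in> letters N" if "x \<in> set (\<gamma> d)" for x
      using N[of "\<bar>x\<bar>"] that \<gamma>(4)[OF \<open>d \<in> ?C\<close>] \<open>d \<in> ?C\<close> unfolding letters_def generic_def by blast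
    then show ?thesis using \<gamma>(5)[OF that] unfolding words_def by blast
  qed
  have lead: "W.leading (W.act (mor_of d) 0 (start_vector m)) (\<gamma> d) (cr (\<gamma> d))" if "d \<in> ?C" for d
    by (rule W.leading_reduced[OF C(1) \<gamma>(1,2)]) (use that in auto)
  \<comment> \<open>The value at the word of \<open>d\<close>; it does not depend on the representative of the class, by \<open>act_sound\<close>.\<close>
  define L where "L d A = W.act (SOME f. f \<in> A) 0 (start_vector m) (\<gamma> d)" for d A
  have L_class: "L d (mor_class q m s f) = W.act f 0 (start_vector m) (\<gamma> d)" if "d \<in> ?C" "in_hom f m s" for d f
  proof -
    have "f \<in> mor_class q m s f" using mor_eq.refl[OF that(2)] by (simp add: mor_class_def')
    then have "(SOME f'. f' \<in> mor_class q m s f) \<in> mor_class q m s f" by (rule someI)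
    then have e: "mor_eq q m s f (SOME f'. f' \<in> mor_class q m s f)" by (simp add: mor_class_def')
    show ?thesis unfolding L_def
      by (rule W.act_sound[OF e HOL.refl, symmetric, of _ 0 m]) (use \<gamma>_words[OF that(1)] in simp)
  qed
  show ?thesis
  proof (rule triangular_basis[where n = n and L = L and rank = "\<lambda>d. cr (\<gamma> d)"])
    show "Module.module type_ring ?M" by (rule Hom_module)
    show "finite ?C" by (rule finC)
    show "?x d \<in> carrier ?M" if "d \<in> ?C" for d using C(1)[OF that] tangle_in_hom by blast
    show "n d \<in> carrier ?M" for d by (rule n_carrier)
    show "v \<in> lspan ?M (n ` ?C)" if "v \<in> carrier ?M" for v
    proof (rule lspan_mono[OF Hom_spanned[OF that]])
      show "(\<lambda>ks. ?x (?nd ks)) ` codes (m + s) \<subseteq> n ` ?C"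
      proof
        fix v assume "v \<in> (\<lambda>ks. ?x (?nd ks)) ` codes (m + s)"
        then obtain ks where ks: "ks \<in> codes (m + s)" "v = ?x (?nd ks)" by blast
        show "v \<in> n ` ?C" using n_code[OF ks(1)] ks(2) by (metis image_eqI)
      qed
    qed
    show "L d (v \<oplus>\<^bsub>?M\<^esub> w) = L d v + L d w" if d: "d \<in> ?C" and v: "v \<in> carrier ?M" and w: "w \<in> carrier ?M" for d v w
    proof -
      obtain f where f: "in_hom f m s" "v = mor_class q m s f" using v by (rule carrier_HomE)
      obtain g where g: "in_hom g m s" "w = mor_class q m s g" using w by (rule carrier_HomE)
      show ?thesis unfolding f(2) g(2) Hom_add[OF f(1) g(1)]
        using L_class[OF d] f(1) g(1) in_hom_rules(2)[OF f(1) g(1)] by simp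
    qed
    show "L d (c \<odot>\<^bsub>?M\<^esub> v) = c * L d v" if d: "d \<in> ?C" and v: "v \<in> carrier ?M" for d c v
    proof -
      obtain f where f: "in_hom f m s" "v = mor_class q m s f" using v by (rule carrier_HomE)
      show ?thesis unfolding f(2) Hom_smult[OF f(1)]
        using L_class[OF d] f(1) in_hom_rules(3)[OF f(1)] by simp
    qed
    show "L d (?x d) dvd 1" if d: "d \<in> ?C" for d
    proof -
      have "L d (?x d) = 1 \<or> L d (?x d) = - 1"
        unfolding L_class[OF d tangle_in_hom[OF C(1)[OF d]]]
        by (rule W.leading_diagonal[OF lead[OF d]]) (use \<gamma>_words[OF d] \<gamma>(5)[OF d] in simp)
      then show ?thesis by auto
    qed
    show "d = e \<or> cr (\<gamma> e) < cr (\<gamma> d)" if d: "d \<in> ?C" and e: "e \<in> ?C" and nz: "L e (?x d) \<noteq> 0" for d e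
    proof -
      have "compat (\<gamma> e) (\<gamma> d) \<or> cr (\<gamma> e) < cr (\<gamma> d)"
      proof (rule W.leading_off_diagonal[OF lead[OF d]])
        show "\<gamma> e \<in> words N (length (\<gamma> d))" using \<gamma>_words[OF e] \<gamma>(5)[OF d] by simp
        show "W.act (mor_of d) 0 (start_vector m) (\<gamma> e) \<noteq> 0"
          using nz unfolding L_class[OF e tangle_in_hom[OF C(1)[OF d]]] .
        show "generic (\<gamma> e)" by (rule \<gamma>(4)[OF e])
      qed
      moreover have "d = e" if c: "compat (\<gamma> e) (\<gamma> d)"
      proof -
        from c[unfolded compat_def] obtain h where hh: "(\<forall>x. h (- x) = - h x) \<and> \<gamma> e = map h (\<gamma> d)" by (rule exE)
        note h = conjunct1[OF hh] conjunct2[OF hh]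
        have l: "length (\<gamma> d) = m + s" using \<gamma>(5)[OF d] by simp
        have "word_conn m s (map h (\<gamma> d)) = word_conn m s (\<gamma> d)"
          by (rule word_conn_compat[OF \<gamma>(4)[OF d] \<gamma>(4)[OF e, unfolded h(2)] spec[OF h(1)] l])
        then have "conn e = conn d" using \<gamma>(3)[OF d] \<gamma>(3)[OF e] h(2) by simp
        then show ?thesis using conn_inj[OF e d] by simp
      qed
      ultimately show ?thesis by blast
    qed
  qed
qed

end
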